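(* Let $x,y,z\in\mathbb{Z}^d$ with $y\ne z$. Then $H^-_{x,y,z}(\infty)=H_{x,y,z}(\infty)$, and all conclusions of the two following results hold with $H$ replaced by $H^-$ (right-hand sides unchanged): (A) If $S$ is not the simple random walk on $\mathbb{Z}$: $H^-_{x,y,z}(\infty)=\frac{\rho_d(x-z)+\rho_d(y-z)-\rho_d(y-x)}{2\rho_d(y-z)}\in(0,1)$ for $d\in\{1,2\}$; $H^-_{x,y,z}(\infty)=\frac{G_0(\mathbf 0,\mathbf 0)\rho_d(y-z)-G_0(\mathbf 0,\mathbf 0)\rho_d(y-x)+G_0(y,z)\rho_d(x-z)}{\rho_d(y-z)(G_0(\mathbf 0,\mathbf 0)+G_0(y,z))}\in(0,1)$ for $d\ge3$; and as $t\to\infty$, $H^-_{x,y,z}(\infty)-H^-_{x,y,z}(t)$ is asymptotically equivalent to $C_1(x-z,y-z)/\sqrt t$ for $d=1$, to $C_2(x-z,y-z)/\ln t$ for $d=2$, and to $C_d(x-z,y-z)/t^{d/2-1}$ for $d\ge3$. (B) If $S$ is the simple random walk on $\mathbb{Z}$, then for some $\varepsilon\in(0,1)$, as $t\to\infty$: $1-H^-_{x,y,z}(t)\sim\frac{\sqrt2|y-x|}{\sqrt{a\pi}\sqrt t}$ if $x<y<z$ or $z<y<x$; $1-\frac{1}{2|y-z|}-H^-_{y,y,z}(t)\sim\frac{1}{\sqrt{2a\pi}\sqrt t}$; $\frac{x-z}{y-z}-H^-_{x,y,z}(t)=o(e^{-a\varepsilon t})$ if $z<x<y$ or $y<x<z$;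 $\frac{1}{2|y-z|}-H^-_{z,y,z}(t)=o(e^{-a\varepsilon t})$; and $H^-_{x,y,z}\equiv0$ if $x<z<y$ or $y<z<x$.
   Context: Fix $d\in\mathbb{N}$. Let $a(\cdot):\mathbb{Z}^d\to\mathbb{R}$ satisfy $a(z)\ge 0$ for $z\ne\mathbf 0$, $a(\mathbf 0)=-a<0$, $\sum_{z}a(z)=0$, $a(z)=a(-z)$ for all $z$, and $\sum_z\|z\|^2a(z)<\infty$. Let $S=\{S(t),t\ge0\}$ be the continuous-time Markov chain on $\mathbb{Z}^d$ with generator $(a(y-x))_{x,y\in\mathbb{Z}^d}$ (right-continuous version): it stays at its current state an exponential time with parameter $a$, then jumps from $x$ to $y\ne x$ with probability $a(y-x)/a$, independently of the past. Write $p(t;x,y)=\mathsf P(S(t)=y\mid S(0)=x)$ and assume irreducibility: for all $x,y$ there is $t>0$ with $p(t;x,y)>0$. The simple random walk on $\mathbb{Z}$ is the case $d=1$, $a(1)=a(-1)=a/2$, $a(k)=0$ for $|k|>1$. Notation: $\phi(\theta)=\sum_z a(z)\cos(z,\theta)$ for $\theta\in[-\pi,\pi]^d$; $\gamma_d=\big((2\pi)^{d/2}\sqrt{|\det\phi''(\mathbf 0)|}\big)^{-1}$ with $\phi''(\mathbf 0)$ the Hessian of $\phi$ at $\mathbf 0$; $G_\lambda(x,y)=\int_0^\infty e^{-\lambda t}p(t;x,y)\,dt$ for $\lambda>0$, and for $d\ge3$ also for $\lambda=0$ (then finite); $\rho_d(\mathbf 0)=1$ and for $x\ne\mathbf 0$,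 $\rho_d(x)=a\lim_{\lambda\to0+}(G_\lambda(\mathbf 0,\mathbf 0)-G_\lambda(\mathbf 0,x))=\frac{a}{(2\pi)^d}\int_{[-\pi,\pi]^d}\frac{\cos(x,\theta)-1}{\phi(\theta)}d\theta$ (finite). Let $\tau=\inf\{t\ge0:S(t)\ne S(0)\}$. For $y\ne z$, $\tau_{y,z}=\inf\{t\ge\tau:S(t)=y,\ S(u)\ne z\ \forall u\in[\tau,t]\}$ ($\inf\emptyset=\infty$), $H_{x,y,z}(t)=\mathsf P(\tau_{y,z}\le t\mid S(0)=x)$, $H_{x,y,z}(\infty)=\lim_{t\to\infty}H_{x,y,z}(t)$. Further $\tau^-_{y,z}=\inf\{t\ge0:S(t+\tau)=y,\ S(u)\ne z\ \forall u\in[\tau,t+\tau]\}$, $H^-_{x,y,z}(t)=\mathsf P(\tau^-_{y,z}\le t\mid S(0)=x)$, $H^-_{x,y,z}(\infty)=\lim_{t\to\infty}H^-_{x,y,z}(t)$. For $x,y\in\mathbb{Z}^d$, $y\ne\mathbf 0$ (in $C_1$, $x,y\in\mathbb{Z}$): $C_1(x,y)=\frac{\rho_1(y-x)+\rho_1(x)-\rho_1(y)}{4a\pi\gamma_1}+\frac{a\pi y^2\gamma_1^3(\rho_1(y-x)-\rho_1(x)-\rho_1(y))}{\rho_1^2(y)}+\frac{2a\pi xy\gamma_1^3}{\rho_1(y)}$, $C_2(x,y)=\frac{\rho_2(y-x)+\rho_2(x)-\rho_2(y)}{4a\gamma_2}$, $C_d(x,y)=\frac{2\gamma_d(\rho_d(y-x)+\rho_d(x)-\rho_d(y))}{a(d-2)(G_0(\mathbf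 0,\mathbf 0)+G_0(\mathbf 0,y))^2}$ for $d\ge3$. *)

theory Defs
  imports "HOL-Probability.Probability" "HOL-Library.Landau_Symbols"
begin

(* Z^d is rendered as int^'d with d = CARD('d); the rate function is A :: int^'d => real
   (the paper's a(.)), and the total jump rate a = -A 0. *)

definition arate :: "(int^'d \<Rightarrow> real) \<Rightarrow> real" where
  "arate A = - A 0"

definition scal_prod_int :: "int^'d \<Rightarrow> real^'d \<Rightarrow> real" where
  "scal_prod_int z \<theta> = (\<Sum>i\<in>UNIV. real_of_int (z $ i) * \<theta> $ i)"

definition sqnorm_int :: "int^'d \<Rightarrow> real" where
  "sqnorm_int z = (\<Sum>i\<in>UNIV. (real_of_int (z $ i))^2)"

definition jump_measure :: "(int^'d \<Rightarrow> real) \<Rightarrow> (int^'d) measure" where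
  "jump_measure A = density (count_space UNIV)
      (\<lambda>z. ennreal (if z = 0 then 0 else A z / arate A))"

definition hold_measure :: "(int^'d \<Rightarrow> real) \<Rightarrow> real measure" where
  "hold_measure A = density lborel (exponential_density (arate A))"

text \<open>Underlying probability space: an i.i.d. sequence of (jump increment, holding time)
  pairs, all independent.  The n-th holding time is the time spent in the n-th visited state.\<close>
definition Omega :: "(int^'d \<Rightarrow> real) \<Rightarrow> ((int^'d) \<times> real) stream measure" where
  "Omega A = stream_space (jump_measure A \<Otimes>\<^sub>M hold_measure A)"

definition jump_chain :: "int^'d \<Rightarrow> ((int^'d) \<times> real) stream \<Rightarrow> nat \<Rightarrow> int^'d" where
  "jump_chain x \<omega> n = x + (\<Sum>i<n. fst (\<omega> !! i))"

definition jump_time :: "((int^'d) \<times> real) stream \<Rightarrow> nat \<Rightarrow> real" where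
  "jump_time \<omega> n = (\<Sum>i<n. snd (\<omega> !! i))"

definition S_proc :: "int^'d \<Rightarrow> ((int^'d) \<times> real) stream \<Rightarrow> real \<Rightarrow> int^'d" where
  "S_proc x \<omega> t = jump_chain x \<omega> (LEAST n. t < jump_time \<omega> (Suc n))"

definition ptrans :: "(int^'d \<Rightarrow> real) \<Rightarrow> real \<Rightarrow> int^'d \<Rightarrow> int^'d \<Rightarrow> real" where
  "ptrans A t x y = measure (Omega A) {\<omega> \<in> space (Omega A). S_proc x \<omega> t = y}"

definition irreducible_rw :: "(int^'d \<Rightarrow> real) \<Rightarrow> bool" where
  "irreducible_rw A \<longleftrightarrow> (\<forall>x y. \<exists>t>0. ptrans A t x y > 0)"

definition admissible_rates :: "(int^'d \<Rightarrow> real) \<Rightarrow> bool" where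
  "admissible_rates A \<longleftrightarrow>
     (\<forall>z. z \<noteq> 0 \<longrightarrow> A z \<ge> 0) \<and> A 0 < 0 \<and>
     A summable_on UNIV \<and> infsum A UNIV = 0 \<and>
     (\<forall>z. A z = A (- z)) \<and>
     (\<lambda>z. sqnorm_int z * A z) summable_on UNIV \<and>
     irreducible_rw A"

text \<open>Simple random walk on Z (d = 1); for CARD('d) = 1 the integer point is its only coordinate.\<close>
definition scal1 :: "int^'d \<Rightarrow> int" where
  "scal1 v = v $ (SOME i. True)"

definition is_srw :: "(int^'d \<Rightarrow> real) \<Rightarrow> bool" where
  "is_srw A \<longleftrightarrow> CARD('d) = 1 \<and>
     (\<forall>v. v \<noteq> 0 \<longrightarrow> A v = (if \<bar>scal1 v\<bar> = 1 then arate A / 2 else 0))"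

definition phi :: "(int^'d \<Rightarrow> real) \<Rightarrow> real^'d \<Rightarrow> real" where
  "phi A \<theta> = (\<Sum>\<^sub>\<infinity>z. A z * cos (scal_prod_int z \<theta>))"

definition hessian0 :: "(real^'d \<Rightarrow> real) \<Rightarrow> real^'d^'d" where
  "hessian0 f = (\<chi> i j. deriv (\<lambda>s. deriv (\<lambda>r. f (s *\<^sub>R axis j 1 + r *\<^sub>R axis i 1)) 0) 0)"

definition gamma_d :: "(int^'d \<Rightarrow> real) \<Rightarrow> real" where
  "gamma_d A = 1 / ((2 * pi) powr (real CARD('d) / 2) * sqrt \<bar>det (hessian0 (phi A))\<bar>)"

definition Green :: "(int^'d \<Rightarrow> real) \<Rightarrow> real \<Rightarrow> int^'d \<Rightarrow> int^'d \<Rightarrow> real" where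
  "Green A lam x y = (LINT t:{0..}|lborel. exp (- lam * t) * ptrans A t x y)"

definition rho :: "(int^'d \<Rightarrow> real) \<Rightarrow> int^'d \<Rightarrow> real" where
  "rho A x = (if x = 0 then 1 else
      arate A * Lim (at_right 0) (\<lambda>lam. Green A lam 0 0 - Green A lam 0 x))"

text \<open>Hitting times (values in ereal, Inf {} = \<infinity>).\<close>
definition tau :: "int^'d \<Rightarrow> ((int^'d) \<times> real) stream \<Rightarrow> ereal" where
  "tau x \<omega> = Inf {ereal t | t. t \<ge> 0 \<and> S_proc x \<omega> t \<noteq> S_proc x \<omega> 0}"

definition tau_yz :: "int^'d \<Rightarrow> int^'d \<Rightarrow> int^'d \<Rightarrow> ((int^'d) \<times> real) stream \<Rightarrow> ereal" where
  "tau_yz x y z \<omega> = Inf {ereal t | t. tau x \<omega> \<le> ereal t \<and> S_proc x \<omega> t = y \<and>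
      (\<forall>u. tau x \<omega> \<le> ereal u \<and> u \<le> t \<longrightarrow> S_proc x \<omega> u \<noteq> z)}"

definition tau_yz_minus :: "int^'d \<Rightarrow> int^'d \<Rightarrow> int^'d \<Rightarrow> ((int^'d) \<times> real) stream \<Rightarrow> ereal" where
  "tau_yz_minus x y z \<omega> = Inf {ereal t | t. t \<ge> 0 \<and>
      S_proc x \<omega> (t + real_of_ereal (tau x \<omega>)) = y \<and>
      (\<forall>u. tau x \<omega> \<le> ereal u \<and> u \<le> t + real_of_ereal (tau x \<omega>) \<longrightarrow> S_proc x \<omega> u \<noteq> z)}"

definition Hfun :: "(int^'d \<Rightarrow> real) \<Rightarrow> int^'d \<Rightarrow> int^'d \<Rightarrow> int^'d \<Rightarrow> real \<Rightarrow> real" where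
  "Hfun A x y z t = measure (Omega A) {\<omega> \<in> space (Omega A). tau_yz x y z \<omega> \<le> ereal t}"

definition Hminus :: "(int^'d \<Rightarrow> real) \<Rightarrow> int^'d \<Rightarrow> int^'d \<Rightarrow> int^'d \<Rightarrow> real \<Rightarrow> real" where
  "Hminus A x y z t = measure (Omega A) {\<omega> \<in> space (Omega A). tau_yz_minus x y z \<omega> \<le> ereal t}"

definition Hinf :: "(int^'d \<Rightarrow> real) \<Rightarrow> int^'d \<Rightarrow> int^'d \<Rightarrow> int^'d \<Rightarrow> real" where
  "Hinf A x y z = Lim at_top (Hfun A x y z)"

definition Hminus_inf :: "(int^'d \<Rightarrow> real) \<Rightarrow> int^'d \<Rightarrow> int^'d \<Rightarrow> int^'d \<Rightarrow> real" where
  "Hminus_inf A x y z = Lim at_top (Hminus A x y z)"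

definition C1 :: "(int^'d \<Rightarrow> real) \<Rightarrow> int^'d \<Rightarrow> int^'d \<Rightarrow> real" where
  "C1 A x y = (let a = arate A; g = gamma_d A; r = rho A;
      xr = real_of_int (scal1 x); yr = real_of_int (scal1 y) in
      (r (y - x) + r x - r y) / (4 * a * pi * g)
      + a * pi * yr^2 * g^3 * (r (y - x) - r x - r y) / (r y)^2
      + 2 * a * pi * xr * yr * g^3 / r y)"

definition C2 :: "(int^'d \<Rightarrow> real) \<Rightarrow> int^'d \<Rightarrow> int^'d \<Rightarrow> real" where
  "C2 A x y = (rho A (y - x) + rho A x - rho A y) / (4 * arate A * gamma_d A)"

definition Cd :: "(int^'d \<Rightarrow> real) \<Rightarrow> int^'d \<Rightarrow> int^'d \<Rightarrow> real" where
  "Cd A x y = 2 * gamma_d A * (rho A (y - x) + rho A x - rho A y) /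
      (arate A * (real CARD('d) - 2) * (Green A 0 0 0 + Green A 0 0 y)^2)"

end

(* The Laplace transforms of the two hitting laws (of y avoiding z, and of z avoiding y) solve a
   2x2 linear system whose coefficients are resolvents G_l; sum and difference diagonalise it.
   Local limit estimates for the characteristic function give the behaviour of G_l as l tends to 0,
   and Karamata's Tauberian theorem turns this into the tail of H^-; for d >= 3 it is applied to a
   derivative of the transform, since low derivatives stay less singular.  Positivity of the limit
   constants comes from connectivity of the walk off one point and, for d = 1, from the fact that
   C_1 is up to a factor a nonnegative superharmonic function whose zero set is finite and closed
   under jumps.  The simple random walk is computed explicitly; its exponential tails come from
   comparison with the positive eigenfunction 2 cos(kappa p) on the segment between y and z. *)
theory Submission
  imports Defs "HOL-Real_Asymp.Real_Asymp"
begin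

text \<open>The system is symmetric under exchanging \<open>y\<close> and \<open>z\<close>, so its
  eigenvectors are (1, 1) and (1, -1); the sum gets the coefficient
  \<open>GF l 0 + GF l (y - z)\<close>, the difference gets \<open>GF l 0 - GF l (y - z)\<close>.
  The second converges in every dimension. The first diverges for d <= 2, which yields recurrence
  and makes the sum and the difference contribute on different footings. Counting time from the
  first jump is convenient: the first holding time drops out, and the transform becomes an average
  over one increment. The Fourier integrals enter through uniqueness of bounded solutions of the
  resolvent equation, so transition probabilities and their Fourier form are compared only after a
  Laplace transform. A Tauberian theorem gives no asymptotic equivalence when its constant is 0, so
  strict positivity of each constant has to be settled first. Nonnegativity is immediate, since a
  transform never exceeds the total mass; strictness is where the simple walk must be excluded. For
  d >= 3 the derivative of order \<open>CARD('d) div 2\<close> is the first one that diverges like a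
  power of \<open>l\<close>.\<close>

section \<open>The jump law, the holding law and the path space\<close>

locale random_walk =
  fixes A :: "int^'d \<Rightarrow> real"
  assumes admissible: "admissible_rates A"
begin

abbreviation a where "a \<equiv> arate A"
abbreviation J where "J \<equiv> jump_measure A"
abbreviation E where "E \<equiv> hold_measure A"

definition steps :: "(int^'d) set" where
  "steps = {z. z \<noteq> 0 \<and> A z > 0}"

lemma a_pos: "a > 0"
  and A_nonneg: "z \<noteq> 0 \<Longrightarrow> A z \<ge> 0"
  and A_sym: "A (- z) = A z"
  using admissible by (auto simp: admissible_rates_def arate_def)

text \<open>For real functions unordered summability is absolute summability, so the
  \<open>infsum\<close> conditions on the rates can be traded for Lebesgue integrals over counting
  measure.\<close>

lemma integrable_count_space_of_summable_on:
  fixes f :: "int^'d \<Rightarrow> real"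
  assumes "f summable_on UNIV"
  shows "integrable (count_space UNIV) f" "(\<integral>z. f z \<partial>count_space UNIV) = infsum f UNIV"
proof -
  have "Infinite_Set_Sum.abs_summable_on f UNIV"
    using assms summable_on_iff_abs_summable_on_real[of f UNIV] abs_summable_equivalent by blast
  then show "integrable (count_space UNIV) f" "(\<integral>z. f z \<partial>count_space UNIV) = infsum f UNIV"
    using infsetsum_infsum[of f UNIV]
    by (auto simp: Infinite_Set_Sum.abs_summable_on_def infsetsum_def)
qed

lemma integrable_A: "integrable (count_space UNIV) A"
  and integral_A: "(\<integral>z. A z \<partial>count_space UNIV) = 0"
  and integrable_sqnorm_A: "integrable (count_space UNIV) (\<lambda>z. sqnorm_int z * A z)"
  using admissible integrable_count_space_of_summable_on by (auto simp: admissible_rates_def)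

lemma sets_J [simp, measurable_cong]: "sets J = sets (count_space UNIV)"
  and space_J [simp]: "space J = UNIV"
  and sets_E [simp, measurable_cong]: "sets E = sets borel"
  and space_E [simp]: "space E = UNIV"
  by (auto simp: jump_measure_def hold_measure_def)

lemma integral_single_count_space:
  fixes f :: "int^'d \<Rightarrow> real"
  shows "integrable (count_space UNIV) (\<lambda>z. if z = 0 then f z else 0)"
    "(\<integral>z. (if z = 0 then f z else 0) \<partial>count_space UNIV) = f 0"
proof -
  have eq: "(\<lambda>z. if z = 0 then f z else 0) = (\<lambda>z. indicator {0} z *\<^sub>R f 0)"
    by (auto simp: indicator_def)
  show "integrable (count_space UNIV) (\<lambda>z. if z = 0 then f z else 0)"
    "(\<integral>z. (if z = 0 then f z else 0) \<partial>count_space UNIV) = f 0"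
    unfolding eq by (auto simp: integrable_indicator_iff)
qed

text \<open>The rate function carries the mass \<open>- a\<close> at the origin, the jump law
  carries none; the term \<open>a * f 0\<close> accounts for exactly this atom. The lemma turns sums
  against \<open>A\<close>, such as \<open>phi\<close>, into expectations over one jump.\<close>

lemma integral_J:
  fixes f :: "int^'d \<Rightarrow> real"
  shows "integrable J f \<longleftrightarrow> integrable (count_space UNIV) (\<lambda>z. A z * f z)"
    and "integrable J f \<Longrightarrow> a * (\<integral>z. f z \<partial>J) = (\<integral>z. A z * f z \<partial>count_space UNIV) + a * f 0"
proof -
  let ?w = "\<lambda>z. if z = 0 then 0 else A z / a"
  have nn: "0 \<le> ?w z" for z using A_nonneg a_pos by simp
  have split: "A z * f z = a * (?w z * f z) + (if z = 0 then - a * f z else 0)" for z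
    using a_pos by (auto simp: arate_def)
  have "integrable J f \<longleftrightarrow> integrable (count_space UNIV) (\<lambda>z. ?w z * f z)"
    unfolding jump_measure_def using nn by (subst integrable_density) (auto simp: AE_count_space)
  also have "\<dots> \<longleftrightarrow> integrable (count_space UNIV) (\<lambda>z. a * (?w z * f z))"
    using a_pos by simp
  also have "\<dots> \<longleftrightarrow> integrable (count_space UNIV) (\<lambda>z. A z * f z)"
  proof
    assume "integrable (count_space UNIV) (\<lambda>z. a * (?w z * f z))"
    from Bochner_Integration.integrable_add[OF this integral_single_count_space(1)[of "\<lambda>z. - a * f z"]]
    show "integrable (count_space UNIV) (\<lambda>z. A z * f z)"
      by (simp only: split)
  next
    assume "integrable (count_space UNIV) (\<lambda>z. A z * f z)"
    from Bochner_Integration.integrable_diff[OF this integral_single_count_space(1)[of "\<lambda>z. - a * f z"]]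
    show "integrable (count_space UNIV) (\<lambda>z. a * (?w z * f z))"
      by (simp only: split add_diff_cancel)
  qed
  finally show iff: "integrable J f \<longleftrightarrow> integrable (count_space UNIV) (\<lambda>z. A z * f z)" .
  assume "integrable J f"
  then have Af: "integrable (count_space UNIV) (\<lambda>z. A z * f z)" using iff by simp
  have "(\<integral>z. f z \<partial>J) = (\<integral>z. ?w z * f z \<partial>count_space UNIV)"
    unfolding jump_measure_def using nn by (subst integral_density) (auto simp: AE_count_space)
  then have "a * (\<integral>z. f z \<partial>J) = (\<integral>z. a * (?w z * f z) \<partial>count_space UNIV)"
    by simp
  also have "\<dots> = (\<integral>z. A z * f z - (if z = 0 then - a * f z else 0) \<partial>count_space UNIV)"
    by (simp only: split add_diff_cancel)
  also have "\<dots> = (\<integral>z. A z * f z \<partial>count_space UNIV) + a * f 0"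
    using Af integral_single_count_space[of "\<lambda>z. - a * f z"]
    by (subst Bochner_Integration.integral_diff) simp_all
  finally show "a * (\<integral>z. f z \<partial>J) = (\<integral>z. A z * f z \<partial>count_space UNIV) + a * f 0" .
qed

lemma emeasure_J: "emeasure J UNIV = 1"
proof -
  have "integrable J (\<lambda>_. 1::real)"
    using integrable_A by (simp add: integral_J(1))
  moreover from integral_J(2)[OF this] have "(\<integral>z. 1 \<partial>J) = (1::real)"
    using a_pos integral_A by simp
  ultimately have "integral\<^sup>N J (\<lambda>_. ennreal 1) = ennreal 1"
    by (subst nn_integral_eq_integral) auto
  then show ?thesis by (simp add: nn_integral_const)
qed

sublocale J: prob_space J
  by (rule prob_spaceI) (simp add: emeasure_J)

sublocale E: prob_space E
  unfolding hold_measure_def by (rule prob_space_exponential_density[OF a_pos])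

sublocale JE: pair_prob_space J E ..

sublocale W: prob_space "Omega A"
  unfolding Omega_def by (rule JE.P.prob_space_stream_space)

lemma sets_W [measurable_cong]: "sets (Omega A) = sets (stream_space (J \<Otimes>\<^sub>M E))"
  by (simp add: Omega_def)

lemma space_W [simp]: "space (Omega A) = UNIV"
  by (simp add: Omega_def space_stream_space space_pair_measure)

text \<open>The first increment, the first holding time and the remaining stream are independent,
  and the remaining stream has the law of the whole. This is the Markov property at the first jump,
  in the form from which all one-step equations are derived.\<close>

lemma nn_integral_W:
  assumes [measurable]: "f \<in> borel_measurable (Omega A)"
  shows "(\<integral>\<^sup>+\<omega>. f \<omega> \<partial>Omega A) = (\<integral>\<^sup>+v. \<integral>\<^sup>+s. \<integral>\<^sup>+\<omega>. f ((v, s) ## \<omega>) \<partial>Omega A \<partial>E \<partial>J)"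
proof -
  have [measurable]: "f \<in> borel_measurable (stream_space (J \<Otimes>\<^sub>M E))"
    using assms by (simp cong: measurable_cong_sets add: sets_W)
  interpret S: prob_space "stream_space (J \<Otimes>\<^sub>M E)"
    by (rule JE.P.prob_space_stream_space)
  show ?thesis
    unfolding Omega_def
    by (subst JE.P.nn_integral_stream_space, simp, subst E.nn_integral_fst[symmetric]) simp_all
qed

lemma AE_J_steps: "AE v in J. v \<in> steps"
  unfolding jump_measure_def
  using a_pos by (subst AE_density) (auto simp: AE_count_space steps_def zero_less_divide_iff)

lemma AE_E_pos: "AE s in E. s > 0"
proof -
  have "AE s in lborel. s \<noteq> (0::real)"
    by (rule AE_lborel_singleton)
  then show ?thesis
    unfolding hold_measure_def
    by (subst AE_density) (auto simp: exponential_density_def elim: eventually_mono)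
qed

lemma nn_integral_exp_E:
  assumes "l > - a"
  shows "(\<integral>\<^sup>+s. ennreal (exp (- l * s)) \<partial>E) = ennreal (a / (a + l))"
proof -
  have al: "a + l > 0" using assms by simp
  interpret D: prob_space "density lborel (exponential_density (a + l))"
    by (rule prob_space_exponential_density[OF al])
  have *: "exponential_density a s * exp (- l * s) = a / (a + l) * exponential_density (a + l) s" for s
    using al by (simp add: exponential_density_def field_simps flip: exp_add)
  have "(\<integral>\<^sup>+s. ennreal (exp (- l * s)) \<partial>E) =
      (\<integral>\<^sup>+s. ennreal (exponential_density a s * exp (- l * s)) \<partial>lborel)"
    unfolding hold_measure_def
    by (subst nn_integral_density) (auto simp: ennreal_mult exponential_density_nonneg a_pos)
  also have "\<dots> = (\<integral>\<^sup>+s. ennreal (a / (a + l)) * ennreal (exponential_density (a + l) s) \<partial>lborel)"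
    using al a_pos by (simp only: *) (subst ennreal_mult, auto simp: exponential_density_nonneg)
  also have "\<dots> = ennreal (a / (a + l)) * (\<integral>\<^sup>+s. ennreal (exponential_density (a + l) s) \<partial>lborel)"
    by (subst nn_integral_cmult) auto
  also have "(\<integral>\<^sup>+s. ennreal (exponential_density (a + l) s) \<partial>lborel) = 1"
    using D.emeasure_space_1 by (simp add: emeasure_density)
  finally show ?thesis by simp
qed

section \<open>Almost sure path properties and the decomposition at the first jump\<close>

text \<open>The paths on which the encoding is faithful: every holding time is positive, every
  increment has positive rate, and there is no explosion. The last clause keeps the set under
  \<open>LEAST\<close> in \<open>S_proc\<close> nonempty.\<close>

definition good :: "((int^'d) \<times> real) stream \<Rightarrow> bool" where
  "good \<omega> \<longleftrightarrow> (\<forall>i. snd (\<omega> !! i) > 0 \<and> fst (\<omega> !! i) \<in> steps) \<and> (\<forall>t. \<exists>n. t < jump_time \<omega> n)"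

lemma jump_time_Cons: "jump_time (p ## \<omega>) (Suc n) = snd p + jump_time \<omega> n"
  by (simp add: jump_time_def sum.lessThan_Suc_shift del: sum.lessThan_Suc)

lemma jump_time_0 [simp]: "jump_time \<omega> 0 = 0"
  by (simp add: jump_time_def)

lemma jump_chain_Cons: "jump_chain x (p ## \<omega>) (Suc n) = jump_chain (x + fst p) \<omega> n"
  by (simp add: jump_chain_def sum.lessThan_Suc_shift add.assoc del: sum.lessThan_Suc)

lemma jump_chain_0 [simp]: "jump_chain x \<omega> 0 = x"
  by (simp add: jump_chain_def)

lemma measurable_jump_time [measurable]: "(\<lambda>\<omega>. jump_time \<omega> n) \<in> borel_measurable (Omega A)"
  unfolding jump_time_def by measurable

lemma measurable_jump_chain [measurable]:
  "(\<lambda>\<omega>. jump_chain x \<omega> n) \<in> measurable (Omega A) (count_space UNIV)"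
proof (induction n)
  case (Suc n)
  note [measurable] = Suc
  have [measurable]: "(\<lambda>\<omega>. fst (\<omega> !! n)) \<in> measurable (Omega A) (count_space UNIV)"
    by (rule measurable_compose[OF _ measurable_fst[of J E, simplified measurable_cong_sets[OF refl sets_J]]]) measurable
  have "(\<lambda>\<omega>. jump_chain x \<omega> n + fst (\<omega> !! n)) \<in> measurable (Omega A) (count_space UNIV)"
    by (rule measurable_compose_countable[where f = "\<lambda>i \<omega>. i + fst (\<omega> !! n)"]) measurable
  then show ?case by (simp add: jump_chain_def add.assoc)
qed simp

text \<open>Non-explosion holds because the mean of \<open>exp (- jump_time \<omega> n)\<close> is
  \<open>q ^ n\<close> with \<open>q < 1\<close>; hence the infimum over \<open>n\<close> vanishes
  almost surely, which says that the jump times are unbounded. Natural thresholds keep the number of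
  null sets countable.\<close>

lemma AE_good: "AE \<omega> in Omega A. good \<omega>"
proof -
  have stepwise: "AE p in J \<Otimes>\<^sub>M E. snd p > 0 \<and> fst p \<in> steps"
  proof (rule AE_conjI)
    show "AE p in J \<Otimes>\<^sub>M E. snd p > 0"
      using AE_E_pos by (intro JE.AE_pair_measure) (auto simp: measurable_split_conv)
    show "AE p in J \<Otimes>\<^sub>M E. fst p \<in> steps"
      by (rule JE.AE_pair_measure) (use AE_J_steps in \<open>auto elim: eventually_mono\<close>)
  qed
  have "AE \<omega> in Omega A. stream_all (\<lambda>p. snd p > 0 \<and> fst p \<in> steps) \<omega>"
    unfolding Omega_def by (rule JE.P.AE_stream_all[OF _ stepwise]) measurable
  then have 1: "AE \<omega> in Omega A. \<forall>i. snd (\<omega> !! i) > 0 \<and> fst (\<omega> !! i) \<in> steps"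
    by (rule eventually_mono) (auto simp: sset_range)
  define q where "q = a / (a + 1)"
  have q: "0 < q" "q < 1" using a_pos by (auto simp: q_def)
  have exp_q: "(\<integral>\<^sup>+\<omega>. ennreal (exp (- jump_time \<omega> n)) \<partial>Omega A) = ennreal (q ^ n)" for n
  proof (induction n)
    case 0
    then show ?case using W.emeasure_space_1 by simp
  next
    case (Suc n)
    have "(\<integral>\<^sup>+\<omega>. ennreal (exp (- jump_time \<omega> (Suc n))) \<partial>Omega A) =
       (\<integral>\<^sup>+v. \<integral>\<^sup>+s. \<integral>\<^sup>+\<omega>. ennreal (exp (-s)) * ennreal (exp (- jump_time \<omega> n)) \<partial>Omega A \<partial>E \<partial>J)"
      by (subst nn_integral_W) (auto simp: jump_time_Cons exp_diff ennreal_mult' exp_minus field_simps exp_add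
         simp flip: ennreal_mult)
    also have "\<dots> = (\<integral>\<^sup>+v. \<integral>\<^sup>+s. ennreal (exp (-s)) * ennreal (q ^ n) \<partial>E \<partial>J)"
      using Suc by (simp add: nn_integral_cmult)
    also have "\<dots> = ennreal q * ennreal (q ^ n)"
      using nn_integral_exp_E[of 1] a_pos by (simp add: nn_integral_multc J.emeasure_space_1[simplified] q_def)
    finally show ?case using q by (simp add: ennreal_mult)
  qed
  have "AE \<omega> in Omega A. t < (SUP n. ereal (jump_time \<omega> n))" if "t \<in> range real" for t
  proof -
    have "(\<integral>\<^sup>+\<omega>. (INF n. ennreal (exp (- jump_time \<omega> n))) \<partial>Omega A) \<le> ennreal (q ^ n)" for n
      unfolding exp_q[symmetric] by (intro nn_integral_mono INF_lower) auto
    moreover have "(\<lambda>n. ennreal (q ^ n)) \<longlonglongrightarrow> ennreal 0"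
      using q by (intro tendsto_ennrealI LIMSEQ_realpow_zero) auto
    ultimately have "(\<integral>\<^sup>+\<omega>. (INF n. ennreal (exp (- jump_time \<omega> n))) \<partial>Omega A) \<le> 0"
      by (intro LIMSEQ_le_const[where X = "\<lambda>n. ennreal (q ^ n)"]) auto
    then have "AE \<omega> in Omega A. (INF n. ennreal (exp (- jump_time \<omega> n))) = 0"
      by (subst (asm) le_zero_eq, subst (asm) nn_integral_0_iff_AE) auto
    then show ?thesis
    proof eventually_elim
      case (elim \<omega>)
      then have "(INF n. ennreal (exp (- jump_time \<omega> n))) < ennreal (exp (- t))" by simp
      then obtain n where "ennreal (exp (- jump_time \<omega> n)) < ennreal (exp (- t))"
        by (auto simp: INF_less_iff)
      then have "ereal t < ereal (jump_time \<omega> n)" by (simp add: ennreal_less_iff)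
      also have "\<dots> \<le> (SUP n. ereal (jump_time \<omega> n))" by (rule SUP_upper) simp
      finally show ?case .
    qed
  qed
  then have "AE \<omega> in Omega A. \<forall>m. ereal (real m) < (SUP n. ereal (jump_time \<omega> n))"
    by (subst AE_all_countable) auto
  with 1 show ?thesis
  proof eventually_elim
    case (elim \<omega>)
    have "\<exists>n. t < jump_time \<omega> n" for t
    proof -
      obtain m where "t < real m" using reals_Archimedean2 by blast
      moreover obtain n where "real m < jump_time \<omega> n"
        using elim(2) by (auto simp: less_SUP_iff)
      ultimately show ?thesis by (meson less_trans)
    qed
    then show ?case using elim(1) by (auto simp: good_def)
  qed
qed

lemma good_Cons: "good (p ## \<omega>) \<Longrightarrow> snd p > 0 \<and> fst p \<in> steps \<and> good \<omega>"
proof -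
  assume g: "good (p ## \<omega>)"
  have 1: "snd ((p ## \<omega>) !! i) > 0 \<and> fst ((p ## \<omega>) !! i) \<in> steps" for i using g by (simp add: good_def)
  have "\<exists>n. t < jump_time \<omega> n" for t
  proof -
    obtain n where "max 0 (t + snd p) < jump_time (p ## \<omega>) n" using g unfolding good_def by blast
    then show ?thesis by (cases n) (auto simp: jump_time_Cons)
  qed
  then show ?thesis using 1[of 0] 1[of "Suc _"] by (auto simp: good_def)
qed

text \<open>Pathwise counterpart of the Markov property: after the first holding time the process is
  the one driven by the shifted stream, started at the new state. Non-explosion supplies the witness
  that \<open>Least_Suc\<close> needs.\<close>

lemma S_proc_Cons:
  assumes "good (p ## \<omega>)"
  shows "S_proc x (p ## \<omega>) t = (if t < snd p then x else S_proc (x + fst p) \<omega> (t - snd p))"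
proof (cases "t < snd p")
  case True
  then have "(LEAST n. t < jump_time (p ## \<omega>) (Suc n)) = 0"
    by (intro Least_eq_0) (simp add: jump_time_Cons)
  then show ?thesis using True by (simp add: S_proc_def)
next
  case False
  obtain m where m: "max t 0 < jump_time (p ## \<omega>) m" using assms unfolding good_def by blast
  then obtain n where "t < jump_time (p ## \<omega>) (Suc n)" by (cases m) auto
  \<comment> \<open>Once the first holding time is over, index 0 fails, so the least index is one
    more than the least index of the shifted predicate.\<close>
  then have "(LEAST n. t < jump_time (p ## \<omega>) (Suc n)) =
      Suc (LEAST m. t < jump_time (p ## \<omega>) (Suc (Suc m)))"
    by (rule Least_Suc) (use False in \<open>simp add: jump_time_Cons\<close>)
  also have "(LEAST m. t < jump_time (p ## \<omega>) (Suc (Suc m))) =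
      (LEAST m. t - snd p < jump_time \<omega> (Suc m))"
    by (simp add: jump_time_Cons less_diff_eq algebra_simps)
  finally show ?thesis
    using False by (simp add: S_proc_def jump_chain_Cons)
qed

lemma S_proc_0: "good \<omega> \<Longrightarrow> S_proc x \<omega> 0 = x"
  using S_proc_Cons[of "shd \<omega>" "stl \<omega>" x 0] good_Cons[of "shd \<omega>" "stl \<omega>"] by simp

text \<open>No assumption on \<^term>\<open>\<omega>\<close>: where \<open>LEAST\<close> ranges over an empty set it returns the same
  index for all later times.\<close>
lemma S_proc_right_const: "\<exists>d>0. \<forall>u. t \<le> u \<and> u < t + d \<longrightarrow> S_proc x \<omega> u = S_proc x \<omega> t"
proof (cases "\<exists>n. t < jump_time \<omega> (Suc n)")
  case True
  define m where "m = (LEAST n. t < jump_time \<omega> (Suc n))"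
  have m: "t < jump_time \<omega> (Suc m)" "\<And>k. k < m \<Longrightarrow> jump_time \<omega> (Suc k) \<le> t"
    unfolding m_def using LeastI_ex[OF True] not_less_Least by (auto simp: not_less[symmetric])
  have "(LEAST n. u < jump_time \<omega> (Suc n)) = m" if "t \<le> u" "u < jump_time \<omega> (Suc m)" for u
    using that m(2) by (intro Least_equality) (force simp: not_less[symmetric])+
  then show ?thesis
    using m(1) unfolding S_proc_def m_def[symmetric]
    by (intro exI[of _ "jump_time \<omega> (Suc m) - t"]) auto
next
  case False
  then have "\<not> t < jump_time \<omega> (Suc n)" for n by blast
  then have eq: "(\<lambda>n. u < jump_time \<omega> (Suc n)) = (\<lambda>n. t < jump_time \<omega> (Suc n))" if "t \<le> u" for u
    using that by (intro ext) (metis order_le_less_trans)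
  have "S_proc x \<omega> u = S_proc x \<omega> t" if "t \<le> u" for u
    unfolding S_proc_def by (subst eq[OF that]) (rule refl)
  then show ?thesis using zero_less_one by blast
qed

lemma measurable_S_proc [measurable (raw)]:
  assumes [measurable]: "T \<in> borel_measurable M" "W \<in> measurable M (Omega A)"
  shows "(\<lambda>\<eta>. S_proc x (W \<eta>) (T \<eta>)) \<in> measurable M (count_space UNIV)"
  unfolding S_proc_def
proof (rule measurable_compose_countable[where f = "\<lambda>n \<eta>. jump_chain x (W \<eta>) n"])
  show "(\<lambda>\<eta>. jump_chain x (W \<eta>) n) \<in> measurable M (count_space UNIV)" for n
    by (rule measurable_compose[OF assms(2) measurable_jump_chain])
  have [measurable]: "(\<lambda>\<eta>. jump_time (W \<eta>) n) \<in> borel_measurable M" for n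
    by (rule measurable_compose[OF assms(2) measurable_jump_time])
  show "(\<lambda>\<eta>. LEAST n. T \<eta> < jump_time (W \<eta>) (Suc n)) \<in> measurable M (count_space UNIV)"
    by measurable
qed

end

section \<open>Measurability of hitting times through rational times\<close>

text \<open>If each admissible time has an admissible right neighbourhood, rational admissible times
  approach it from above. The uncountable infimum thus becomes a countable one; the value
  \<open>\<infinity>\<close> at inadmissible rationals leaves it unchanged.\<close>

lemma Inf_ereal_rat:
  fixes P :: "real \<Rightarrow> bool"
  assumes "\<And>t. t \<ge> 0 \<Longrightarrow> P t \<Longrightarrow> \<exists>d>0. \<forall>u. t \<le> u \<and> u < t + d \<longrightarrow> P u"
  shows "Inf {ereal t | t. t \<ge> 0 \<and> P t} =
    (INF q::rat. if 0 \<le> q \<and> P (of_rat q) then ereal (of_rat q) else \<infinity>)"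
proof (rule antisym)
  show "Inf {ereal t | t. t \<ge> 0 \<and> P t} \<le>
      (INF q::rat. if 0 \<le> q \<and> P (of_rat q) then ereal (of_rat q) else \<infinity>)"
    by (intro INF_greatest) (auto intro!: Inf_lower)
next
  show "(INF q::rat. if 0 \<le> q \<and> P (of_rat q) then ereal (of_rat q) else \<infinity>)
      \<le> Inf {ereal t | t. t \<ge> 0 \<and> P t}" (is "?I \<le> _")
  proof (rule Inf_greatest, clarify)
    fix t :: real assume t: "t \<ge> 0" "P t"
    obtain d where d: "d > 0" "\<And>u. t \<le> u \<Longrightarrow> u < t + d \<Longrightarrow> P u"
      using assms[OF t] by blast
    show "?I \<le> ereal t"
    proof (rule ereal_le_epsilon2)
      fix e :: real assume "e > 0"
      then have "t < t + min d e" using d(1) by simp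
      then obtain r where r: "t < real_of_rat r" "real_of_rat r < t + min d e"
        using of_rat_dense by blast
      then have "P (of_rat r)" using d(2)[of "of_rat r"] by simp
      moreover have "0 \<le> real_of_rat r" using r t by linarith
      then have "0 \<le> r" by simp
      ultimately have "?I \<le> ereal (of_rat r)"
        by (intro INF_lower2[of r]) auto
      also have "\<dots> \<le> ereal t + ereal e" using r by simp
      finally show "?I \<le> ereal t + ereal e" .
    qed
  qed
qed

lemma Inf_ereal_shift:
  fixes S :: "ereal set"
  shows "Inf ((\<lambda>s. ereal c + s) ` S) = ereal c + Inf S"
proof (rule antisym)
  show "ereal c + Inf S \<le> Inf ((\<lambda>s. ereal c + s) ` S)"
    by (auto intro!: Inf_greatest add_left_mono Inf_lower)
  have "Inf ((\<lambda>s. ereal c + s) ` S) - ereal c \<le> Inf S"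
  proof (rule Inf_greatest)
    fix s assume "s \<in> S"
    then have "Inf ((\<lambda>s. ereal c + s) ` S) \<le> ereal c + s" by (intro Inf_lower) auto
    then show "Inf ((\<lambda>s. ereal c + s) ` S) - ereal c \<le> s"
      by (simp add: ereal_minus_le add.commute)
  qed
  then show "Inf ((\<lambda>s. ereal c + s) ` S) \<le> ereal c + Inf S"
    by (simp add: ereal_minus_le add.commute)
qed

text \<open>The rational time points suffice because the paths are constant to the right of every time.\<close>
lemma hitting_time_rat:
  fixes X :: "real \<Rightarrow> 's"
  assumes X: "\<And>t. \<exists>d>0. \<forall>u. t \<le> u \<and> u < t + d \<longrightarrow> X u = X t" and "y \<noteq> z"
  shows "Inf {ereal t | t. t \<ge> 0 \<and> X t = y \<and> (\<forall>u. 0 \<le> u \<and> u \<le> t \<longrightarrow> b \<or> X u \<noteq> z)} =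
    (INF q::rat. if 0 \<le> q \<and> X (of_rat q) = y \<and>
        (\<forall>r::rat. 0 \<le> r \<and> r \<le> q \<longrightarrow> b \<or> X (of_rat r) \<noteq> z) then ereal (of_rat q) else \<infinity>)"
proof -
  have "\<exists>d>0. \<forall>u. t \<le> u \<and> u < t + d \<longrightarrow> X u = y \<and> (\<forall>v. 0 \<le> v \<and> v \<le> u \<longrightarrow> b \<or> X v \<noteq> z)"
    if t: "X t = y" "\<forall>u. 0 \<le> u \<and> u \<le> t \<longrightarrow> b \<or> X u \<noteq> z" for t
  proof -
    obtain d where d: "d > 0" "\<And>u. t \<le> u \<Longrightarrow> u < t + d \<Longrightarrow> X u = y"
      using X[of t] t(1) by auto
    have "b \<or> X v \<noteq> z" if "0 \<le> v" "v \<le> u" "u < t + d" for u v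
      using t(2) d(2)[of v] that \<open>y \<noteq> z\<close> by (cases "v \<le> t") auto
    then show ?thesis using d by (intro exI[of _ d]) auto
  qed
  then have "Inf {ereal t | t. t \<ge> 0 \<and> X t = y \<and> (\<forall>u. 0 \<le> u \<and> u \<le> t \<longrightarrow> b \<or> X u \<noteq> z)} =
    (INF q::rat. if 0 \<le> q \<and> (X (of_rat q) = y \<and>
        (\<forall>u. 0 \<le> u \<and> u \<le> of_rat q \<longrightarrow> b \<or> X u \<noteq> z)) then ereal (of_rat q) else \<infinity>)"
    by (intro Inf_ereal_rat) auto
  moreover have "(\<forall>u. 0 \<le> u \<and> u \<le> of_rat q \<longrightarrow> b \<or> X u \<noteq> z) \<longleftrightarrow>
      (\<forall>r::rat. 0 \<le> r \<and> r \<le> q \<longrightarrow> b \<or> X (of_rat r) \<noteq> z)" if y: "X (of_rat q) = y" for q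
  proof (intro iffI allI impI)
    fix r :: rat assume "\<forall>u. 0 \<le> u \<and> u \<le> of_rat q \<longrightarrow> b \<or> X u \<noteq> z" "0 \<le> r \<and> r \<le> q"
    then show "b \<or> X (of_rat r) \<noteq> z"
      by (auto simp: zero_le_of_rat_iff of_rat_less_eq)
  next
    fix u :: real
    assume r: "\<forall>r::rat. 0 \<le> r \<and> r \<le> q \<longrightarrow> b \<or> X (of_rat r) \<noteq> z" and u: "0 \<le> u \<and> u \<le> of_rat q"
    \<comment> \<open>A visit to \<open>z\<close> lasts for some time to the right of
      \<open>u\<close>, and it starts strictly before \<open>of_rat q\<close> because the path is at
      \<open>y\<close> there. Hence some rational time up to \<open>q\<close> would also see
      it.\<close>
    show "b \<or> X u \<noteq> z"
    proof (rule ccontr)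
      assume contra: "\<not> (b \<or> X u \<noteq> z)"
      then have "u < of_rat q" using u y \<open>y \<noteq> z\<close> by (cases "u = of_rat q") auto
      moreover obtain d where d: "d > 0" "\<And>v. u \<le> v \<Longrightarrow> v < u + d \<Longrightarrow> X v = z"
        using X[of u] contra by auto
      ultimately have "u < min (of_rat q) (u + d)" by simp
      then obtain s where s: "u < real_of_rat s" "real_of_rat s < min (of_rat q) (u + d)"
        using of_rat_dense by blast
      then have "X (of_rat s) = z" using d(2)[of "of_rat s"] by simp
      moreover have "0 \<le> real_of_rat s" "real_of_rat s \<le> of_rat q" using s u by linarith+
      then have "0 \<le> s" "s \<le> q" by (simp_all add: of_rat_less_eq)
      ultimately show False using r contra by auto
    qed
  qed
  ultimately show ?thesis by (simp cong: conj_cong)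
qed

section \<open>Hitting times seen from the first jump\<close>

context random_walk
begin

text \<open>The taboo hitting time counted from time 0. Unlike the two hitting times of the theorem
  it obeys a recursion in the starting point, with boundary values 0 at \<open>y\<close> and
  \<open>\<infinity>\<close> at \<open>z\<close>.\<close>

definition sigma :: "int^'d \<Rightarrow> int^'d \<Rightarrow> int^'d \<Rightarrow> ((int^'d) \<times> real) stream \<Rightarrow> ereal" where
  "sigma y z w \<omega> = Inf {ereal t | t. t \<ge> 0 \<and> S_proc w \<omega> t = y \<and>
      (\<forall>u. 0 \<le> u \<and> u \<le> t \<longrightarrow> S_proc w \<omega> u \<noteq> z)}"

lemma tau_nonneg: "0 \<le> tau x \<omega>"
  unfolding tau_def by (auto intro!: Inf_greatest)

lemma tau_yz_minus_nonneg: "0 \<le> tau_yz_minus x y z \<omega>"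
  unfolding tau_yz_minus_def by (auto intro!: Inf_greatest)

lemma sigma_nonneg: "0 \<le> sigma x y z \<omega>"
  unfolding sigma_def by (auto intro!: Inf_greatest)

lemma measurable_tau [measurable]: "tau x \<in> borel_measurable (Omega A)"
proof -
  have "tau x \<omega> = (INF q::rat. if 0 \<le> q \<and> S_proc x \<omega> (of_rat q) \<noteq> S_proc x \<omega> 0
      then ereal (of_rat q) else \<infinity>)" for \<omega>
    unfolding tau_def using S_proc_right_const[of _ x \<omega>] by (intro Inf_ereal_rat) metis
  then have eq: "tau x = (\<lambda>\<omega>. INF q::rat. if 0 \<le> q \<and> S_proc x \<omega> (of_rat q) \<noteq> S_proc x \<omega> 0
      then ereal (of_rat q) else \<infinity>)" by auto
  show ?thesis unfolding eq by measurable
qed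

text \<open>On a path that never jumps, \<open>real_of_ereal\<close> sends the infinite
  \<open>tau\<close> to 0 and the taboo condition of the definition is vacuous. The disjunct
  \<open>tau x \<omega> = \<infinity>\<close> reproduces this, and the result has the shape required
  by \<open>hitting_time_rat\<close>, with that disjunct as the flag \<open>b\<close>.\<close>

lemma tau_yz_minus_alt:
  "tau_yz_minus x y z \<omega> = Inf {ereal t | t. t \<ge> 0 \<and> S_proc x \<omega> (t + real_of_ereal (tau x \<omega>)) = y \<and>
      (\<forall>u. 0 \<le> u \<and> u \<le> t \<longrightarrow> tau x \<omega> = \<infinity> \<or> S_proc x \<omega> (u + real_of_ereal (tau x \<omega>)) \<noteq> z)}"
proof -
  have "(\<forall>u. tau x \<omega> \<le> ereal u \<and> u \<le> t + real_of_ereal (tau x \<omega>) \<longrightarrow> S_proc x \<omega> u \<noteq> z) \<longleftrightarrow>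
    (\<forall>u. 0 \<le> u \<and> u \<le> t \<longrightarrow> tau x \<omega> = \<infinity> \<or> S_proc x \<omega> (u + real_of_ereal (tau x \<omega>)) \<noteq> z)" for t
  proof (cases "tau x \<omega>")
    case (real c)
    have "(\<forall>u. c \<le> u \<and> u \<le> t + c \<longrightarrow> S_proc x \<omega> u \<noteq> z) \<longleftrightarrow>
      (\<forall>u. 0 \<le> u \<and> u \<le> t \<longrightarrow> S_proc x \<omega> (u + c) \<noteq> z)"
      by (metis add_le_cancel_right add.commute add_0 diff_add_cancel)
    then show ?thesis using real by simp
  qed (use tau_nonneg[of x \<omega>] in auto)
  then show ?thesis unfolding tau_yz_minus_def by simp
qed

text \<open>A translation of the time axis by \<open>tau\<close>; when \<open>tau\<close> is
  infinite both sides are infinite. It is the link between the two laws: they differ by the first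
  holding time only, so they have the same total mass.\<close>

lemma tau_yz_eq: "tau_yz x y z \<omega> = tau x \<omega> + tau_yz_minus x y z \<omega>"
proof (cases "tau x \<omega>")
  case (real c)
  have "{ereal t | t. c \<le> t \<and> S_proc x \<omega> t = y \<and> (\<forall>u. c \<le> u \<and> u \<le> t \<longrightarrow> S_proc x \<omega> u \<noteq> z)} =
    (\<lambda>s. ereal c + s) ` {ereal t | t. t \<ge> 0 \<and> S_proc x \<omega> (t + c) = y \<and>
      (\<forall>u. c \<le> u \<and> u \<le> t + c \<longrightarrow> S_proc x \<omega> u \<noteq> z)}" (is "?L = ?R")
  proof (intro equalityI subsetI)
    fix s assume "s \<in> ?L"
    then obtain t where "s = ereal t" "c \<le> t" "S_proc x \<omega> t = y" "\<forall>u. c \<le> u \<and> u \<le> t \<longrightarrow> S_proc x \<omega> u \<noteq> z"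
      by auto
    then show "s \<in> ?R"
      by (intro image_eqI[of _ _ "ereal (t - c)"]) auto
  qed (auto simp: add.commute)
  then show ?thesis
    using real Inf_ereal_shift[of c] by (simp add: tau_yz_def tau_yz_minus_def)
next
  case PInf
  then show ?thesis using tau_yz_minus_nonneg[of x y z \<omega>]
    by (simp add: tau_yz_def top_ereal_def)
qed (use tau_nonneg[of x \<omega>] in auto)

lemma measurable_tau_yz_minus [measurable]:
  assumes "y \<noteq> z"
  shows "tau_yz_minus x y z \<in> borel_measurable (Omega A)"
proof -
  let ?X = "\<lambda>\<omega> t. S_proc x \<omega> (t + real_of_ereal (tau x \<omega>))"
  have right: "\<exists>d>0. \<forall>u. t \<le> u \<and> u < t + d \<longrightarrow> ?X \<omega> u = ?X \<omega> t" for \<omega> t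
  proof -
    obtain d where d: "d > 0" "\<And>u. t + real_of_ereal (tau x \<omega>) \<le> u \<Longrightarrow>
        u < t + real_of_ereal (tau x \<omega>) + d \<Longrightarrow> S_proc x \<omega> u = ?X \<omega> t"
      using S_proc_right_const[of "t + real_of_ereal (tau x \<omega>)" x \<omega>] by blast
    have "?X \<omega> u = ?X \<omega> t" if "t \<le> u" "u < t + d" for u
      using that by (intro d(2)) auto
    then show ?thesis using d(1) by blast
  qed
  have eq: "tau_yz_minus x y z = (\<lambda>\<omega>. INF q::rat. if 0 \<le> q \<and> ?X \<omega> (of_rat q) = y \<and>
        (\<forall>r::rat. 0 \<le> r \<and> r \<le> q \<longrightarrow> tau x \<omega> = \<infinity> \<or> ?X \<omega> (of_rat r) \<noteq> z) then ereal (of_rat q) else \<infinity>)"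
    unfolding tau_yz_minus_alt using hitting_time_rat[OF right \<open>y \<noteq> z\<close>] by (intro ext) simp
  show ?thesis unfolding eq by measurable
qed

lemma measurable_tau_yz [measurable]:
  "y \<noteq> z \<Longrightarrow> tau_yz x y z \<in> borel_measurable (Omega A)"
  unfolding tau_yz_eq[abs_def] by measurable

lemma measurable_sigma [measurable]:
  assumes "y \<noteq> z"
  shows "sigma y z w \<in> borel_measurable (Omega A)"
proof -
  have eq: "sigma y z w = (\<lambda>\<omega>. INF q::rat. if 0 \<le> q \<and> S_proc w \<omega> (of_rat q) = y \<and>
        (\<forall>r::rat. 0 \<le> r \<and> r \<le> q \<longrightarrow> False \<or> S_proc w \<omega> (of_rat r) \<noteq> z) then ereal (of_rat q) else \<infinity>)"
    unfolding sigma_def using hitting_time_rat[OF S_proc_right_const \<open>y \<noteq> z\<close>, where b = False]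
    by (intro ext) simp
  show ?thesis unfolding eq by measurable
qed

lemma sigma_target: "good \<omega> \<Longrightarrow> y \<noteq> z \<Longrightarrow> sigma y z y \<omega> = 0"
  using S_proc_0[of \<omega> y] unfolding sigma_def
  by (intro antisym[OF Inf_lower Inf_greatest]) (auto intro!: exI[of _ 0])

lemma sigma_taboo: "good \<omega> \<Longrightarrow> sigma y z z \<omega> = \<infinity>"
  using S_proc_0[of \<omega> z] by (force simp: sigma_def top_ereal_def intro: Inf_eqI)

lemma sigma_Cons:
  assumes g: "good (p ## \<omega>)" and w: "w \<noteq> y" "w \<noteq> z"
  shows "sigma y z w (p ## \<omega>) = ereal (snd p) + sigma y z (w + fst p) \<omega>"
proof -
  have p: "snd p > 0" using good_Cons[OF g] by simp
  let ?Q = "\<lambda>t. \<forall>u. 0 \<le> u \<and> u \<le> t \<longrightarrow> S_proc (w + fst p) \<omega> u \<noteq> z"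
  have "{ereal t | t. t \<ge> 0 \<and> S_proc w (p ## \<omega>) t = y \<and>
      (\<forall>u. 0 \<le> u \<and> u \<le> t \<longrightarrow> S_proc w (p ## \<omega>) u \<noteq> z)} =
    (\<lambda>s. ereal (snd p) + s) ` {ereal t | t. t \<ge> 0 \<and> S_proc (w + fst p) \<omega> t = y \<and> ?Q t}" (is "?L = ?R")
  proof (intro equalityI subsetI)
    fix s assume "s \<in> ?L"
    then obtain t where t: "s = ereal t" "0 \<le> t" "S_proc w (p ## \<omega>) t = y"
      "\<And>u. 0 \<le> u \<Longrightarrow> u \<le> t \<Longrightarrow> S_proc w (p ## \<omega>) u \<noteq> z"
      by auto
    have tp: "snd p \<le> t" using t(3) w(1) by (auto simp: S_proc_Cons[OF g] split: if_splits)
    have "?Q (t - snd p)"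
    proof (intro allI impI)
      fix u assume "0 \<le> u \<and> u \<le> t - snd p"
      then show "S_proc (w + fst p) \<omega> u \<noteq> z" using t(4)[of "u + snd p"] p by (simp add: S_proc_Cons[OF g])
    qed
    then show "s \<in> ?R" using t(1,3) tp
      by (intro image_eqI[of _ _ "ereal (t - snd p)"]) (auto simp: S_proc_Cons[OF g])
  next
    fix s assume "s \<in> ?R"
    then obtain t where t: "s = ereal (t + snd p)" "0 \<le> t" "S_proc (w + fst p) \<omega> t = y" "?Q t"
      by (auto simp: add.commute)
    moreover have "S_proc w (p ## \<omega>) u \<noteq> z" if "0 \<le> u" "u \<le> t + snd p" for u
      using t(4) w(2) that by (auto simp: S_proc_Cons[OF g])
    ultimately show "s \<in> ?L" using p by (auto simp: S_proc_Cons[OF g] intro!: exI[of _ "t + snd p"])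
  qed
  then show ?thesis by (simp add: sigma_def Inf_ereal_shift)
qed

lemma tau_Cons:
  assumes g: "good (p ## \<omega>)"
  shows "tau x (p ## \<omega>) = ereal (snd p)"
proof -
  have p: "snd p > 0" "fst p \<noteq> 0" "good \<omega>" using good_Cons[OF g] by (auto simp: steps_def)
  have "S_proc x (p ## \<omega>) (snd p) \<noteq> S_proc x (p ## \<omega>) 0"
    using p by (simp add: S_proc_Cons[OF g] S_proc_0)
  then show ?thesis unfolding tau_def
    using p by (intro antisym Inf_lower Inf_greatest)
      (auto simp: S_proc_Cons[OF g] not_less[symmetric] split: if_splits)
qed

text \<open>The first holding time cancels and only the first increment survives. This is why the
  transform of this law is a plain average over one jump, without a factor
  \<open>a / (a + l)\<close>.\<close>

lemma tau_yz_minus_Cons: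
  assumes g: "good (p ## \<omega>)"
  shows "tau_yz_minus x y z (p ## \<omega>) = sigma y z (x + fst p) \<omega>"
  using good_Cons[OF g] unfolding tau_yz_minus_alt sigma_def tau_Cons[OF g]
  by (simp add: S_proc_Cons[OF g] not_less cong: conj_cong)

lemma AE_good_Cons: "AE v in J. AE s in E. AE \<omega> in Omega A. good ((v, s) ## \<omega>)"
proof -
  have "AE \<omega> in Omega A. (\<forall>i. snd (\<omega> !! i) > 0 \<and> fst (\<omega> !! i) \<in> steps) \<and> (\<forall>t. \<exists>n. t < jump_time \<omega> n)"
    using AE_good by (simp add: good_def)
  show ?thesis
    using AE_J_steps
  proof eventually_elim
    case (elim v)
    show ?case using AE_E_pos
    proof eventually_elim
      case s: (elim s)
      show ?case using AE_good
      proof eventually_elim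
        case \<omega>: (elim \<omega>)
        have "\<exists>n. t < jump_time ((v, s) ## \<omega>) n" for t
        proof -
          obtain n where "t - s < jump_time \<omega> n" using \<omega> by (auto simp: good_def)
          then show ?thesis by (intro exI[of _ "Suc n"]) (simp add: jump_time_Cons)
        qed
        moreover have "snd (((v, s) ## \<omega>) !! i) > 0 \<and> fst (((v, s) ## \<omega>) !! i) \<in> steps" for i
          using elim s \<omega> by (cases i) (auto simp: good_def)
        ultimately show ?case by (auto simp: good_def)
      qed
    qed
  qed
qed

lemma nn_integral_W_good:
  assumes [measurable]: "f \<in> borel_measurable (Omega A)"
    and "\<And>v s \<omega>. good ((v, s) ## \<omega>) \<Longrightarrow> f ((v, s) ## \<omega>) = g v s \<omega>"
  shows "(\<integral>\<^sup>+\<omega>. f \<omega> \<partial>Omega A) = (\<integral>\<^sup>+v. \<integral>\<^sup>+s. \<integral>\<^sup>+\<omega>. g v s \<omega> \<partial>Omega A \<partial>E \<partial>J)"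
proof -
  have "AE v in J. (\<integral>\<^sup>+s. \<integral>\<^sup>+\<omega>. f ((v, s) ## \<omega>) \<partial>Omega A \<partial>E) = (\<integral>\<^sup>+s. \<integral>\<^sup>+\<omega>. g v s \<omega> \<partial>Omega A \<partial>E)"
    using AE_good_Cons
  proof eventually_elim
    case (elim v)
    then show ?case
      by (intro nn_integral_cong_AE) (auto elim!: eventually_mono intro!: nn_integral_cong_AE simp: assms(2))
  qed
  then show ?thesis by (subst nn_integral_W) (auto intro: nn_integral_cong_AE)
qed

end

section \<open>Resolvent equations for the transforms of hitting times\<close>

text \<open>The exponential weight with the value 0 at \<open>\<infinity>\<close>, so that
  expectations automatically run over the paths on which the target is reached.\<close>

definition ltrans :: "real \<Rightarrow> ereal \<Rightarrow> real" where
  "ltrans l s = (if s = \<infinity> then 0 else exp (- l * real_of_ereal s))"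

lemma ltrans_infinity [simp]: "ltrans l \<infinity> = 0"
  and ltrans_0 [simp]: "ltrans l 0 = 1"
  by (auto simp: ltrans_def)

lemma ltrans_nonneg [simp]: "0 \<le> ltrans l s"
  by (simp add: ltrans_def)

lemma ltrans_le_1: "0 \<le> l \<Longrightarrow> 0 \<le> s \<Longrightarrow> ltrans l s \<le> 1"
  by (cases s) (auto simp: ltrans_def)

lemma ltrans_add: "0 \<le> s \<Longrightarrow> ltrans l (ereal c + s) = exp (- l * c) * ltrans l s"
  by (cases s) (auto simp: ltrans_def ring_distribs simp flip: exp_add)

lemma measurable_ltrans [measurable]: "ltrans l \<in> borel_measurable borel"
  unfolding ltrans_def by measurable

context random_walk
begin

lemma integrable_J_bounded:
  fixes f :: "int^'d \<Rightarrow> real"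
  assumes "\<And>v. \<bar>f v\<bar> \<le> B"
  shows "integrable J f"
  by (rule J.integrable_const_bound[of _ B]) (use assms in auto)

text \<open>Each use of the equation contracts the uniform bound by the factor \<open>q < 1\<close>.
  Applied to differences, this is the uniqueness principle by which probabilistic and analytic
  expressions are identified; \<open>S\<close> is the set of boundary points.\<close>

lemma bounded_resolvent_unique:
  fixes u :: "int^'d \<Rightarrow> real"
  assumes "\<And>w. \<bar>u w\<bar> \<le> B" "0 \<le> q" "q < 1"
    and "\<And>w. w \<notin> S \<Longrightarrow> u w = q * (\<integral>v. u (w + v) \<partial>J)" "\<And>w. w \<in> S \<Longrightarrow> u w = 0"
  shows "u w = 0"
proof -
  have B: "0 \<le> B" using assms(1)[of 0] by linarith
  have bound: "\<bar>u w\<bar> \<le> q ^ n * B" for n w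
  proof (induction n arbitrary: w)
    case (Suc n)
    show ?case
    proof (cases "w \<in> S")
      case False
      have "\<bar>\<integral>v. u (w + v) \<partial>J\<bar> \<le> (\<integral>v. \<bar>u (w + v)\<bar> \<partial>J)" by (rule integral_abs_bound)
      also have "\<dots> \<le> (\<integral>v. q ^ n * B \<partial>J)"
        by (intro integral_mono integrable_J_bounded[of "\<lambda>v. \<bar>u (w + v)\<bar>" B] Suc) (auto simp: assms(1))
      also have "\<dots> = q ^ n * B" using J.prob_space by simp
      finally show ?thesis using assms(2) assms(4)[OF False]
        by (simp add: abs_mult mult.assoc mult_left_mono)
    next
      case True
      then show ?thesis using assms(2) B by (simp add: assms(5) del: power_Suc)
    qed
  next
    case 0
    show ?case using assms(1) by simp
  qed
  have "(\<lambda>n. q ^ n * B) \<longlonglongrightarrow> 0 * B"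
    using assms by (intro tendsto_intros LIMSEQ_realpow_zero)
  then have "\<bar>u w\<bar> \<le> 0"
    using bound by (intro LIMSEQ_le_const[where X = "\<lambda>n. q ^ n * B"]) auto
  then show ?thesis by simp
qed

definition hit :: "real \<Rightarrow> int^'d \<Rightarrow> int^'d \<Rightarrow> int^'d \<Rightarrow> real" where
  "hit l y z w = (\<integral>\<omega>. ltrans l (sigma y z w \<omega>) \<partial>Omega A)"

definition hit_minus :: "real \<Rightarrow> int^'d \<Rightarrow> int^'d \<Rightarrow> int^'d \<Rightarrow> real" where
  "hit_minus l y z x = (\<integral>\<omega>. ltrans l (tau_yz_minus x y z \<omega>) \<partial>Omega A)"

context
  fixes l :: real and y z :: "int^'d"
  assumes l: "l > 0" and yz: "y \<noteq> z"
begin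

private lemma measurable_sigma' [measurable]: "sigma y z w \<in> borel_measurable (Omega A)"
  and measurable_tau_yz_minus' [measurable]: "tau_yz_minus w y z \<in> borel_measurable (Omega A)"
  using yz by measurable

lemma nn_hit: "(\<integral>\<^sup>+\<omega>. ennreal (ltrans l (sigma y z w \<omega>)) \<partial>Omega A) = ennreal (hit l y z w)"
  unfolding hit_def using l sigma_nonneg
  by (intro nn_integral_eq_integral W.integrable_const_bound[where B = 1]) (auto simp: ltrans_le_1)

lemma nn_hit_minus: "(\<integral>\<^sup>+\<omega>. ennreal (ltrans l (tau_yz_minus x y z \<omega>)) \<partial>Omega A) = ennreal (hit_minus l y z x)"
  unfolding hit_minus_def using l
  by (intro nn_integral_eq_integral W.integrable_const_bound[where B = 1] AE_I2)
    (auto simp: ltrans_le_1 tau_yz_minus_nonneg)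

lemma hit_nonneg: "0 \<le> hit l y z w"
  and hit_minus_nonneg: "0 \<le> hit_minus l y z w"
  by (auto simp: hit_def hit_minus_def)

lemma hit_le_1: "hit l y z w \<le> 1"
proof -
  have "ennreal (hit l y z w) \<le> (\<integral>\<^sup>+\<omega>. 1 \<partial>Omega A)"
    unfolding nn_hit[symmetric] using l sigma_nonneg
    by (intro nn_integral_mono) (auto simp: ltrans_le_1)
  then show ?thesis using W.emeasure_space_1 by simp
qed

lemma hit_abs_le_1: "\<bar>hit l y z w\<bar> \<le> 1"
  using hit_le_1[of w] hit_nonneg[of w] by simp

lemma hit_target: "hit l y z y = 1"
proof -
  have "hit l y z y = (\<integral>\<omega>. 1 \<partial>Omega A)"
    unfolding hit_def using AE_good yz
    by (intro integral_cong_AE) (auto elim!: eventually_mono simp: sigma_target)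
  then show ?thesis using W.prob_space by simp
qed

lemma hit_taboo: "hit l y z z = 0"
proof -
  have "hit l y z z = (\<integral>\<omega>. 0 \<partial>Omega A)"
    unfolding hit_def using AE_good yz
    by (intro integral_cong_AE) (auto elim!: eventually_mono simp: sigma_taboo)
  then show ?thesis by simp
qed

lemma nn_hit_J: "(\<integral>\<^sup>+v. ennreal (hit l y z (x + v)) \<partial>J) = ennreal (\<integral>v. hit l y z (x + v) \<partial>J)"
  using hit_abs_le_1 by (intro nn_integral_eq_integral integrable_J_bounded[where B = 1]) (auto simp: hit_nonneg)

text \<open>Away from both points the walk waits and then jumps; \<open>a / (a + l)\<close> is the
  transform of the waiting time.\<close>

lemma hit_step:
  assumes w: "w \<noteq> y" "w \<noteq> z"
  shows "hit l y z w = a / (a + l) * (\<integral>v. hit l y z (w + v) \<partial>J)"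
proof -
  have q: "0 \<le> a / (a + l)" using l a_pos by simp
  have "ennreal (hit l y z w) =
    (\<integral>\<^sup>+v. \<integral>\<^sup>+s. \<integral>\<^sup>+\<omega>. ennreal (exp (- l * s)) * ennreal (ltrans l (sigma y z (w + v) \<omega>)) \<partial>Omega A \<partial>E \<partial>J)"
    unfolding nn_hit[symmetric] using w
    by (intro nn_integral_W_good) (auto simp: sigma_Cons ltrans_add sigma_nonneg ennreal_mult)
  also have "\<dots> = (\<integral>\<^sup>+v. \<integral>\<^sup>+s. ennreal (exp (- l * s)) * ennreal (hit l y z (w + v)) \<partial>E \<partial>J)"
    by (simp add: nn_integral_cmult nn_hit)
  also have "\<dots> = (\<integral>\<^sup>+v. ennreal (a / (a + l)) * ennreal (hit l y z (w + v)) \<partial>J)"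
    using nn_integral_exp_E[of l] l a_pos by (subst nn_integral_multc) auto
  also have "\<dots> = ennreal (a / (a + l)) * ennreal (\<integral>v. hit l y z (w + v) \<partial>J)"
    by (simp add: nn_integral_cmult nn_hit_J)
  also have "\<dots> = ennreal (a / (a + l) * (\<integral>v. hit l y z (w + v) \<partial>J))"
    using q by (subst ennreal_mult) (auto simp: Bochner_Integration.integral_nonneg hit_nonneg)
  finally show ?thesis
    using q by (subst (asm) ennreal_inj) (simp_all add: hit_nonneg Bochner_Integration.integral_nonneg del: times_divide_eq_left)
qed

lemma hit_minus_eq: "hit_minus l y z x = (\<integral>v. hit l y z (x + v) \<partial>J)"
proof -
  have "ennreal (hit_minus l y z x) =
    (\<integral>\<^sup>+v. \<integral>\<^sup>+s. \<integral>\<^sup>+\<omega>. ennreal (ltrans l (sigma y z (x + v) \<omega>)) \<partial>Omega A \<partial>E \<partial>J)"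
    unfolding nn_hit_minus[symmetric]
    by (intro nn_integral_W_good) (auto simp: tau_yz_minus_Cons)
  also have "\<dots> = (\<integral>\<^sup>+v. ennreal (hit l y z (x + v)) \<partial>J)"
    using E.emeasure_space_1 by (simp add: nn_hit)
  finally show ?thesis
    by (simp add: nn_hit_J hit_minus_nonneg Bochner_Integration.integral_nonneg hit_nonneg)
qed

end

section \<open>The Green function and the last exit decomposition\<close>

lemma measurable_ptrans [measurable]: "(\<lambda>t. ptrans A t x y) \<in> borel_measurable borel"
proof -
  have "(\<lambda>t. ptrans A t x y) = (\<lambda>t. \<integral>\<omega>. indicator {y} (S_proc x \<omega> t) \<partial>Omega A)"
  proof
    fix t
    have "{\<omega>. S_proc x \<omega> t = y} \<in> W.events"
      using measurable_sets[OF measurable_S_proc[of "\<lambda>_. t" "Omega A" "\<lambda>\<omega>. \<omega>" x], of "{y}"]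
      by (simp add: vimage_def)
    moreover have "(\<lambda>\<omega>. indicator {y} (S_proc x \<omega> t) :: real) = indicator {\<omega>. S_proc x \<omega> t = y}"
      by (auto simp: indicator_def)
    ultimately show "ptrans A t x y = (\<integral>\<omega>. indicator {y} (S_proc x \<omega> t) \<partial>Omega A)"
      by (simp add: ptrans_def)
  qed
  moreover have "(\<lambda>(t, \<omega>). indicator {y} (S_proc x \<omega> t) :: real) \<in> borel_measurable (borel \<Otimes>\<^sub>M Omega A)"
    by measurable
  ultimately show ?thesis
    using W.borel_measurable_lebesgue_integral[of "\<lambda>t \<omega>. indicator {y} (S_proc x \<omega> t) :: real" borel] by simp
qed

lemma ptrans_nonneg: "0 \<le> ptrans A t x y"
  and ptrans_le_1: "ptrans A t x y \<le> 1"
  by (auto simp: ptrans_def)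

text \<open>The discounted time spent at \<open>y\<close> along one path. Its mean is the Green
  function by Fubini, and pathwise it splits at the first jump, whereas \<open>ptrans\<close> alone
  would need a convolution in time.\<close>

definition occupation :: "real \<Rightarrow> int^'d \<Rightarrow> int^'d \<Rightarrow> ((int^'d) \<times> real) stream \<Rightarrow> ennreal" where
  "occupation l y x \<omega> =
    (\<integral>\<^sup>+t. ennreal (indicator {0..} t * exp (- l * t)) * indicator {y} (S_proc x \<omega> t) \<partial>lborel)"

lemma measurable_occupation [measurable]: "occupation l y x \<in> borel_measurable (Omega A)"
  unfolding occupation_def by measurable

lemma nn_integral_exp_0:
  assumes "l > 0"
  shows "(\<integral>\<^sup>+t. ennreal (indicator {0..} t * exp (- l * t)) \<partial>lborel) = ennreal (1 / l)"
    "s \<ge> 0 \<Longrightarrow> (\<integral>\<^sup>+t. ennreal (indicator {0..<s} t * exp (- l * t)) \<partial>lborel) = ennreal ((1 - exp (- l * s)) / l)"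
proof -
  have D: "((\<lambda>x. - exp (- l * x) / l) has_real_derivative exp (- l * x)) (at x)" for x
    using assms by (auto intro!: derivative_eq_intros)
  have lim: "((\<lambda>x. - exp (- l * x) / l) \<longlongrightarrow> 0) at_top"
    using assms by real_asymp
  have "(\<integral>\<^sup>+t. ennreal (exp (- l * t)) * indicator {0..} t \<partial>lborel) = ennreal (0 - (- exp (- l * 0) / l))"
    by (rule nn_integral_FTC_atLeast[OF _ D _ lim]) auto
  then show "(\<integral>\<^sup>+t. ennreal (indicator {0..} t * exp (- l * t)) \<partial>lborel) = ennreal (1 / l)"
    by (simp add: ennreal_mult' ennreal_indicator[symmetric] mult.commute)
  assume s: "s \<ge> 0"
  have "(\<integral>\<^sup>+t. ennreal (exp (- l * t)) * indicator {0..s} t \<partial>lborel) =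
      ennreal (- exp (- l * s) / l - (- exp (- l * 0) / l))"
    using s by (intro nn_integral_FTC_Icc D) auto
  moreover have "(\<integral>\<^sup>+t. ennreal (indicator {0..<s} t * exp (- l * t)) \<partial>lborel) =
      (\<integral>\<^sup>+t. ennreal (exp (- l * t)) * indicator {0..s} t \<partial>lborel)"
    using AE_lborel_singleton[of s]
    by (intro nn_integral_cong_AE) (auto elim!: eventually_mono split: split_indicator)
  ultimately show "(\<integral>\<^sup>+t. ennreal (indicator {0..<s} t * exp (- l * t)) \<partial>lborel) = ennreal ((1 - exp (- l * s)) / l)"
    by (simp add: diff_divide_distrib)
qed

lemma nn_Green:
  assumes l: "l > 0"
  shows "(\<integral>\<^sup>+\<omega>. occupation l y x \<omega> \<partial>Omega A) = ennreal (Green A l x y)"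
    and Green_nonneg: "0 \<le> Green A l x y" and Green_le: "Green A l x y \<le> 1 / l"
proof -
  interpret pair_sigma_finite lborel "Omega A" ..
  have "(\<integral>\<^sup>+\<omega>. occupation l y x \<omega> \<partial>Omega A) =
      (\<integral>\<^sup>+t. \<integral>\<^sup>+\<omega>. ennreal (indicator {0..} t * exp (- l * t)) * indicator {y} (S_proc x \<omega> t) \<partial>Omega A \<partial>lborel)"
    unfolding occupation_def by (rule Fubini') measurable
  also have "\<dots> = (\<integral>\<^sup>+t. ennreal (indicator {0..} t * exp (- l * t)) * ennreal (ptrans A t x y) \<partial>lborel)"
  proof (rule nn_integral_cong)
    fix t :: real
    have [measurable]: "{\<omega>. S_proc x \<omega> t = y} \<in> W.events"
      using measurable_sets[OF measurable_S_proc[of "\<lambda>_. t" "Omega A" "\<lambda>\<omega>. \<omega>" x], of "{y}"]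
      by (simp add: vimage_def)
    have eq: "(\<lambda>\<omega>. indicator {y} (S_proc x \<omega> t) :: ennreal) = indicator {\<omega>. S_proc x \<omega> t = y}"
      by (auto simp: indicator_def)
    have "(\<integral>\<^sup>+\<omega>. indicator {y} (S_proc x \<omega> t) \<partial>Omega A) = ennreal (ptrans A t x y)"
      unfolding eq by (subst nn_integral_indicator) (auto simp: ptrans_def W.emeasure_eq_measure)
    then show "(\<integral>\<^sup>+\<omega>. ennreal (indicator {0..} t * exp (- l * t)) * indicator {y} (S_proc x \<omega> t) \<partial>Omega A) =
        ennreal (indicator {0..} t * exp (- l * t)) * ennreal (ptrans A t x y)"
      by (simp add: nn_integral_cmult)
  qed
  also have "\<dots> = (\<integral>\<^sup>+t. ennreal (indicator {0..} t * (exp (- l * t) * ptrans A t x y)) \<partial>lborel)"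
    by (simp add: ennreal_mult'[symmetric] ptrans_nonneg mult.assoc)
  finally have *: "(\<integral>\<^sup>+\<omega>. occupation l y x \<omega> \<partial>Omega A) = \<dots>" .
  have le: "\<dots> \<le> ennreal (1 / l)"
    unfolding nn_integral_exp_0(1)[OF l, symmetric]
    by (intro nn_integral_mono ennreal_leI mult_left_mono) (auto simp: mult_left_le ptrans_le_1)
  then have fin: "(\<integral>\<^sup>+t. ennreal (indicator {0..} t * (exp (- l * t) * ptrans A t x y)) \<partial>lborel) < \<infinity>"
    by (simp add: order_le_less_trans)
  have int: "integrable lborel (\<lambda>t. indicator {0..} t * (exp (- l * t) * ptrans A t x y))"
    by (rule integrableI_nonneg[OF _ _ fin]) (auto simp: ptrans_nonneg)
  have G: "(\<integral>\<^sup>+t. ennreal (indicator {0..} t * (exp (- l * t) * ptrans A t x y)) \<partial>lborel) = ennreal (Green A l x y)"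
    unfolding Green_def set_lebesgue_integral_def real_scaleR_def
    by (rule nn_integral_eq_integral[OF int]) (auto simp: ptrans_nonneg)
  show "(\<integral>\<^sup>+\<omega>. occupation l y x \<omega> \<partial>Omega A) = ennreal (Green A l x y)" using * G by simp
  show "0 \<le> Green A l x y"
    unfolding Green_def set_lebesgue_integral_def by (intro Bochner_Integration.integral_nonneg) (auto simp: ptrans_nonneg)
  show "Green A l x y \<le> 1 / l" using le l unfolding G by simp
qed

lemma occupation_Cons:
  assumes l: "l > 0" and g: "good ((v, s) ## \<omega>)"
  shows "occupation l y x ((v, s) ## \<omega>) =
    indicator {y} x * ennreal ((1 - exp (- l * s)) / l) + ennreal (exp (- l * s)) * occupation l y (x + v) \<omega>"
proof -
  have s: "s > 0" using good_Cons[OF g] by simp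
  let ?f = "\<lambda>t. ennreal (indicator {0..} t * exp (- l * t)) * indicator {y} (S_proc (x + v) \<omega> t)"
  have [measurable]: "(\<lambda>t. S_proc (x + v) \<omega> t) \<in> measurable borel (count_space UNIV)"
    by (rule measurable_S_proc) auto
  have "occupation l y x ((v, s) ## \<omega>) =
    (\<integral>\<^sup>+t. ennreal (indicator {0..<s} t * exp (- l * t)) * indicator {y} x + ennreal (exp (- l * s)) * ?f (t - s) \<partial>lborel)"
    unfolding occupation_def using s
    by (intro nn_integral_cong)
      (auto simp: S_proc_Cons[OF g] indicator_def algebra_simps exp_diff exp_add exp_minus field_simps simp flip: ennreal_mult)
  also have "\<dots> = indicator {y} x * ennreal ((1 - exp (- l * s)) / l) + ennreal (exp (- l * s)) * (\<integral>\<^sup>+t. ?f (t - s) \<partial>lborel)"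
    using nn_integral_exp_0(2)[OF l, of s] s
    by (simp add: nn_integral_add nn_integral_multc nn_integral_cmult mult.commute)
  also have "(\<integral>\<^sup>+t. ?f (t - s) \<partial>lborel) = occupation l y (x + v) \<omega>"
    using nn_integral_real_affine[of "\<lambda>t. ?f (t - s)" 1 s] by (simp add: occupation_def)
  finally show ?thesis .
qed

text \<open>The source term \<open>1 / (a + l)\<close> is the mean discounted length of the first
  holding time, counted only when the walk starts at the target.\<close>

lemma Green_step:
  assumes l: "l > 0"
  shows "Green A l x y = (if x = y then 1 / (a + l) else 0) + a / (a + l) * (\<integral>v. Green A l (x + v) y \<partial>J)"
proof -
  have al: "a + l > 0" "0 \<le> a / (a + l)" using l a_pos by auto
  have nnJ: "(\<integral>\<^sup>+v. ennreal (Green A l (x + v) y) \<partial>J) = ennreal (\<integral>v. Green A l (x + v) y \<partial>J)"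
    using Green_nonneg[OF l] Green_le[OF l]
    by (intro nn_integral_eq_integral integrable_J_bounded[where B = "1 / l"]) auto
  have hold: "(\<integral>\<^sup>+s. ennreal ((1 - exp (- l * s)) / l) \<partial>E) = ennreal (1 / (a + l))"
  proof -
    have int: "integrable E (\<lambda>s. exp (- l * s))"
      using nn_integral_exp_E[of l] l a_pos by (intro integrableI_nonneg) auto
    have e: "(\<integral>s. exp (- l * s) \<partial>E) = a / (a + l)"
      using nn_integral_eq_integral[OF int] nn_integral_exp_E[of l] l a_pos by (simp add: al)
    have "(\<integral>\<^sup>+s. ennreal ((1 - exp (- l * s)) / l) \<partial>E) = ennreal (\<integral>s. (1 - exp (- l * s)) / l \<partial>E)"
      using int AE_E_pos l by (intro nn_integral_eq_integral) (auto elim!: eventually_mono)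
    also have "(\<integral>s. (1 - exp (- l * s)) / l \<partial>E) = (1 - a / (a + l)) / l"
      using int e E.prob_space by simp
    also have "1 - a / (a + l) = l / (a + l)" using al by (simp add: diff_divide_eq_iff)
    also have "l / (a + l) / l = 1 / (a + l)" using l by simp
    finally show ?thesis .
  qed
  have "ennreal (Green A l x y) = (\<integral>\<^sup>+v. \<integral>\<^sup>+s. \<integral>\<^sup>+\<omega>. indicator {y} x * ennreal ((1 - exp (- l * s)) / l)
       + ennreal (exp (- l * s)) * occupation l y (x + v) \<omega> \<partial>Omega A \<partial>E \<partial>J)"
    unfolding nn_Green(1)[OF l, symmetric] by (intro nn_integral_W_good) (auto simp: occupation_Cons[OF l])
  also have "\<dots> = (\<integral>\<^sup>+v. \<integral>\<^sup>+s. indicator {y} x * ennreal ((1 - exp (- l * s)) / l)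
       + ennreal (exp (- l * s)) * ennreal (Green A l (x + v) y) \<partial>E \<partial>J)"
    using W.emeasure_space_1 by (simp add: nn_integral_add nn_integral_cmult nn_Green(1)[OF l])
  also have "\<dots> = (\<integral>\<^sup>+v. indicator {y} x * ennreal (1 / (a + l)) + ennreal (a / (a + l)) * ennreal (Green A l (x + v) y) \<partial>J)"
    using nn_integral_exp_E[of l] l a_pos
    by (simp add: nn_integral_add nn_integral_cmult nn_integral_multc hold[simplified])
  also have "\<dots> = indicator {y} x * ennreal (1 / (a + l)) + ennreal (a / (a + l)) * ennreal (\<integral>v. Green A l (x + v) y \<partial>J)"
    using J.emeasure_space_1 by (simp add: nn_integral_add nn_integral_cmult nnJ)
  also have "\<dots> = ennreal ((if x = y then 1 / (a + l) else 0) + a / (a + l) * (\<integral>v. Green A l (x + v) y \<partial>J))"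
  proof -
    have "ennreal c + ennreal q * ennreal i = ennreal (c + q * i)" if "0 \<le> c" "0 \<le> q" "0 \<le> i" for c q i
      using that by (simp add: ennreal_mult)
    from this[of "if x = y then 1 / (a + l) else 0", OF _ al(2)] show ?thesis
      using al by (auto simp: indicator_def Bochner_Integration.integral_nonneg Green_nonneg[OF l]
          simp del: times_divide_eq_left)
  qed
  finally have eq: "ennreal (Green A l x y) =
      ennreal ((if x = y then 1 / (a + l) else 0) + a / (a + l) * (\<integral>v. Green A l (x + v) y \<partial>J))" .
  have "0 \<le> a / (a + l) * (\<integral>v. Green A l (x + v) y \<partial>J)"
    using al Green_nonneg[OF l] by (intro mult_nonneg_nonneg Bochner_Integration.integral_nonneg) auto
  then show ?thesis
    using al Green_nonneg[OF l, of x y] by (intro ennreal_inj[THEN iffD1, OF _ _ eq]) auto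
qed

text \<open>The last exit decomposition of the Green function at \<open>{y, z}\<close>; both sides solve the
  same resolvent equation off \<open>{y, z}\<close> and agree on \<open>{y, z}\<close>.\<close>
lemma Green_hit:
  assumes l: "l > 0" and "y \<noteq> z"
  shows "Green A l x y = hit l y z x * Green A l y y + hit l z y x * Green A l z y"
proof -
  let ?u = "\<lambda>w. Green A l w y - (hit l y z w * Green A l y y + hit l z y w * Green A l z y)"
  have yz: "y \<noteq> z" "z \<noteq> y" using assms by auto
  have q: "0 \<le> a / (a + l)" "a / (a + l) < 1" using l a_pos by auto
  have [simp]: "integrable J (\<lambda>v. Green A l (w + v) y)" "integrable J (\<lambda>v. hit l y z (w + v))"
    "integrable J (\<lambda>v. hit l z y (w + v))" for w
    using Green_nonneg[OF l] Green_le[OF l] hit_abs_le_1[OF l yz(1)] hit_abs_le_1[OF l yz(2)]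
    by (auto intro: integrable_J_bounded[of _ "1 / l"] integrable_J_bounded[of _ 1])
  have "?u x = 0"
  proof (rule bounded_resolvent_unique[OF _ q, of ?u "1/l + (1 * (1/l) + 1 * (1/l))" "{y, z}"])
    fix w
    have "\<bar>Green A l w y\<bar> \<le> 1/l" "\<bar>hit l y z w * Green A l y y\<bar> \<le> 1 * (1/l)" "\<bar>hit l z y w * Green A l z y\<bar> \<le> 1 * (1/l)"
      using Green_nonneg[OF l] Green_le[OF l] mult_mono[OF hit_abs_le_1[OF l yz(1)] Green_le[OF l]]
        mult_mono[OF hit_abs_le_1[OF l yz(2)] Green_le[OF l]]
      by (simp_all add: abs_mult)
    then show "\<bar>?u w\<bar> \<le> 1/l + (1 * (1/l) + 1 * (1/l))" by linarith
    show "?u w = 0" if "w \<in> {y, z}"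
      using that hit_target[OF l] hit_taboo[OF l] yz by auto
    assume w: "w \<notin> {y, z}"
    have I: "(\<integral>v. ?u (w + v) \<partial>J) = (\<integral>v. Green A l (w + v) y \<partial>J) -
        ((\<integral>v. hit l y z (w + v) \<partial>J) * Green A l y y + (\<integral>v. hit l z y (w + v) \<partial>J) * Green A l z y)"
      by simp
    show "?u w = a / (a + l) * (\<integral>v. ?u (w + v) \<partial>J)"
      unfolding I using w Green_step[OF l, of w y] hit_step[OF l yz(1), of w] hit_step[OF l yz(2), of w]
      by (simp add: algebra_simps)
  qed
  then show ?thesis by simp
qed

text \<open>The one-step equation solved for the average after a jump, since this average is what
  appears once time is counted from the first jump.\<close>

lemma integral_Green_J:
  assumes l: "l > 0"
  shows "(\<integral>v. Green A l (x + v) y \<partial>J) = (1 + l / a) * Green A l x y - (if x = y then 1 / a else 0)"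
proof -
  have "a + l \<noteq> 0" "a \<noteq> 0" using l a_pos by auto
  then have "(1 + l / a) * (c / (a + l) + a / (a + l) * I) - c / a = I" for c I
    by (simp add: divide_simps)
  from this[of "if x = y then 1 else 0" "\<integral>v. Green A l (x + v) y \<partial>J"] show ?thesis
    by (subst Green_step[OF l, of x y]) (simp split: if_splits)
qed

text \<open>\<open>Green_hit\<close> averaged over the first increment. Together with the version in
  which \<open>y\<close> and \<open>z\<close> are exchanged it forms the linear system for the two
  hitting transforms.\<close>

lemma Green_hit_minus:
  assumes l: "l > 0" and "y \<noteq> z"
  shows "(1 + l / a) * Green A l x y - (if x = y then 1 / a else 0) =
    hit_minus l y z x * Green A l y y + hit_minus l z y x * Green A l z y"
proof -
  have yz: "y \<noteq> z" "z \<noteq> y" using assms by auto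
  have [simp]: "integrable J (\<lambda>v. hit l y z (x + v))" "integrable J (\<lambda>v. hit l z y (x + v))"
    using hit_abs_le_1[OF l yz(1)] hit_abs_le_1[OF l yz(2)] by (auto intro!: integrable_J_bounded[of _ 1])
  show ?thesis
    unfolding integral_Green_J[OF l, symmetric] hit_minus_eq[OF l yz(1)] hit_minus_eq[OF l yz(2)]
    by (subst Green_hit[OF l yz(1)]) simp
qed

end

section \<open>Fourier representation of the Green function\<close>

lemma lborel_prod_integral:
  fixes f :: "'a::euclidean_space \<Rightarrow> real \<Rightarrow> 'b::{real_normed_field,banach,second_countable_topology}"
  assumes f: "\<And>b. b \<in> Basis \<Longrightarrow> integrable lborel (f b)"
  shows "(\<integral>x. (\<Prod>b\<in>Basis. f b (x \<bullet> b)) \<partial>lborel) = (\<Prod>b\<in>Basis. \<integral>t. f b t \<partial>lborel)"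
    and "integrable lborel (\<lambda>x::'a. \<Prod>b\<in>Basis. f b (x \<bullet> b))"
proof -
  interpret product_sigma_finite "\<lambda>_::'a. lborel :: real measure" ..
  have [measurable]: "f b \<in> borel_measurable borel" if "b \<in> Basis" for b
    using borel_measurable_integrable[OF f[OF that]] by simp
  have [measurable]: "(\<lambda>x::'a. \<Prod>b\<in>Basis. f b (x \<bullet> b)) \<in> borel_measurable borel"
    by (intro borel_measurable_prod measurable_compose[OF borel_measurable_inner[OF measurable_ident_sets borel_measurable_const]]) auto
  have [measurable]: "(\<lambda>g. \<Sum>b\<in>Basis. g b *\<^sub>R b) \<in> measurable (\<Pi>\<^sub>M b\<in>(Basis::'a set). lborel) borel"
    by (intro borel_measurable_sum borel_measurable_scaleR) (auto intro!: measurable_component_singleton)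
  have eq: "(\<Prod>b\<in>Basis. f b ((\<Sum>c\<in>Basis. g c *\<^sub>R c) \<bullet> b)) = (\<Prod>b\<in>(Basis::'a set). f b (g b))" for g
    by (intro prod.cong) (auto simp: inner_sum_left inner_Basis if_distrib cong: if_cong)
  show "(\<integral>x. (\<Prod>b\<in>Basis. f b (x \<bullet> b)) \<partial>lborel) = (\<Prod>b\<in>Basis. \<integral>t. f b t \<partial>lborel)"
    by (subst lborel_eq, subst integral_distr) (simp_all add: eq product_integral_prod f)
  show "integrable lborel (\<lambda>x::'a. \<Prod>b\<in>Basis. f b (x \<bullet> b))"
    by (subst lborel_eq, subst integrable_distr_eq) (simp_all add: eq product_integrable_prod f)
qed

lemma integral_cis_period:
  "(\<integral>t. indicator {-pi..pi} t *\<^sub>R cis (of_int n * t) \<partial>lborel) = (if n = 0 then 2 * pi else 0)"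
    "integrable lborel (\<lambda>t. indicator {-pi..pi} t *\<^sub>R cis (of_int n * t))"
proof -
  show "integrable lborel (\<lambda>t. indicator {-pi..pi} t *\<^sub>R cis (of_int n * t))"
    by (intro borel_integrable_compact) (auto simp: cis_conv_exp intro!: continuous_intros)
  show "(\<integral>t. indicator {-pi..pi} t *\<^sub>R cis (of_int n * t) \<partial>lborel) = (if n = 0 then 2 * pi else 0)"
  proof (cases "n = 0")
    case True
    then show ?thesis by (simp add: scaleR_conv_of_real)
  next
    case False
    let ?F = "\<lambda>t. exp (\<i> * of_int n * of_real t) / (\<i> * of_int n)"
    have "(\<integral>t. indicator {-pi..pi} t *\<^sub>R exp (\<i> * of_int n * of_real t) \<partial>lborel) = ?F pi - ?F (- pi)"
      using False
      by (intro integral_FTC_Icc[of "-pi" pi ?F])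
        (auto intro!: derivative_eq_intros continuous_intros has_vector_derivative_real_field simp: mult.commute)
    also have "\<dots> = (exp (\<i> * of_int n * of_real pi) - exp (- (\<i> * of_int n * of_real pi))) / (\<i> * of_int n)"
      by (simp add: diff_divide_distrib)
    also have "exp (\<i> * of_int n * of_real pi) = exp (- (\<i> * of_int n * of_real pi))"
      by (subst exp_eq) (auto intro!: exI[of _ n] simp: algebra_simps)
    finally show ?thesis using False by (simp add: cis_conv_exp mult_ac)
  qed
qed

definition torus :: "(real^'d) set" where
  "torus = cbox (\<chi> i. - pi) (\<chi> i. pi)"

definition rvec :: "int^'d \<Rightarrow> real^'d" where
  "rvec z = (\<chi> i. real_of_int (z $ i))"

lemma rvec_component [simp]: "rvec z $ i = real_of_int (z $ i)"
  by (simp add: rvec_def)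

lemma rvec_simps [simp]: "rvec 0 = 0" "rvec (- x) = - rvec x" "rvec (x + y) = rvec x + rvec y"
  "rvec (x - y) = rvec x - rvec y"
  by (simp_all add: vec_eq_iff)

lemma scal_prod_rvec: "scal_prod_int z \<theta> = rvec z \<bullet> \<theta>"
  by (simp add: scal_prod_int_def inner_vec_def)

lemma sqnorm_rvec: "sqnorm_int z = (norm (rvec z))\<^sup>2"
  by (simp add: sqnorm_int_def norm_eq_sqrt_inner inner_vec_def sum_nonneg power2_eq_square)

text \<open>Nonzero lattice vectors have norm at least 1. Consequently a finite second moment of the
  jumps controls the first moment as well.\<close>

lemma norm_rvec_le_sq: "norm (rvec z) \<le> (norm (rvec z))\<^sup>2"
proof (cases "z = 0")
  case False
  then obtain i where "z $ i \<noteq> 0" by (auto simp: vec_eq_iff)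
  then have "1 \<le> \<bar>rvec z $ i\<bar>" by (simp flip: of_int_abs)
  also have "\<dots> \<le> norm (rvec z)" by (rule component_le_norm_cart)
  finally show ?thesis by (simp add: power2_eq_square mult_le_cancel_left1)
qed simp

lemma Basis_rvec:
  fixes x :: "int^'d"
  assumes "b \<in> Basis"
  shows "\<exists>n::int. rvec x \<bullet> b = of_int n"
  using assms by (auto simp: Basis_vec_def inner_axis)

lemma torus_sets [measurable]: "torus \<in> sets borel"
  by (simp add: torus_def)

lemma mem_torus: "\<theta> \<in> torus \<longleftrightarrow> (\<forall>b\<in>Basis. \<theta> \<bullet> b \<in> {-pi..pi})"
  by (auto simp: torus_def mem_box Basis_vec_def inner_axis)

lemma emeasure_torus: "emeasure lborel (torus :: (real^'d) set) = ennreal ((2 * pi) ^ CARD('d))"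
proof -
  have "((\<chi> i. pi) - (\<chi> i. - pi)) \<bullet> b = 2 * pi" if "b \<in> Basis" for b :: "real^'d"
    using that by (auto simp: Basis_vec_def inner_axis)
  moreover have "(\<chi> i. - pi) \<bullet> b \<le> (\<chi> i. pi) \<bullet> b" if "b \<in> Basis" for b :: "real^'d"
    using that by (auto simp: Basis_vec_def inner_axis)
  ultimately have "emeasure lborel (torus :: (real^'d) set) = ennreal (\<Prod>b\<in>(Basis::(real^'d) set). 2 * pi)"
    unfolding torus_def by (subst emeasure_lborel_cbox) simp_all
  then show ?thesis by simp
qed

text \<open>Normalised to a probability measure, which absorbs the factor
  \<open>(2 * pi) ^ CARD('d)\<close> of Fourier inversion and makes bounded measurable functions
  integrable.\<close>

definition torus_measure :: "(real^'d) measure" where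
  "torus_measure = uniform_measure lborel torus"

lemma sets_torus_measure [simp, measurable_cong]: "sets torus_measure = sets borel"
  and space_torus_measure [simp]: "space torus_measure = UNIV"
  by (auto simp: torus_measure_def)

lemma prob_space_torus_measure: "prob_space torus_measure"
  unfolding torus_measure_def by (rule prob_space_uniform_measure) (auto simp: emeasure_torus)

lemma torus_measure_density:
  "torus_measure = density lborel (\<lambda>\<theta>::real^'d. ennreal (indicator torus \<theta> / (2 * pi) ^ CARD('d)))"
  unfolding torus_measure_def uniform_measure_def emeasure_torus
  by (rule arg_cong[of _ _ "density lborel"])
    (auto simp: fun_eq_iff indicator_def divide_ennreal simp flip: ennreal_1)

lemma integral_torus_measure:
  fixes f :: "real^'d \<Rightarrow> real"
  assumes [measurable]: "f \<in> borel_measurable borel"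
  shows "(\<integral>\<theta>. f \<theta> \<partial>torus_measure) = (\<integral>\<theta>. indicator torus \<theta> * f \<theta> \<partial>lborel) / (2 * pi) ^ CARD('d)"
  unfolding torus_measure_density by (subst integral_density) auto

lemma Re_prod_cis: "finite S \<Longrightarrow> (\<Prod>b\<in>S. cis (f b)) = cis (\<Sum>b\<in>S. f b)"
  by (induction S rule: finite_induct) (auto simp: cis_mult)

text \<open>Orthogonality of characters: the complex exponential factors over the coordinates, and a
  nonzero lattice vector has a nonzero integer coordinate whose period integral vanishes.\<close>

lemma integral_cos_torus:
  fixes x :: "int^'d"
  shows "(\<integral>\<theta>. cos (rvec x \<bullet> \<theta>) \<partial>torus_measure) = (if x = 0 then 1 else 0)"
proof -
  define f where "f = (\<lambda>b t. indicator {-pi..pi} t *\<^sub>R cis (rvec x \<bullet> b * t))"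
  have f: "integrable lborel (f b)" "(\<integral>t. f b t \<partial>lborel) = (if rvec x \<bullet> b = 0 then 2 * pi else 0)" if "b \<in> Basis" for b
    using Basis_rvec[OF that, of x] integral_cis_period by (auto simp: f_def scaleR_conv_of_real)
  have eq: "(\<Prod>b\<in>Basis. f b (\<theta> \<bullet> b)) = indicator torus \<theta> *\<^sub>R cis (rvec x \<bullet> \<theta>)" for \<theta>
  proof -
    have "(\<Prod>b\<in>Basis. f b (\<theta> \<bullet> b)) = (\<Prod>b\<in>Basis. of_real (indicator {-pi..pi} (\<theta> \<bullet> b))) * (\<Prod>b\<in>Basis. cis (rvec x \<bullet> b * (\<theta> \<bullet> b)))"
      by (simp add: f_def scaleR_conv_of_real prod.distrib)
    also have "(\<Prod>b\<in>Basis. of_real (indicator {-pi..pi} (\<theta> \<bullet> b))) = (of_real (indicator torus \<theta>) :: complex)"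
      by (auto simp: indicator_def mem_torus)
    also have "(\<Prod>b\<in>Basis. cis (rvec x \<bullet> b * (\<theta> \<bullet> b))) = cis (rvec x \<bullet> \<theta>)"
      by (subst Re_prod_cis) (auto simp flip: euclidean_inner)
    finally show ?thesis by (simp add: scaleR_conv_of_real)
  qed
  have int: "integrable lborel (\<lambda>\<theta>. indicator torus \<theta> *\<^sub>R cis (rvec x \<bullet> \<theta>))"
    and val: "(\<integral>\<theta>. indicator torus \<theta> *\<^sub>R cis (rvec x \<bullet> \<theta>) \<partial>lborel) =
      (\<Prod>b\<in>(Basis :: (real^'d) set). if rvec x \<bullet> b = 0 then of_real (2 * pi) else 0)"
    using lborel_prod_integral[of f] f unfolding eq by (auto intro!: prod.cong)
  have "(\<integral>\<theta>. indicator torus \<theta> * cos (rvec x \<bullet> \<theta>) \<partial>lborel) = Re (\<integral>\<theta>. indicator torus \<theta> *\<^sub>R cis (rvec x \<bullet> \<theta>) \<partial>lborel)"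
    by (subst integral_Re[OF int, symmetric]) simp
  also have "\<dots> = (if x = 0 then (2 * pi) ^ CARD('d) else 0)"
  proof (cases "x = 0")
    case True
    then show ?thesis unfolding val by (simp flip: of_real_mult of_real_power)
  next
    case False
    then have "rvec x \<noteq> 0" by (auto simp: vec_eq_iff)
    then obtain b where "b \<in> Basis" "rvec x \<bullet> b \<noteq> 0" using euclidean_all_zero_iff by blast
    then have prod0: "(\<Prod>b\<in>(Basis :: (real^'d) set). if rvec x \<bullet> b = 0 then complex_of_real (2 * pi) else 0) = 0"
      by (intro prod_zero) auto
    show ?thesis unfolding val prod0 using False by simp
  qed
  finally show ?thesis by (subst integral_torus_measure) auto
qed

context random_walk
begin

sublocale T: prob_space "torus_measure :: (real^'d) measure"
  by (rule prob_space_torus_measure)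

text \<open>One minus the characteristic function of a single jump, real by symmetry of the rates.
  Thus \<open>a * psi\<close> is the characteristic exponent of the walk, with nonnegative
  values.\<close>

definition psi :: "real^'d \<Rightarrow> real" where
  "psi \<theta> = (\<integral>z. 1 - cos (rvec z \<bullet> \<theta>) \<partial>J)"

lemma measurable_inner_rvec [measurable]:
  "(\<lambda>p. rvec (snd p) \<bullet> fst p) \<in> borel_measurable (borel \<Otimes>\<^sub>M J)"
proof -
  have "(\<lambda>p. rvec (snd p) \<bullet> fst p) \<in> borel_measurable (borel \<Otimes>\<^sub>M count_space (UNIV :: (int^'d) set))"
    by (rule measurable_compose_countable[where f = "\<lambda>z p. rvec z \<bullet> fst p" and g = snd]) measurable
  then show ?thesis by (simp cong: measurable_cong_sets sets_pair_measure_cong)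
qed

lemma measurable_psi [measurable]: "psi \<in> borel_measurable borel"
proof -
  have "(\<lambda>(\<theta>, z). 1 - cos (rvec z \<bullet> \<theta>)) \<in> borel_measurable (borel \<Otimes>\<^sub>M J)"
    unfolding split_beta' by measurable
  then show ?thesis unfolding psi_def by (rule J.borel_measurable_lebesgue_integral)
qed

lemma integrable_cos_J: "integrable J (\<lambda>z. cos (rvec z \<bullet> \<theta> + c))" "integrable J (\<lambda>z. sin (rvec z \<bullet> \<theta> + c))"
  by (auto intro!: integrable_J_bounded[of _ 1])

lemma integrable_cos_J' [simp]: "integrable J (\<lambda>z. cos (rvec z \<bullet> \<theta>))" "integrable J (\<lambda>z. sin (rvec z \<bullet> \<theta>))"
  using integrable_cos_J[of \<theta> 0] by auto

lemma psi_eq: "psi \<theta> = 1 - (\<integral>z. cos (rvec z \<bullet> \<theta>) \<partial>J)"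
  unfolding psi_def using J.prob_space by simp

lemma psi_nonneg: "0 \<le> psi \<theta>"
  unfolding psi_def by (intro Bochner_Integration.integral_nonneg) simp

lemma phi_eq: "phi A \<theta> = - a * psi \<theta>"
proof -
  have "(\<lambda>z. norm (A z * cos (scal_prod_int z \<theta>))) summable_on UNIV"
  proof (rule summable_on_comparison_test)
    show "(\<lambda>z. norm (A z)) summable_on UNIV"
      using admissible summable_on_iff_abs_summable_on_real[of A UNIV] by (simp add: admissible_rates_def)
    show "norm (A z * cos (scal_prod_int z \<theta>)) \<le> norm (A z)" for z
      by (simp add: abs_mult mult_left_le)
  qed simp
  then have "phi A \<theta> = (\<integral>z. A z * cos (rvec z \<bullet> \<theta>) \<partial>count_space UNIV)"
    unfolding phi_def
    by (subst integrable_count_space_of_summable_on(2)) (auto simp: scal_prod_rvec intro: abs_summable_summable)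
  then show ?thesis
    using integral_J(2)[OF integrable_cos_J'(1), of \<theta>] by (simp add: psi_eq algebra_simps)
qed

lemma integral_J_reflect:
  fixes f :: "int^'d \<Rightarrow> real"
  assumes "integrable J f"
  shows "(\<integral>z. f (- z) \<partial>J) = (\<integral>z. f z \<partial>J)" "integrable J (\<lambda>z. f (- z))"
proof -
  have bij: "bij_betw uminus (UNIV :: (int^'d) set) UNIV"
    by (intro bij_betwI[of _ _ _ uminus]) auto
  have "integrable (count_space UNIV) (\<lambda>z. A (- z) * f (- z))"
    using integrable_bij_count_space[OF bij, of "\<lambda>z. A z * f z"] assms integral_J(1)[of f] by simp
  then show int: "integrable J (\<lambda>z. f (- z))"
    unfolding integral_J(1) by (simp add: A_sym)
  have "(\<integral>z. A (- z) * f (- z) \<partial>count_space UNIV) = (\<integral>z. A z * f z \<partial>count_space UNIV)"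
    by (rule integral_bij_count_space[OF bij])
  then have "a * (\<integral>z. f (- z) \<partial>J) = a * (\<integral>z. f z \<partial>J)"
    using integral_J(2)[OF int] integral_J(2)[OF assms] by (simp add: A_sym)
  then show "(\<integral>z. f (- z) \<partial>J) = (\<integral>z. f z \<partial>J)" using a_pos by simp
qed

text \<open>Symmetry of the jump law kills the sine part, so cosines are eigenfunctions of averaging
  over one jump, with eigenvalue \<open>1 - psi \<theta>\<close>.\<close>

lemma integral_cos_shift_J: "(\<integral>z. cos (c + rvec z \<bullet> \<theta>) \<partial>J) = cos c * (1 - psi \<theta>)"
proof -
  have "(\<integral>z. sin (rvec z \<bullet> \<theta>) \<partial>J) = - (\<integral>z. sin (rvec z \<bullet> \<theta>) \<partial>J)"
    using integral_J_reflect(1)[OF integrable_cos_J'(2), of \<theta>] by simp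
  then have "(\<integral>z. sin (rvec z \<bullet> \<theta>) \<partial>J) = 0" by simp
  then show ?thesis by (simp add: cos_add psi_eq)
qed

text \<open>The Fourier expression for the transition probability over the displacement
  \<open>x\<close>. It meets \<open>ptrans\<close> only through Laplace transforms, which is all
  that the asymptotic analysis requires.\<close>

definition pF :: "real \<Rightarrow> int^'d \<Rightarrow> real" where
  "pF t x = (\<integral>\<theta>. cos (rvec x \<bullet> \<theta>) * exp (- (t * a * psi \<theta>)) \<partial>torus_measure)"

definition GF :: "real \<Rightarrow> int^'d \<Rightarrow> real" where
  "GF l x = (\<integral>\<theta>. cos (rvec x \<bullet> \<theta>) / (l + a * psi \<theta>) \<partial>torus_measure)"

lemma GF_bound:
  assumes "l > 0"
  shows "\<bar>cos s / (l + a * psi \<theta>)\<bar> \<le> 1 / l"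
  using assms psi_nonneg[of \<theta>] a_pos
  by (simp add: abs_divide frac_le)

lemma integrable_GF:
  assumes "l > 0" shows "integrable torus_measure (\<lambda>\<theta>. cos (rvec x \<bullet> \<theta>) / (l + a * psi \<theta>))"
  by (rule T.integrable_const_bound[of _ "1/l"]) (use GF_bound[OF assms] in auto)

text \<open>Since cosines are eigenfunctions of the jump average, the equation reduces to a partial
  fraction identity under the integral; the source term at the origin comes from
  orthogonality.\<close>

lemma GF_step:
  assumes l: "l > 0"
  shows "GF l x = (if x = 0 then 1 / (a + l) else 0) + a / (a + l) * (\<integral>v. GF l (x + v) \<partial>J)"
proof -
  interpret TJ: pair_prob_space "torus_measure :: (real^'d) measure" J ..
  have pos: "l + a * psi \<theta> > 0" for \<theta> using l a_pos psi_nonneg[of \<theta>] by (simp add: add_pos_nonneg)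
  have m: "(\<lambda>p. cos (rvec x \<bullet> fst p + rvec (snd p) \<bullet> fst p) / (l + a * psi (fst p))) \<in> borel_measurable (borel \<Otimes>\<^sub>M J)"
    by measurable
  have sets: "sets (torus_measure \<Otimes>\<^sub>M J) = sets (borel \<Otimes>\<^sub>M J)"
    by (intro sets_pair_measure_cong) auto
  have "integrable (torus_measure \<Otimes>\<^sub>M J) (\<lambda>p. cos (rvec x \<bullet> fst p + rvec (snd p) \<bullet> fst p) / (l + a * psi (fst p)))"
    by (rule TJ.P.integrable_const_bound[of _ "1/l"])
      (use GF_bound[OF l] m in \<open>auto simp: measurable_cong_sets[OF sets refl]\<close>)
  then have "(\<integral>v. \<integral>\<theta>. cos (rvec x \<bullet> \<theta> + rvec v \<bullet> \<theta>) / (l + a * psi \<theta>) \<partial>torus_measure \<partial>J) =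
      (\<integral>\<theta>. \<integral>v. cos (rvec x \<bullet> \<theta> + rvec v \<bullet> \<theta>) / (l + a * psi \<theta>) \<partial>J \<partial>torus_measure)"
    by (intro TJ.Fubini_integral) (simp add: split_beta')
  also have "\<dots> = (\<integral>\<theta>. ((a + l) / a) * (cos (rvec x \<bullet> \<theta>) / (l + a * psi \<theta>)) - cos (rvec x \<bullet> \<theta>) / a \<partial>torus_measure)"
  proof (intro Bochner_Integration.integral_cong refl)
    fix \<theta>
    have "(\<integral>v. cos (rvec x \<bullet> \<theta> + rvec v \<bullet> \<theta>) / (l + a * psi \<theta>) \<partial>J) = cos (rvec x \<bullet> \<theta>) * (1 - psi \<theta>) / (l + a * psi \<theta>)"
      by (simp add: integral_cos_shift_J)
    also have "\<dots> = ((a + l) / a) * (cos (rvec x \<bullet> \<theta>) / (l + a * psi \<theta>)) - cos (rvec x \<bullet> \<theta>) / a"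
    proof -
      have "a \<noteq> 0" using a_pos by simp
      moreover have "a + l - a - a * p = l - a * p" for p :: real by simp
      ultimately have "c * (1 - p) / (l + a * p) = ((a + l) / a) * (c / (l + a * p)) - c / a"
        if "l + a * p \<noteq> 0" for c p
        using that by (simp add: divide_simps) (simp add: algebra_simps)
      from this[of "psi \<theta>"] show ?thesis using pos[of \<theta>] by simp
    qed
    finally show "(\<integral>v. cos (rvec x \<bullet> \<theta> + rvec v \<bullet> \<theta>) / (l + a * psi \<theta>) \<partial>J) = \<dots>" .
  qed
  also have "\<dots> = ((a + l) / a) * GF l x - (if x = 0 then 1 else 0) / a"
  proof -
    have "(\<integral>\<theta>. k * f \<theta> - g \<theta> / a \<partial>torus_measure) = k * (\<integral>\<theta>. f \<theta> \<partial>torus_measure) - (\<integral>\<theta>. g \<theta> \<partial>torus_measure) / a"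
      if "integrable torus_measure f" "integrable torus_measure g" for k and f g :: "real^'d \<Rightarrow> real"
      using that by simp
    from this[OF integrable_GF[OF l, of x] T.integrable_const_bound[of "\<lambda>\<theta>. cos (rvec x \<bullet> \<theta>)" 1], of "(a + l) / a"] show ?thesis
      unfolding GF_def integral_cos_torus by (rule trans) auto
  qed
  finally have "(\<integral>v. GF l (x + v) \<partial>J) = ((a + l) / a) * GF l x - (if x = 0 then 1 else 0) / a"
    by (simp add: GF_def inner_add_left)
  moreover have "a / (a + l) * ((a + l) / a * g - d / a) = g - d / (a + l)" for g d
    using l a_pos by (simp add: right_diff_distrib)
  ultimately show ?thesis by simp
qed

text \<open>Both sides are bounded by \<open>1 / l\<close> and satisfy the same one-step equation at
  every point, so their difference vanishes by \<open>bounded_resolvent_unique\<close> with empty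
  boundary.\<close>

lemma Green_eq_GF:
  assumes l: "l > 0"
  shows "Green A l x y = GF l (x - y)"
proof -
  let ?u = "\<lambda>w. Green A l w y - GF l (w - y)"
  have q: "0 \<le> a / (a + l)" "a / (a + l) < 1" using l a_pos by auto
  have G: "\<bar>GF l w\<bar> \<le> 1 / l" for w
  proof -
    have "\<bar>GF l w\<bar> \<le> (\<integral>\<theta>. \<bar>cos (rvec w \<bullet> \<theta>) / (l + a * psi \<theta>)\<bar> \<partial>torus_measure)"
      unfolding GF_def by (rule integral_abs_bound)
    also have "\<dots> \<le> (\<integral>\<theta>. 1 / l \<partial>(torus_measure :: (real^'d) measure))"
      using integrable_GF[OF l] GF_bound[OF l] by (intro integral_mono integrable_abs) auto
    finally show ?thesis using T.prob_space by simp
  qed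
  have [simp]: "integrable J (\<lambda>v. Green A l (w + v) y)" "integrable J (\<lambda>v. GF l (w - y + v))" for w
    using Green_nonneg[OF l] Green_le[OF l] G
    by (auto intro: integrable_J_bounded[of _ "1 / l"])
  have "?u x = 0"
  proof (rule bounded_resolvent_unique[OF _ q, of ?u "1/l + 1/l" "{}"])
    fix w
    have "\<bar>Green A l w y\<bar> \<le> 1/l" using Green_nonneg[OF l, of w y] Green_le[OF l, of w y] by simp
    then show "\<bar>?u w\<bar> \<le> 1/l + 1/l" using G[of "w - y"] by linarith
    have "(\<integral>v. ?u (w + v) \<partial>J) = (\<integral>v. Green A l (w + v) y \<partial>J) - (\<integral>v. GF l (w - y + v) \<partial>J)"
    proof -
      have shift: "w + v - y = w - y + v" for v by simp
      show ?thesis unfolding shift by (intro Bochner_Integration.integral_diff) simp_all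
    qed
    then show "?u w = a / (a + l) * (\<integral>v. ?u (w + v) \<partial>J)"
      using Green_step[OF l, of w y] GF_step[OF l, of "w - y"] by (simp add: right_diff_distrib)
  qed simp
  then show ?thesis by simp
qed

lemma GF_minus: "GF l (- x) = GF l x"
  by (simp add: GF_def)

lemma pF_minus: "pF t (- x) = pF t x"
  by (simp add: pF_def)

lemma abs_pF_le: "t \<ge> 0 \<Longrightarrow> \<bar>pF t x\<bar> \<le> pF t 0"
proof -
  assume t: "t \<ge> 0"
  have int: "integrable torus_measure (\<lambda>\<theta>. exp (- (t * a * psi \<theta>)))"
    using t a_pos psi_nonneg by (intro T.integrable_const_bound[of _ 1]) auto
  have "\<bar>pF t x\<bar> \<le> (\<integral>\<theta>. \<bar>cos (rvec x \<bullet> \<theta>) * exp (- (t * a * psi \<theta>))\<bar> \<partial>torus_measure)"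
    unfolding pF_def by (rule integral_abs_bound)
  also have "\<dots> \<le> (\<integral>\<theta>. exp (- (t * a * psi \<theta>)) \<partial>torus_measure)"
    using int by (intro integral_mono' ) (auto simp: abs_mult mult_left_le_one_le)
  finally show ?thesis by (simp add: pF_def)
qed

lemma pF_0_le_1: "t \<ge> 0 \<Longrightarrow> pF t 0 \<le> 1"
proof -
  assume t: "t \<ge> 0"
  have "pF t 0 \<le> (\<integral>\<theta>. 1 \<partial>(torus_measure :: (real^'d) measure))"
    unfolding pF_def using t a_pos psi_nonneg
    by (intro integral_mono' T.integrable_const) auto
  then show ?thesis using T.prob_space by simp
qed

lemma abs_pF_le_1: "t \<ge> 0 \<Longrightarrow> \<bar>pF t x\<bar> \<le> 1"
  using abs_pF_le[of t x] pF_0_le_1[of t] by simp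

lemma measurable_pF [measurable]: "(\<lambda>t. pF t x) \<in> borel_measurable borel"
  unfolding pF_def by measurable

text \<open>Writing \<open>1 / (l + a * psi \<theta>)\<close> as a Laplace integral and exchanging
  integrals moves everything to the time domain. From here on \<open>pF\<close> with its explicit
  decay replaces \<open>ptrans\<close>.\<close>

lemma Green_eq_pF:
  assumes l: "l > 0"
  shows "Green A l x y = (\<integral>t. indicator {0..} t * (exp (- l * t) * pF t (x - y)) \<partial>lborel)"
proof -
  interpret TL: pair_sigma_finite "torus_measure :: (real^'d) measure" "lborel :: real measure" ..
  let ?f = "\<lambda>(\<theta> :: real^'d) t. indicator {0..} t * (exp (- l * t) * (cos (rvec (x - y) \<bullet> \<theta>) * exp (- (t * a * psi \<theta>))))"
  have base: "integrable lborel (\<lambda>t. indicator {0..} t * exp (- l * t))"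
    using nn_integral_exp_0(1)[OF l] by (intro integrableI_nonneg) auto
  have bound: "\<bar>?f \<theta> t\<bar> \<le> indicator {0..} t * exp (- l * t)" for \<theta> t
  proof -
    have "\<bar>cos (rvec (x - y) \<bullet> \<theta>)\<bar> * exp (- (t * a * psi \<theta>)) \<le> 1 * 1" if "t \<ge> 0"
      using that a_pos psi_nonneg[of \<theta>] by (intro mult_mono) auto
    then show ?thesis by (auto simp: abs_mult indicator_def mult_left_le)
  qed
  have sets: "sets (torus_measure \<Otimes>\<^sub>M lborel) = sets (borel \<Otimes>\<^sub>M borel)"
    by (intro sets_pair_measure_cong) auto
  have "(\<lambda>p. ?f (fst p) (snd p)) \<in> borel_measurable (borel \<Otimes>\<^sub>M borel)"
    by measurable
  then have m: "(\<lambda>p. ?f (fst p) (snd p)) \<in> borel_measurable (torus_measure \<Otimes>\<^sub>M lborel)"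
    by (simp only: measurable_cong_sets[OF sets refl])
  have i: "integrable lborel (?f \<theta>)" for \<theta>
    by (rule Bochner_Integration.integrable_bound[OF base]) (use bound[of _ \<theta>] in auto)
  have "integrable (torus_measure \<Otimes>\<^sub>M lborel) (\<lambda>p. ?f (fst p) (snd p))"
  proof (rule TL.Fubini_integrable[OF m])
    show "AE \<theta> in (torus_measure :: (real^'d) measure). integrable lborel (\<lambda>t. ?f (fst (\<theta>, t)) (snd (\<theta>, t)))"
      using i by simp
    have le: "(\<integral>t. \<bar>?f \<theta> t\<bar> \<partial>lborel) \<le> (\<integral>t. indicator {0..} t * exp (- l * t) \<partial>lborel)" for \<theta>
      using bound[of _ \<theta>] by (intro integral_mono integrable_abs i base) auto
    have "(\<lambda>p. norm (?f (fst p) (snd p))) \<in> borel_measurable (torus_measure \<Otimes>\<^sub>M lborel)"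
      by (rule measurable_compose[OF m, of norm borel]) measurable
    then have "(\<lambda>\<theta>. \<integral>t. norm (?f \<theta> t) \<partial>lborel) \<in> borel_measurable torus_measure"
      by (intro lborel.borel_measurable_lebesgue_integral) (simp add: split_beta')
    then show "integrable torus_measure (\<lambda>\<theta>. \<integral>t. norm (?f (fst (\<theta>, t)) (snd (\<theta>, t))) \<partial>lborel)"
      using le by (intro T.integrable_const_bound[of _ "\<integral>t. indicator {0..} t * exp (- l * t) \<partial>lborel"]) auto
  qed
  then have "(\<integral>t. \<integral>\<theta>. ?f \<theta> t \<partial>torus_measure \<partial>lborel) = (\<integral>\<theta>. \<integral>t. ?f \<theta> t \<partial>lborel \<partial>torus_measure)"
    by (intro TL.Fubini_integral) (simp add: split_beta')
  also have "(\<lambda>\<theta>. \<integral>t. ?f \<theta> t \<partial>lborel) = (\<lambda>\<theta>. cos (rvec (x - y) \<bullet> \<theta>) / (l + a * psi \<theta>))"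
  proof
    fix \<theta>
    have p: "l + a * psi \<theta> > 0" using l a_pos psi_nonneg[of \<theta>] by (simp add: add_pos_nonneg)
    have "(\<integral>t. indicator {0..} t * exp (- (l + a * psi \<theta>) * t) \<partial>lborel) = 1 / (l + a * psi \<theta>)"
      using nn_integral_exp_0(1)[OF p] p by (intro integral_eq_nn_integral[THEN trans]) auto
    moreover have "?f \<theta> = (\<lambda>t. cos (rvec (x - y) \<bullet> \<theta>) * (indicator {0..} t * exp (- (l + a * psi \<theta>) * t)))"
      by (auto simp: fun_eq_iff algebra_simps simp flip: exp_add)
    ultimately show "(\<integral>t. ?f \<theta> t \<partial>lborel) = cos (rvec (x - y) \<bullet> \<theta>) / (l + a * psi \<theta>)"
      by (simp only: integral_mult_right_zero) simp
  qed
  finally show ?thesis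
    unfolding Green_eq_GF[OF l] GF_def pF_def by simp
qed

end

section \<open>Linear substitution and Gaussian integrals\<close>

lemma nn_integral_lborel_shift:
  fixes g :: "real \<Rightarrow> ennreal"
  assumes [measurable]: "g \<in> borel_measurable borel"
  shows "(\<integral>\<^sup>+y. g (c + y) \<partial>lborel) = (\<integral>\<^sup>+y. g y \<partial>lborel)"
  using nn_integral_real_affine[of g 1 c] by simp

text \<open>Integrating over the coordinate \<open>m\<close> first, with all others frozen, the
  shear becomes a translation of a one-dimensional integral.\<close>

lemma nn_integral_lborel_shear:
  fixes f :: "'a::euclidean_space \<Rightarrow> ennreal"
  assumes [measurable]: "f \<in> borel_measurable borel" and m: "m \<in> Basis" "n \<in> Basis" "m \<noteq> n"
  shows "(\<integral>\<^sup>+x. f (x + (x \<bullet> n) *\<^sub>R m) \<partial>lborel) = (\<integral>\<^sup>+x. f x \<partial>lborel)"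
proof -
  interpret product_sigma_finite "\<lambda>_::'a. lborel :: real measure" ..
  have B: "Basis = insert m (Basis - {m})" using m by auto
  define e where "e = (\<lambda>g::'a \<Rightarrow> real. \<Sum>b\<in>Basis. g b *\<^sub>R b)"
  have e_meas [measurable]: "e \<in> measurable (\<Pi>\<^sub>M b\<in>Basis. lborel) borel"
    unfolding e_def by (intro borel_measurable_sum borel_measurable_scaleR) (auto intro!: measurable_component_singleton)
  have e: "(lborel :: 'a measure) = distr (\<Pi>\<^sub>M b\<in>insert m (Basis - {m}). lborel) borel e"
    unfolding e_def B[symmetric] by (rule lborel_eq)
  have [measurable]: "e \<in> measurable (\<Pi>\<^sub>M b\<in>insert m (Basis - {m}). lborel) borel"
    using e_meas unfolding B[symmetric] .
  have upd: "e (g(m := y)) = (\<Sum>b\<in>Basis - {m}. g b *\<^sub>R b) + y *\<^sub>R m" for g y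
    unfolding e_def by (subst B, subst sum.insert) (auto intro!: sum.cong simp: add.commute)
  have updn: "e (g(m := y)) \<bullet> n = g n" for g y
    using m unfolding upd
    by (simp add: inner_add_left inner_sum_left inner_Basis if_distrib[of "(*) _"] cong: if_cong)
  have "(\<integral>\<^sup>+x. f (x + (x \<bullet> n) *\<^sub>R m) \<partial>lborel) = (\<integral>\<^sup>+g. f (e g + (e g \<bullet> n) *\<^sub>R m) \<partial>(\<Pi>\<^sub>M b\<in>insert m (Basis - {m}). lborel))"
    by (subst e, rule nn_integral_distr; measurable)
  also have "\<dots> = (\<integral>\<^sup>+g. (\<integral>\<^sup>+y. f (e (g(m := y)) + (e (g(m := y)) \<bullet> n) *\<^sub>R m) \<partial>lborel) \<partial>(\<Pi>\<^sub>M b\<in>Basis - {m}. lborel))"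
    by (rule product_nn_integral_insert) (simp, simp, measurable)
  also have "\<dots> = (\<integral>\<^sup>+g. (\<integral>\<^sup>+y. f (e (g(m := y))) \<partial>lborel) \<partial>(\<Pi>\<^sub>M b\<in>Basis - {m}. lborel))"
  proof (rule nn_integral_cong)
    fix g
    let ?s = "\<Sum>b\<in>Basis - {m}. g b *\<^sub>R b"
    have "(\<integral>\<^sup>+y. f (e (g(m := y)) + (e (g(m := y)) \<bullet> n) *\<^sub>R m) \<partial>lborel) = (\<integral>\<^sup>+y. f (?s + (g n + y) *\<^sub>R m) \<partial>lborel)"
      unfolding updn by (simp add: upd algebra_simps)
    also have "\<dots> = (\<integral>\<^sup>+y. f (?s + y *\<^sub>R m) \<partial>lborel)"
      by (rule nn_integral_lborel_shift) measurable
    finally show "(\<integral>\<^sup>+y. f (e (g(m := y)) + (e (g(m := y)) \<bullet> n) *\<^sub>R m) \<partial>lborel) = (\<integral>\<^sup>+y. f (e (g(m := y))) \<partial>lborel)"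
      by (simp add: upd)
  qed
  also have "\<dots> = (\<integral>\<^sup>+g. f (e g) \<partial>(\<Pi>\<^sub>M b\<in>insert m (Basis - {m}). lborel))"
    by (rule product_nn_integral_insert[symmetric]) (simp, simp, measurable)
  also have "\<dots> = (\<integral>\<^sup>+x. f x \<partial>lborel)"
    by (subst e, rule nn_integral_distr[symmetric]; measurable)
  finally show ?thesis .
qed

text \<open>A permutation of coordinates maps boxes to boxes with the same side lengths, and the
  values on boxes characterise Lebesgue measure.\<close>

lemma nn_integral_lborel_permute:
  fixes f :: "real^'n \<Rightarrow> ennreal"
  assumes [measurable]: "f \<in> borel_measurable borel" and p: "bij (p :: 'n \<Rightarrow> 'n)"
  shows "(\<integral>\<^sup>+x. f (\<chi> i. x $ p i) \<partial>lborel) = (\<integral>\<^sup>+x. f x \<partial>lborel)"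
proof -
  let ?T = "\<lambda>x::real^'n. \<chi> i. x $ p i"
  have T [measurable]: "?T \<in> borel_measurable borel"
    by (intro borel_measurable_continuous_onI continuous_intros)
  have "lborel = distr lborel borel ?T"
  proof (rule lborel_eqI)
    fix l u :: "real^'n" assume le: "\<And>b. b \<in> Basis \<Longrightarrow> l \<bullet> b \<le> u \<bullet> b"
    have lu: "l $ i \<le> u $ i" for i using le[of "axis i 1"] by (simp add: inner_axis)
    have "?T -` box l u = box (\<chi> i. l $ inv p i) (\<chi> i. u $ inv p i)"
      using p by (auto simp: mem_box_cart bij_is_inj bij_is_surj surj_f_inv_f inv_f_f)
        (metis bij_inv_eq_iff)+
    then have "emeasure (distr lborel borel ?T) (box l u) = emeasure lborel (box (\<chi> i. l $ inv p i) (\<chi> i. u $ inv p i))"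
      by (simp add: emeasure_distr)
    also have "\<dots> = ennreal (\<Prod>b\<in>Basis. ((\<chi> i. u $ inv p i) - (\<chi> i. l $ inv p i)) \<bullet> b)"
      by (subst emeasure_lborel_box) (auto simp: Basis_vec_def inner_axis lu)
    also have "(\<Prod>b\<in>Basis. ((\<chi> i. u $ inv p i) - (\<chi> i. l $ inv p i)) \<bullet> b) = (\<Prod>i\<in>UNIV. u $ inv p i - l $ inv p i)"
      by (simp add: Basis_vec_def prod.reindex_nontrivial UNION_singleton_eq_range axis_eq_axis inner_axis prod.reindex inj_on_def)
    also have "\<dots> = (\<Prod>i\<in>UNIV. u $ i - l $ i)"
      by (rule prod.reindex_bij_betw[OF bij_imp_bij_inv[OF p]])
    also have "\<dots> = (\<Prod>b\<in>Basis. (u - l) \<bullet> b)"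
      by (simp add: Basis_vec_def UNION_singleton_eq_range axis_eq_axis inner_axis prod.reindex inj_on_def)
    finally show "emeasure (distr lborel borel ?T) (box l u) = (\<Prod>b\<in>Basis. (u - l) \<bullet> b)" .
  qed simp
  then have "(\<integral>\<^sup>+x. f x \<partial>lborel) = (\<integral>\<^sup>+x. f x \<partial>distr lborel borel ?T)" by simp
  then show ?thesis by (simp add: nn_integral_distr)
qed

text \<open>The library has the linear change of variables only for well-ordered index types.\<close>
lemma nn_integral_lborel_linear:
  fixes B :: "real^'n^'n" and f :: "real^'n \<Rightarrow> ennreal"
  assumes "det B \<noteq> 0" and "f \<in> borel_measurable borel"
  shows "ennreal \<bar>det B\<bar> * (\<integral>\<^sup>+x. f (B *v x) \<partial>lborel) = (\<integral>\<^sup>+x. f x \<partial>lborel)"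
proof -
  have meas [measurable]: "(\<lambda>x. C *v x) \<in> borel_measurable borel" for C :: "real^'n^'n"
    by (intro borel_measurable_continuous_onI linear_continuous_on matrix_vector_mul_bounded_linear)
  \<comment> \<open>The guard on the determinant lets the induction over elementary matrices pass
    through singular factors: the case of a zero row holds vacuously, and in a product with nonzero
    determinant both factors have nonzero determinant.\<close>
  define P where "P = (\<lambda>C::real^'n^'n. det C \<noteq> 0 \<longrightarrow> (\<forall>f::real^'n \<Rightarrow> ennreal. f \<in> borel_measurable borel \<longrightarrow>
      ennreal \<bar>det C\<bar> * (\<integral>\<^sup>+x. f (C *v x) \<partial>lborel) = (\<integral>\<^sup>+x. f x \<partial>lborel)))"
  have "P B"
  proof (rule induct_matrix_elementary_alt)
    fix C D :: "real^'n^'n" assume CD: "P C" "P D"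
    show "P (C ** D)" unfolding P_def
    proof (intro impI allI)
      fix f :: "real^'n \<Rightarrow> ennreal" assume nz: "det (C ** D) \<noteq> 0" and [measurable]: "f \<in> borel_measurable borel"
      have "det C \<noteq> 0" "det D \<noteq> 0" using nz by (auto simp: det_mul)
      then have 1: "ennreal \<bar>det D\<bar> * (\<integral>\<^sup>+x. f (C *v (D *v x)) \<partial>lborel) = (\<integral>\<^sup>+x. f (C *v x) \<partial>lborel)"
        and 2: "ennreal \<bar>det C\<bar> * (\<integral>\<^sup>+x. f (C *v x) \<partial>lborel) = (\<integral>\<^sup>+x. f x \<partial>lborel)"
        using CD(2)[unfolded P_def, rule_format, of "\<lambda>x. f (C *v x)"] CD(1)[unfolded P_def, rule_format, of f] by auto
      show "ennreal \<bar>det (C ** D)\<bar> * (\<integral>\<^sup>+x. f ((C ** D) *v x) \<partial>lborel) = (\<integral>\<^sup>+x. f x \<partial>lborel)"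
        by (simp add: det_mul abs_mult ennreal_mult mult.assoc 1 2 flip: matrix_vector_mul_assoc)
    qed
  next
    fix C :: "real^'n^'n" and i assume "row i C = 0"
    then show "P C" by (simp add: P_def det_zero_row)
  next
    fix C :: "real^'n^'n" assume diag: "\<And>i j. i \<noteq> j \<Longrightarrow> C $ i $ j = 0"
    show "P C" unfolding P_def
    proof (intro impI allI)
      fix f :: "real^'n \<Rightarrow> ennreal" assume nz: "det C \<noteq> 0" and [measurable]: "f \<in> borel_measurable borel"
      have det: "det C = (\<Prod>i\<in>UNIV. C $ i $ i)" by (rule det_diagonal[OF diag])
      let ?c = "\<lambda>b. (C *v b) \<bullet> b"
      have Cv: "(C *v axis i 1) \<bullet> axis i 1 = C $ i $ i" for i
        by (simp add: inner_axis matrix_vector_mult_basis column_def)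
      have T: "0 + (\<Sum>j\<in>Basis. (?c j * (x \<bullet> j)) *\<^sub>R j) = C *v x" for x
      proof -
        have "(C *v x) \<bullet> axis i 1 = C $ i $ i * x $ i" for i
          using diag by (auto simp: inner_axis matrix_vector_mult_def intro!: sum.remove[THEN trans, of _ i])
        then have "(C *v x) \<bullet> j = ?c j * (x \<bullet> j)" if "j \<in> Basis" for j
          using that Cv by (auto simp: Basis_vec_def inner_axis)
        then show ?thesis by (subst (2) euclidean_representation[symmetric]) simp
      qed
      have nzb: "?c j \<noteq> 0" if "j \<in> Basis" for j
        using that nz Cv by (auto simp: Basis_vec_def det)
      have "(\<Prod>j\<in>Basis. \<bar>?c j\<bar>) = \<bar>det C\<bar>"
        by (simp add: Basis_vec_def UNION_singleton_eq_range prod.reindex inj_on_def axis_eq_axis Cv det abs_prod)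
      then have "lborel = density (distr lborel borel (\<lambda>x. C *v x)) (\<lambda>_. ennreal \<bar>det C\<bar>)"
        using lborel_affine_euclidean[where c = ?c and t = 0, OF nzb] unfolding T by simp
      then have "(\<integral>\<^sup>+x. f x \<partial>lborel) = (\<integral>\<^sup>+x. f x \<partial>density (distr lborel borel (\<lambda>x. C *v x)) (\<lambda>_. ennreal \<bar>det C\<bar>))" by simp
      then show "ennreal \<bar>det C\<bar> * (\<integral>\<^sup>+x. f (C *v x) \<partial>lborel) = (\<integral>\<^sup>+x. f x \<partial>lborel)"
        by (simp add: nn_integral_density nn_integral_distr nn_integral_cmult)
    qed
  next
    fix m n :: 'n assume "m \<noteq> n"
    let ?p = "Transposition.transpose m n"
    let ?C = "(\<chi> i j. mat 1 $ i $ ?p j) :: real^'n^'n"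
    have "?C = (\<chi> i. mat 1 $ ?p i)"
      by (auto simp: vec_eq_iff mat_def Transposition.transpose_def)
    then have "det ?C = of_int (sign ?p) * det (mat 1 :: real^'n^'n)"
      using det_permute_rows[of ?p "mat 1 :: real^'n^'n"] by (simp add: permutes_swap_id)
    then have det: "\<bar>det ?C\<bar> = 1" using \<open>m \<noteq> n\<close> by (simp add: sign_swap_id)
    have "?C *v x = (\<chi> i. x $ ?p i)" for x
    proof -
      have "(\<Sum>j\<in>UNIV. mat 1 $ i $ ?p j * x $ j) = x $ ?p i" for i
      proof -
        have "(\<Sum>j\<in>UNIV. mat 1 $ i $ ?p j * x $ j) = (\<Sum>j\<in>UNIV. if j = ?p i then x $ j else 0)"
          by (intro sum.cong) (auto simp: mat_def)
        then show ?thesis by simp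
      qed
      then show ?thesis by (simp add: matrix_vector_mult_def vec_eq_iff)
    qed
    then show "P ?C" unfolding P_def using det nn_integral_lborel_permute[of _ ?p] by simp
  next
    fix m n :: 'n assume mn: "m \<noteq> n"
    let ?C = "(\<chi> i j. of_bool (i = m \<and> j = n \<or> i = j)) :: real^'n^'n"
    have "?C = (\<chi> k. if k = m then row m (mat 1) + 1 *s row n (mat 1) else row k (mat 1))"
      using mn by (auto simp: vec_eq_iff row_def mat_def)
    then have det: "det ?C = 1" using det_row_operation[OF mn, of "mat 1" 1] by simp
    have "?C *v x = x + (x \<bullet> axis n 1) *\<^sub>R axis m 1" for x
    proof -
      have "(\<Sum>j\<in>UNIV. of_bool (i = m \<and> j = n \<or> i = j) * x $ j) = x $ i + (if i = m then x $ n else 0)" for i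
      proof -
        have "(\<Sum>j\<in>UNIV. of_bool (i = m \<and> j = n \<or> i = j) * x $ j) =
          (\<Sum>j\<in>UNIV. (if j = i then x $ j else 0) + (if j = n then (if i = m then x $ j else 0) else 0))"
          using mn by (intro sum.cong) auto
        then show ?thesis by (simp add: sum.distrib)
      qed
      moreover have "x \<bullet> axis n 1 = x $ n" by (simp add: inner_axis)
      ultimately show ?thesis by (auto simp: matrix_vector_mult_def vec_eq_iff axis_def)
    qed
    then show "P ?C" unfolding P_def
      using det nn_integral_lborel_shear[of _ "axis m 1 :: real^'n" "axis n 1"] mn
      by (simp add: axis_eq_axis axis_in_Basis_iff)
  qed
  then show ?thesis using assms by (simp add: P_def)
qed

lemma nn_integral_gaussian_std:
  "(\<integral>\<^sup>+x. ennreal (exp (- (norm x)\<^sup>2 / 2)) \<partial>(lborel :: 'a::euclidean_space measure)) = ennreal (sqrt (2 * pi) ^ DIM('a))"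
proof -
  have "(\<integral>\<^sup>+t. ennreal (std_normal_density t) \<partial>lborel) = 1"
    using prob_space.emeasure_space_1[OF prob_space_normal_density[of 1 0]] by (simp add: emeasure_density)
  moreover have "ennreal (exp (- t\<^sup>2 / 2)) = ennreal (sqrt (2 * pi)) * ennreal (std_normal_density t)" for t
    by (subst ennreal_mult[symmetric]) (auto simp: std_normal_density_def)
  ultimately have 1: "(\<integral>\<^sup>+t. ennreal (exp (- t\<^sup>2 / 2)) \<partial>lborel) = ennreal (sqrt (2 * pi))"
    by (simp add: nn_integral_cmult)
  have eq: "ennreal (exp (- (norm x)\<^sup>2 / 2)) = (\<Prod>b\<in>Basis. ennreal (exp (- (x \<bullet> b)\<^sup>2 / 2)))" for x :: 'a
  proof -
    have "(norm x)\<^sup>2 = (\<Sum>b\<in>Basis. (x \<bullet> b)\<^sup>2)"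
      by (subst power2_norm_eq_inner, subst euclidean_inner) (simp add: power2_eq_square)
    then have "exp (- (norm x)\<^sup>2 / 2) = (\<Prod>b\<in>Basis. exp (- (x \<bullet> b)\<^sup>2 / 2))"
      by (simp add: exp_sum[symmetric] sum_negf sum_divide_distrib)
    then show ?thesis by (simp add: prod_ennreal)
  qed
  show ?thesis unfolding eq
    by (subst nn_integral_lborel_prod) (auto simp: 1[simplified] ennreal_power)
qed

text \<open>Gram-Schmidt for the inner product given by \<open>S\<close>. With fewer than
  \<open>CARD('n)\<close> vectors chosen, their images under \<open>S\<close> do not span, so some
  nonzero vector is orthogonal to all of these images and can be normalised by positivity. The
  chosen vectors are the columns of \<open>B\<close>.\<close>

lemma gram_schmidt_matrix:
  fixes S :: "real^'n^'n"
  assumes sym: "transpose S = S" and pos: "\<And>x. x \<noteq> 0 \<Longrightarrow> x \<bullet> (S *v x) > 0"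
  shows "\<exists>B :: real^'n^'n. transpose B ** S ** B = mat 1"
proof -
  have comm: "x \<bullet> (S *v y) = y \<bullet> (S *v x)" for x y
    by (metis sym dot_lmul_matrix inner_commute vector_transpose_matrix)
  have "\<exists>V. finite V \<and> card V = k \<and> (\<forall>v\<in>V. \<forall>w\<in>V. v \<bullet> (S *v w) = (if v = w then 1 else 0))" if "k \<le> CARD('n)" for k
    using that
  proof (induction k)
    case 0
    then show ?case by (intro exI[of _ "{}"]) auto
  next
    case (Suc k)
    then obtain V where V: "finite V" "card V = k" "\<And>v w. v \<in> V \<Longrightarrow> w \<in> V \<Longrightarrow> v \<bullet> (S *v w) = (if v = w then 1 else 0)"
      by auto
    have "dim ((*v) S ` V) \<le> card ((*v) S ` V)" using V(1) by (intro dim_le_card') auto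
    also have "\<dots> \<le> k" using V card_image_le by blast
    finally have "dim ((*v) S ` V) < DIM(real^'n)" using Suc.prems by simp
    from orthogonal_to_subspace_exists[OF this] obtain x where x: "x \<noteq> 0" "\<And>y. y \<in> span ((*v) S ` V) \<Longrightarrow> orthogonal x y"
      by blast
    have xv: "x \<bullet> (S *v v) = 0" if "v \<in> V" for v
      using x(2)[of "S *v v"] that by (auto simp: orthogonal_def intro: span_base)
    define y where "y = (1 / sqrt (x \<bullet> (S *v x))) *\<^sub>R x"
    have yy: "y \<bullet> (S *v y) = 1"
      using pos[OF x(1)] by (simp add: y_def matrix_vector_mult_scaleR field_simps)
    have yv: "y \<bullet> (S *v v) = 0" "v \<bullet> (S *v y) = 0" if "v \<in> V" for v
      using xv[OF that] comm[of v y] by (simp_all add: y_def)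
    have "y \<notin> V" using yy yv(1)[of y] by auto
    then show ?case using V yy yv by (intro exI[of _ "insert y V"]) auto
  qed
  from this[of "CARD('n)"] obtain V :: "(real^'n) set" where V: "finite V" "card V = CARD('n)"
    "\<And>v w. v \<in> V \<Longrightarrow> w \<in> V \<Longrightarrow> v \<bullet> (S *v w) = (if v = w then 1 else 0)"
    by auto
  obtain f where f: "bij_betw f (UNIV :: 'n set) V"
    using finite_same_card_bij[of "UNIV :: 'n set" V] V by auto
  define B :: "real^'n^'n" where "B = (\<chi> i j. f j $ i)"
  have fV: "f i \<bullet> (S *v f j) = (if i = j then 1 else 0)" for i j
    using V(3)[of "f i" "f j"] f by (auto simp: bij_betw_def inj_on_def)
  have "(transpose B ** S ** B) $ i $ j = f i \<bullet> (S *v f j)" for i j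
    by (simp add: matrix_matrix_mult_def transpose_def B_def inner_vec_def matrix_vector_mult_def
       sum_distrib_left sum_distrib_right mult_ac) (rule sum.swap)
  then show ?thesis using fV by (intro exI[of _ B]) (simp add: vec_eq_iff mat_def)
qed

text \<open>Substituting by the matrix of \<open>gram_schmidt_matrix\<close> reduces the form to the
  squared norm, and taking determinants of the matrix identity gives the Jacobian
  \<open>1 / sqrt (det S)\<close>. The same identity shows that the determinant is positive.\<close>

lemma nn_integral_gaussian:
  fixes S :: "real^'n^'n"
  assumes sym: "transpose S = S" and pos: "\<And>x. x \<noteq> 0 \<Longrightarrow> x \<bullet> (S *v x) > 0"
  shows "(\<integral>\<^sup>+x. ennreal (exp (- (x \<bullet> (S *v x)) / 2)) \<partial>lborel) = ennreal (sqrt (2 * pi) ^ CARD('n) / sqrt (det S))"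
    and "det S > 0"
proof -
  obtain B :: "real^'n^'n" where B: "transpose B ** S ** B = mat 1" using gram_schmidt_matrix[OF sym pos] by auto
  have "det B * det S * det B = 1"
    using arg_cong[OF B, of det] by (simp add: det_mul)
  then have d: "(det B)\<^sup>2 * det S = 1" by (simp add: power2_eq_square mult_ac)
  then have nz: "det B \<noteq> 0" by auto
  show dS: "det S > 0" using d nz by (metis mult_eq_0_iff zero_less_mult_pos zero_less_one zero_less_power2)
  have "\<bar>det B\<bar> = sqrt (1 / det S)"
    using d dS by (intro real_sqrt_unique[symmetric]) (auto simp: field_simps)
  then have absB: "\<bar>det B\<bar> = 1 / sqrt (det S)" by (simp add: real_sqrt_divide)
  have [measurable]: "(\<lambda>x. S *v x) \<in> borel_measurable borel"
    by (intro borel_measurable_continuous_onI linear_continuous_on matrix_vector_mul_bounded_linear)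
  have q: "(B *v x) \<bullet> (S *v (B *v x)) = (norm x)\<^sup>2" for x
  proof -
    have "(B *v x) \<bullet> (S *v (B *v x)) = x \<bullet> ((transpose B ** S ** B) *v x)"
      by (metis dot_lmul_matrix matrix_vector_mul_assoc vector_transpose_matrix transpose_transpose matrix_mul_assoc inner_commute)
    then show ?thesis by (simp add: B power2_norm_eq_inner)
  qed
  have "(\<integral>\<^sup>+x. ennreal (exp (- (x \<bullet> (S *v x)) / 2)) \<partial>lborel) =
      ennreal \<bar>det B\<bar> * (\<integral>\<^sup>+x. ennreal (exp (- (norm x)\<^sup>2 / 2)) \<partial>(lborel :: (real^'n) measure))"
    by (subst nn_integral_lborel_linear[OF nz, symmetric]) (auto simp: q)
  also have "\<dots> = ennreal (sqrt (2 * pi) ^ CARD('n) / sqrt (det S))"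
    using dS by (simp add: nn_integral_gaussian_std[simplified] absB ennreal_mult[symmetric])
  finally show "(\<integral>\<^sup>+x. ennreal (exp (- (x \<bullet> (S *v x)) / 2)) \<partial>lborel) = ennreal (sqrt (2 * pi) ^ CARD('n) / sqrt (det S))" .
qed

section \<open>Differentiation under the integral and elementary bounds\<close>

text \<open>Dominated convergence for difference quotients: on the convex set \<open>S\<close> the
  mean value inequality bounds each quotient by \<open>w\<close>.\<close>

lemma has_real_derivative_integral:
  fixes f f' :: "real \<Rightarrow> 'a \<Rightarrow> real"
  assumes S: "open S" "convex S" "s \<in> S"
    and f: "\<And>t. t \<in> S \<Longrightarrow> integrable M (f t)"
    and f': "\<And>t x. t \<in> S \<Longrightarrow> x \<in> space M \<Longrightarrow> ((\<lambda>t. f t x) has_real_derivative f' t x) (at t)"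
    and bound: "\<And>t x. t \<in> S \<Longrightarrow> x \<in> space M \<Longrightarrow> \<bar>f' t x\<bar> \<le> w x"
    and w: "integrable M w" and meas: "f' s \<in> borel_measurable M"
  shows "((\<lambda>t. \<integral>x. f t x \<partial>M) has_real_derivative (\<integral>x. f' s x \<partial>M)) (at s)"
  unfolding has_field_derivative_iff tendsto_at_iff_sequentially comp_def
proof (intro allI impI)
  fix X :: "nat \<Rightarrow> real"
  assume X: "\<forall>i. X i \<in> UNIV - {s}" "X \<longlonglongrightarrow> s"
  \<comment> \<open>The sequence enters \<open>S\<close> only eventually. The value 0 before that
    keeps the bound by \<open>w\<close> valid at every index.\<close>
  let ?g = "\<lambda>n x. if X n \<in> S then (f (X n) x - f s x) / (X n - s) else 0"
  have inS: "eventually (\<lambda>n. X n \<in> S) sequentially"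
    using X(2) S by (simp add: topological_tendstoD)
  have "(\<lambda>n. \<integral>x. ?g n x \<partial>M) \<longlonglongrightarrow> (\<integral>x. f' s x \<partial>M)"
  proof (rule integral_dominated_convergence[OF meas _ w])
    show "?g n \<in> borel_measurable M" for n
      using f S(3) by (cases "X n \<in> S") (auto intro!: borel_measurable_divide borel_measurable_diff)
    show "AE x in M. (\<lambda>n. ?g n x) \<longlonglongrightarrow> f' s x"
    proof (rule AE_I2)
      fix x assume x: "x \<in> space M"
      have "(\<lambda>n. (f (X n) x - f s x) / (X n - s)) \<longlonglongrightarrow> f' s x"
        using f'[OF S(3) x] X unfolding has_field_derivative_iff tendsto_at_iff_sequentially comp_def by blast
      moreover have "eventually (\<lambda>n. (f (X n) x - f s x) / (X n - s) = ?g n x) sequentially"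
        using inS by eventually_elim simp
      ultimately show "(\<lambda>n. ?g n x) \<longlonglongrightarrow> f' s x"
        by (rule Lim_transform_eventually)
    qed
    show "AE x in M. norm (?g n x) \<le> w x" for n
    proof (rule AE_I2)
      fix x assume x: "x \<in> space M"
      have "0 \<le> w x" using bound[OF S(3) x] by linarith
      moreover have "norm (f t x - f s x) \<le> w x * norm (t - s)" if "t \<in> S" for t
        using f'[OF _ x] bound[OF _ x] S that
        by (intro field_differentiable_bound[of S "\<lambda>t. f t x" "\<lambda>t. f' t x"])
          (auto intro: has_field_derivative_at_within)
      ultimately show "norm (?g n x) \<le> w x"
        using X(1) by (simp add: divide_le_eq)
    qed
  qed
  moreover have "eventually (\<lambda>n. (\<integral>x. ?g n x \<partial>M) = ((\<integral>x. f (X n) x \<partial>M) - (\<integral>x. f s x \<partial>M)) / (X n - s)) sequentially"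
    using inS by eventually_elim (simp add: f S(3))
  ultimately show "(\<lambda>n. ((\<integral>x. f (X n) x \<partial>M) - (\<integral>x. f s x \<partial>M)) / (X n - s)) \<longlonglongrightarrow> (\<integral>x. f' s x \<partial>M)"
    by (rule Lim_transform_eventually)
qed

lemma one_minus_cos_le: "1 - cos (x::real) \<le> x\<^sup>2 / 2"
proof -
  have "1 - cos x = 2 * (sin (x / 2))\<^sup>2"
    using cos_double_sin[of "x / 2"] by simp
  moreover have "(sin (x / 2))\<^sup>2 \<le> (x / 2)\<^sup>2"
    using abs_sin_x_le_abs_x[of "x / 2"] by (simp only: abs_le_square_iff)
  ultimately show ?thesis by (simp add: power_divide)
qed

text \<open>With \<open>x / 2\<close> at most 2 in modulus, the cubic remainder of the sine is at
  most two thirds of its argument, hence the sine of \<open>x / 2\<close> is at least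
  \<open>x / 6\<close> in modulus; doubling the square gives the constant 18.\<close>

lemma one_minus_cos_ge:
  fixes x :: real
  assumes "\<bar>x\<bar> \<le> pi"
  shows "x\<^sup>2 / 18 \<le> 1 - cos x"
proof -
  let ?y = "x / 2"
  have y: "\<bar>?y\<bar> \<le> 2" using assms pi_less_4 by linarith
  have "\<bar>sin ?y - (\<Sum>m<3. sin_coeff m * ?y ^ m)\<bar> \<le> inverse (fact 3) * \<bar>?y\<bar> ^ 3"
    by (rule Maclaurin_sin_bound)
  moreover have "(\<Sum>m<3. sin_coeff m * ?y ^ m) = ?y"
    by (simp add: sin_coeff_def numeral_3_eq_3)
  moreover have "inverse (fact 3) * \<bar>?y\<bar> ^ 3 \<le> \<bar>?y\<bar> * (2 / 3)"
  proof -
    have "\<bar>?y\<bar> ^ 2 \<le> 2 ^ 2" using y by (intro power_mono) auto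
    then have "\<bar>?y\<bar> * \<bar>?y\<bar> ^ 2 \<le> \<bar>?y\<bar> * 4" by (intro mult_left_mono) auto
    then show ?thesis by (simp add: fact_numeral power3_eq_cube power2_eq_square)
  qed
  ultimately have "\<bar>?y / 3\<bar> \<le> \<bar>sin ?y\<bar>" by (simp add: abs_if split: if_splits)
  then have "(?y / 3)\<^sup>2 \<le> (sin ?y)\<^sup>2" by (simp only: abs_le_square_iff)
  moreover have "1 - cos x = 2 * (sin ?y)\<^sup>2"
    using cos_double_sin[of ?y] by simp
  ultimately show ?thesis by (simp add: power_divide)
qed

text \<open>In terms of half-angles this is the subadditivity of the modulus of the sine, followed
  by squaring. It transfers bounds from single steps to sums of steps.\<close>

lemma one_minus_cos_add: "1 - cos (x + y) \<le> 2 * (1 - cos x) + 2 * (1 - cos (y::real))"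
proof -
  have h: "1 - cos u = 2 * (sin (u / 2))\<^sup>2" for u :: real
    using cos_double_sin[of "u / 2"] by simp
  have "sin ((x + y) / 2) = sin (x/2) * cos (y/2) + cos (x/2) * sin (y/2)"
    by (simp add: add_divide_distrib sin_add)
  then have "\<bar>sin ((x + y) / 2)\<bar> \<le> \<bar>sin (x/2)\<bar> * \<bar>cos (y/2)\<bar> + \<bar>cos (x/2)\<bar> * \<bar>sin (y/2)\<bar>"
    by (metis abs_mult abs_triangle_ineq)
  also have "\<dots> \<le> \<bar>sin (x/2)\<bar> + \<bar>sin (y/2)\<bar>"
    by (intro add_mono) (auto intro: mult_left_le mult_left_le_one_le)
  finally have "(sin ((x + y) / 2))\<^sup>2 \<le> (\<bar>sin (x/2)\<bar> + \<bar>sin (y/2)\<bar>)\<^sup>2"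
    by (metis abs_ge_zero power2_abs power_mono)
  also have "\<dots> \<le> 2 * (sin (x/2))\<^sup>2 + 2 * (sin (y/2))\<^sup>2"
    using sum_squares_bound[of "\<bar>sin (x/2)\<bar>" "\<bar>sin (y/2)\<bar>"] by (simp add: power2_sum)
  finally show ?thesis unfolding h by simp
qed

lemma nn_integral_gaussian_finite:
  assumes "k > 0"
  shows "integrable lborel (\<lambda>u::real^'n. exp (- k * (norm u)\<^sup>2))"
proof (rule integrableI_nonneg)
  let ?S = "mat (2 * k) :: real^'n^'n"
  have S: "?S *v u = (2 * k) *\<^sub>R u" for u
    by (simp add: vec_eq_iff matrix_vector_mult_def mat_def if_distrib[of "\<lambda>x. x * _"] cong: if_cong)
  have "(\<integral>\<^sup>+u. ennreal (exp (- (u \<bullet> (?S *v u)) / 2)) \<partial>lborel) = ennreal (sqrt (2 * pi) ^ CARD('n) / sqrt (det ?S))"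
    by (rule nn_integral_gaussian) (use assms S in \<open>auto simp: transpose_mat\<close>)
  then show "(\<integral>\<^sup>+u. ennreal (exp (- k * (norm u)\<^sup>2)) \<partial>(lborel :: (real^'n) measure)) < \<infinity>"
    by (simp add: S power2_norm_eq_inner)
qed auto

lemma integrable_power_gaussian:
  assumes "k > 0" and "m \<le> 1"
  shows "integrable lborel (\<lambda>u::real^'n. norm u ^ (2 * m) * exp (- k * (norm u)\<^sup>2))"
proof (rule Bochner_Integration.integrable_bound)
  show "integrable lborel (\<lambda>u::real^'n. (1 + 2 / k) * exp (- (k / 2) * (norm u)\<^sup>2))"
    using nn_integral_gaussian_finite[of "k / 2"] assms by (intro integrable_mult_right) auto
  show "AE u in (lborel :: (real^'n) measure). norm (norm u ^ (2 * m) * exp (- k * (norm u)\<^sup>2)) \<le> norm ((1 + 2 / k) * exp (- (k / 2) * (norm u)\<^sup>2))"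
  proof (rule AE_I2)
    fix u :: "real^'n"
    define y where "y = (norm u)\<^sup>2"
    have y: "0 \<le> y" by (simp add: y_def)
    have "y ^ m \<le> 1 + y" using assms(2) y by (cases m) auto
    also have "\<dots> \<le> (1 + 2 / k) * (1 + k / 2 * y)"
    proof -
      have "0 \<le> 2 / k" "0 \<le> k * y" using assms(1) y by auto
      moreover have "(1 + 2 / k) * (1 + k / 2 * y) = 1 + 2 / k + k * y / 2 + y"
        using assms(1) by (simp add: field_simps)
      ultimately show ?thesis by linarith
    qed
    also have "\<dots> \<le> (1 + 2 / k) * exp (k / 2 * y)"
      using assms(1) by (intro mult_left_mono exp_ge_add_one_self) auto
    finally have "y ^ m * exp (- k * y) \<le> (1 + 2 / k) * exp (k / 2 * y) * exp (- k * y)"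
      by (rule mult_right_mono) simp
    also have "\<dots> = (1 + 2 / k) * exp (- (k / 2) * y)"
      by (simp add: mult.assoc flip: exp_add)
    finally show "norm (norm u ^ (2 * m) * exp (- k * (norm u)\<^sup>2)) \<le> norm ((1 + 2 / k) * exp (- (k / 2) * (norm u)\<^sup>2))"
      using assms(1) by (simp add: y_def power_mult abs_mult)
  qed
qed simp

lemma lborel_integral_scale:
  fixes f :: "'a::euclidean_space \<Rightarrow> real"
  assumes [measurable]: "f \<in> borel_measurable borel" and "c > 0"
  shows "(\<integral>x. f x \<partial>lborel) = c ^ DIM('a) * (\<integral>x. f (c *\<^sub>R x) \<partial>lborel)"
proof -
  have "(\<integral>x. f x \<partial>lborel) = (\<integral>x. f x \<partial>density (distr lborel borel (\<lambda>x. 0 + c *\<^sub>R x)) (\<lambda>_. \<bar>c\<bar> ^ DIM('a)))"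
    using lborel_affine[of c "0::'a"] assms by simp
  also have "\<dots> = c ^ DIM('a) * (\<integral>x. f (c *\<^sub>R x) \<partial>lborel)"
    using assms(2) by (subst integral_density) (auto simp: integral_distr)
  finally show ?thesis .
qed

section \<open>The characteristic exponent and local limit estimates\<close>

context random_walk
begin

inductive_set generated :: "(int^'d) set" where
  zero: "0 \<in> generated"
| step: "v \<in> generated \<Longrightarrow> s \<in> steps \<Longrightarrow> v + s \<in> generated"

text \<open>Irreducibility is stated by transition probabilities; a positive probability yields one
  good path that is at \<open>v\<close> at some time, and its increments exhibit \<open>v\<close> as
  a finite sum of steps. This provides the induction over lattice points used below.\<close>

lemma generated_UNIV: "v \<in> generated"
proof -
  obtain t where "ptrans A t 0 v > 0"
    using admissible unfolding admissible_rates_def irreducible_rw_def by blast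
  then have "\<not> (AE \<omega> in Omega A. S_proc 0 \<omega> t \<noteq> v)"
  proof -
    have [measurable]: "{\<omega>. S_proc 0 \<omega> t = v} \<in> W.events"
      using measurable_sets[OF measurable_S_proc[of "\<lambda>_. t" "Omega A" "\<lambda>\<omega>. \<omega>" 0], of "{v}"]
      by (simp add: vimage_def)
    assume "ptrans A t 0 v > 0"
    then have "W.prob {\<omega>. S_proc 0 \<omega> t = v} > 0" by (simp add: ptrans_def)
    then show ?thesis
      using W.AE_prob_1[of "{\<omega>. S_proc 0 \<omega> t \<noteq> v}"] W.prob_eq_0[of "{\<omega>. S_proc 0 \<omega> t = v}"] by auto
  qed
  then obtain \<omega> where \<omega>: "good \<omega>" "S_proc 0 \<omega> t = v"
    using AE_good by (metis (mono_tags, lifting) eventually_mono)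
  have "jump_chain 0 \<omega> n \<in> generated" for n
  proof (induction n)
    case (Suc n)
    then show ?case using \<omega>(1) generated.step[of "jump_chain 0 \<omega> n" "fst (\<omega> !! n)"]
      by (simp add: jump_chain_def good_def)
  qed (simp add: generated.zero)
  then show ?thesis using \<omega>(2) by (auto simp: S_proc_def)
qed

text \<open>The contribution of the single atom at \<open>s\<close>. It is the source of all maximum
  principle arguments: a nonnegative function with vanishing jump average vanishes after every
  step.\<close>

lemma integral_J_ge_step:
  assumes "s \<in> steps" "integrable J f" "\<And>z. 0 \<le> f z"
  shows "A s / a * f s \<le> (\<integral>z. f z \<partial>J)"
proof -
  have s: "s \<noteq> 0" "A s > 0" using assms by (auto simp: steps_def)
  have "emeasure J {s} = ennreal (A s / a)"
    unfolding jump_measure_def using s by (subst emeasure_density) (auto simp: nn_integral_count_space_indicator[symmetric] nn_integral_count_space_finite)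
  then have "measure J {s} = A s / a" using s a_pos by (simp add: measure_def)
  then have "A s / a * f s = (\<integral>z. indicator {s} z * f s \<partial>J)" by simp
  also have "\<dots> \<le> (\<integral>z. f z \<partial>J)"
    using assms integrable_J_bounded[of "\<lambda>z. indicator {s} z * f s" "\<bar>f s\<bar>"]
    by (intro integral_mono) (auto simp: indicator_def)
  finally show ?thesis .
qed

text \<open>For a single step the bound is its own term in \<open>psi\<close>;
  \<open>one_minus_cos_add\<close> carries it along sums, at the cost of a constant depending on
  \<open>v\<close>. This is the quantitative content of irreducibility.\<close>

lemma one_minus_cos_le_psi: "\<exists>C\<ge>0. \<forall>\<theta>. 1 - cos (rvec v \<bullet> \<theta>) \<le> C * psi \<theta>"
  using generated_UNIV[of v]
proof induction
  case zero
  then show ?case by (intro exI[of _ 0]) simp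
next
  case (step v s)
  then obtain C where C: "C \<ge> 0" "\<And>\<theta>. 1 - cos (rvec v \<bullet> \<theta>) \<le> C * psi \<theta>" by blast
  have As: "A s / a > 0" using step a_pos by (simp add: steps_def)
  have "A s / a * (1 - cos (rvec s \<bullet> \<theta>)) \<le> psi \<theta>" for \<theta>
    unfolding psi_def using step by (intro integral_J_ge_step) auto
  then have s: "1 - cos (rvec s \<bullet> \<theta>) \<le> 1 / (A s / a) * psi \<theta>" for \<theta>
    using As by (simp add: pos_le_divide_eq mult.commute del: divide_divide_eq_right)
  have "1 - cos (rvec (v + s) \<bullet> \<theta>) \<le> (2 * C + 2 * (1 / (A s / a))) * psi \<theta>" for \<theta>
    using one_minus_cos_add[of "rvec v \<bullet> \<theta>" "rvec s \<bullet> \<theta>"] C(2)[of \<theta>] s[of \<theta>]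
    by (simp add: inner_add_left ring_distribs del: divide_divide_eq_right)
  moreover have "2 * C + 2 * (1 / (A s / a)) \<ge> 0"
    using C(1) As by (simp del: divide_divide_eq_right)
  ultimately show ?case by blast
qed

lemma psi_ge: "\<exists>c>0. \<forall>\<theta>\<in>torus. c * (norm \<theta>)\<^sup>2 \<le> psi \<theta>"
proof -
  have "\<exists>C. \<forall>i. C i \<ge> 0 \<and> (\<forall>\<theta>. 1 - cos (rvec (axis i 1) \<bullet> \<theta>) \<le> C i * psi \<theta>)"
    by (rule choice) (use one_minus_cos_le_psi in auto)
  then obtain C where C: "\<And>i. C i \<ge> 0" "\<And>i \<theta>. 1 - cos (rvec (axis i 1) \<bullet> \<theta>) \<le> C i * psi \<theta>" by blast
  \<comment> \<open>The factor 18 is the constant of \<open>one_minus_cos_ge\<close>, applied to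
    each coordinate; the summand 1 makes \<open>K\<close> positive.\<close>
  define K where "K = 18 * (\<Sum>i\<in>UNIV. C i) + 1"
  have K: "K > 0" unfolding K_def using C(1) by (intro add_nonneg_pos mult_nonneg_nonneg sum_nonneg) auto
  have "1 / K * (norm \<theta>)\<^sup>2 \<le> psi \<theta>" if \<theta>: "\<theta> \<in> torus" for \<theta>
  proof -
    have "rvec (axis i 1) \<bullet> \<theta> = \<theta> $ i" for i
    proof -
      have "rvec (axis i 1) = axis i 1" by (simp add: vec_eq_iff axis_def)
      then show ?thesis by (simp add: inner_axis')
    qed
    moreover have "\<bar>\<theta> $ i\<bar> \<le> pi" for i
      using \<theta> by (simp add: torus_def mem_box_cart abs_le_iff)
        (metis minus_le_iff)
    ultimately have "(\<theta> $ i)\<^sup>2 \<le> 18 * (C i * psi \<theta>)" for i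
      using one_minus_cos_ge[of "\<theta> $ i"] C(2)[of i \<theta>] by simp
    then have "(\<Sum>i\<in>UNIV. (\<theta> $ i)\<^sup>2) \<le> (\<Sum>i\<in>UNIV. 18 * (C i * psi \<theta>))" by (rule sum_mono)
    also have "\<dots> = 18 * (\<Sum>i\<in>UNIV. C i) * psi \<theta>" by (simp add: sum_distrib_left sum_distrib_right mult.assoc)
    also have "\<dots> \<le> K * psi \<theta>" using psi_nonneg[of \<theta>] by (intro mult_right_mono) (auto simp: K_def)
    finally have "(norm \<theta>)\<^sup>2 \<le> K * psi \<theta>"
      by (simp add: norm_eq_sqrt_inner inner_vec_def sum_nonneg power2_eq_square)
    then show ?thesis using K by (simp add: pos_divide_le_eq mult.commute)
  qed
  then show ?thesis using K by (intro exI[of _ "1 / K"]) auto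
qed

lemma integrable_norm_sq_J: "integrable J (\<lambda>z. (norm (rvec z))\<^sup>2)"
  using integrable_sqnorm_A by (simp add: integral_J(1) sqnorm_rvec mult.commute)

lemma integrable_prod_J: "integrable J (\<lambda>z. (rvec z \<bullet> u) * (rvec z \<bullet> v))"
proof (rule Bochner_Integration.integrable_bound)
  show "integrable J (\<lambda>z. (norm u * norm v) * (norm (rvec z))\<^sup>2)"
    using integrable_norm_sq_J by simp
  have "\<bar>(rvec z \<bullet> u) * (rvec z \<bullet> v)\<bar> \<le> (norm (rvec z) * norm u) * (norm (rvec z) * norm v)" for z
    unfolding abs_mult by (intro mult_mono Cauchy_Schwarz_ineq2) auto
  then show "AE z in J. norm ((rvec z \<bullet> u) * (rvec z \<bullet> v)) \<le> norm ((norm u * norm v) * (norm (rvec z))\<^sup>2)"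
    by (intro AE_I2) (simp add: power2_eq_square mult_ac)
qed simp

lemma integrable_lin_J: "integrable J (\<lambda>z. rvec z \<bullet> u)"
proof (rule Bochner_Integration.integrable_bound)
  show "integrable J (\<lambda>z. norm u * (norm (rvec z))\<^sup>2)"
    using integrable_norm_sq_J by simp
  have "\<bar>rvec z \<bullet> u\<bar> \<le> (norm (rvec z))\<^sup>2 * norm u" for z
    using Cauchy_Schwarz_ineq2[of "rvec z" u] norm_rvec_le_sq[of z] by (meson mult_right_mono norm_ge_zero order_trans)
  then show "AE z in J. norm (rvec z \<bullet> u) \<le> norm (norm u * (norm (rvec z))\<^sup>2)"
    by (intro AE_I2) (simp add: mult_ac)
qed simp

text \<open>The covariance matrix of the walk per unit of time, which is the negative Hessian of
  \<open>phi A\<close> at the origin.\<close>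

definition Sig :: "real^'d^'d" where
  "Sig = (\<chi> i j. a * (\<integral>z. rvec z $ i * rvec z $ j \<partial>J))"

lemma integrable_comp_J: "integrable J (\<lambda>z. rvec z $ i * rvec z $ j)"
  using integrable_prod_J[of "axis i 1" "axis j 1"] by (simp add: inner_axis)

lemma Sig_quadratic: "u \<bullet> (Sig *v u) = a * (\<integral>z. (rvec z \<bullet> u)\<^sup>2 \<partial>J)"
proof -
  have "(\<integral>z. (rvec z \<bullet> u)\<^sup>2 \<partial>J) = (\<integral>z. (\<Sum>i\<in>UNIV. \<Sum>j\<in>UNIV. u $ i * u $ j * (rvec z $ i * rvec z $ j)) \<partial>J)"
    by (simp add: power2_eq_square inner_vec_def sum_product mult_ac)
  also have "\<dots> = (\<Sum>i\<in>UNIV. \<Sum>j\<in>UNIV. u $ i * u $ j * (\<integral>z. rvec z $ i * rvec z $ j \<partial>J))"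
    using integrable_comp_J by (simp del: rvec_component)
  finally show ?thesis
    by (simp add: inner_vec_def matrix_vector_mult_def Sig_def sum_distrib_left mult_ac del: rvec_component)
qed

lemma Sig_sym: "transpose Sig = Sig"
  by (simp add: Sig_def transpose_def vec_eq_iff mult.commute del: rvec_component)

lemma integrable_sq_J: "integrable J (\<lambda>z. (rvec z \<bullet> u)\<^sup>2)"
  using integrable_prod_J[of u u] by (simp add: power2_eq_square)

text \<open>If the quadratic form vanished at \<open>x\<close>, every step would be orthogonal to
  \<open>x\<close>, hence every lattice point, in particular the unit vectors.\<close>

lemma Sig_pos:
  assumes "x \<noteq> 0"
  shows "x \<bullet> (Sig *v x) > 0"
proof -
  have "(\<integral>z. (rvec z \<bullet> x)\<^sup>2 \<partial>J) \<noteq> 0"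
  proof
    assume 0: "(\<integral>z. (rvec z \<bullet> x)\<^sup>2 \<partial>J) = 0"
    have s0: "rvec s \<bullet> x = 0" if "s \<in> steps" for s
    proof -
      have "A s / a * (rvec s \<bullet> x)\<^sup>2 \<le> 0"
        using integral_J_ge_step[OF that integrable_sq_J[of x]] 0 by simp
      moreover have "A s / a > 0" using that a_pos by (simp add: steps_def)
      ultimately have "(rvec s \<bullet> x)\<^sup>2 \<le> 0" by (metis mult_pos_pos not_le)
      then show ?thesis by simp
    qed
    have v0: "rvec v \<bullet> x = 0" for v
      using generated_UNIV[of v] by induction (auto simp: inner_add_left s0)
    have "x $ i = 0" for i
    proof -
      have "rvec (axis i 1) = axis i 1" by (simp add: vec_eq_iff axis_def)
      then show ?thesis using v0[of "axis i 1"] by (simp add: inner_axis')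
    qed
    then show False using assms by (simp add: vec_eq_iff)
  qed
  moreover have "(\<integral>z. (rvec z \<bullet> x)\<^sup>2 \<partial>J) \<ge> 0" by (intro Bochner_Integration.integral_nonneg) simp
  ultimately have "(\<integral>z. (rvec z \<bullet> x)\<^sup>2 \<partial>J) > 0" by linarith
  then show ?thesis using a_pos by (simp add: Sig_quadratic)
qed

text \<open>Two differentiations under the jump integral: the first is dominated by the modulus of
  one coordinate, the second by the modulus of a product of two coordinates. Both are integrable by
  the second moment assumption.\<close>

lemma hessian_phi: "hessian0 (phi A) = - Sig"
proof -
  have "hessian0 (phi A) $ i $ j = - Sig $ i $ j" for i j
  proof -
    have ph: "phi A (s *\<^sub>R axis j 1 + r *\<^sub>R axis i 1) = - a + a * (\<integral>z. cos (rvec z $ j * s + rvec z $ i * r) \<partial>J)" for s r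
      by (simp add: phi_eq psi_eq inner_add_right inner_axis algebra_simps)
    have int: "integrable J (\<lambda>z. cos (rvec z $ j * s + rvec z $ i * r))" for s r
      by (rule integrable_J_bounded[of _ 1]) simp
    have abs_i: "integrable J (\<lambda>z. \<bar>rvec z $ i\<bar>)"
      using integrable_lin_J[of "axis i 1"] by (intro integrable_abs) (simp add: inner_axis)
    have "((\<lambda>r. \<integral>z. cos (rvec z $ j * s + rvec z $ i * r) \<partial>J) has_real_derivative
        (\<integral>z. - sin (rvec z $ j * s + rvec z $ i * 0) * rvec z $ i \<partial>J)) (at 0)" for s
      by (rule has_real_derivative_integral[of UNIV, OF _ _ _ int _ _ abs_i])
        (auto intro!: derivative_eq_intros mult_left_le_one_le simp: abs_mult)
    then have d1: "((\<lambda>r. phi A (s *\<^sub>R axis j 1 + r *\<^sub>R axis i 1)) has_real_derivative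
        a * (\<integral>z. - sin (rvec z $ j * s) * rvec z $ i \<partial>J)) (at 0)" for s
      unfolding ph by (auto intro!: derivative_eq_intros)
    have abs_ij: "integrable J (\<lambda>z. \<bar>rvec z $ j * rvec z $ i\<bar>)"
      using integrable_comp_J by (rule integrable_abs)
    have int2: "integrable J (\<lambda>z. - sin (rvec z $ j * s) * rvec z $ i)" for s
      by (rule Bochner_Integration.integrable_bound[OF abs_i]) (auto simp: abs_mult mult_left_le_one_le)
    have "((\<lambda>s. \<integral>z. - sin (rvec z $ j * s) * rvec z $ i \<partial>J) has_real_derivative
        (\<integral>z. - cos (rvec z $ j * 0) * rvec z $ j * rvec z $ i \<partial>J)) (at 0)"
      by (rule has_real_derivative_integral[of UNIV, OF _ _ _ int2 _ _ abs_ij])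
        (auto intro!: derivative_eq_intros mult_left_le_one_le simp: abs_mult mult.assoc)
    from DERIV_cmult[OF this, of a]
    have d2: "((\<lambda>s. a * (\<integral>z. - sin (rvec z $ j * s) * rvec z $ i \<partial>J)) has_real_derivative
        a * (\<integral>z. - (rvec z $ i * rvec z $ j) \<partial>J)) (at 0)"
      by (simp add: mult_ac)
    have "hessian0 (phi A) $ i $ j = deriv (\<lambda>s. a * (\<integral>z. - sin (rvec z $ j * s) * rvec z $ i \<partial>J)) 0"
      by (simp add: hessian0_def DERIV_imp_deriv[OF d1] del: rvec_component)
    also have "\<dots> = a * (\<integral>z. - (rvec z $ i * rvec z $ j) \<partial>J)"
      by (rule DERIV_imp_deriv[OF d2])
    finally show ?thesis by (simp add: Sig_def del: rvec_component)
  qed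
  then show ?thesis by (simp add: vec_eq_iff)
qed

lemma det_Sig_pos: "det Sig > 0"
  using nn_integral_gaussian(2)[OF Sig_sym Sig_pos] .

lemma gamma_d_eq: "gamma_d A = 1 / (sqrt (2 * pi) ^ CARD('d) * sqrt (det Sig))"
  and gamma_d_pos: "gamma_d A > 0"
proof -
  have "- Sig = mat (- 1) ** Sig"
    by (simp add: vec_eq_iff matrix_matrix_mult_def mat_def if_distrib[of "\<lambda>x. x * _"] cong: if_cong)
  then have "\<bar>det (- Sig)\<bar> = \<bar>det (mat (- 1) :: real^'d^'d)\<bar> * \<bar>det Sig\<bar>"
    by (simp add: det_mul abs_mult)
  also have "det (mat (- 1) :: real^'d^'d) = (- 1) ^ CARD('d)"
    by (subst det_diagonal) (auto simp: mat_def)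
  finally have "\<bar>det (- Sig)\<bar> = det Sig" using det_Sig_pos by (simp add: power_abs)
  moreover have "(2 * pi) powr (real CARD('d) / 2) = sqrt (2 * pi) ^ CARD('d)"
    by (simp add: powr_half_sqrt[symmetric] powr_realpow[symmetric] powr_powr)
  ultimately show "gamma_d A = 1 / (sqrt (2 * pi) ^ CARD('d) * sqrt (det Sig))"
    by (simp add: gamma_d_def hessian_phi)
  then show "gamma_d A > 0" using det_Sig_pos by simp
qed

text \<open>Identifies \<open>gamma_d A\<close> as the value at the origin of the Gaussian density
  with covariance \<open>Sig\<close>, the constant of the local limit theorem.\<close>

lemma integral_gaussian_Sig:
  "(\<integral>u. exp (- (u \<bullet> (Sig *v u)) / 2) \<partial>lborel) / (2 * pi) ^ CARD('d) = gamma_d A"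
proof -
  have [measurable]: "(\<lambda>x. Sig *v x) \<in> borel_measurable borel"
    by (intro borel_measurable_continuous_onI linear_continuous_on matrix_vector_mul_bounded_linear)
  have "(\<integral>u. exp (- (u \<bullet> (Sig *v u)) / 2) \<partial>lborel) = enn2real (\<integral>\<^sup>+u. ennreal (exp (- (u \<bullet> (Sig *v u)) / 2)) \<partial>lborel)"
    by (rule integral_eq_nn_integral; measurable)
  also have "\<dots> = sqrt (2 * pi) ^ CARD('d) / sqrt (det Sig)"
    by (subst nn_integral_gaussian(1)[OF Sig_sym]) (use Sig_pos det_Sig_pos in auto)
  finally have "(\<integral>u. exp (- (u \<bullet> (Sig *v u)) / 2) \<partial>lborel) = sqrt (2 * pi) ^ CARD('d) / sqrt (det Sig)" .
  moreover have "(2 * pi) ^ CARD('d) = sqrt (2 * pi) ^ CARD('d) * sqrt (2 * pi) ^ CARD('d)"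
    by (subst power_mult_distrib[symmetric]) (simp only: real_sqrt_mult_self, simp)
  ultimately show ?thesis by (simp add: gamma_d_eq)
qed

text \<open>Only two moments of the jumps are available, so no Taylor expansion of
  \<open>psi\<close> with remainder is used: the inequality \<open>1 - cos x\<close> at most half of
  \<open>x\<close> squared gives a majorant independent of \<open>t\<close>, and the limit is taken
  for each increment separately.\<close>

lemma psi_scaled_limit: "((\<lambda>t. t * a * psi (u /\<^sub>R sqrt t)) \<longlongrightarrow> u \<bullet> (Sig *v u) / 2) at_top"
proof -
  have "((\<lambda>t. \<integral>z. t * (1 - cos (rvec z \<bullet> (u /\<^sub>R sqrt t))) \<partial>J) \<longlongrightarrow> (\<integral>z. (rvec z \<bullet> u)\<^sup>2 / 2 \<partial>J)) at_top"
  proof (rule integral_dominated_convergence_at_top[of _ _ _ "\<lambda>z. (rvec z \<bullet> u)\<^sup>2 / 2"])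
    show "integrable J (\<lambda>z. (rvec z \<bullet> u)\<^sup>2 / 2)" using integrable_sq_J by simp
    show "\<forall>\<^sub>F t in at_top. AE z in J. norm (t * (1 - cos (rvec z \<bullet> (u /\<^sub>R sqrt t)))) \<le> (rvec z \<bullet> u)\<^sup>2 / 2"
      using eventually_gt_at_top[of 0]
    proof eventually_elim
      case (elim t)
      have "t * (1 - cos (rvec z \<bullet> (u /\<^sub>R sqrt t))) \<le> t * ((rvec z \<bullet> (u /\<^sub>R sqrt t))\<^sup>2 / 2)" for z
        using elim by (intro mult_left_mono one_minus_cos_le) auto
      also have "t * ((rvec z \<bullet> (u /\<^sub>R sqrt t))\<^sup>2 / 2) = (rvec z \<bullet> u)\<^sup>2 / 2" for z
        using elim by (simp add: power_mult_distrib field_simps)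
      finally show ?case using elim by (intro AE_I2) (simp add: abs_mult)
    qed
    show "AE z in J. ((\<lambda>t. t * (1 - cos (rvec z \<bullet> (u /\<^sub>R sqrt t)))) \<longlongrightarrow> (rvec z \<bullet> u)\<^sup>2 / 2) at_top"
    proof (rule AE_I2)
      fix z
      define b where "b = rvec z \<bullet> u"
      have "((\<lambda>t. t * (1 - cos (b / sqrt t))) \<longlongrightarrow> b\<^sup>2 / 2) at_top"
        by real_asymp (simp add: power2_eq_square)
      moreover have "rvec z \<bullet> (u /\<^sub>R sqrt t) = b / sqrt t" for t
        by (simp add: b_def divide_inverse)
      ultimately show "((\<lambda>t. t * (1 - cos (rvec z \<bullet> (u /\<^sub>R sqrt t)))) \<longlongrightarrow> (rvec z \<bullet> u)\<^sup>2 / 2) at_top"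
        by (simp only: b_def[symmetric])
    qed
  qed auto
  then have "((\<lambda>t. a * (\<integral>z. t * (1 - cos (rvec z \<bullet> (u /\<^sub>R sqrt t))) \<partial>J)) \<longlongrightarrow> a * (\<integral>z. (rvec z \<bullet> u)\<^sup>2 / 2 \<partial>J)) at_top"
    by (intro tendsto_intros)
  then show ?thesis
    by (simp add: Sig_quadratic psi_def mult_ac)
qed

text \<open>Local limit theorem with a weight \<open>W\<close>: the cases of interest are \<open>W = cos (x \<bullet> \<theta>)\<close> with \<open>m = 0\<close>
  and \<open>W = 1 - cos (x \<bullet> \<theta>)\<close> with \<open>m = 1\<close>.\<close>
lemma weighted_local_limit:
  fixes W w :: "real^'d \<Rightarrow> real" and m :: nat
  assumes [measurable]: "W \<in> borel_measurable borel" "w \<in> borel_measurable borel"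
    and m: "m \<le> 1" and W: "\<And>\<theta>. \<bar>W \<theta>\<bar> \<le> K * norm \<theta> ^ (2 * m)"
    and lim: "\<And>u. ((\<lambda>t. t ^ m * W (u /\<^sub>R sqrt t)) \<longlongrightarrow> w u) at_top"
  shows "((\<lambda>t. t powr (CARD('d) / 2) * t ^ m * (\<integral>\<theta>. W \<theta> * exp (- (t * a * psi \<theta>)) \<partial>torus_measure)) \<longlongrightarrow>
      (\<integral>u. w u * exp (- (u \<bullet> (Sig *v u)) / 2) \<partial>lborel) / (2 * pi) ^ CARD('d)) at_top" (is ?limit)
    and "\<exists>C. \<forall>t>0. \<bar>t powr (CARD('d) / 2) * t ^ m * (\<integral>\<theta>. W \<theta> * exp (- (t * a * psi \<theta>)) \<partial>torus_measure)\<bar> \<le> C" (is ?bound)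
proof -
  have [measurable]: "(\<lambda>x. Sig *v x) \<in> borel_measurable borel"
    by (intro borel_measurable_continuous_onI linear_continuous_on matrix_vector_mul_bounded_linear)
  obtain c where c: "c > 0" "\<And>\<theta>. \<theta> \<in> torus \<Longrightarrow> c * (norm \<theta>)\<^sup>2 \<le> psi \<theta>" using psi_ge by blast
  \<comment> \<open>The integrand after scaling the angle by \<open>1 / sqrt t\<close>. The
    quadratic lower bound of \<open>psi_ge\<close> turns into the Gaussian majorant
    \<open>?d\<close>, uniformly in \<open>t\<close>.\<close>
  let ?g = "\<lambda>t u. indicator torus (u /\<^sub>R sqrt t) * (t ^ m * W (u /\<^sub>R sqrt t)) * exp (- (t * a * psi (u /\<^sub>R sqrt t)))"
  let ?d = "\<lambda>u::real^'d. K * (norm u ^ (2 * m) * exp (- (a * c) * (norm u)\<^sup>2))"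
  have d_int: "integrable lborel ?d"
    using integrable_power_gaussian[of "a * c" m] m c a_pos by (intro integrable_mult_right) auto
  have eq: "t powr (CARD('d) / 2) * t ^ m * (\<integral>\<theta>. W \<theta> * exp (- (t * a * psi \<theta>)) \<partial>torus_measure) =
      (\<integral>u. ?g t u \<partial>lborel) / (2 * pi) ^ CARD('d)" if t: "t > 0" for t
  proof -
    have "t powr (CARD('d) / 2) = sqrt t ^ CARD('d)"
      using t by (simp add: powr_half_sqrt[symmetric] powr_realpow[symmetric] powr_powr)
    moreover have "(\<integral>\<theta>. indicator torus \<theta> * (W \<theta> * exp (- (t * a * psi \<theta>))) \<partial>lborel) =
       (1 / sqrt t) ^ CARD('d) * (\<integral>u. indicator torus (u /\<^sub>R sqrt t) * (W (u /\<^sub>R sqrt t) * exp (- (t * a * psi (u /\<^sub>R sqrt t)))) \<partial>lborel)"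
      using t by (subst lborel_integral_scale[of _ "1 / sqrt t"]) (auto simp: inverse_eq_divide)
    moreover have "(\<integral>u. ?g t u \<partial>lborel) = t ^ m * (\<integral>u. indicator torus (u /\<^sub>R sqrt t) * (W (u /\<^sub>R sqrt t) * exp (- (t * a * psi (u /\<^sub>R sqrt t)))) \<partial>lborel)"
      by (subst integral_mult_right_zero[symmetric]) (simp add: mult_ac)
    moreover have "sqrt t ^ CARD('d) * (1 / sqrt t) ^ CARD('d) = 1"
      using t by (subst power_mult_distrib[symmetric]) simp
    ultimately show ?thesis
      by (subst integral_torus_measure) (auto simp: mult_ac power_one_over field_simps)
  qed
  have dom: "\<bar>?g t u\<bar> \<le> ?d u" if t: "t > 0" for t u
  proof (cases "u /\<^sub>R sqrt t \<in> torus")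
    case True
    have n: "norm (u /\<^sub>R sqrt t) = norm u / sqrt t" using t by (simp add: divide_inverse mult.commute)
    have "t ^ m * \<bar>W (u /\<^sub>R sqrt t)\<bar> \<le> t ^ m * (K * norm (u /\<^sub>R sqrt t) ^ (2 * m))"
      using t by (intro mult_left_mono W) auto
    also have "\<dots> = K * norm u ^ (2 * m)"
      using t unfolding n by (simp add: power_divide power_mult)
    finally have 1: "t ^ m * \<bar>W (u /\<^sub>R sqrt t)\<bar> \<le> K * norm u ^ (2 * m)" .
    have "(a * c) * (norm u)\<^sup>2 = t * a * (c * (norm (u /\<^sub>R sqrt t))\<^sup>2)"
      using t unfolding n by (simp add: power_divide)
    also have "\<dots> \<le> t * a * psi (u /\<^sub>R sqrt t)"
      using t a_pos c(2)[OF True] by (intro mult_left_mono) auto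
    finally have 2: "exp (- (t * a * psi (u /\<^sub>R sqrt t))) \<le> exp (- (a * c) * (norm u)\<^sup>2)" by simp
    have "0 \<le> t ^ m * \<bar>W (u /\<^sub>R sqrt t)\<bar>" using t by simp
    then have "0 \<le> K * norm u ^ (2 * m)" using 1 by linarith
    then have "(t ^ m * \<bar>W (u /\<^sub>R sqrt t)\<bar>) * exp (- (t * a * psi (u /\<^sub>R sqrt t))) \<le> (K * norm u ^ (2 * m)) * exp (- (a * c) * (norm u)\<^sup>2)"
      by (intro mult_mono[OF 1 2]) auto
    then show ?thesis using True t by (simp add: abs_mult mult.assoc)
  next
    case False
    have "0 \<le> K * norm u ^ (2 * m)" using W[of u] by linarith
    then show ?thesis using False by (simp add: mult.assoc[symmetric])
  qed
  have "((\<lambda>t. \<integral>u. ?g t u \<partial>lborel) \<longlongrightarrow> (\<integral>u. w u * exp (- (u \<bullet> (Sig *v u)) / 2) \<partial>lborel)) at_top"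
  proof (rule integral_dominated_convergence_at_top[OF _ _ d_int])
    show "\<forall>\<^sub>F t in at_top. AE u in lborel. norm (?g t u) \<le> ?d u"
      using eventually_gt_at_top[of 0] by eventually_elim (use dom in auto)
    show "AE u in lborel. ((\<lambda>t. ?g t u) \<longlongrightarrow> w u * exp (- (u \<bullet> (Sig *v u)) / 2)) at_top"
    proof (rule AE_I2)
      fix u :: "real^'d"
      have "((\<lambda>t. (inverse (sqrt t)) *\<^sub>R u) \<longlongrightarrow> 0 *\<^sub>R u) at_top"
        by (intro tendsto_scaleR tendsto_const) real_asymp
      moreover have "(0::real^'d) \<in> interior torus" unfolding torus_def
        by (simp add: interior_cbox mem_box_cart)
      ultimately have "eventually (\<lambda>t. u /\<^sub>R sqrt t \<in> interior torus) at_top"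
        by (intro topological_tendstoD) auto
      then have ind: "eventually (\<lambda>t. 1 = (indicator torus (u /\<^sub>R sqrt t) :: real)) at_top"
        by eventually_elim (use interior_subset in \<open>auto simp: indicator_def\<close>)
      have "((\<lambda>t. indicator torus (u /\<^sub>R sqrt t) * (t ^ m * W (u /\<^sub>R sqrt t)) * exp (- (t * a * psi (u /\<^sub>R sqrt t)))) \<longlongrightarrow>
         1 * w u * exp (- (u \<bullet> (Sig *v u) / 2))) at_top"
        by (intro tendsto_mult lim tendsto_exp tendsto_minus psi_scaled_limit Lim_transform_eventually[OF tendsto_const ind])
      then show "((\<lambda>t. ?g t u) \<longlongrightarrow> w u * exp (- (u \<bullet> (Sig *v u)) / 2)) at_top" by simp
    qed
  qed auto
  then have "((\<lambda>t. (\<integral>u. ?g t u \<partial>lborel) / (2 * pi) ^ CARD('d)) \<longlongrightarrow>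
      (\<integral>u. w u * exp (- (u \<bullet> (Sig *v u)) / 2) \<partial>lborel) / (2 * pi) ^ CARD('d)) at_top"
    by (intro tendsto_intros) auto
  then show ?limit
    by (rule Lim_transform_eventually)
      (rule eventually_mono[OF eventually_gt_at_top[of 0]], rule eq[symmetric])
  show ?bound
  proof (intro exI allI impI)
    fix t :: real assume t: "t > 0"
    have "\<bar>\<integral>u. ?g t u \<partial>lborel\<bar> \<le> (\<integral>u. ?d u \<partial>lborel)"
      by (rule integral_abs_bound_integral[OF Bochner_Integration.integrable_bound[OF d_int] d_int])
        (use dom[OF t] in \<open>auto intro: order_trans[OF _ abs_ge_self]\<close>)
    then show "\<bar>t powr (CARD('d) / 2) * t ^ m * (\<integral>\<theta>. W \<theta> * exp (- (t * a * psi \<theta>)) \<partial>torus_measure)\<bar> \<le>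
       (\<integral>u. ?d u \<partial>lborel) / (2 * pi) ^ CARD('d)"
      unfolding eq[OF t] by (simp add: abs_divide divide_right_mono)
  qed
qed

lemma pF_limit: "((\<lambda>t. t powr (CARD('d) / 2) * pF t x) \<longlongrightarrow> gamma_d A) at_top"
  and pF_bound: "\<exists>C. \<forall>t>0. \<bar>t powr (CARD('d) / 2) * pF t x\<bar> \<le> C"
proof -
  have lim: "((\<lambda>t. t ^ 0 * cos (rvec x \<bullet> (u /\<^sub>R sqrt t))) \<longlongrightarrow> 1) at_top" for u
  proof -
    have "((\<lambda>t. cos (inverse (sqrt t) * (rvec x \<bullet> u))) \<longlongrightarrow> cos (0 * (rvec x \<bullet> u))) at_top"
      by (intro tendsto_cos tendsto_mult tendsto_const) real_asymp
    then show ?thesis by simp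
  qed
  note * = weighted_local_limit[of "\<lambda>\<theta>. cos (rvec x \<bullet> \<theta>)" "\<lambda>_. 1" 0 1, OF _ _ _ _ lim]
  show "((\<lambda>t. t powr (CARD('d) / 2) * pF t x) \<longlongrightarrow> gamma_d A) at_top"
    using *(1) by (simp add: pF_def integral_gaussian_Sig[simplified])
  show "\<exists>C. \<forall>t>0. \<bar>t powr (CARD('d) / 2) * pF t x\<bar> \<le> C"
    using *(2) by (simp add: pF_def)
qed

lemma pF_diff:
  assumes "t \<ge> 0"
  shows "pF t 0 - pF t x = (\<integral>\<theta>. (1 - cos (rvec x \<bullet> \<theta>)) * exp (- (t * a * psi \<theta>)) \<partial>torus_measure)"
proof -
  have "integrable torus_measure (\<lambda>\<theta>. exp (- (t * a * psi \<theta>)))"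
    "integrable torus_measure (\<lambda>\<theta>. cos (rvec x \<bullet> \<theta>) * exp (- (t * a * psi \<theta>)))"
    using assms a_pos psi_nonneg
    by (auto intro!: T.integrable_const_bound[of _ 1] AE_I2 mult_le_one simp: abs_mult)
  then show ?thesis by (simp add: pF_def left_diff_distrib)
qed

text \<open>The weight \<open>1 - cos\<close> vanishes to second order at the origin, which gains a
  factor \<open>1 / t\<close> over \<open>pF_limit\<close>. The difference is therefore integrable
  at infinity in every dimension, also where \<open>pF\<close> itself is not.\<close>

lemma pF_diff_limit: "((\<lambda>t. t powr (CARD('d) / 2 + 1) * (pF t 0 - pF t x)) \<longlongrightarrow>
      (\<integral>u. (rvec x \<bullet> u)\<^sup>2 / 2 * exp (- (u \<bullet> (Sig *v u)) / 2) \<partial>lborel) / (2 * pi) ^ CARD('d)) at_top"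
  and pF_diff_bound: "\<exists>C. \<forall>t>0. \<bar>t powr (CARD('d) / 2 + 1) * (pF t 0 - pF t x)\<bar> \<le> C"
proof -
  have lim: "((\<lambda>t. t ^ 1 * (1 - cos (rvec x \<bullet> (u /\<^sub>R sqrt t)))) \<longlongrightarrow> (rvec x \<bullet> u)\<^sup>2 / 2) at_top" for u
  proof -
    define b where "b = rvec x \<bullet> u"
    have "((\<lambda>t. t * (1 - cos (b / sqrt t))) \<longlongrightarrow> b\<^sup>2 / 2) at_top" by real_asymp (simp add: power2_eq_square)
    moreover have "rvec x \<bullet> (u /\<^sub>R sqrt t) = b / sqrt t" for t
      by (simp add: b_def divide_inverse)
    ultimately show ?thesis by (simp only: b_def[symmetric] power_one_right)
  qed
  have bd: "\<bar>1 - cos (rvec x \<bullet> \<theta>)\<bar> \<le> (norm (rvec x))\<^sup>2 / 2 * norm \<theta> ^ (2 * 1)" for \<theta>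
  proof -
    have "1 - cos (rvec x \<bullet> \<theta>) \<le> (rvec x \<bullet> \<theta>)\<^sup>2 / 2" by (rule one_minus_cos_le)
    also have "(rvec x \<bullet> \<theta>)\<^sup>2 \<le> (norm (rvec x) * norm \<theta>)\<^sup>2"
      using Cauchy_Schwarz_ineq2[of "rvec x" \<theta>] by (metis abs_ge_zero power2_abs power_mono)
    finally show ?thesis by (simp add: power_mult_distrib)
  qed
  have W: "(\<lambda>\<theta>. 1 - cos (rvec x \<bullet> \<theta>)) \<in> borel_measurable borel" "(\<lambda>u. (rvec x \<bullet> u)\<^sup>2 / 2) \<in> borel_measurable borel"
    by measurable
  note * = weighted_local_limit[OF W order_refl bd lim]
  have eq: "t powr (CARD('d) / 2) * t ^ 1 * (\<integral>\<theta>. (1 - cos (rvec x \<bullet> \<theta>)) * exp (- (t * a * psi \<theta>)) \<partial>torus_measure) =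
      t powr (CARD('d) / 2 + 1) * (pF t 0 - pF t x)" if "t > 0" for t
    using that by (simp add: pF_diff powr_add)
  show "((\<lambda>t. t powr (CARD('d) / 2 + 1) * (pF t 0 - pF t x)) \<longlongrightarrow>
      (\<integral>u. (rvec x \<bullet> u)\<^sup>2 / 2 * exp (- (u \<bullet> (Sig *v u)) / 2) \<partial>lborel) / (2 * pi) ^ CARD('d)) at_top"
    by (rule Lim_transform_eventually[OF *(1)])
      (rule eventually_mono[OF eventually_gt_at_top[of 0]], rule eq)
  obtain C where C: "\<And>t. t > 0 \<Longrightarrow> \<bar>t powr (CARD('d) / 2) * t ^ 1 *
      (\<integral>\<theta>. (1 - cos (rvec x \<bullet> \<theta>)) * exp (- (t * a * psi \<theta>)) \<partial>torus_measure)\<bar> \<le> C"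
    using *(2) by blast
  show "\<exists>C. \<forall>t>0. \<bar>t powr (CARD('d) / 2 + 1) * (pF t 0 - pF t x)\<bar> \<le> C"
    by (intro exI[of _ C] allI impI) (subst eq[symmetric], assumption, rule C)
qed

lemma pF_diff_nonneg: "t \<ge> 0 \<Longrightarrow> 0 \<le> pF t 0 - pF t x"
  by (subst pF_diff) (auto intro!: Bochner_Integration.integral_nonneg)

end

section \<open>Abelian and Tauberian theorems\<close>

lemma integral_real_scale:
  fixes f :: "real \<Rightarrow> real"
  assumes "c > 0"
  shows "(\<integral>t. f t \<partial>lborel) = c * (\<integral>t. f (c * t) \<partial>lborel)"
  using lborel_integral_real_affine[of c f 0] assms by simp

text \<open>After the substitution \<open>v = l * t\<close> the factor \<open>l powr (1 - s)\<close>
  is exactly compensated. The power bound is demanded for all \<open>t > 0\<close>, not only for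
  large ones, since it has to dominate near 0 after scaling.\<close>

lemma abelian_kernel:
  fixes f K :: "real \<Rightarrow> real"
  assumes [measurable]: "f \<in> borel_measurable borel" "K \<in> borel_measurable borel"
    and f: "\<And>t. t > 0 \<Longrightarrow> \<bar>f t\<bar> \<le> C * t powr - s" and lim: "((\<lambda>t. t powr s * f t) \<longlongrightarrow> c) at_top"
    and K: "integrable lborel (\<lambda>v. indicator {0<..} v * (K v * v powr - s))"
  shows "((\<lambda>l. l powr (1 - s) * (\<integral>t. indicator {0<..} t * (K (l * t) * f t) \<partial>lborel)) \<longlongrightarrow>
      c * (\<integral>v. indicator {0<..} v * (K v * v powr - s) \<partial>lborel)) (at_right 0)"
proof -
  let ?g = "\<lambda>x v. indicator {0<..} v * (K v * (x powr s * f (x * v)))"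
  have eq: "inverse x powr (1 - s) * (\<integral>t. indicator {0<..} t * (K (inverse x * t) * f t) \<partial>lborel) = (\<integral>v. ?g x v \<partial>lborel)"
    if x: "x > 0" for x
  proof -
    have "(\<integral>t. indicator {0<..} t * (K (inverse x * t) * f t) \<partial>lborel) =
        x * (\<integral>t. indicator {0<..} (x * t) * (K (inverse x * (x * t)) * f (x * t)) \<partial>lborel)"
      using x by (rule integral_real_scale)
    also have "(\<lambda>t. indicator {0<..} (x * t) * (K (inverse x * (x * t)) * f (x * t))) =
        (\<lambda>t. indicator {0<..} t * (K t * f (x * t)))"
      using x by (auto simp: indicator_def zero_less_mult_iff fun_eq_iff simp flip: mult.assoc)
    also have "x * (\<integral>t. indicator {0<..} t * (K t * f (x * t)) \<partial>lborel) = x powr (1 - s) * (\<integral>v. ?g x v \<partial>lborel)"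
    proof -
      have "(\<integral>v. ?g x v \<partial>lborel) = x powr s * (\<integral>t. indicator {0<..} t * (K t * f (x * t)) \<partial>lborel)"
        by (subst integral_mult_right_zero[symmetric]) (simp add: mult_ac)
      then show ?thesis using x by (simp add: powr_diff)
    qed
    finally show ?thesis
      using x by (simp add: powr_minus inverse_powr flip: mult.assoc)
  qed
  have "((\<lambda>x. \<integral>v. ?g x v \<partial>lborel) \<longlongrightarrow> (\<integral>v. c * (indicator {0<..} v * (K v * v powr - s)) \<partial>lborel)) at_top"
  proof (rule integral_dominated_convergence_at_top[of _ _ _ "\<lambda>v. C * \<bar>indicator {0<..} v * (K v * v powr - s)\<bar>"])
    show "integrable lborel (\<lambda>v. C * \<bar>indicator {0<..} v * (K v * v powr - s)\<bar>)"
      using K by (intro integrable_mult_right integrable_abs)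
    show "\<forall>\<^sub>F x in at_top. AE v in lborel. norm (?g x v) \<le> C * \<bar>indicator {0<..} v * (K v * v powr - s)\<bar>"
      using eventually_gt_at_top[of 0]
    proof eventually_elim
      case (elim x)
      show ?case
      proof (rule AE_I2)
        fix v :: real
        show "norm (?g x v) \<le> C * \<bar>indicator {0<..} v * (K v * v powr - s)\<bar>"
        proof (cases "v > 0")
          case True
          have "x powr s * \<bar>f (x * v)\<bar> \<le> x powr s * (C * (x * v) powr - s)"
            using True elim by (intro mult_left_mono f) auto
          also have "\<dots> = C * v powr - s"
            using True elim by (simp add: powr_mult powr_minus)
          finally have "\<bar>K v\<bar> * (x powr s * \<bar>f (x * v)\<bar>) \<le> \<bar>K v\<bar> * (C * v powr - s)"
            by (rule mult_left_mono) simp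
          then show ?thesis using True by (simp add: abs_mult mult_ac)
        qed simp
      qed
    qed
    show "AE v in lborel. ((\<lambda>x. ?g x v) \<longlongrightarrow> c * (indicator {0<..} v * (K v * v powr - s))) at_top"
    proof (rule AE_I2)
      fix v :: real
      show "((\<lambda>x. ?g x v) \<longlongrightarrow> c * (indicator {0<..} v * (K v * v powr - s))) at_top"
      proof (cases "v > 0")
        case True
        have "filterlim (\<lambda>x. v * x) at_top at_top"
          using True by (intro filterlim_tendsto_pos_mult_at_top[OF tendsto_const _ filterlim_ident])
        from filterlim_compose[OF lim this]
        have "((\<lambda>x. K v * v powr - s * ((v * x) powr s * f (v * x))) \<longlongrightarrow> K v * v powr - s * c) at_top"
          by (intro tendsto_intros)
        moreover have "\<forall>\<^sub>F x in at_top. K v * v powr - s * ((v * x) powr s * f (v * x)) = ?g x v"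
          using eventually_gt_at_top[of 0]
          by eventually_elim (use True in \<open>simp add: powr_mult powr_minus mult.commute[of v]\<close>)
        ultimately have "((\<lambda>x. ?g x v) \<longlongrightarrow> K v * v powr - s * c) at_top"
          by (rule Lim_transform_eventually)
        then show ?thesis
          using True by (simp add: mult_ac)
      qed simp
    qed
  qed simp_all
  then have "((\<lambda>x. inverse x powr (1 - s) * (\<integral>t. indicator {0<..} t * (K (inverse x * t) * f t) \<partial>lborel)) \<longlongrightarrow>
      (\<integral>v. c * (indicator {0<..} v * (K v * v powr - s)) \<partial>lborel)) at_top"
    by (rule Lim_transform_eventually)
      (rule eventually_mono[OF eventually_gt_at_top[of 0]], rule eq[symmetric])
  then show ?thesis
    unfolding filterlim_at_right_to_top by simp
qed

lemma power_le_exp: "0 \<le> (x::real) \<Longrightarrow> x ^ j \<le> real (j ^ j) * exp x"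
proof (cases "j = 0")
  case False
  assume x: "0 \<le> x"
  have "x / real j \<le> exp (x / real j)" using exp_ge_add_one_self[of "x / real j"] by linarith
  then have "(x / real j) ^ j \<le> exp (x / real j) ^ j" using x by (intro power_mono) auto
  also have "\<dots> = exp x" using False by (simp flip: exp_of_nat_mult)
  finally show ?thesis using False by (simp add: power_divide divide_le_eq mult.commute)
qed simp

text \<open>Half of the exponential absorbs the power of \<open>t\<close>, and on the half line
  above \<open>l / 2\<close> the derivative has a fixed integrable majorant. The measure is general
  because the result is applied both to Lebesgue measure and to the law of a hitting time.\<close>

lemma
  fixes F :: "real \<Rightarrow> real"
  assumes [measurable]: "F \<in> borel_measurable M" "sets M = sets borel"
    and int: "\<And>l. l > 0 \<Longrightarrow> integrable M (\<lambda>t. indicator {0..} t * (exp (- l * t) * F t))"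
    and l: "l > 0"
  shows laplace_moment_integrable: "integrable M (\<lambda>t. indicator {0..} t * (t ^ j * exp (- l * t) * F t))" (is "?int l j")
    and laplace_moment_deriv: "((\<lambda>l. \<integral>t. indicator {0..} t * (t ^ j * exp (- l * t) * F t) \<partial>M) has_real_derivative
      - (\<integral>t. indicator {0..} t * (t ^ Suc j * exp (- l * t) * F t) \<partial>M)) (at l)"
proof -
  have [measurable_cong]: "sets M = sets borel" by fact
  have i: "integrable M (\<lambda>t. indicator {0..} t * (t ^ j * exp (- l * t) * F t))" if l: "l > 0" for l j
  proof (rule Bochner_Integration.integrable_bound)
    let ?C = "(2 / l) ^ j * real (j ^ j)"
    show "integrable M (\<lambda>t. ?C * (indicator {0..} t * (exp (- (l / 2) * t) * F t)))"
      using int[of "l / 2"] l by (intro integrable_mult_right) auto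
    have "t ^ j * exp (- l * t) \<le> ?C * exp (- (l / 2) * t)" if t: "t \<ge> 0" for t
    proof -
      have "t ^ j = (2 / l) ^ j * (l * t / 2) ^ j" using l by (simp add: power_divide power_mult_distrib)
      also have "\<dots> \<le> (2 / l) ^ j * (real (j ^ j) * exp (l * t / 2))"
        using l t by (intro mult_left_mono power_le_exp) auto
      finally have "t ^ j * exp (- l * t) \<le> (2 / l) ^ j * (real (j ^ j) * exp (l * t / 2)) * exp (- l * t)"
        by (rule mult_right_mono) simp
      also have "\<dots> = ?C * (exp (l * t / 2) * exp (- l * t))" by (simp only: mult_ac)
      also have "exp (l * t / 2) * exp (- l * t) = exp (- (l / 2) * t)"
        by (simp flip: exp_add)
      finally show ?thesis .
    qed
    then have "\<bar>t ^ j * exp (- l * t)\<bar> * \<bar>F t\<bar> \<le> (?C * exp (- (l / 2) * t)) * \<bar>F t\<bar>" if "t \<ge> 0" for t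
      using that by (intro mult_right_mono) auto
    then show "AE t in M. norm (indicator {0..} t * (t ^ j * exp (- l * t) * F t)) \<le>
        norm (?C * (indicator {0..} t * (exp (- (l / 2) * t) * F t)))"
      using l by (intro AE_I2) (auto simp: indicator_def abs_mult mult.assoc)
  qed measurable
  show "?int l j" using i l by blast
  have D: "((\<lambda>l. indicator {0..} t * (t ^ j * exp (- l * t) * F t)) has_real_derivative
      - (indicator {0..} t * (t ^ Suc j * exp (- l' * t) * F t))) (at l')" for l' t :: real
    by (auto intro!: derivative_eq_intros simp: indicator_def)
  have B: "\<bar>- (indicator {0..} t * (t ^ Suc j * exp (- l' * t) * F t))\<bar> \<le>
      \<bar>indicator {0..} t * (t ^ Suc j * exp (- (l / 2) * t) * F t)\<bar>" if "l' \<in> {l / 2<..}" for l' t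
  proof (cases "t \<ge> 0")
    case True
    then have "exp (- l' * t) \<le> exp (- (l / 2) * t)" using that mult_right_mono[of "l / 2" l' t] by simp
    then have "(t ^ Suc j * \<bar>F t\<bar>) * exp (- l' * t) \<le> (t ^ Suc j * \<bar>F t\<bar>) * exp (- (l / 2) * t)"
      using True by (intro mult_left_mono) auto
    then show ?thesis using True by (simp add: abs_mult mult_ac)
  qed simp
  have "((\<lambda>l. \<integral>t. indicator {0..} t * (t ^ j * exp (- l * t) * F t) \<partial>M) has_real_derivative
      (\<integral>t. - (indicator {0..} t * (t ^ Suc j * exp (- l * t) * F t)) \<partial>M)) (at l)"
  proof (rule has_real_derivative_integral[where S = "{l / 2<..}"])
    show "integrable M (\<lambda>t. \<bar>indicator {0..} t * (t ^ Suc j * exp (- (l / 2) * t) * F t)\<bar>)"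
      using i[of "l / 2" "Suc j"] l by (intro integrable_abs) auto
    show "integrable M (\<lambda>t. indicator {0..} t * (t ^ j * exp (- l' * t) * F t))" if "l' \<in> {l / 2<..}" for l'
      using that l by (intro i) auto
    show "(\<lambda>t. - (indicator {0..} t * (t ^ Suc j * exp (- l * t) * F t))) \<in> borel_measurable M"
      by measurable
  qed (use D B l in auto)
  then show "((\<lambda>l. \<integral>t. indicator {0..} t * (t ^ j * exp (- l * t) * F t) \<partial>M) has_real_derivative
      - (\<integral>t. indicator {0..} t * (t ^ Suc j * exp (- l * t) * F t) \<partial>M)) (at l)"
    by (simp del: power_Suc)
qed

lemma gamma_nn_integral:
  assumes "r > 0" "k > 0"
  shows "(\<integral>\<^sup>+t. ennreal (indicator {0<..} t * (t powr (r - 1) * exp (- k * t))) \<partial>lborel) = ennreal (Gamma r / k powr r)"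
proof -
  have ind: "indicator {0<..} t = (indicator {0..} t * (1::ennreal))" if "t \<noteq> 0" for t :: real
    using that by (auto simp: indicator_def)
  have "(\<integral>\<^sup>+t. ennreal (indicator {0<..} t * (t powr (r - 1) * exp (- k * t))) \<partial>lborel) =
     ennreal (1 / k) * (\<integral>\<^sup>+t. ennreal (indicator {0<..} (t / k) * ((t / k) powr (r - 1) * exp (- k * (t / k)))) \<partial>lborel)"
    using nn_integral_real_affine[of "\<lambda>t. ennreal (indicator {0<..} t * (t powr (r - 1) * exp (- k * t)))" "1 / k" 0] assms
    by simp
  also have "(\<lambda>t. ennreal (indicator {0<..} (t / k) * ((t / k) powr (r - 1) * exp (- k * (t / k))))) =
     (\<lambda>t. ennreal (1 / k powr (r - 1)) * ennreal (indicator {0..} t * t powr (r - 1) / exp t))"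
  proof
    fix t :: real
    have "indicator {0<..} (t / k) * ((t / k) powr (r - 1) * exp (- k * (t / k))) =
        1 / k powr (r - 1) * (indicator {0..} t * t powr (r - 1) / exp t)"
      using assms by (cases "t = 0") (auto simp: indicator_def zero_less_divide_iff powr_divide exp_minus field_simps)
    then show "ennreal (indicator {0<..} (t / k) * ((t / k) powr (r - 1) * exp (- k * (t / k)))) =
        ennreal (1 / k powr (r - 1)) * ennreal (indicator {0..} t * t powr (r - 1) / exp t)"
      using assms by (simp add: ennreal_mult'[symmetric])
  qed
  also have "(\<integral>\<^sup>+t. ennreal (1 / k powr (r - 1)) * ennreal (indicator {0..} t * t powr (r - 1) / exp t) \<partial>lborel) =
      ennreal (1 / k powr (r - 1)) * ennreal (Gamma r)"
    using Gamma_conv_nn_integral_real[OF assms(1)] by (subst nn_integral_cmult) auto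
  also have "ennreal (1 / k) * (ennreal (1 / k powr (r - 1)) * ennreal (Gamma r)) = ennreal (Gamma r / k powr r)"
    using assms Gamma_real_pos[of r] by (simp add: powr_diff flip: ennreal_mult)
  finally show ?thesis .
qed

lemma gamma_integral:
  fixes r k :: real
  assumes "r > 0" "k > 0"
  shows "integrable lborel (\<lambda>t. indicator {0<..} t * (t powr (r - 1) * exp (- k * t)))"
    and "(\<integral>t. indicator {0<..} t * (t powr (r - 1) * exp (- k * t)) \<partial>lborel) = Gamma r / k powr r"
  using gamma_nn_integral[OF assms] Gamma_real_pos[of r] assms
  by (auto intro!: integrableI_nonneg simp: integral_eq_nn_integral)

text \<open>On the unit interval a continuous step function is uniformly close to a polynomial by
  Weierstrass, and integrals of polynomials converge with the moments.\<close>

lemma moments_imp_weak_conv: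
  fixes \<mu> :: "nat \<Rightarrow> real measure" and m :: "real measure"
  assumes \<mu>: "\<And>k. real_distribution (\<mu> k)" and m: "real_distribution m"
    and supp: "\<And>k. AE x in \<mu> k. x \<in> {0..1}" "AE x in m. x \<in> {0..1}"
    and mom: "\<And>n. (\<lambda>k. \<integral>x. x ^ n \<partial>\<mu> k) \<longlonglongrightarrow> (\<integral>x. x ^ n \<partial>m)"
  shows "weak_conv_m \<mu> m"
proof (rule integral_cts_step_conv_imp_weak_conv[OF \<mu> m])
  fix a b :: real assume "a < b"
  have cont: "continuous_on {0..1} (cts_step a b)"
    using cts_step_uniformly_continuous[OF \<open>a < b\<close>] uniformly_continuous_imp_continuous continuous_on_subset by blast
  have [measurable]: "cts_step a b \<in> borel_measurable borel"
    using cts_step_uniformly_continuous[OF \<open>a < b\<close>] uniformly_continuous_imp_continuous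
    by (blast intro: borel_measurable_continuous_onI)
  have pow_int: "integrable N (\<lambda>x. x ^ i)" if N: "real_distribution N" "AE x in N. x \<in> {0..1}" for N and i :: nat
  proof -
    interpret N: real_distribution N by fact
    show ?thesis
      by (rule N.integrable_const_bound[of _ 1])
        (rule eventually_mono[OF N(2)], auto simp: power_abs[symmetric] intro: power_le_one)
  qed
  have close: "\<bar>(\<integral>x. cts_step a b x \<partial>N) - (\<integral>x. (\<Sum>i\<le>n. c i * x ^ i) \<partial>N)\<bar> \<le> e"
    if N: "real_distribution N" "AE x in N. x \<in> {0..1}" and e: "\<And>x. x \<in> {0..1} \<Longrightarrow> \<bar>cts_step a b x - (\<Sum>i\<le>n. c i * x ^ i)\<bar> < e"
    for N and c :: "nat \<Rightarrow> real" and n e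
  proof -
    interpret N: real_distribution N by fact
    have i2: "integrable N (\<lambda>x. \<Sum>i\<le>n. c i * x ^ i)"
      by (intro Bochner_Integration.integrable_sum integrable_mult_right pow_int N)
    have i1: "integrable N (cts_step a b)"
      by (rule N.integrable_const_bound[of _ 1]) (auto simp: cts_step_def field_simps)
    have "\<bar>\<integral>x. cts_step a b x - (\<Sum>i\<le>n. c i * x ^ i) \<partial>N\<bar> \<le> (\<integral>x. \<bar>cts_step a b x - (\<Sum>i\<le>n. c i * x ^ i)\<bar> \<partial>N)"
      by (rule integral_abs_bound)
    also have "\<dots> \<le> (\<integral>x. e \<partial>N)"
      using i1 i2 by (intro integral_mono_AE eventually_mono[OF N(2)]) (auto intro: less_imp_le[OF e])
    finally show ?thesis using i1 i2 N.prob_space by simp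
  qed
  show "(\<lambda>k. integral\<^sup>L (\<mu> k) (cts_step a b)) \<longlonglongrightarrow> integral\<^sup>L m (cts_step a b)"
  proof (rule LIMSEQ_I)
    fix e :: real assume e: "e > 0"
    obtain g where g: "real_polynomial_function g" "\<And>x. x \<in> {0..1} \<Longrightarrow> \<bar>cts_step a b x - g x\<bar> < e / 3"
      using Stone_Weierstrass_real_polynomial_function[OF _ cont, of "e / 3"] e by auto
    then obtain c n where gc: "g = (\<lambda>x. \<Sum>i\<le>n. c i * x ^ i)"
      by (auto simp: real_polynomial_function_iff_sum)
    have "(\<lambda>k. \<integral>x. g x \<partial>\<mu> k) \<longlonglongrightarrow> (\<integral>x. g x \<partial>m)"
    proof -
      have "(\<integral>x. g x \<partial>N) = (\<Sum>i\<le>n. c i * (\<integral>x. x ^ i \<partial>N))" if "real_distribution N" "AE x in N. x \<in> {0..1}" for N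
        unfolding gc using pow_int[OF that] by simp
      then show ?thesis using \<mu> m supp mom by (auto intro!: tendsto_intros)
    qed
    then obtain k0 where k0: "\<And>k. k \<ge> k0 \<Longrightarrow> \<bar>(\<integral>x. g x \<partial>\<mu> k) - (\<integral>x. g x \<partial>m)\<bar> < e / 3"
      using LIMSEQ_D[of _ _ "e / 3"] e by fastforce
    show "\<exists>k0. \<forall>k\<ge>k0. norm (integral\<^sup>L (\<mu> k) (cts_step a b) - integral\<^sup>L m (cts_step a b)) < e"
    proof (intro exI allI impI)
      fix k assume "k \<ge> k0"
      then have "\<bar>(\<integral>x. g x \<partial>\<mu> k) - (\<integral>x. g x \<partial>m)\<bar> < e / 3" by (rule k0)
      moreover have "\<bar>(\<integral>x. cts_step a b x \<partial>\<mu> k) - (\<integral>x. g x \<partial>\<mu> k)\<bar> \<le> e / 3"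
        unfolding gc by (rule close[OF \<mu> supp(1)]) (use g(2) gc in auto)
      moreover have "\<bar>(\<integral>x. cts_step a b x \<partial>m) - (\<integral>x. g x \<partial>m)\<bar> \<le> e / 3"
        unfolding gc by (rule close[OF m supp(2)]) (use g(2) gc in auto)
      ultimately show "norm (integral\<^sup>L (\<mu> k) (cts_step a b) - integral\<^sup>L m (cts_step a b)) < e"
        unfolding real_norm_def by linarith
    qed
  qed
qed

text \<open>Karamata's argument: under \<open>x = exp (- l t)\<close> the weighted measures become probability measures
  on \<open>[0, 1]\<close> whose moments converge; the indicator of \<open>t \<le> c / l\<close> then becomes the bounded function \<open>1 / x\<close>
  on \<open>[exp (- c), 1]\<close>.\<close>
lemma karamata:
  fixes M :: "real measure" and L :: "real \<Rightarrow> real"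
  assumes sets_M: "sets M = sets borel" and nonneg: "AE t in M. t \<ge> 0"
    and int: "\<And>l. l > 0 \<Longrightarrow> integrable M (\<lambda>t. exp (- l * t))"
    and L: "\<And>l. l > 0 \<Longrightarrow> L l = (\<integral>t. exp (- l * t) \<partial>M)" and pos: "\<And>l. l > 0 \<Longrightarrow> L l > 0"
    and ratio: "\<And>n::nat. n \<ge> 1 \<Longrightarrow> ((\<lambda>l::real. L (real n * l) / L l) \<longlongrightarrow> real n powr - r) (at_right 0)"
    and r: "r > 0" and c: "c > 0"
  shows "((\<lambda>l. measure M {..c / l} / L l) \<longlongrightarrow> c powr r / Gamma (r + 1)) (at_right 0)"
  unfolding tendsto_at_iff_sequentially comp_def
proof (intro allI impI)
  note [measurable_cong] = sets_M
  fix X :: "nat \<Rightarrow> real" assume X: "\<forall>i. X i \<in> {0<..} - {0}" "X \<longlonglongrightarrow> 0"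
  have Xpos: "X i > 0" for i using X(1) by auto
  define P where "P = (\<lambda>l. density M (\<lambda>t. ennreal (exp (- l * t) / L l)))"
  define \<mu> where "\<mu> = (\<lambda>k. distr (P (X k)) borel (\<lambda>t. exp (- X k * t)))"
  \<comment> \<open>The Gamma law of shape \<open>r\<close>. Its image under
    \<open>exp (- t)\<close> has n-th moment \<open>real (n + 1) powr - r\<close>, precisely the
    limit that the hypothesis on ratios gives for the rescaled measures.\<close>
  define D where "D = density lborel (\<lambda>t. ennreal (indicator {0<..} t * (t powr (r - 1) * exp (- t)) / Gamma r))"
  define m where "m = distr D borel (\<lambda>t. exp (- t))"
  have G: "Gamma r > 0" using r by (rule Gamma_real_pos)
  have sets_P [measurable_cong]: "sets (P l) = sets borel" for l by (simp add: P_def sets_M)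
  have sets_D [measurable_cong]: "sets D = sets borel" by (simp add: D_def)
  have meas_P: "f \<in> borel_measurable (P l)" if "f \<in> borel_measurable borel" for l and f :: "real \<Rightarrow> real"
    using that by (simp add: measurable_cong_sets[OF sets_P refl])
  have meas_D: "f \<in> borel_measurable D" if "f \<in> borel_measurable borel" for f :: "real \<Rightarrow> real"
    using that by (simp add: measurable_cong_sets[OF sets_D refl])
  have P_prob: "prob_space (P l)" if l: "l > 0" for l
  proof (rule prob_spaceI)
    have "emeasure (P l) (space (P l)) = (\<integral>\<^sup>+t. ennreal (exp (- l * t) / L l) \<partial>M)"
      by (simp add: P_def emeasure_density)
    also have "\<dots> = ennreal (\<integral>t. exp (- l * t) / L l \<partial>M)"
      using int[OF l] pos[OF l] by (intro nn_integral_eq_integral) auto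
    also have "\<dots> = 1" using L[OF l] pos[OF l] by simp
    finally show "emeasure (P l) (space (P l)) = 1" .
  qed
  have D_prob: "prob_space D"
  proof (rule prob_spaceI)
    have "emeasure D (space D) = (\<integral>\<^sup>+t. ennreal (1 / Gamma r) * ennreal (indicator {0<..} t * (t powr (r - 1) * exp (- 1 * t))) \<partial>lborel)"
      unfolding D_def using G by (subst emeasure_density) (auto simp: ennreal_mult'[symmetric] intro!: nn_integral_cong)
    also have "\<dots> = ennreal (1 / Gamma r) * ennreal (Gamma r / 1 powr r)"
      using gamma_nn_integral[OF r, of 1] by (subst nn_integral_cmult) auto
    also have "\<dots> = 1" using G by (simp flip: ennreal_mult)
    finally show "emeasure D (space D) = 1" .
  qed
  have \<mu>_dist: "real_distribution (\<mu> k)" for k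
    unfolding \<mu>_def real_distribution_def real_distribution_axioms_def
    by (intro conjI prob_space.prob_space_distr[OF P_prob[OF Xpos[of k]]] meas_P) simp_all
  have m_dist: "real_distribution m"
    unfolding m_def real_distribution_def real_distribution_axioms_def
    by (intro conjI prob_space.prob_space_distr[OF D_prob] meas_D) simp_all
  have int_P: "(\<integral>t. f t \<partial>P l) = (\<integral>t. exp (- l * t) / L l * f t \<partial>M)" if "l > 0" "f \<in> borel_measurable borel" for l and f :: "real \<Rightarrow> real"
    unfolding P_def using pos[OF that(1)] that(2) by (subst integral_density) auto
  have int_D: "(\<integral>t. f t \<partial>D) = (\<integral>t. indicator {0<..} t * (t powr (r - 1) * exp (- t)) / Gamma r * f t \<partial>lborel)"
    if "f \<in> borel_measurable borel" for f :: "real \<Rightarrow> real"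
    unfolding D_def using G that by (subst integral_density) auto
  have "weak_conv_m \<mu> m"
  proof (rule moments_imp_weak_conv[OF \<mu>_dist m_dist])
    show "AE x in \<mu> k. x \<in> {0..1}" for k
      unfolding \<mu>_def P_def using nonneg Xpos[of k] by (auto simp: AE_distr_iff AE_density elim!: eventually_mono)
    show "AE x in m. x \<in> {0..1}"
      unfolding m_def D_def by (auto simp: AE_distr_iff AE_density indicator_def)
    fix n :: nat
    have "(\<integral>x. x ^ n \<partial>\<mu> k) = L (real (n + 1) * X k) / L (X k)" for k
    proof -
      have "(\<integral>x. x ^ n \<partial>\<mu> k) = (\<integral>t. exp (- X k * t) / L (X k) * exp (- X k * t) ^ n \<partial>M)"
        unfolding \<mu>_def using Xpos[of k] by (simp add: integral_distr meas_P int_P)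
      also have "\<dots> = (\<integral>t. exp (- (real (n + 1) * X k) * t) / L (X k) \<partial>M)"
        by (intro Bochner_Integration.integral_cong) (auto simp: algebra_simps simp flip: exp_of_nat_mult exp_add)
      also have "\<dots> = (\<integral>t. exp (- (real (n + 1) * X k) * t) \<partial>M) / L (X k)"
        by simp
      finally show ?thesis using L[of "real (n + 1) * X k"] Xpos[of k] by simp
    qed
    moreover have "(\<lambda>k. L (real (n + 1) * X k) / L (X k)) \<longlonglongrightarrow> real (n + 1) powr - r"
      using ratio[of "n + 1"] X unfolding tendsto_at_iff_sequentially comp_def by auto
    moreover have "(\<integral>x. x ^ n \<partial>m) = real (n + 1) powr - r"
    proof -
      have "(\<integral>x. x ^ n \<partial>m) = (\<integral>t. indicator {0<..} t * (t powr (r - 1) * exp (- t)) / Gamma r * exp (- t) ^ n \<partial>lborel)"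
        unfolding m_def by (simp add: integral_distr meas_D int_D)
      also have "\<dots> = (\<integral>t. indicator {0<..} t * (t powr (r - 1) * exp (- real (n + 1) * t)) / Gamma r \<partial>lborel)"
        by (intro Bochner_Integration.integral_cong) (auto simp: algebra_simps simp flip: exp_of_nat_mult exp_add)
      also have "\<dots> = (\<integral>t. indicator {0<..} t * (t powr (r - 1) * exp (- real (n + 1) * t)) \<partial>lborel) / Gamma r"
        by simp
      also have "\<dots> = Gamma r / real (n + 1) powr r / Gamma r"
        by (subst gamma_integral(2)[OF r]) auto
      also have "\<dots> = real (n + 1) powr - r" using G by (simp add: powr_minus divide_inverse)
      finally show ?thesis .
    qed
    ultimately show "(\<lambda>k. \<integral>x. x ^ n \<partial>\<mu> k) \<longlonglongrightarrow> (\<integral>x. x ^ n \<partial>m)" by simp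
  qed
  define F where "F = (\<lambda>x::real. if exp (- c) \<le> x then 1 / x else 0)"
  have F_meas [measurable]: "F \<in> borel_measurable borel" unfolding F_def by measurable
  have "(\<lambda>k. \<integral>x. F x \<partial>\<mu> k) \<longlonglongrightarrow> (\<integral>x. F x \<partial>m)"
  proof (rule weak_conv_imp_bdd_ae_continuous_conv[OF \<mu>_dist m_dist \<open>weak_conv_m \<mu> m\<close>])
    show "norm (F x) \<le> exp c" for x
    proof (cases "exp (- c) \<le> x")
      case True
      then have "0 < x" using exp_gt_zero[of "- c"] by linarith
      then have "1 / x \<le> 1 / exp (- c)" using True by (intro divide_left_mono) auto
      then show ?thesis using True \<open>0 < x\<close> by (simp add: F_def exp_minus divide_inverse)
    qed (simp add: F_def)
    have cont: "isCont F x" if "x \<noteq> exp (- c)" for x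
    proof (cases "exp (- c) < x")
      case True
      then have "x \<noteq> 0" using exp_gt_zero[of "- c"] by linarith
      have "eventually (\<lambda>y. y \<in> {exp (- c)<..}) (nhds x)"
        using True by (intro eventually_nhds_in_open) auto
      then have "eventually (\<lambda>y. F y = 1 / y) (nhds x)" by eventually_elim (auto simp: F_def)
      then show ?thesis using \<open>x \<noteq> 0\<close> by (subst isCont_cong[where g = "\<lambda>y. 1 / y"]) auto
    next
      case False
      then have "eventually (\<lambda>y. y \<in> {..<exp (- c)}) (nhds x)"
        using that by (intro eventually_nhds_in_open) auto
      then have "eventually (\<lambda>y. F y = 0) (nhds x)" by eventually_elim (auto simp: F_def)
      then show ?thesis by (subst isCont_cong[where g = "\<lambda>y. 0"]) auto
    qed
    \<comment> \<open>The only possible discontinuity of \<open>F\<close> is the threshold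
      \<open>exp (- c)\<close>; the limit law gives it no mass because the Gamma law has a
      density.\<close>
    have "emeasure m {exp (- c)} = emeasure D ((\<lambda>t. exp (- t)) -` {exp (- c)} \<inter> space D)"
      unfolding m_def by (rule emeasure_distr) auto
    also have "(\<lambda>t. exp (- t)) -` {exp (- c)} \<inter> space D = {c}" by (auto simp: D_def)
    also have "emeasure D {c} = (\<integral>\<^sup>+t. ennreal (indicator {0<..} t * (t powr (r - 1) * exp (- t)) / Gamma r) * indicator {c} t \<partial>lborel)"
      unfolding D_def by (rule emeasure_density) auto
    also have "\<dots> = 0" by (subst nn_integral_indicator_singleton) auto
    finally have "emeasure m {exp (- c)} = 0" .
    moreover have "emeasure m {x. \<not> isCont F x} \<le> emeasure m {exp (- c)}"
      using cont by (intro emeasure_mono) (auto simp: m_def)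
    ultimately show "emeasure m {x. \<not> isCont F x} = 0" by simp
  qed auto
  moreover have "(\<integral>x. F x \<partial>\<mu> k) = measure M {..c / X k} / L (X k)" for k
  proof -
    have "(\<integral>x. F x \<partial>\<mu> k) = (\<integral>t. exp (- X k * t) / L (X k) * F (exp (- X k * t)) \<partial>M)"
      unfolding \<mu>_def using Xpos[of k] by (simp add: integral_distr meas_P int_P)
    also have "\<dots> = (\<integral>t. indicator {..c / X k} t / L (X k) \<partial>M)"
      using Xpos[of k] by (intro Bochner_Integration.integral_cong)
        (auto simp: F_def indicator_def pos_le_divide_eq mult.commute)
    also have "\<dots> = measure M {..c / X k} / L (X k)"
      using sets_eq_imp_space_eq[OF sets_M] by simp
    finally show ?thesis .
  qed
  moreover have "(\<integral>x. F x \<partial>m) = c powr r / Gamma (r + 1)"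
  proof -
    have "(\<integral>x. F x \<partial>m) = (\<integral>t. indicator {0<..} t * (t powr (r - 1) * exp (- t)) / Gamma r * F (exp (- t)) \<partial>lborel)"
      unfolding m_def by (simp add: integral_distr meas_D int_D)
    also have "\<dots> = (\<integral>t. (t powr (r - 1) * indicator {0..c} t) / Gamma r \<partial>lborel)"
    proof (rule integral_cong_AE)
      show "AE t in lborel. indicator {0<..} t * (t powr (r - 1) * exp (- t)) / Gamma r * F (exp (- t)) =
          (t powr (r - 1) * indicator {0..c} t) / Gamma r"
        by (rule AE_I2) (auto simp: F_def indicator_def)
    qed auto
    also have "\<dots> = (\<integral>t. t powr (r - 1) * indicator {0..c} t \<partial>lborel) / Gamma r" by simp
    also have "(\<integral>t. t powr (r - 1) * indicator {0..c} t \<partial>lborel) = c powr r / r"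
    proof -
      have "((\<lambda>t. t powr (r - 1)) has_integral (c powr (r - 1 + 1) / (r - 1 + 1))) {0..c}"
        using r c by (intro has_integral_powr_from_0) auto
      then have "(\<integral>\<^sup>+t. ennreal (indicator {0..c} t * t powr (r - 1)) \<partial>lborel) = ennreal (c powr r / r)"
        using nn_integral_has_integral_lebesgue[of "{0..c}" "\<lambda>t. t powr (r - 1)"] by simp
      then show ?thesis using r by (subst integral_eq_nn_integral) (auto simp: mult.commute)
    qed
    finally show ?thesis using r Gamma_plus1[of r] by (simp add: nonpos_Ints_def)
  qed
  ultimately show "(\<lambda>k. measure M {..c / X k} / L (X k)) \<longlonglongrightarrow> c powr r / Gamma (r + 1)" by simp
qed

text \<open>Karamata's theorem controls the distribution function of the measure with density
  \<open>T\<close>. Monotonicity of \<open>T\<close> squeezes \<open>s * T s\<close> between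
  increments of this function over intervals with end points \<open>s\<close> and
  \<open>c * s\<close>. Letting \<open>c\<close> tend to 1 produces the derivative of
  \<open>c powr r\<close>, and \<open>r / Gamma (r + 1)\<close> equals
  \<open>1 / Gamma r\<close>.\<close>

lemma tauberian_monotone:
  fixes T L :: "real \<Rightarrow> real"
  assumes meas [measurable]: "T \<in> borel_measurable borel"
    and mono: "\<And>s t. 0 \<le> s \<Longrightarrow> s \<le> t \<Longrightarrow> T t \<le> T s" and nonneg: "\<And>t. 0 \<le> T t"
    and L: "\<And>l. l > 0 \<Longrightarrow> L l = (\<integral>t. indicator {0..} t * (exp (- l * t) * T t) \<partial>lborel)"
    and pos: "\<And>l. l > 0 \<Longrightarrow> L l > 0"
    and ratio: "\<And>n::nat. n \<ge> 1 \<Longrightarrow> ((\<lambda>l::real. L (real n * l) / L l) \<longlongrightarrow> real n powr - r) (at_right 0)"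
    and r: "r > 0"
  shows "((\<lambda>s. s * T s / L (1 / s)) \<longlongrightarrow> 1 / Gamma r) at_top"
proof -
  define M where "M = density lborel (\<lambda>t. ennreal (indicator {0..} t * T t))"
  have sets_M [measurable_cong]: "sets M = sets borel" by (simp add: M_def)
  have base: "integrable lborel (\<lambda>t. indicator {0..} t * (exp (- l * t) * T t))" if l: "l > 0" for l
    using pos[OF l] not_integrable_integral_eq unfolding L[OF l] by fastforce
  have K: "((\<lambda>l. measure M {..c / l} / L l) \<longlongrightarrow> c powr r / Gamma (r + 1)) (at_right 0)" if c: "c > 0" for c
  proof (rule karamata[OF sets_M _ _ _ pos ratio r c])
    show "AE t in M. 0 \<le> t" unfolding M_def by (subst AE_density) (auto simp: indicator_def)
    fix l :: real assume l: "l > 0"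
    show "integrable M (\<lambda>t. exp (- l * t))"
      unfolding M_def using base[OF l] nonneg
      by (subst integrable_density) (auto simp: mult_ac)
    show "L l = (\<integral>t. exp (- l * t) \<partial>M)"
      unfolding M_def L[OF l] using nonneg
      by (subst integral_density) (auto simp: mult_ac)
  qed
  have K_top: "((\<lambda>s. measure M {..c * s} / L (1 / s)) \<longlongrightarrow> c powr r / Gamma (r + 1)) at_top" if c: "c > 0" for c
    using K[OF c] unfolding filterlim_at_right_to_top by (simp add: inverse_eq_divide)
  have fin: "emeasure M {..x} < \<infinity>" for x
  proof -
    have "emeasure M {..x} = (\<integral>\<^sup>+t. ennreal (indicator {0..} t * T t) * indicator {..x} t \<partial>lborel)"
      unfolding M_def by (rule emeasure_density) auto
    also have "\<dots> \<le> (\<integral>\<^sup>+t. ennreal (T 0) * indicator {0..x} t \<partial>lborel)"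
      using mono by (intro nn_integral_mono) (auto simp: indicator_def intro!: ennreal_leI)
    also have "\<dots> < \<infinity>" by (simp add: nn_integral_cmult ennreal_mult_less_top emeasure_lborel_Icc_eq)
    finally show ?thesis .
  qed
  have diff: "ennreal (measure M {..y} - measure M {..x}) = (\<integral>\<^sup>+t. ennreal (T t) * indicator {x<..y} t \<partial>lborel)"
    if "0 \<le> x" "x \<le> y" for x y
  proof -
    have "measure M {..y} - measure M {..x} = measure M ({..y} - {..x})"
      using fin[of x] fin[of y] that by (intro measure_Diff[symmetric]) (auto simp: fmeasurable_def sets_M)
    also have "ennreal \<dots> = emeasure M ({..y} - {..x})"
    proof (rule emeasure_eq_ennreal_measure[symmetric])
      have "emeasure M ({..y} - {..x}) \<le> emeasure M {..y}" by (intro emeasure_mono) (auto simp: sets_M)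
      then show "emeasure M ({..y} - {..x}) \<noteq> \<top>" using fin[of y] by (auto simp: top_unique)
    qed
    also have "{..y} - {..x} = {x<..y}" by auto
    also have "emeasure M {x<..y} = (\<integral>\<^sup>+t. ennreal (indicator {0..} t * T t) * indicator {x<..y} t \<partial>lborel)"
      unfolding M_def by (rule emeasure_density) auto
    also have "\<dots> = (\<integral>\<^sup>+t. ennreal (T t) * indicator {x<..y} t \<partial>lborel)"
      using that by (intro nn_integral_cong) (auto simp: indicator_def)
    finally show ?thesis .
  qed
  have upper: "measure M {..y} - measure M {..x} \<le> (y - x) * T x" if "0 \<le> x" "x \<le> y" for x y
  proof -
    have "ennreal (measure M {..y} - measure M {..x}) \<le> (\<integral>\<^sup>+t. ennreal (T x) * indicator {x<..y} t \<partial>lborel)"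
      unfolding diff[OF that] using that mono by (intro nn_integral_mono) (auto simp: indicator_def intro!: ennreal_leI)
    also have "\<dots> = ennreal ((y - x) * T x)"
      using that nonneg by (simp add: nn_integral_cmult mult.commute flip: ennreal_mult)
    finally show ?thesis using that nonneg by (simp add: ennreal_le_iff)
  qed
  have lower: "(y - x) * T y \<le> measure M {..y} - measure M {..x}" if "0 \<le> x" "x \<le> y" for x y
  proof -
    have "ennreal ((y - x) * T y) = (\<integral>\<^sup>+t. ennreal (T y) * indicator {x<..y} t \<partial>lborel)"
      using that nonneg by (simp add: nn_integral_cmult mult.commute flip: ennreal_mult)
    also have "\<dots> \<le> ennreal (measure M {..y} - measure M {..x})"
      unfolding diff[OF that] using that mono by (intro nn_integral_mono) (auto simp: indicator_def intro!: ennreal_leI)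
    finally show ?thesis
    proof (rule ennreal_le_iff[THEN iffD1, rotated])
      have "measure M {..x} \<le> measure M {..y}"
        using that fin[of y] by (intro measure_mono_fmeasurable) (auto simp: fmeasurable_def sets_M)
      then show "0 \<le> measure M {..y} - measure M {..x}" by simp
    qed
  qed
  have slope: "((\<lambda>c. (c powr r - 1) / (c - 1) / Gamma (r + 1)) \<longlongrightarrow> 1 / Gamma r) (at (1::real))"
  proof -
    have "((\<lambda>c. c powr r) has_real_derivative r) (at (1::real))"
      by (auto intro!: derivative_eq_intros)
    then have "((\<lambda>c. (c powr r - 1) / (c - 1)) \<longlongrightarrow> r) (at (1::real))"
      unfolding has_field_derivative_iff by simp
    moreover have G0: "Gamma r \<noteq> 0" using Gamma_real_pos[OF r] by linarith
    moreover have "Gamma (r + 1) = r * Gamma r" using r Gamma_plus1[of r] by (simp add: nonpos_Ints_def)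
    ultimately have "((\<lambda>c. (c powr r - 1) / (c - 1) / Gamma (r + 1)) \<longlongrightarrow> r / (r * Gamma r)) (at (1::real))"
      using r by (intro tendsto_divide) auto
    then show ?thesis using r by simp
  qed
  have quot: "((\<lambda>s. (measure M {..c * s} - measure M {..1 * s}) / L (1 / s) / (c - 1)) \<longlongrightarrow> (c powr r - 1) / (c - 1) / Gamma (r + 1)) at_top"
    if c: "c > 0" "c \<noteq> 1" for c
  proof -
    have "((\<lambda>s. (measure M {..c * s} / L (1 / s) - measure M {..1 * s} / L (1 / s)) / (c - 1)) \<longlongrightarrow>
        (c powr r / Gamma (r + 1) - 1 powr r / Gamma (r + 1)) / (c - 1)) at_top"
      using c by (intro tendsto_divide tendsto_diff K_top tendsto_const) auto
    then show ?thesis by (simp add: diff_divide_distrib mult.commute)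
  qed
  have Lpos: "eventually (\<lambda>s. s > 0 \<and> L (1 / s) > 0) at_top"
    using eventually_gt_at_top[of 0] by eventually_elim (use pos in auto)
  show ?thesis
  proof (rule order_tendstoI)
    fix y assume y: "y < 1 / Gamma r"
    \<comment> \<open>For the lower estimate the interval lies to the right of \<open>s\<close>,
      where \<open>T\<close> is at most \<open>T s\<close>; so \<open>c > 1\<close>.\<close>
    have "eventually (\<lambda>c. (c powr r - 1) / (c - 1) / Gamma (r + 1) > y) (at_right (1::real))"
      using order_tendstoD(1)[OF slope y] by (simp add: eventually_at_split)
    then have "eventually (\<lambda>c. c > 1 \<and> (c powr r - 1) / (c - 1) / Gamma (r + 1) > y) (at_right (1::real))"
      using eventually_at_right_less[of 1] by eventually_elim simp
    then obtain c where c: "c > 1" "(c powr r - 1) / (c - 1) / Gamma (r + 1) > y"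
      using eventually_happens'[OF trivial_limit_at_right_real] by blast
    have "eventually (\<lambda>s. (measure M {..c * s} - measure M {..1 * s}) / L (1 / s) / (c - 1) > y) at_top"
      using order_tendstoD(1)[OF quot c(2)] c(1) by simp
    then show "eventually (\<lambda>s. s * T s / L (1 / s) > y) at_top"
      using Lpos
    proof eventually_elim
      case (elim s)
      have "(measure M {..c * s} - measure M {..1 * s}) / L (1 / s) / (c - 1) \<le> ((c * s - 1 * s) * T (1 * s)) / L (1 / s) / (c - 1)"
        using c(1) elim(2) by (intro divide_right_mono upper) auto
      also have "\<dots> = s * T s / L (1 / s)"
      proof -
        have "c * s - 1 * s = (c - 1) * s" by (simp add: left_diff_distrib)
        then show ?thesis using c(1) by (simp only:) simp
      qed
      finally show ?case using elim(1) by linarith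
    qed
  next
    fix y assume y: "1 / Gamma r < y"
    \<comment> \<open>For the upper estimate the interval lies to the left of \<open>s\<close>,
      where \<open>T\<close> is at least \<open>T s\<close>; so \<open>c < 1\<close>.\<close>
    have "eventually (\<lambda>c. (c powr r - 1) / (c - 1) / Gamma (r + 1) < y) (at_left (1::real))"
      using order_tendstoD(2)[OF slope y] by (simp add: eventually_at_split)
    then have "eventually (\<lambda>c. 0 < c \<and> c < 1 \<and> (c powr r - 1) / (c - 1) / Gamma (r + 1) < y) (at_left (1::real))"
      using eventually_at_left_real[OF zero_less_one] by eventually_elim auto
    then obtain c where c: "0 < c" "c < 1" "(c powr r - 1) / (c - 1) / Gamma (r + 1) < y"
      using eventually_happens'[OF trivial_limit_at_left_real] by blast
    have "eventually (\<lambda>s. (measure M {..c * s} - measure M {..1 * s}) / L (1 / s) / (c - 1) < y) at_top"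
      using order_tendstoD(2)[OF quot c(3)] c(1,2) by simp
    then show "eventually (\<lambda>s. s * T s / L (1 / s) < y) at_top"
      using Lpos
    proof eventually_elim
      case (elim s)
      have "s * T s / L (1 / s) = ((s - c * s) * T s) / L (1 / s) / (1 - c)"
      proof -
        have "s - c * s = (1 - c) * s" by (simp add: left_diff_distrib)
        then show ?thesis using c(2) by (simp only:) simp
      qed
      also have "\<dots> \<le> (measure M {..s} - measure M {..c * s}) / L (1 / s) / (1 - c)"
        using c elim(2) by (intro divide_right_mono lower) auto
      also have "\<dots> = (measure M {..c * s} - measure M {..1 * s}) / L (1 / s) / (c - 1)"
        using c(2) by (simp add: divide_simps) (simp add: algebra_simps)
      finally show ?case using elim(1) by linarith
    qed
  qed
qed

lemma powr_tail_nn_integral: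
  fixes p s :: real
  assumes "p > 0" "s > 0"
  shows "(\<integral>\<^sup>+v. ennreal (v powr (- p - 1)) * indicator {s..} v \<partial>lborel) = ennreal (s powr - p / p)"
proof -
  have "(\<integral>\<^sup>+v. ennreal (v powr (- p - 1)) * indicator {s..} v \<partial>lborel) = ennreal (0 - (- (s powr - p) / p))"
  proof (rule nn_integral_FTC_atLeast)
    show "((\<lambda>v. - (v powr - p) / p) has_real_derivative v powr (- p - 1)) (at v)" if "s \<le> v" for v
      using assms that by (auto intro!: derivative_eq_intros)
    show "((\<lambda>v. - (v powr - p) / p) \<longlongrightarrow> 0) at_top" using assms by real_asymp
  qed auto
  then show ?thesis by simp
qed

lemma powr_tail_integral:
  fixes p :: real
  assumes "p > 0"
  shows "integrable lborel (\<lambda>v. indicator {1<..} v * v powr (- p - 1))"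
    "(\<integral>v. indicator {1<..} v * v powr (- p - 1) \<partial>lborel) = 1 / p"
proof -
  have "(\<integral>\<^sup>+v. ennreal (indicator {1<..} v * v powr (- p - 1)) \<partial>lborel) = (\<integral>\<^sup>+v. ennreal (v powr (- p - 1)) * indicator {1..} v \<partial>lborel)"
    using AE_lborel_singleton[of "1::real"]
    by (intro nn_integral_cong_AE) (auto elim!: eventually_mono simp: indicator_def)
  then have n: "(\<integral>\<^sup>+v. ennreal (indicator {1<..} v * v powr (- p - 1)) \<partial>lborel) = ennreal (1 / p)"
    using powr_tail_nn_integral[OF assms, of 1] by simp
  show "integrable lborel (\<lambda>v. indicator {1<..} v * v powr (- p - 1))"
    using n by (intro integrableI_nonneg) auto
  show "(\<integral>v. indicator {1<..} v * v powr (- p - 1) \<partial>lborel) = 1 / p"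
    using n assms by (subst integral_eq_nn_integral) auto
qed

text \<open>Here the transform of the measure itself is too regular at 0, but that of its k-th
  moment measure is singular. Karamata's theorem gives the growth of the truncated moments
  \<open>U\<close>, and integration by parts recovers the tail as the integral of
  \<open>k * v powr (- k - 1) * (U v - U t)\<close> over \<open>v > t\<close>. The condition
  \<open>r < k\<close> makes this integral converge after scaling.\<close>

lemma tauberian_tail:
  fixes N :: "real measure" and k :: nat and r c :: real
  assumes N: "finite_measure N" and sets_N: "sets N = sets borel"
    and r: "0 < r" "r < k" and c: "c > 0"
    and lim: "((\<lambda>l. l powr r * (\<integral>t. indicator {0..} t * (t ^ k * exp (- l * t)) \<partial>N)) \<longlongrightarrow> c) (at_right 0)"
  shows "((\<lambda>t. t powr (k - r) * measure N {t<..}) \<longlongrightarrow> c / (Gamma r * (k - r))) at_top"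
proof -
  interpret N: finite_measure N by fact
  note [measurable_cong] = sets_N
  have space_N [simp]: "space N = UNIV" using sets_eq_imp_space_eq[OF sets_N] by simp
  have k: "k \<ge> 1" using r by (cases k) auto
  define M where "M = density N (\<lambda>t. ennreal (indicator {0..} t * t ^ k))"
  define L where "L = (\<lambda>l. \<integral>t. indicator {0..} t * (t ^ k * exp (- l * t)) \<partial>N)"
  have sets_M [measurable_cong]: "sets M = sets borel" by (simp add: M_def sets_N)
  have int0: "integrable N (\<lambda>t. indicator {0..} t * (exp (- l * t) * 1))" if "l > 0" for l
    using that by (intro N.integrable_const_bound[of _ 1]) (auto simp: indicator_def)
  have int: "integrable N (\<lambda>t. indicator {0..} t * (t ^ k * exp (- l * t)))" if "l > 0" for l
    using laplace_moment_integrable[OF _ sets_N int0 that, of k] by simp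
  have lim': "((\<lambda>l. l powr r * L l) \<longlongrightarrow> c) (at_right 0)" using lim by (simp only: L_def)
  have L_nonneg: "L l \<ge> 0" for l
    unfolding L_def by (intro Bochner_Integration.integral_nonneg) (auto simp: indicator_def)
  \<comment> \<open>A zero at one \<open>l\<close> would force the integrand to vanish almost
    everywhere, so the transform would vanish for all \<open>l\<close>, against the positive limit
    \<open>c\<close>.\<close>
  have pos: "L l > 0" if l: "l > 0" for l
  proof (rule ccontr)
    assume "\<not> L l > 0"
    then have "L l = 0" using L_nonneg[of l] by linarith
    then have "AE t in N. indicator {0..} t * (t ^ k * exp (- l * t)) = 0"
      unfolding L_def using int[OF l] by (subst (asm) integral_nonneg_eq_0_iff_AE) (auto simp: indicator_def)
    then have "AE t in N. indicator {0..} t * (t ^ k * exp (- l' * t)) = 0" for l'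
      by (auto elim!: eventually_mono)
    then have "L l' = 0" for l' unfolding L_def by (intro integral_eq_zero_AE)
    then have "((\<lambda>l::real. 0) \<longlongrightarrow> c) (at_right (0::real))" using lim' by simp
    then show False using c tendsto_unique[OF trivial_limit_at_right_real _ tendsto_const] by fastforce
  qed
  have ratio: "((\<lambda>l::real. L (real n * l) / L l) \<longlongrightarrow> real n powr - r) (at_right 0)" if n: "n \<ge> 1" for n :: nat
  proof -
    have "filterlim (\<lambda>l::real. real n * l) (at_right 0) (at_right 0)"
      using n by real_asymp
    from filterlim_compose[OF lim' this]
    have "((\<lambda>l::real. ((real n * l) powr r * L (real n * l)) / (l powr r * L l) * real n powr - r) \<longlongrightarrow> c / c * real n powr - r) (at_right 0)"
      using c by (intro tendsto_intros lim') auto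
    then have "((\<lambda>l::real. ((real n * l) powr r * L (real n * l)) / (l powr r * L l) * real n powr - r) \<longlongrightarrow> real n powr - r) (at_right 0)"
      using c by simp
    then show ?thesis
    proof (rule Lim_transform_eventually)
      show "\<forall>\<^sub>F l in at_right 0. ((real n * l) powr r * L (real n * l)) / (l powr r * L l) * real n powr - r = L (real n * l) / L l"
        using eventually_at_right_less[of 0]
        by eventually_elim (use n in \<open>simp add: powr_mult powr_minus field_simps\<close>)
    qed
  qed
  have K: "((\<lambda>l. measure M {..1 / l} / L l) \<longlongrightarrow> 1 powr r / Gamma (r + 1)) (at_right 0)"
  proof (rule karamata[OF sets_M _ _ _ pos ratio r(1)])
    show "AE t in M. 0 \<le> t" unfolding M_def by (subst AE_density) (auto simp: indicator_def)
    fix l :: real assume l: "l > 0"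
    show "integrable M (\<lambda>t. exp (- l * t))"
      unfolding M_def using int[OF l] by (subst integrable_density) (auto simp: mult_ac indicator_def)
    show "L l = (\<integral>t. exp (- l * t) \<partial>M)"
      unfolding M_def L_def by (subst integral_density) (auto simp: mult_ac indicator_def)
  qed auto
  define U where "U = (\<lambda>x. measure M {..x})"
  define c' where "c' = c / Gamma (r + 1)"
  have G: "Gamma (r + 1) = r * Gamma r" "Gamma r > 0" "Gamma (r + 1) > 0"
    using r Gamma_plus1[of r] Gamma_real_pos[of r] by (auto simp: nonpos_Ints_def)
  have c': "c' > 0" using c G by (simp add: c'_def)
  have U: "((\<lambda>x. U x / x powr r) \<longlongrightarrow> c') at_top"
  proof -
    have "((\<lambda>l. (measure M {..1 / l} / L l) * (l powr r * L l)) \<longlongrightarrow> 1 powr r / Gamma (r + 1) * c) (at_right 0)"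
      by (intro tendsto_mult K lim')
    then have "((\<lambda>x. (measure M {..1 / inverse x} / L (inverse x)) * (inverse x powr r * L (inverse x))) \<longlongrightarrow> c') at_top"
      unfolding filterlim_at_right_to_top by (simp add: c'_def)
    then show ?thesis
    proof (rule Lim_transform_eventually)
      show "\<forall>\<^sub>F x in at_top. (measure M {..1 / inverse x} / L (inverse x)) * (inverse x powr r * L (inverse x)) = U x / x powr r"
        using eventually_gt_at_top[of 0]
      proof eventually_elim
        case (elim x)
        then have "L (inverse x) > 0" using pos by simp
        then show ?case using elim by (simp add: U_def inverse_powr powr_minus divide_inverse)
      qed
    qed
  qed
  have emeasure_M: "emeasure M {x<..y} = (\<integral>\<^sup>+s. ennreal (s ^ k) * indicator {x<..y} s \<partial>N)" if "0 \<le> x" for x y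
  proof -
    have "emeasure M {x<..y} = (\<integral>\<^sup>+s. ennreal (indicator {0..} s * s ^ k) * indicator {x<..y} s \<partial>N)"
      unfolding M_def by (rule emeasure_density) (auto simp: sets_N)
    also have "\<dots> = (\<integral>\<^sup>+s. ennreal (s ^ k) * indicator {x<..y} s \<partial>N)"
      using that by (intro nn_integral_cong) (auto simp: indicator_def)
    finally show ?thesis .
  qed
  have fin: "emeasure M {..x} < \<infinity>" for x
  proof -
    have "emeasure M {..x} = (\<integral>\<^sup>+s. ennreal (indicator {0..} s * s ^ k) * indicator {..x} s \<partial>N)"
      unfolding M_def by (rule emeasure_density) (auto simp: sets_N)
    also have "\<dots> \<le> (\<integral>\<^sup>+s. ennreal (\<bar>x\<bar> ^ k) \<partial>N)"
      by (intro nn_integral_mono) (auto simp: indicator_def intro!: ennreal_leI power_mono)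
    also have "\<dots> < \<infinity>" using N.emeasure_finite[of UNIV] by (simp add: less_top[symmetric] ennreal_mult_eq_top_iff)
    finally show ?thesis .
  qed
  have U_mono: "U x \<le> U y" if "x \<le> y" for x y
    unfolding U_def using that fin[of y] by (intro measure_mono_fmeasurable) (auto simp: fmeasurable_def sets_M)
  have U_diff: "emeasure M {x<..y} = ennreal (U y - U x)" if "x \<le> y" for x y
  proof -
    have "{x<..y} = {..y} - {..x}" by auto
    then have "emeasure M {x<..y} = emeasure M {..y} - emeasure M {..x}"
      using that fin[of x] by (simp add: emeasure_Diff sets_M)
    also have "\<dots> = ennreal (U y) - ennreal (U x)"
      using fin[of x] fin[of y] by (simp add: U_def emeasure_eq_ennreal_measure)
    finally show ?thesis by (simp add: ennreal_minus U_def)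
  qed
  have U_meas [measurable]: "U \<in> borel_measurable borel"
    by (rule borel_measurable_mono) (auto simp: mono_def U_mono)
  interpret pair_sigma_finite N lborel ..
  have tail: "emeasure N {t<..} = (\<integral>\<^sup>+v. ennreal (indicator {t<..} v * (k * v powr (- k - 1) * (U v - U t))) \<partial>lborel)" if t: "t > 0" for t
  proof -
    \<comment> \<open>Integrating \<open>k * v powr (- real k - 1)\<close> over \<open>v\<close>
      beyond \<open>s\<close> gives the reciprocal of \<open>s ^ k\<close>. So the constant 1 is
      written as an integral over \<open>v\<close>, and exchanging the order leaves increments of
      \<open>U\<close>.\<close>
    let ?h = "\<lambda>s v. ennreal (s ^ k) * ennreal (k * v powr (- real k - 1)) * (if t < s \<and> s \<le> v then 1 else 0)"
    have "emeasure N {t<..} = (\<integral>\<^sup>+s. indicator {t<..} s \<partial>N)" by simp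
    also have "\<dots> = (\<integral>\<^sup>+s. (\<integral>\<^sup>+v. ?h s v \<partial>lborel) \<partial>N)"
    proof (intro nn_integral_cong)
      fix s
      show "indicator {t<..} s = (\<integral>\<^sup>+v. ?h s v \<partial>lborel)"
      proof (cases "t < s")
        case True
        have "(\<integral>\<^sup>+v. ?h s v \<partial>lborel) = (\<integral>\<^sup>+v. ennreal (s ^ k * k) * (ennreal (v powr (- real k - 1)) * indicator {s..} v) \<partial>lborel)"
          using True t by (intro nn_integral_cong) (auto simp: ennreal_mult mult_ac indicator_def)
        also have "\<dots> = ennreal (s ^ k * k) * ennreal (s powr - real k / real k)"
          using True t k powr_tail_nn_integral[of "real k" s] by (subst nn_integral_cmult) auto
        also have "\<dots> = 1"
          using True t k by (simp add: powr_minus powr_realpow flip: ennreal_mult)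
        finally show ?thesis using True by simp
      qed simp
    qed
    also have "\<dots> = (\<integral>\<^sup>+v. (\<integral>\<^sup>+s. ?h s v \<partial>N) \<partial>lborel)"
      by (rule Fubini'[symmetric]) measurable
    also have "\<dots> = (\<integral>\<^sup>+v. ennreal (indicator {t<..} v * (k * v powr (- k - 1) * (U v - U t))) \<partial>lborel)"
    proof (intro nn_integral_cong)
      fix v
      have "(\<integral>\<^sup>+s. ?h s v \<partial>N) = (\<integral>\<^sup>+s. ennreal (k * v powr (- real k - 1)) * (ennreal (s ^ k) * indicator {t<..v} s) \<partial>N)"
        by (intro nn_integral_cong) (auto simp: indicator_def mult_ac)
      also have "\<dots> = ennreal (k * v powr (- real k - 1)) * emeasure M {t<..v}"
        using t by (subst nn_integral_cmult) (auto simp: emeasure_M)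
      also have "\<dots> = ennreal (indicator {t<..} v * (k * v powr (- k - 1) * (U v - U t)))"
      proof (cases "t < v")
        case True
        then show ?thesis using U_mono[of t v] by (simp add: U_diff flip: ennreal_mult)
      qed simp
      finally show "(\<integral>\<^sup>+s. ?h s v \<partial>N) = ennreal (indicator {t<..} v * (k * v powr (- k - 1) * (U v - U t)))" .
    qed
    finally show ?thesis .
  qed
  let ?g = "\<lambda>t v. indicator {1<..} v * (k * v powr (- real k - 1) * ((U (t * v) - U t) / t powr r))"
  have scaled: "t powr (k - r) * measure N {t<..} = (\<integral>v. ?g t v \<partial>lborel)" if t: "t > 0" for t
  proof -
    have "measure N {t<..} = (\<integral>v. indicator {t<..} v * (k * v powr (- k - 1) * (U v - U t)) \<partial>lborel)"
      unfolding measure_def tail[OF t] using U_mono[of t]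
      by (subst integral_eq_nn_integral) (auto simp: indicator_def)
    also have "\<dots> = t * (\<integral>v. indicator {t<..} (t * v) * (k * (t * v) powr (- k - 1) * (U (t * v) - U t)) \<partial>lborel)"
      using t by (rule integral_real_scale)
    finally have "t powr (k - r) * measure N {t<..} =
        (\<integral>v. t powr (k - r) * (t * (indicator {t<..} (t * v) * (k * (t * v) powr (- k - 1) * (U (t * v) - U t)))) \<partial>lborel)"
      by simp
    also have "\<dots> = (\<integral>v. ?g t v \<partial>lborel)"
    proof (intro Bochner_Integration.integral_cong refl)
      fix v :: real
      have "t powr (k - r) * t * t powr (- k - 1) = t powr ((k - r) + 1 + (- k - 1))"
        using t by (simp only: powr_add) simp
      also have "\<dots> = 1 / t powr r" by (simp add: powr_minus divide_inverse)
      finally have tt: "t powr (k - r) * t * t powr (- k - 1) = 1 / t powr r" .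
      show "t powr (k - r) * (t * (indicator {t<..} (t * v) * (k * (t * v) powr (- k - 1) * (U (t * v) - U t)))) = ?g t v"
      proof (cases "v > 1")
        case True
        have "t powr (k - r) * (t * (k * (t * v) powr (- k - 1) * (U (t * v) - U t))) =
            (t powr (k - r) * t * t powr (- k - 1)) * (k * v powr (- k - 1) * (U (t * v) - U t))"
          using True t by (simp add: powr_mult mult_ac)
        then show ?thesis using True t unfolding tt by simp
      qed (use t in simp)
    qed
    finally show ?thesis .
  qed
  have "((\<lambda>t. \<integral>v. ?g t v \<partial>lborel) \<longlongrightarrow> (\<integral>v. indicator {1<..} v * (k * v powr (- real k - 1) * (c' * v powr r - c')) \<partial>lborel)) at_top"
  proof (rule integral_dominated_convergence_at_top[of _ _ _ "\<lambda>v. (c' + 1) * k * (indicator {1<..} v * v powr (- (k - r) - 1))"])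
    show "integrable lborel (\<lambda>v. (c' + 1) * k * (indicator {1<..} v * v powr (- (k - r) - 1)))"
      using powr_tail_integral(1)[of "k - r"] r by (intro integrable_mult_right) auto
    \<comment> \<open>The bound \<open>c' + 1\<close> is only available from some \<open>x0\<close>
      on. Since \<open>t * v\<close> is at least \<open>t\<close>, it suffices to take
      \<open>t\<close> beyond \<open>x0\<close>.\<close>
    have "eventually (\<lambda>x. U x / x powr r < c' + 1) at_top"
      using order_tendstoD(2)[OF U] by simp
    then obtain x0 where x0: "\<And>x. x \<ge> x0 \<Longrightarrow> U x / x powr r < c' + 1"
      by (auto simp: eventually_at_top_linorder)
    show "\<forall>\<^sub>F t in at_top. AE v in lborel. norm (?g t v) \<le> (c' + 1) * k * (indicator {1<..} v * v powr (- (k - r) - 1))"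
      using eventually_ge_at_top[of "max 1 x0"]
    proof eventually_elim
      case (elim t)
      show ?case
      proof (rule AE_I2)
        fix v :: real
        show "norm (?g t v) \<le> (c' + 1) * k * (indicator {1<..} v * v powr (- (k - r) - 1))"
        proof (cases "v > 1")
          case True
          have tv: "t * v \<ge> t" using True elim by simp
          have "U (t * v) / (t * v) powr r < c' + 1" using x0[of "t * v"] tv elim by simp
          then have "U (t * v) \<le> (c' + 1) * (t * v) powr r"
            using True elim by (simp add: divide_less_eq)
          moreover have "U t \<ge> 0" "U t \<le> U (t * v)" using U_mono[OF tv] by (auto simp: U_def)
          ultimately have "(U (t * v) - U t) / t powr r \<le> (c' + 1) * (t * v) powr r / t powr r" "0 \<le> (U (t * v) - U t) / t powr r"
            by (auto intro: divide_right_mono)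
          moreover have "(c' + 1) * (t * v) powr r / t powr r = (c' + 1) * v powr r"
            using True elim by (simp add: powr_mult)
          ultimately have b: "\<bar>(U (t * v) - U t) / t powr r\<bar> \<le> (c' + 1) * v powr r" by simp
          have "norm (?g t v) = (k * v powr (- real k - 1)) * \<bar>(U (t * v) - U t) / t powr r\<bar>"
            using True by (simp add: abs_mult)
          also have "\<dots> \<le> (k * v powr (- real k - 1)) * ((c' + 1) * v powr r)"
            by (intro mult_left_mono b) auto
          also have "\<dots> = (c' + 1) * k * (v powr (- real k - 1) * v powr r)" by simp
          also have "v powr (- real k - 1) * v powr r = v powr (- (k - r) - 1)"
            by (simp add: algebra_simps flip: powr_add)
          finally show ?thesis using True by simp
        qed simp
      qed
    qed
    show "AE v in lborel. ((\<lambda>t. ?g t v) \<longlongrightarrow> indicator {1<..} v * (k * v powr (- real k - 1) * (c' * v powr r - c'))) at_top"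
    proof (rule AE_I2)
      fix v :: real
      show "((\<lambda>t. ?g t v) \<longlongrightarrow> indicator {1<..} v * (k * v powr (- real k - 1) * (c' * v powr r - c'))) at_top"
      proof (cases "v > 1")
        case True
        have "filterlim (\<lambda>t. v * t) at_top at_top"
          using True by (intro filterlim_tendsto_pos_mult_at_top[OF tendsto_const _ filterlim_ident]) auto
        from filterlim_compose[OF U this]
        have "((\<lambda>t. U (v * t) / (v * t) powr r * v powr r - U t / t powr r) \<longlongrightarrow> c' * v powr r - c') at_top"
          by (intro tendsto_intros U)
        moreover have "\<forall>\<^sub>F t in at_top. U (v * t) / (v * t) powr r * v powr r - U t / t powr r = (U (t * v) - U t) / t powr r"
          using eventually_gt_at_top[of 0]
          by eventually_elim (use True in \<open>simp add: powr_mult diff_divide_distrib mult.commute\<close>)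
        ultimately have "((\<lambda>t. (U (t * v) - U t) / t powr r) \<longlongrightarrow> c' * v powr r - c') at_top"
          by (rule Lim_transform_eventually)
        then show ?thesis by (intro tendsto_intros)
      qed simp
    qed
  qed simp_all
  also have "(\<integral>v. indicator {1<..} v * (k * v powr (- real k - 1) * (c' * v powr r - c')) \<partial>lborel) = c / (Gamma r * (k - r))"
  proof -
    have "(\<integral>v. indicator {1<..} v * (k * v powr (- real k - 1) * (c' * v powr r - c')) \<partial>lborel) =
        (\<integral>v. c' * k * (indicator {1<..} v * v powr (- (k - r) - 1)) - c' * k * (indicator {1<..} v * v powr (- real k - 1)) \<partial>lborel)"
    proof (intro Bochner_Integration.integral_cong refl)
      fix v :: real
      have "v powr (- real k - 1) * v powr r = v powr (- (k - r) - 1)"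
        by (simp add: algebra_simps flip: powr_add)
      moreover have "i * (p * x * (c' * y - c')) = c' * p * (i * (x * y)) - c' * p * (i * x)" for i p x y :: real
        by (simp add: algebra_simps)
      ultimately show "indicator {1<..} v * (k * v powr (- real k - 1) * (c' * v powr r - c')) =
        c' * k * (indicator {1<..} v * v powr (- (k - r) - 1)) - c' * k * (indicator {1<..} v * v powr (- real k - 1))"
        by metis
    qed
    also have "\<dots> = c' * k * (1 / (k - r)) - c' * k * (1 / real k)"
      using powr_tail_integral[of "k - r"] powr_tail_integral[of "real k"] r k
      by (subst Bochner_Integration.integral_diff) auto
    also have "\<dots> = c' * r / (k - r)" using r k by (simp add: field_simps)
    also have "\<dots> = c / (Gamma r * (k - r))" using r G by (simp add: c'_def)
    finally show ?thesis .
  qed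
  finally show ?thesis
    by (rule Lim_transform_eventually)
      (rule eventually_mono[OF eventually_gt_at_top[of 0]], rule scaled[symmetric])
qed

text \<open>Fubini applied to the indicator of \<open>t < s\<close>. The mass missing from the
  transform becomes the transform of the tail, which is a monotone function and so accessible to
  \<open>tauberian_monotone\<close>.\<close>

lemma tail_laplace:
  fixes N :: "real measure"
  assumes N: "finite_measure N" and sets_N: "sets N = sets borel" and nonneg: "AE t in N. 0 \<le> t" and l: "l > 0"
  shows "(\<integral>t. indicator {0..} t * (exp (- l * t) * measure N {t<..}) \<partial>lborel) =
    (measure N UNIV - (\<integral>t. exp (- l * t) \<partial>N)) / l"
proof -
  interpret N: finite_measure N by fact
  note [measurable_cong] = sets_N
  have space_N [simp]: "space N = UNIV" using sets_eq_imp_space_eq[OF sets_N] by simp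
  interpret pair_sigma_finite N lborel ..
  have anti: "(\<lambda>t. measure N {t<..}) \<in> borel_measurable borel"
  proof -
    have "(\<lambda>t. - measure N {t<..}) \<in> borel_measurable borel"
      by (rule borel_measurable_mono) (auto simp: mono_def sets_N intro!: N.finite_measure_mono)
    then show ?thesis using borel_measurable_uminus by fastforce
  qed
  note [measurable] = anti
  let ?h = "\<lambda>s t. ennreal (indicator {0..} t * exp (- l * t)) * (if t < s then 1 else 0)"
  have "(\<integral>\<^sup>+t. ennreal (indicator {0..} t * (exp (- l * t) * measure N {t<..})) \<partial>lborel) = (\<integral>\<^sup>+t. (\<integral>\<^sup>+s. ?h s t \<partial>N) \<partial>lborel)"
  proof (rule nn_integral_cong)
    fix t
    have "(\<integral>\<^sup>+s. ?h s t \<partial>N) = (\<integral>\<^sup>+s. ennreal (indicator {0..} t * exp (- l * t)) * indicator {t<..} s \<partial>N)"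
      by (intro nn_integral_cong) (auto simp: indicator_def)
    also have "\<dots> = ennreal (indicator {0..} t * exp (- l * t)) * emeasure N {t<..}"
      by (subst nn_integral_cmult) (auto simp: sets_N)
    finally show "ennreal (indicator {0..} t * (exp (- l * t) * measure N {t<..})) = (\<integral>\<^sup>+s. ?h s t \<partial>N)"
      by (simp add: N.emeasure_eq_measure mult.assoc flip: ennreal_mult)
  qed
  also have "\<dots> = (\<integral>\<^sup>+s. (\<integral>\<^sup>+t. ?h s t \<partial>lborel) \<partial>N)"
    by (rule Fubini') measurable
  also have "\<dots> = (\<integral>\<^sup>+s. ennreal ((1 - exp (- l * s)) / l) \<partial>N)"
  proof (rule nn_integral_cong_AE, rule eventually_mono[OF nonneg])
    fix s :: real assume s: "0 \<le> s"
    have "(\<integral>\<^sup>+t. ?h s t \<partial>lborel) = (\<integral>\<^sup>+t. ennreal (indicator {0..<s} t * exp (- l * t)) \<partial>lborel)"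
      by (intro nn_integral_cong) (auto simp: indicator_def)
    also have "\<dots> = ennreal ((1 - exp (- l * s)) / l)"
    proof -
      have "((\<lambda>x. - exp (- l * x) / l) has_real_derivative exp (- l * x)) (at x)" for x
        using l by (auto intro!: derivative_eq_intros)
      then have "(\<integral>\<^sup>+t. ennreal (exp (- l * t)) * indicator {0..s} t \<partial>lborel) = ennreal (- exp (- l * s) / l - (- exp (- l * 0) / l))"
        using s by (intro nn_integral_FTC_Icc) auto
      moreover have "(\<integral>\<^sup>+t. ennreal (indicator {0..<s} t * exp (- l * t)) \<partial>lborel) = (\<integral>\<^sup>+t. ennreal (exp (- l * t)) * indicator {0..s} t \<partial>lborel)"
        using AE_lborel_singleton[of s]
        by (intro nn_integral_cong_AE) (auto elim!: eventually_mono split: split_indicator)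
      ultimately show ?thesis by (simp add: diff_divide_distrib)
    qed
    finally show "(\<integral>\<^sup>+t. ?h s t \<partial>lborel) = ennreal ((1 - exp (- l * s)) / l)" .
  qed
  also have "\<dots> = ennreal (\<integral>s. (1 - exp (- l * s)) / l \<partial>N)"
  proof (rule nn_integral_eq_integral)
    show "integrable N (\<lambda>s. (1 - exp (- l * s)) / l)"
      by (rule N.integrable_const_bound[of _ "1 / l"])
        (rule eventually_mono[OF nonneg], use l in \<open>auto simp: abs_divide intro!: divide_right_mono\<close>)
    show "AE s in N. 0 \<le> (1 - exp (- l * s)) / l"
      by (rule eventually_mono[OF nonneg]) (use l in auto)
  qed
  also have "(\<integral>s. (1 - exp (- l * s)) / l \<partial>N) = (measure N UNIV - (\<integral>t. exp (- l * t) \<partial>N)) / l"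
  proof -
    have "integrable N (\<lambda>s. exp (- l * s))"
      by (rule N.integrable_const_bound[of _ 1]) (rule eventually_mono[OF nonneg], use l in auto)
    then show ?thesis by simp
  qed
  finally have nn: "(\<integral>\<^sup>+t. ennreal (indicator {0..} t * (exp (- l * t) * measure N {t<..})) \<partial>lborel) =
    ennreal ((measure N UNIV - (\<integral>t. exp (- l * t) \<partial>N)) / l)" .
  have "(\<integral>t. exp (- l * t) \<partial>N) \<le> (\<integral>t. 1 \<partial>N)"
    by (intro integral_mono_AE N.integrable_const_bound[of _ 1]; (rule eventually_mono[OF nonneg])?) (use l in auto)
  then have "0 \<le> (measure N UNIV - (\<integral>t. exp (- l * t) \<partial>N)) / l" using l by simp
  then show ?thesis
    by (subst integral_eq_nn_integral) (auto simp: nn[simplified])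
qed

text \<open>The form needed in low dimensions, where the transform already approaches the total mass
  slowly. The weight \<open>w\<close> varies regularly at 0 with index \<open>r - 1\<close>: a power
  in dimension one, a logarithm with \<open>r = 1\<close> in dimension two. It is kept abstract so
  that one statement covers both.\<close>

lemma tauberian_tail_monotone:
  fixes N :: "real measure" and w :: "real \<Rightarrow> real"
  assumes N: "finite_measure N" and sets_N: "sets N = sets borel" and nonneg: "AE t in N. 0 \<le> t"
    and lim: "((\<lambda>l. w l * (measure N UNIV - (\<integral>t. exp (- l * t) \<partial>N))) \<longlongrightarrow> C) (at_right 0)" and C: "C > 0"
    and w: "\<And>n::nat. n \<ge> 1 \<Longrightarrow> ((\<lambda>l. w l / w (real n * l)) \<longlongrightarrow> real n powr (1 - r)) (at_right 0)"
    and r: "r > 0"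
  shows "((\<lambda>s. w (1 / s) * measure N {s<..}) \<longlongrightarrow> C / Gamma r) at_top"
proof -
  interpret N: finite_measure N by fact
  note [measurable_cong] = sets_N
  have space_N [simp]: "space N = UNIV" using sets_eq_imp_space_eq[OF sets_N] by simp
  define h where "h = (\<lambda>l. measure N UNIV - (\<integral>t. exp (- l * t) \<partial>N))"
  have lim': "((\<lambda>l. w l * h l) \<longlongrightarrow> C) (at_right 0)" using lim by (simp only: h_def)
  have int: "integrable N (\<lambda>s. exp (- l * s))" if "l > 0" for l
    by (rule N.integrable_const_bound[of _ 1]) (rule eventually_mono[OF nonneg], use that in auto)
  have h_eq: "h l = (\<integral>t. 1 - exp (- l * t) \<partial>N)" if "l > 0" for l
    using int[OF that] by (simp add: h_def)
  have h_pos: "h l > 0" if l: "l > 0" for l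
  proof (rule ccontr)
    assume neg: "\<not> h l > 0"
    have nn: "AE t in N. 0 \<le> 1 - exp (- l * t)"
      by (rule eventually_mono[OF nonneg]) (use l in auto)
    then have "h l \<ge> 0" unfolding h_eq[OF l] by (rule integral_nonneg_AE)
    then have "h l = 0" using neg by linarith
    then have "AE t in N. 1 - exp (- l * t) = 0"
      unfolding h_eq[OF l] using int[OF l] nn by (subst (asm) integral_nonneg_eq_0_iff_AE) auto
    then have "AE t in N. 1 - exp (- l' * t) = 0" for l' using l by (auto elim!: eventually_mono)
    then have "h l' = 0" if "l' > 0" for l' unfolding h_eq[OF that] by (intro integral_eq_zero_AE)
    then have "eventually (\<lambda>l. w l * h l = 0) (at_right 0)"
      using eventually_at_right_less[of 0] by (auto elim!: eventually_mono)
    then have "((\<lambda>l::real. 0) \<longlongrightarrow> C) (at_right (0::real))" using lim' by (rule Lim_transform_eventually[rotated])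
    then show False using C tendsto_unique[OF trivial_limit_at_right_real _ tendsto_const] by fastforce
  qed
  have wh: "eventually (\<lambda>l. w l > 0) (at_right 0)"
    using order_tendstoD(1)[OF lim' C] eventually_at_right_less[of 0]
  proof eventually_elim
    case (elim l)
    then show ?case using h_pos[of l] by (simp add: zero_less_mult_iff)
  qed
  define L where "L = (\<lambda>l. h l / l)"
  have T: "((\<lambda>s. s * measure N {s<..} / L (1 / s)) \<longlongrightarrow> 1 / Gamma r) at_top"
  proof (rule tauberian_monotone[OF _ _ _ _ _ _ r])
    have "(\<lambda>t. - measure N {t<..}) \<in> borel_measurable borel"
      by (rule borel_measurable_mono) (auto simp: mono_def sets_N intro!: N.finite_measure_mono)
    then show "(\<lambda>t. measure N {t<..}) \<in> borel_measurable borel" using borel_measurable_uminus by fastforce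
    show "measure N {t<..} \<le> measure N {s<..}" if "s \<le> t" for s t
      using that by (intro N.finite_measure_mono) (auto simp: sets_N)
    show "L l = (\<integral>t. indicator {0..} t * (exp (- l * t) * measure N {t<..}) \<partial>lborel)" "L l > 0" if "l > 0" for l
      using tail_laplace[OF N sets_N nonneg that] h_pos[OF that] that by (simp_all add: L_def h_def)
    fix n :: nat assume n: "n \<ge> 1"
    have sc: "filterlim (\<lambda>l::real. real n * l) (at_right 0) (at_right 0)"
      using n by real_asymp
    have "((\<lambda>l. (w (real n * l) * h (real n * l)) / (w l * h l) * (w l / w (real n * l)) / real n) \<longlongrightarrow> C / C * real n powr (1 - r) / real n) (at_right 0)"
      using C n by (intro tendsto_divide tendsto_mult w lim' filterlim_compose[OF lim' sc] tendsto_const) auto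
    moreover have "C / C * real n powr (1 - r) / real n = real n powr - r"
      using C n by (simp add: powr_diff powr_minus divide_inverse)
    moreover have "eventually (\<lambda>l. (w (real n * l) * h (real n * l)) / (w l * h l) * (w l / w (real n * l)) / real n = L (real n * l) / L l) (at_right 0)"
      using eventually_at_right_less[of 0] wh eventually_compose_filterlim[OF wh sc]
    proof eventually_elim
      case (elim l)
      then show ?case using n h_pos[of l] by (simp add: L_def)
    qed
    ultimately show "((\<lambda>l. L (real n * l) / L l) \<longlongrightarrow> real n powr - r) (at_right 0)"
      by (auto dest: Lim_transform_eventually)
  qed auto
  have inv: "filterlim (\<lambda>s::real. 1 / s) (at_right 0) at_top" by real_asymp
  have "((\<lambda>s. s * measure N {s<..} / L (1 / s) * (w (1 / s) * h (1 / s))) \<longlongrightarrow> 1 / Gamma r * C) at_top"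
    by (intro tendsto_mult T filterlim_compose[OF lim' inv])
  then have "((\<lambda>s. s * measure N {s<..} / L (1 / s) * (w (1 / s) * h (1 / s))) \<longlongrightarrow> C / Gamma r) at_top" by simp
  then show ?thesis
  proof (rule Lim_transform_eventually)
    show "eventually (\<lambda>s. s * measure N {s<..} / L (1 / s) * (w (1 / s) * h (1 / s)) = w (1 / s) * measure N {s<..}) at_top"
      using eventually_gt_at_top[of 0]
    proof eventually_elim
      case (elim s)
      then have "h (1 / s) > 0" using h_pos by simp
      then show ?case using elim by (simp add: L_def)
    qed
  qed
qed

section \<open>The law of the hitting time as a measure on the half line\<close>

context random_walk
begin

text \<open>The restriction to finite hitting times precedes the image measure because
  \<open>real_of_ereal\<close> maps \<open>\<infinity>\<close> to 0, which would otherwise create a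
  spurious atom there. The total mass may be less than 1.\<close>

definition nu :: "int^'d \<Rightarrow> int^'d \<Rightarrow> int^'d \<Rightarrow> real measure" where
  "nu x y z = distr (density (Omega A) (indicator {\<omega>. tau_yz_minus x y z \<omega> < \<infinity>})) borel (\<lambda>\<omega>. real_of_ereal (tau_yz_minus x y z \<omega>))"

lemma sets_nu: "sets (nu x y z) = sets borel"
  by (simp add: nu_def)

context
  fixes x y z :: "int^'d"
  assumes yz: "y \<noteq> z"
begin

private lemma meas [measurable]: "tau_yz_minus x y z \<in> borel_measurable (Omega A)"
  by (rule measurable_tau_yz_minus[OF yz])

lemma tau_finite_sets: "{\<omega>. tau_yz_minus x y z \<omega> < \<infinity>} \<in> W.events"
  using measurable_sets[OF meas, of "{..<\<infinity>}"] by (simp add: vimage_def)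

lemma nn_integral_nu:
  assumes [measurable]: "f \<in> borel_measurable borel"
  shows "(\<integral>\<^sup>+t. f t \<partial>nu x y z) =
    (\<integral>\<^sup>+\<omega>. (if tau_yz_minus x y z \<omega> < \<infinity> then f (real_of_ereal (tau_yz_minus x y z \<omega>)) else 0) \<partial>Omega A)"
proof -
  have "(\<integral>\<^sup>+t. f t \<partial>nu x y z) = (\<integral>\<^sup>+\<omega>. indicator {\<omega>. tau_yz_minus x y z \<omega> < \<infinity>} \<omega> * f (real_of_ereal (tau_yz_minus x y z \<omega>)) \<partial>Omega A)"
    unfolding nu_def using tau_finite_sets by (simp add: nn_integral_distr nn_integral_density)
  also have "\<dots> = (\<integral>\<^sup>+\<omega>. (if tau_yz_minus x y z \<omega> < \<infinity> then f (real_of_ereal (tau_yz_minus x y z \<omega>)) else 0) \<partial>Omega A)"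
    by (intro nn_integral_cong) (simp add: indicator_def)
  finally show ?thesis .
qed

lemma emeasure_nu:
  assumes "S \<in> sets borel"
  shows "emeasure (nu x y z) S = emeasure (Omega A) {\<omega>. tau_yz_minus x y z \<omega> < \<infinity> \<and> real_of_ereal (tau_yz_minus x y z \<omega>) \<in> S}"
proof -
  have [measurable]: "S \<in> sets borel" by fact
  have "{\<omega> \<in> space (Omega A). tau_yz_minus x y z \<omega> < \<infinity> \<and> real_of_ereal (tau_yz_minus x y z \<omega>) \<in> S} \<in> W.events"
    by measurable
  then have 1: "{\<omega>. tau_yz_minus x y z \<omega> < \<infinity> \<and> real_of_ereal (tau_yz_minus x y z \<omega>) \<in> S} \<in> W.events" by simp
  have "emeasure (nu x y z) S = (\<integral>\<^sup>+t. indicator S t \<partial>nu x y z)"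
    using assms by (simp add: sets_nu)
  also have "\<dots> = (\<integral>\<^sup>+\<omega>. indicator {\<omega>. tau_yz_minus x y z \<omega> < \<infinity> \<and> real_of_ereal (tau_yz_minus x y z \<omega>) \<in> S} \<omega> \<partial>Omega A)"
    using assms by (subst nn_integral_nu) (auto simp: indicator_def intro!: nn_integral_cong)
  finally show ?thesis using 1 by simp
qed

lemma finite_nu: "finite_measure (nu x y z)"
proof (rule finite_measureI)
  show "emeasure (nu x y z) (space (nu x y z)) \<noteq> \<infinity>"
    using emeasure_nu[of UNIV] by (simp add: nu_def)
qed

lemma AE_nu_nonneg: "AE t in nu x y z. 0 \<le> t"
proof (rule AE_I[where N = "{..<0}"])
  have "{\<omega>. tau_yz_minus x y z \<omega> < \<infinity> \<and> real_of_ereal (tau_yz_minus x y z \<omega>) \<in> {..<0}} = {}"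
    by (auto simp: not_less real_of_ereal_pos tau_yz_minus_nonneg)
  then show "emeasure (nu x y z) {..<0} = 0" by (subst emeasure_nu) (simp, simp only: emeasure_empty)
qed (auto simp: sets_nu)

lemma Hminus_nu: "Hminus A x y z t = measure (nu x y z) {..t}"
proof -
  have "tau_yz_minus x y z \<omega> \<le> ereal t \<longleftrightarrow> tau_yz_minus x y z \<omega> < \<infinity> \<and> real_of_ereal (tau_yz_minus x y z \<omega>) \<in> {..t}" for \<omega>
    using tau_yz_minus_nonneg[of x y z \<omega>] by (cases "tau_yz_minus x y z \<omega>") auto
  then show ?thesis by (simp add: Hminus_def measure_def emeasure_nu)
qed

lemma Hminus_tendsto: "(Hminus A x y z \<longlongrightarrow> measure (nu x y z) UNIV) at_top"
proof -
  interpret N: finite_measure "nu x y z" by (rule finite_nu)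
  have sp: "space (nu x y z) = UNIV" by (simp add: nu_def)
  have "(\<lambda>n. measure (nu x y z) {..real n}) \<longlonglongrightarrow> measure (nu x y z) (\<Union>n. {..real n})"
    by (rule N.finite_Lim_measure_incseq) (auto simp: sets_nu incseq_def)
  moreover have "(\<Union>n. {..real n}) = (UNIV :: real set)" using real_arch_simple by auto
  ultimately have "(\<lambda>n. measure (nu x y z) {..real n}) \<longlonglongrightarrow> measure (nu x y z) UNIV" by simp
  then have "((\<lambda>t. measure (nu x y z) {..t}) \<longlongrightarrow> measure (nu x y z) UNIV) at_top"
    by (intro tendsto_at_topI_sequentially_real) (auto simp: mono_def sets_nu intro!: N.finite_measure_mono)
  then show ?thesis unfolding Hminus_nu[abs_def] .
qed

lemma Hminus_inf_nu: "Hminus_inf A x y z = measure (nu x y z) UNIV"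
  unfolding Hminus_inf_def by (rule tendsto_Lim[OF _ Hminus_tendsto]) simp

lemma Hminus_tail: "Hminus_inf A x y z - Hminus A x y z t = measure (nu x y z) {t<..}"
proof -
  interpret N: finite_measure "nu x y z" by (rule finite_nu)
  have "{t<..} = UNIV - {..t}" by auto
  then have "measure (nu x y z) {t<..} = measure (nu x y z) UNIV - measure (nu x y z) {..t}"
    by (simp add: N.finite_measure_Diff sets_nu)
  then show ?thesis by (simp add: Hminus_inf_nu Hminus_nu)
qed

text \<open>The first jump happens at a finite time almost surely, so by \<open>tau_yz_eq\<close>
  the two hitting times are finite on the same event up to a null set.\<close>

lemma Hinf_eq: "Hinf A x y z = Hminus_inf A x y z"
proof -
  have [measurable]: "tau_yz x y z \<in> borel_measurable (Omega A)" by (rule measurable_tau_yz[OF yz])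
  have sets: "{\<omega>. tau_yz x y z \<omega> \<le> ereal t} \<in> W.events" for t
    using measurable_sets[OF \<open>tau_yz x y z \<in> borel_measurable (Omega A)\<close>, of "{..ereal t}"] by (simp add: vimage_def)
  have H: "Hfun A x y z t = W.prob {\<omega>. tau_yz x y z \<omega> \<le> ereal t}" for t
    by (simp add: Hfun_def)
  have "(\<lambda>n. W.prob {\<omega>. tau_yz x y z \<omega> \<le> ereal (real n)}) \<longlonglongrightarrow> W.prob (\<Union>n. {\<omega>. tau_yz x y z \<omega> \<le> ereal (real n)})"
    using sets by (intro W.finite_Lim_measure_incseq) (auto simp: incseq_def intro: order_trans)
  moreover have "W.prob (\<Union>n. {\<omega>. tau_yz x y z \<omega> \<le> ereal (real n)}) = measure (nu x y z) UNIV"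
  proof -
    have "AE \<omega> in Omega A. tau x \<omega> < \<infinity>"
      using AE_good
    proof eventually_elim
      case (elim \<omega>)
      then show ?case using tau_Cons[of "shd \<omega>" "stl \<omega>" x] by simp
    qed
    then have "AE \<omega> in Omega A. \<omega> \<in> (\<Union>n. {\<omega>. tau_yz x y z \<omega> \<le> ereal (real n)}) \<longleftrightarrow> \<omega> \<in> {\<omega>. tau_yz_minus x y z \<omega> < \<infinity>}"
    proof eventually_elim
      case (elim \<omega>)
      have "(\<exists>n. tau_yz x y z \<omega> \<le> ereal (real n)) \<longleftrightarrow> tau_yz x y z \<omega> < \<infinity>"
        by (cases "tau_yz x y z \<omega>") (auto intro: real_arch_simple)
      also have "\<dots> \<longleftrightarrow> tau_yz_minus x y z \<omega> < \<infinity>"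
        using elim by (cases "tau_yz_minus x y z \<omega>"; cases "tau x \<omega>") (auto simp: tau_yz_eq)
      finally show ?case by simp
    qed
    then have "W.prob (\<Union>n. {\<omega>. tau_yz x y z \<omega> \<le> ereal (real n)}) = W.prob {\<omega>. tau_yz_minus x y z \<omega> < \<infinity>}"
      using sets tau_finite_sets by (intro W.finite_measure_eq_AE) auto
    then show ?thesis by (simp add: measure_def emeasure_nu)
  qed
  ultimately have "((\<lambda>t. W.prob {\<omega>. tau_yz x y z \<omega> \<le> ereal t}) \<longlongrightarrow> measure (nu x y z) UNIV) at_top"
    using sets by (intro tendsto_at_topI_sequentially_real)
      (auto simp: mono_def intro!: W.finite_measure_mono intro: order_trans)
  then show ?thesis
    unfolding Hinf_def Hminus_inf_nu H[abs_def] by (intro tendsto_Lim) auto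
qed

lemma hit_minus_nu: "l > 0 \<Longrightarrow> hit_minus l y z x = (\<integral>t. exp (- l * t) \<partial>nu x y z)"
proof -
  assume l: "l > 0"
  have "ennreal (hit_minus l y z x) = (\<integral>\<^sup>+t. ennreal (exp (- l * t)) \<partial>nu x y z)"
    unfolding nn_hit_minus[OF l yz, symmetric]
    by (subst nn_integral_nu) (auto simp: ltrans_def intro!: nn_integral_cong)
  moreover have "(\<integral>t. exp (- l * t) \<partial>nu x y z) = enn2real (\<integral>\<^sup>+t. ennreal (exp (- l * t)) \<partial>nu x y z)"
    by (rule integral_eq_nn_integral) (auto simp: measurable_cong_sets[OF sets_nu refl])
  ultimately show ?thesis using hit_minus_nonneg[OF l yz] by (metis enn2real_ennreal)
qed

text \<open>As \<open>l\<close> tends to 0 the weight tends to 1 on finite times and stays bounded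
  by 1, so dominated convergence recovers the total mass.\<close>

lemma hit_minus_tendsto: "((\<lambda>l. hit_minus l y z x) \<longlongrightarrow> Hminus_inf A x y z) (at_right 0)"
proof -
  interpret N: finite_measure "nu x y z" by (rule finite_nu)
  have sp: "space (nu x y z) = UNIV" by (simp add: nu_def)
  have "((\<lambda>s. \<integral>t. exp (- inverse s * t) \<partial>nu x y z) \<longlongrightarrow> (\<integral>t. 1 \<partial>nu x y z)) at_top"
  proof (rule integral_dominated_convergence_at_top[of _ _ _ "\<lambda>_. 1"])
    show "\<forall>\<^sub>F s in at_top. AE t in nu x y z. norm (exp (- inverse s * t)) \<le> 1"
      using eventually_gt_at_top[of 0] by eventually_elim (use AE_nu_nonneg in \<open>auto elim!: eventually_mono\<close>)
    show "AE t in nu x y z. ((\<lambda>s. exp (- inverse s * t)) \<longlongrightarrow> 1) at_top"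
    proof (rule AE_I2)
      fix t :: real
      have "((\<lambda>s. exp (- inverse s * t)) \<longlongrightarrow> exp (- 0 * t)) at_top"
        by (intro tendsto_exp tendsto_mult tendsto_minus tendsto_inverse_0_at_top filterlim_ident tendsto_const)
      then show "((\<lambda>s. exp (- inverse s * t)) \<longlongrightarrow> 1) at_top" by simp
    qed
  qed (auto simp: measurable_cong_sets[OF sets_nu refl])
  then have "((\<lambda>l. \<integral>t. exp (- l * t) \<partial>nu x y z) \<longlongrightarrow> Hminus_inf A x y z) (at_right 0)"
    unfolding filterlim_at_right_to_top by (simp add: Hminus_inf_nu sp)
  then show ?thesis
  proof (rule Lim_transform_eventually)
    show "\<forall>\<^sub>F l in at_right 0. (\<integral>t. exp (- l * t) \<partial>nu x y z) = hit_minus l y z x"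
      using eventually_at_right_less[of 0] by eventually_elim (simp add: hit_minus_nu)
  qed
qed

end

end

section \<open>Laplace integrals of functions with power decay\<close>

lemma integral_Ici_Ioi:
  fixes f :: "real \<Rightarrow> real"
  shows "(\<integral>t. indicator {0..} t * f t \<partial>lborel) = (\<integral>t. indicator {0<..} t * f t \<partial>lborel)"
    and "integrable lborel (\<lambda>t. indicator {0..} t * f t) \<longleftrightarrow> integrable lborel (\<lambda>t. indicator {0<..} t * f t)"
proof -
  have "(\<integral>t. indicator {0..} t * f t \<partial>lborel) = (\<integral>t\<in>{0..}. f t \<partial>lborel)" "(\<integral>t. indicator {0<..} t * f t \<partial>lborel) = (\<integral>t\<in>{0<..}. f t \<partial>lborel)"
    by (simp_all add: set_lebesgue_integral_def)
  moreover have eq: "AE t in lborel. indicator {0..} t * f t = indicator {0<..} t * f t"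
    using AE_lborel_singleton[of "0::real"] by (auto elim!: eventually_mono simp: indicator_def)
  show "(\<integral>t. indicator {0..} t * f t \<partial>lborel) = (\<integral>t. indicator {0<..} t * f t \<partial>lborel)"
    by (rule integral_discrete_difference[of "{0}"]) (auto simp: indicator_def)
  show "integrable lborel (\<lambda>t. indicator {0..} t * f t) \<longleftrightarrow> integrable lborel (\<lambda>t. indicator {0<..} t * f t)"
    by (rule integrable_discrete_difference[of "{0}"]) (auto simp: indicator_def)
qed

lemma abelian_exp:
  fixes f :: "real \<Rightarrow> real"
  assumes "f \<in> borel_measurable borel" and "\<And>t. t > 0 \<Longrightarrow> \<bar>f t\<bar> \<le> C * t powr - s"
    and "((\<lambda>t. t powr s * f t) \<longlongrightarrow> c) at_top" and s: "s < 1"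
  shows "((\<lambda>l. l powr (1 - s) * (\<integral>t. indicator {0..} t * (exp (- l * t) * f t) \<partial>lborel)) \<longlongrightarrow> c * Gamma (1 - s)) (at_right 0)"
proof -
  have eq: "(\<lambda>v::real. indicator {0<..} v * (exp (- v) * v powr - s)) = (\<lambda>v. indicator {0<..} v * (v powr ((1 - s) - 1) * exp (- 1 * v)))"
    by (auto simp: fun_eq_iff)
  have "((\<lambda>l. l powr (1 - s) * (\<integral>t. indicator {0<..} t * (exp (- (l * t)) * f t) \<partial>lborel)) \<longlongrightarrow>
      c * (\<integral>v. indicator {0<..} v * (exp (- v) * v powr - s) \<partial>lborel)) (at_right 0)"
    using gamma_integral(1)[of "1 - s" 1] s unfolding eq[symmetric]
    by (intro abelian_kernel[OF assms(1) _ assms(2,3)]) auto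
  moreover have "(\<integral>v. indicator {0<..} v * (exp (- v) * v powr - s) \<partial>lborel) = Gamma (1 - s)"
    unfolding eq using gamma_integral(2)[of "1 - s" 1] s by simp
  ultimately show ?thesis by (simp add: integral_Ici_Ioi)
qed

lemma laplace_bound:
  fixes f :: "real \<Rightarrow> real"
  assumes [measurable]: "f \<in> borel_measurable borel" and f: "\<And>t. t > 0 \<Longrightarrow> \<bar>f t\<bar> \<le> C * t powr - s" and s: "s < 1" and l: "l > 0"
  shows "\<bar>\<integral>t. indicator {0..} t * (exp (- l * t) * f t) \<partial>lborel\<bar> \<le> C * Gamma (1 - s) * l powr (s - 1)"
    and "integrable lborel (\<lambda>t. indicator {0..} t * (exp (- l * t) * f t))"
proof -
  let ?g = "\<lambda>t. C * (indicator {0<..} t * (t powr ((1 - s) - 1) * exp (- l * t)))"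
  have g: "integrable lborel ?g"
    using gamma_integral(1)[of "1 - s" l] s l by (intro integrable_mult_right) auto
  have b: "\<bar>indicator {0<..} t * (exp (- l * t) * f t)\<bar> \<le> ?g t" for t
  proof (cases "t > 0")
    case True
    then have "exp (- l * t) * \<bar>f t\<bar> \<le> exp (- l * t) * (C * t powr - s)"
      by (intro mult_left_mono f) auto
    then show ?thesis using True by (simp add: abs_mult mult_ac)
  qed simp
  have i: "integrable lborel (\<lambda>t. indicator {0<..} t * (exp (- l * t) * f t))"
    by (rule Bochner_Integration.integrable_bound[OF g]) (use b in \<open>auto intro: order_trans[OF _ abs_ge_self]\<close>)
  then show "integrable lborel (\<lambda>t. indicator {0..} t * (exp (- l * t) * f t))" by (simp add: integral_Ici_Ioi)
  have "\<bar>\<integral>t. indicator {0<..} t * (exp (- l * t) * f t) \<partial>lborel\<bar> \<le> (\<integral>t. ?g t \<partial>lborel)"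
    by (rule integral_abs_bound_integral[OF i g b])
  also have "\<dots> = C * (Gamma (1 - s) / l powr (1 - s))"
    using gamma_integral(2)[of "1 - s" l] s l by (subst integral_mult_right_zero) auto
  also have "\<dots> = C * Gamma (1 - s) * l powr (s - 1)"
    using powr_minus_divide[of l "1 - s"] by simp
  finally show "\<bar>\<integral>t. indicator {0..} t * (exp (- l * t) * f t) \<partial>lborel\<bar> \<le> C * Gamma (1 - s) * l powr (s - 1)"
    by (simp add: integral_Ici_Ioi)
qed

lemma laplace_tendsto_integral:
  fixes f :: "real \<Rightarrow> real"
  assumes [measurable]: "f \<in> borel_measurable borel" and int: "integrable lborel (\<lambda>t. indicator {0..} t * f t)"
  shows "((\<lambda>l. \<integral>t. indicator {0..} t * (exp (- l * t) * f t) \<partial>lborel) \<longlongrightarrow> (\<integral>t. indicator {0..} t * f t \<partial>lborel)) (at_right 0)"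
proof -
  have "((\<lambda>x. \<integral>t. indicator {0..} t * (exp (- inverse x * t) * f t) \<partial>lborel) \<longlongrightarrow> (\<integral>t. indicator {0..} t * f t \<partial>lborel)) at_top"
  proof (rule integral_dominated_convergence_at_top[of _ _ _ "\<lambda>t. \<bar>indicator {0..} t * f t\<bar>"])
    show "\<forall>\<^sub>F x in at_top. AE t in lborel. norm (indicator {0..} t * (exp (- inverse x * t) * f t)) \<le> \<bar>indicator {0..} t * f t\<bar>"
      using eventually_gt_at_top[of 0]
    proof eventually_elim
      case (elim x)
      show ?case
      proof (rule AE_I2)
        fix t :: real
        have "exp (- inverse x * t) \<le> 1" if "t \<ge> 0" using that elim by simp
        then show "norm (indicator {0..} t * (exp (- inverse x * t) * f t)) \<le> \<bar>indicator {0..} t * f t\<bar>"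
          by (auto simp: indicator_def abs_mult intro: mult_left_le_one_le)
      qed
    qed
    show "AE t in lborel. ((\<lambda>x. indicator {0..} t * (exp (- inverse x * t) * f t)) \<longlongrightarrow> indicator {0..} t * f t) at_top"
    proof (rule AE_I2)
      fix t :: real
      have "((\<lambda>x. indicator {0..} t * (exp (- inverse x * t) * f t)) \<longlongrightarrow> indicator {0..} t * (exp (- 0 * t) * f t)) at_top"
        by (intro tendsto_exp tendsto_mult tendsto_minus tendsto_inverse_0_at_top filterlim_ident tendsto_const)
      then show "((\<lambda>x. indicator {0..} t * (exp (- inverse x * t) * f t)) \<longlongrightarrow> indicator {0..} t * f t) at_top" by simp
    qed
  qed (use int in auto)
  then show ?thesis unfolding filterlim_at_right_to_top .
qed

section \<open>The potential kernel and the diagonalised system\<close>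

context random_walk
begin

text \<open>For \<open>t\<close> up to 1 the trivial bound by 1 beats every negative power, so the
  exponent of the local limit bound may be lowered at will. An exponent below 1 is what makes the
  Laplace integral converge at 0.\<close>

lemma pF_bound': "0 \<le> s \<Longrightarrow> s \<le> CARD('d) / 2 \<Longrightarrow> \<exists>C. \<forall>t>0. \<bar>pF t v\<bar> \<le> C * t powr - s"
proof -
  assume s: "0 \<le> s" "s \<le> CARD('d) / 2"
  obtain C where C: "\<And>t. t > 0 \<Longrightarrow> \<bar>t powr (CARD('d) / 2) * pF t v\<bar> \<le> C" using pF_bound by blast
  have "\<bar>pF t v\<bar> \<le> max 1 C * t powr - s" if t: "t > 0" for t
  proof (cases "t \<le> 1")
    case True
    have "\<bar>pF t v\<bar> \<le> 1 * 1" using abs_pF_le_1[of t v] t by simp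
    also have "\<dots> \<le> max 1 C * t powr - s"
      using t True s by (intro mult_mono) (auto simp: powr_minus intro!: one_le_inverse powr_le1)
    finally show ?thesis .
  next
    case False
    have "\<bar>pF t v\<bar> = \<bar>t powr (CARD('d) / 2) * pF t v\<bar> * t powr - (CARD('d) / 2)"
      using t by (simp add: abs_mult powr_minus)
    also have "\<dots> \<le> max 1 C * t powr - s"
      using C[OF t] s False by (intro mult_mono powr_mono) auto
    finally show ?thesis .
  qed
  then show ?thesis by blast
qed

lemma pF_diff_bound': "\<exists>C. \<forall>t>0. \<bar>pF t 0 - pF t v\<bar> \<le> C * t powr - (CARD('d) / 2 + 1)"
proof -
  obtain C where C: "\<And>t. t > 0 \<Longrightarrow> \<bar>t powr (CARD('d) / 2 + 1) * (pF t 0 - pF t v)\<bar> \<le> C" using pF_diff_bound by blast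
  have "\<bar>pF t 0 - pF t v\<bar> \<le> C * t powr - (CARD('d) / 2 + 1)" if t: "t > 0" for t
  proof -
    have "\<bar>pF t 0 - pF t v\<bar> = \<bar>t powr (CARD('d) / 2 + 1) * (pF t 0 - pF t v)\<bar> * t powr - (CARD('d) / 2 + 1)"
    proof -
      have "t powr (CARD('d) / 2 + 1) > 0" using t by simp
      then show ?thesis unfolding abs_mult powr_minus by (simp add: field_simps)
    qed
    also have "\<dots> \<le> C * t powr - (CARD('d) / 2 + 1)"
      by (intro mult_right_mono C t) auto
    finally show ?thesis .
  qed
  then show ?thesis by blast
qed

lemma GF_laplace: "l > 0 \<Longrightarrow> GF l v = (\<integral>t. indicator {0..} t * (exp (- l * t) * pF t v) \<partial>lborel)"
  using Green_eq_pF[of l v 0] Green_eq_GF[of l v 0] by simp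

lemma integrable_pF_laplace: "l > 0 \<Longrightarrow> integrable lborel (\<lambda>t. indicator {0..} t * (exp (- l * t) * pF t v))"
proof -
  assume l: "l > 0"
  obtain C where C: "\<And>t. t > 0 \<Longrightarrow> \<bar>pF t v\<bar> \<le> C * t powr - 0" using pF_bound'[of 0 v] by auto
  show ?thesis by (rule laplace_bound(2)[OF measurable_pF C _ l]) auto
qed

text \<open>The classical potential kernel: the limit of \<open>GF l 0 - GF l v\<close>. It is
  finite in every dimension, even where the Green function itself diverges.\<close>

definition pot :: "int^'d \<Rightarrow> real" where
  "pot v = (\<integral>t. indicator {0..} t * (pF t 0 - pF t v) \<partial>lborel)"

lemma pF_diff_laplace: "l > 0 \<Longrightarrow> GF l 0 - GF l v = (\<integral>t. indicator {0..} t * (exp (- l * t) * (pF t 0 - pF t v)) \<partial>lborel)"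
  using integrable_pF_laplace[of l 0] integrable_pF_laplace[of l v]
  by (simp add: GF_laplace right_diff_distrib)

lemma integrable_pF_diff: "integrable lborel (\<lambda>t. indicator {0..} t * (pF t 0 - pF t v))"
proof -
  obtain C where C: "\<And>t. t > 0 \<Longrightarrow> \<bar>pF t 0 - pF t v\<bar> \<le> C * t powr - (CARD('d) / 2 + 1)"
    using pF_diff_bound' by blast
  have p: "0 < real CARD('d) / 2" by simp
  have "integrable lborel (\<lambda>t. indicator {0..1} t *\<^sub>R (2::real) + C * (indicator {1<..} t * t powr (- (CARD('d) / 2) - 1)))"
    using powr_tail_integral(1)[OF p] by (intro Bochner_Integration.integrable_add integrable_mult_right) auto
  then show ?thesis
  proof (rule Bochner_Integration.integrable_bound)
    show "AE t in lborel. norm (indicator {0..} t * (pF t 0 - pF t v)) \<le>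
        norm (indicator {0..1} t *\<^sub>R (2::real) + C * (indicator {1<..} t * t powr (- (CARD('d) / 2) - 1)))"
    proof (rule AE_I2)
      fix t :: real
      consider "t < 0" | "0 \<le> t" "t \<le> 1" | "t > 1" by linarith
      then show "norm (indicator {0..} t * (pF t 0 - pF t v)) \<le>
        norm (indicator {0..1} t *\<^sub>R (2::real) + C * (indicator {1<..} t * t powr (- (CARD('d) / 2) - 1)))"
      proof cases
        case 2
        then show ?thesis using abs_pF_le_1[of t 0] abs_pF_le_1[of t v] by simp
      next
        case 3
        have "- (real CARD('d) / 2) - 1 = - (real CARD('d) / 2 + 1)" by simp
        moreover have "C * t powr - (CARD('d) / 2 + 1) \<le> \<bar>C\<bar> * t powr - (CARD('d) / 2 + 1)"
          by (intro mult_right_mono) auto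
        then have "\<bar>pF t 0 - pF t v\<bar> \<le> \<bar>C\<bar> * t powr - (CARD('d) / 2 + 1)"
          using C[of t] 3 by linarith
        ultimately show ?thesis using 3 by (simp add: abs_mult)
      qed simp
    qed
  qed simp
qed

lemma GF_diff_tendsto: "((\<lambda>l. GF l 0 - GF l v) \<longlongrightarrow> pot v) (at_right 0)"
proof (rule Lim_transform_eventually)
  show "((\<lambda>l. \<integral>t. indicator {0..} t * (exp (- l * t) * (pF t 0 - pF t v)) \<partial>lborel) \<longlongrightarrow> pot v) (at_right 0)"
    unfolding pot_def by (rule laplace_tendsto_integral[OF _ integrable_pF_diff]) simp
  show "\<forall>\<^sub>F l in at_right 0. (\<integral>t. indicator {0..} t * (exp (- l * t) * (pF t 0 - pF t v)) \<partial>lborel) = GF l 0 - GF l v"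
    using eventually_at_right_less[of 0] by eventually_elim (simp add: pF_diff_laplace)
qed

lemma pF_le: "t \<ge> 0 \<Longrightarrow> pF t v \<le> pF t 0"
  using pF_diff_nonneg[of t v] by simp

lemma pot_0 [simp]: "pot 0 = 0" and pot_minus: "pot (- v) = pot v" and pot_nonneg: "0 \<le> pot v"
  by (auto simp: pot_def pF_minus indicator_def intro!: Bochner_Integration.integral_nonneg pF_le)

text \<open>The convention \<open>rho A 0 = 1\<close> is not the value of the potential at the
  origin, which is 0. The extra unit is \<open>a\<close> times the source term of the one-step
  equation, and it makes \<open>Ab_tendsto\<close> hold uniformly for all \<open>v\<close>.\<close>

lemma rho_pot: "rho A v = a * pot v + (if v = 0 then 1 else 0)"
proof (cases "v = 0")
  case False
  have "((\<lambda>l. Green A l 0 0 - Green A l 0 v) \<longlongrightarrow> pot v) (at_right 0)"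
  proof (rule Lim_transform_eventually[OF GF_diff_tendsto])
    show "\<forall>\<^sub>F l in at_right 0. GF l 0 - GF l v = Green A l 0 0 - Green A l 0 v"
      using eventually_at_right_less[of 0] by eventually_elim (simp add: Green_eq_GF GF_minus)
  qed
  then show ?thesis using False by (simp add: rho_def tendsto_Lim[OF trivial_limit_at_right_real])
qed (simp add: rho_def)

lemma rho_minus: "rho A (- v) = rho A v"
  by (simp add: rho_pot pot_minus)

text \<open>Any decay exponent strictly between 0 and 1 that does not exceed half the dimension
  would do; \<open>1 / 4\<close> is one that works in all dimensions.\<close>

lemma l_GF_tendsto: "((\<lambda>l. l * GF l v) \<longlongrightarrow> 0) (at_right 0)"
proof -
  have "1 \<le> CARD('d)" using zero_less_card_finite[where 'a='d] by linarith
  then have "1 \<le> real CARD('d)" by (simp only: real_of_nat_ge_one_iff)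
  then have "1 / 4 \<le> real CARD('d) / 2" by linarith
  then obtain C where C: "\<And>t. t > 0 \<Longrightarrow> \<bar>pF t v\<bar> \<le> C * t powr - (1/4)"
    using pF_bound'[of "1/4" v] by force
  have "((\<lambda>l. C * Gamma (3/4) * l powr (1/4)) \<longlongrightarrow> C * Gamma (3/4) * 0) (at_right 0)"
    by (intro tendsto_mult tendsto_const) real_asymp
  then have lim: "((\<lambda>l. C * Gamma (3/4) * l powr (1/4)) \<longlongrightarrow> 0) (at_right 0)" by simp
  show ?thesis
  proof (rule Lim_null_comparison[OF _ lim])
    show "\<forall>\<^sub>F l in at_right 0. norm (l * GF l v) \<le> C * Gamma (3/4) * l powr (1/4)"
      using eventually_at_right_less[of 0]
    proof eventually_elim
      case (elim l)
      have "\<bar>GF l v\<bar> \<le> C * Gamma (1 - 1/4) * l powr (1/4 - 1)"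
        unfolding GF_laplace[OF elim] by (rule laplace_bound(1)[OF measurable_pF C]) (use elim in auto)
      then have "l * \<bar>GF l v\<bar> \<le> l * (C * Gamma (3/4) * l powr (1/4 - 1))"
        using elim by (intro mult_left_mono) auto
      also have "\<dots> = C * Gamma (3/4) * l powr (1/4)"
      proof -
        have "l * l powr (1/4 - 1) = l powr (1/4)"
          using powr_add[of l 1 "1/4 - 1"] elim by simp
        then show ?thesis by simp
      qed
      finally show ?case using elim by (simp add: abs_mult)
    qed
  qed
qed

text \<open>By \<open>Ab_J\<close> this is \<open>GF l\<close> averaged over one jump from
  \<open>v\<close>; it is the right-hand side of the last exit system.\<close>

definition Ab :: "real \<Rightarrow> int^'d \<Rightarrow> real" where
  "Ab l v = (1 + l / a) * GF l v - (if v = 0 then 1 / a else 0)"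

lemma Ab_tendsto: "((\<lambda>l. GF l 0 - Ab l v) \<longlongrightarrow> rho A v / a) (at_right 0)"
proof -
  have "((\<lambda>l. (GF l 0 - GF l v) - (l * GF l v) / a + (if v = 0 then 1 / a else 0)) \<longlongrightarrow> pot v - 0 / a + (if v = 0 then 1 / a else 0)) (at_right 0)"
    using a_pos by (intro tendsto_intros GF_diff_tendsto l_GF_tendsto) auto
  moreover have "pot v - 0 / a + (if v = 0 then 1 / a else 0) = rho A v / a"
    using a_pos by (simp add: rho_pot field_simps)
  moreover have "(\<lambda>l. (GF l 0 - GF l v) - (l * GF l v) / a + (if v = 0 then 1 / a else 0)) = (\<lambda>l. GF l 0 - Ab l v)"
    by (auto simp: Ab_def fun_eq_iff algebra_simps)
  ultimately show ?thesis by simp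
qed

lemma Ab_J: "l > 0 \<Longrightarrow> Ab l v = (\<integral>w. GF l (v + w) \<partial>J)"
  using integral_Green_J[of l v 0] by (simp add: Ab_def Green_eq_GF)

text \<open>\<open>hit_minus l y z x + hit_minus l z y x\<close> and the difference diagonalise the last exit system.\<close>
lemma hit_minus_system:
  assumes l: "l > 0" and yz: "y \<noteq> z"
  shows "(hit_minus l y z x + hit_minus l z y x) * (GF l 0 + GF l (y - z)) = Ab l (x - y) + Ab l (x - z)"
    and "(hit_minus l y z x - hit_minus l z y x) * (GF l 0 - GF l (y - z)) = Ab l (x - y) - Ab l (x - z)"
proof -
  have sym: "GF l (z - y) = GF l (y - z)" using GF_minus[of l "y - z"] by simp
  have 1: "Ab l (x - y) = hit_minus l y z x * GF l 0 + hit_minus l z y x * GF l (y - z)"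
    using Green_hit_minus[OF l yz, of x] by (simp add: Green_eq_GF[OF l] Ab_def sym)
  have 2: "Ab l (x - z) = hit_minus l z y x * GF l 0 + hit_minus l y z x * GF l (y - z)"
    using Green_hit_minus[OF l yz[symmetric], of x] by (simp add: Green_eq_GF[OF l] Ab_def sym)
  show "(hit_minus l y z x + hit_minus l z y x) * (GF l 0 + GF l (y - z)) = Ab l (x - y) + Ab l (x - z)"
    "(hit_minus l y z x - hit_minus l z y x) * (GF l 0 - GF l (y - z)) = Ab l (x - y) - Ab l (x - z)"
    unfolding 1 2 by (simp_all add: algebra_simps)
qed

text \<open>The coefficient of the difference tends to \<open>pot (y - z)\<close> regardless of
  dimension, so this half of the limit is obtained once and for all. Only the sum needs separate
  arguments for the recurrent and the transient case.\<close>

lemma hit_minus_difference_tendsto: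
  assumes yz: "y \<noteq> z"
  shows "(Hminus_inf A x y z - Hminus_inf A x z y) * rho A (y - z) = rho A (x - z) - rho A (x - y)"
proof -
  have 1: "((\<lambda>l. (hit_minus l y z x - hit_minus l z y x) * (GF l 0 - GF l (y - z))) \<longlongrightarrow>
      (Hminus_inf A x y z - Hminus_inf A x z y) * pot (y - z)) (at_right 0)"
    using yz by (intro tendsto_intros hit_minus_tendsto GF_diff_tendsto) auto
  have 2: "((\<lambda>l. (GF l 0 - Ab l (x - z)) - (GF l 0 - Ab l (x - y))) \<longlongrightarrow> rho A (x - z) / a - rho A (x - y) / a) (at_right 0)"
    by (intro tendsto_intros Ab_tendsto)
  have 3: "\<forall>\<^sub>F l in at_right 0. (hit_minus l y z x - hit_minus l z y x) * (GF l 0 - GF l (y - z)) =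
      (GF l 0 - Ab l (x - z)) - (GF l 0 - Ab l (x - y))"
    using eventually_at_right_less[of 0] by eventually_elim (simp add: hit_minus_system(2)[OF _ yz])
  have "(Hminus_inf A x y z - Hminus_inf A x z y) * pot (y - z) = rho A (x - z) / a - rho A (x - y) / a"
    by (rule tendsto_unique[OF trivial_limit_at_right_real Lim_transform_eventually[OF 1 3] 2])
  then have "a * ((Hminus_inf A x y z - Hminus_inf A x z y) * pot (y - z)) = rho A (x - z) - rho A (x - y)"
    using a_pos by (simp add: right_diff_distrib)
  moreover have "rho A (y - z) = a * pot (y - z)" using yz by (simp add: rho_pot)
  ultimately show ?thesis by (simp only: mult.left_commute)
qed

lemma psi_le_2: "psi \<theta> \<le> 2"
proof -
  have "psi \<theta> \<le> (\<integral>z. 2 \<partial>J)"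
    unfolding psi_def
  proof (intro integral_mono J.integrable_const)
    show "integrable J (\<lambda>z. 1 - cos (rvec z \<bullet> \<theta>))" by simp
    show "1 - cos (rvec z \<bullet> \<theta>) \<le> 2" for z using cos_ge_minus_one[of "rvec z \<bullet> \<theta>"] by linarith
  qed
  then show ?thesis using J.prob_space by simp
qed

text \<open>Since \<open>psi\<close> is at most 2, the resolvent kernel is at least
  \<open>1 / (l + 2 * a)\<close>; against the nonnegative weights \<open>1 - cos\<close> and
  \<open>1 + cos\<close>, both of mean 1, this constant survives integration. Both coefficients of
  the diagonal system are thus bounded away from 0 as \<open>l\<close> tends to 0.\<close>

lemma
  assumes l: "l > 0" and v: "v \<noteq> 0"
  shows GF_diff_ge: "GF l 0 - GF l v \<ge> 1 / (l + 2 * a)" and GF_add_ge: "GF l 0 + GF l v \<ge> 1 / (l + 2 * a)"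
proof -
  have i1: "integrable torus_measure (\<lambda>\<theta>::real^'d. cos (rvec v \<bullet> \<theta>))"
    by (rule T.integrable_const_bound[of _ 1]) auto
  have main: "(\<integral>\<theta>. (1 + s * cos (rvec v \<bullet> \<theta>)) / (l + a * psi \<theta>) \<partial>torus_measure) \<ge> 1 / (l + 2 * a)" if s: "\<bar>s\<bar> \<le> 1" for s :: real
  proof -
    have "1 / (l + 2 * a) = (\<integral>\<theta>. (1 + s * cos (rvec v \<bullet> \<theta>)) / (l + 2 * a) \<partial>torus_measure)"
      using i1 v T.prob_space by (simp add: integral_cos_torus)
    also have "\<dots> \<le> (\<integral>\<theta>. (1 + s * cos (rvec v \<bullet> \<theta>)) / (l + a * psi \<theta>) \<partial>torus_measure)"
    proof (rule integral_mono)
      show "integrable torus_measure (\<lambda>\<theta>. (1 + s * cos (rvec v \<bullet> \<theta>)) / (l + 2 * a))"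
        using i1 by simp
      have "integrable torus_measure (\<lambda>\<theta>. cos (rvec 0 \<bullet> \<theta>) / (l + a * psi \<theta>) + s * (cos (rvec v \<bullet> \<theta>) / (l + a * psi \<theta>)))"
        by (intro Bochner_Integration.integrable_add integrable_mult_right integrable_GF l)
      then show "integrable torus_measure (\<lambda>\<theta>. (1 + s * cos (rvec v \<bullet> \<theta>)) / (l + a * psi \<theta>))"
        by (simp add: add_divide_distrib)
      fix \<theta>
      have "\<bar>s * cos (rvec v \<bullet> \<theta>)\<bar> \<le> 1 * 1" unfolding abs_mult using s by (intro mult_mono) auto
      then have "0 \<le> 1 + s * cos (rvec v \<bullet> \<theta>)" by linarith
      moreover have "0 < l + a * psi \<theta>" using l a_pos psi_nonneg[of \<theta>] by (simp add: add_pos_nonneg)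
      moreover have "a * psi \<theta> \<le> a * 2" using psi_le_2[of \<theta>] a_pos by (intro mult_left_mono) auto
      ultimately show "(1 + s * cos (rvec v \<bullet> \<theta>)) / (l + 2 * a) \<le> (1 + s * cos (rvec v \<bullet> \<theta>)) / (l + a * psi \<theta>)"
        using l by (intro divide_left_mono) (auto intro!: mult_pos_pos simp: mult.commute)
    qed
    finally show ?thesis .
  qed
  have lin: "(\<integral>\<theta>. f \<theta> + s * g \<theta> \<partial>torus_measure) = (\<integral>\<theta>. f \<theta> \<partial>torus_measure) + s * (\<integral>\<theta>. g \<theta> \<partial>torus_measure)"
    if "integrable torus_measure f" "integrable torus_measure g" for f g :: "real^'d \<Rightarrow> real" and s
    using that by simp
  have split: "(\<integral>\<theta>. (1 + s * cos (rvec v \<bullet> \<theta>)) / (l + a * psi \<theta>) \<partial>torus_measure) = GF l 0 + s * GF l v" for s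
  proof -
    have "(\<integral>\<theta>. cos (rvec 0 \<bullet> \<theta>) / (l + a * psi \<theta>) + s * (cos (rvec v \<bullet> \<theta>) / (l + a * psi \<theta>)) \<partial>torus_measure) = GF l 0 + s * GF l v"
      unfolding GF_def by (rule lin[OF integrable_GF[OF l] integrable_GF[OF l]])
    moreover have "cos (rvec 0 \<bullet> \<theta>) / (l + a * psi \<theta>) + s * (cos (rvec v \<bullet> \<theta>) / (l + a * psi \<theta>)) = (1 + s * cos (rvec v \<bullet> \<theta>)) / (l + a * psi \<theta>)" for \<theta>
      by (simp add: add_divide_distrib)
    ultimately show ?thesis by simp
  qed
  show "GF l 0 - GF l v \<ge> 1 / (l + 2 * a)" using main[of "-1"] split[of "-1"] by simp
  show "GF l 0 + GF l v \<ge> 1 / (l + 2 * a)" using main[of 1] split[of 1] by simp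
qed

lemma pot_pos: "v \<noteq> 0 \<Longrightarrow> pot v > 0"
proof -
  assume v: "v \<noteq> 0"
  have "((\<lambda>l. 1 / (l + 2 * a)) \<longlongrightarrow> 1 / (0 + 2 * a)) (at_right 0)"
    using a_pos by (intro tendsto_intros) auto
  then have "1 / (0 + 2 * a) \<le> pot v"
    by (rule tendsto_le[OF trivial_limit_at_right_real GF_diff_tendsto])
      (use eventually_at_right_less[of 0] v in \<open>auto elim!: eventually_mono intro: GF_diff_ge\<close>)
  moreover have "1 / (0 + 2 * a) > 0" using a_pos by simp
  ultimately show ?thesis by linarith
qed

lemma rho_pos: "rho A v > 0"
  using pot_pos[of v] a_pos by (cases "v = 0") (auto simp: rho_pot)

end

section \<open>Derivatives of quotients of Laplace transforms\<close>

text \<open>The sequences satisfy that minus the derivative of each member is the next, as moments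
  of Laplace transforms do; with this convention the alternating signs of the Leibniz rule
  disappear.\<close>

lemma leibniz_laplace:
  fixes F D N :: "nat \<Rightarrow> real \<Rightarrow> real"
  assumes F: "\<And>j l. l > 0 \<Longrightarrow> (F j has_real_derivative - F (Suc j) l) (at l)"
    and D: "\<And>j l. l > 0 \<Longrightarrow> (D j has_real_derivative - D (Suc j) l) (at l)"
    and N: "\<And>j l. l > 0 \<Longrightarrow> (N j has_real_derivative - N (Suc j) l) (at l)"
    and prod: "\<And>l. l > 0 \<Longrightarrow> F 0 l * D 0 l = N 0 l" and l: "l > 0"
  shows "(\<Sum>i\<le>k. real (k choose i) * F i l * D (k - i) l) = N k l"
  using l
proof (induction k arbitrary: l)
  case 0
  then show ?case using prod by simp
next
  case (Suc k)
  let ?S = "\<lambda>l. \<Sum>i\<le>k. real (k choose i) * F i l * D (k - i) l"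
  let ?S' = "\<Sum>i\<le>k. real (k choose i) * (F (Suc i) l * D (k - i) l + F i l * D (Suc k - i) l)"
  have "(?S has_real_derivative (\<Sum>i\<le>k. - (real (k choose i) * (F (Suc i) l * D (k - i) l + F i l * D (Suc k - i) l)))) (at l)"
  proof (rule DERIV_sum)
    fix i assume "i \<in> {..k}"
    then show "((\<lambda>l. real (k choose i) * F i l * D (k - i) l) has_real_derivative
        - (real (k choose i) * (F (Suc i) l * D (k - i) l + F i l * D (Suc k - i) l))) (at l)"
      using F[OF Suc.prems, of i] D[OF Suc.prems, of "k - i"]
      by (auto intro!: derivative_eq_intros simp: Suc_diff_le algebra_simps)
  qed
  then have "(?S has_real_derivative - ?S') (at l)" by (simp only: sum_negf)
  \<comment> \<open>The induction hypothesis identifies \<open>N k\<close> with the sum on the whole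
    open half line, hence near \<open>l\<close>, so the two have the same derivative.\<close>
  moreover have "(N k has_real_derivative - ?S') (at l) \<longleftrightarrow> (?S has_real_derivative - ?S') (at l)"
    by (rule DERIV_cong_ev) (auto intro!: eventually_mono[OF eventually_nhds_in_open[of "{0<..}"]] simp: Suc)
  ultimately have "- N (Suc k) l = - ?S'"
    using DERIV_unique[OF N[OF Suc.prems, of k]] by blast
  then have "N (Suc k) l = ?S'" by simp
  also have "\<dots> = (\<Sum>i\<le>k. real (k choose i) * F (Suc i) l * D (k - i) l) + (\<Sum>i\<le>k. real (k choose i) * F i l * D (Suc k - i) l)"
    by (simp add: ring_distribs sum.distrib mult.assoc)
  also have "(\<Sum>i\<le>k. real (k choose i) * F i l * D (Suc k - i) l) =
      F 0 l * D (Suc k) l + (\<Sum>i\<le>k. real (k choose Suc i) * F (Suc i) l * D (k - i) l)"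
  proof -
    have "(\<Sum>i\<le>k. real (k choose i) * F i l * D (Suc k - i) l) = (\<Sum>i\<le>Suc k. real (k choose i) * F i l * D (Suc k - i) l)"
      by simp
    also have "\<dots> = F 0 l * D (Suc k) l + (\<Sum>i\<le>k. real (k choose Suc i) * F (Suc i) l * D (k - i) l)"
      by (subst sum.atMost_Suc_shift) simp
    finally show ?thesis .
  qed
  also have "(\<Sum>i\<le>k. real (k choose i) * F (Suc i) l * D (k - i) l) +
      (F 0 l * D (Suc k) l + (\<Sum>i\<le>k. real (k choose Suc i) * F (Suc i) l * D (k - i) l)) =
      F 0 l * D (Suc k) l + (\<Sum>i\<le>k. real (Suc k choose Suc i) * F (Suc i) l * D (k - i) l)"
    by (simp add: ring_distribs sum.distrib)
  also have "\<dots> = (\<Sum>i\<le>Suc k. real (Suc k choose i) * F i l * D (Suc k - i) l)"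
    by (subst sum.atMost_Suc_shift) simp
  finally show ?case by simp
qed

definition slow :: "(real \<Rightarrow> real) \<Rightarrow> bool" where
  "slow f \<longleftrightarrow> (\<forall>e>0. ((\<lambda>l. l powr e * f l) \<longlongrightarrow> 0) (at_right 0))"

lemma slowD: "slow f \<Longrightarrow> e > 0 \<Longrightarrow> ((\<lambda>l. l powr e * f l) \<longlongrightarrow> 0) (at_right 0)"
  by (simp add: slow_def)

lemma slow_mult: "slow f \<Longrightarrow> slow g \<Longrightarrow> slow (\<lambda>l. f l * g l)"
  unfolding slow_def
proof (intro allI impI)
  fix e :: real assume fg: "\<forall>e>0. ((\<lambda>l. l powr e * f l) \<longlongrightarrow> 0) (at_right 0)" "\<forall>e>0. ((\<lambda>l. l powr e * g l) \<longlongrightarrow> 0) (at_right 0)" and e: "e > 0"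
  have "((\<lambda>l. (l powr (e / 2) * f l) * (l powr (e / 2) * g l)) \<longlongrightarrow> 0 * 0) (at_right 0)"
    using fg e by (intro tendsto_mult) auto
  then have "((\<lambda>l. (l powr (e / 2) * f l) * (l powr (e / 2) * g l)) \<longlongrightarrow> 0) (at_right 0)" by simp
  then show "((\<lambda>l. l powr e * (f l * g l)) \<longlongrightarrow> 0) (at_right 0)"
  proof (rule Lim_transform_eventually)
    have "l powr (e / 2) * l powr (e / 2) = l powr e" for l by (simp flip: powr_add)
    then have "(l powr (e / 2) * f l) * (l powr (e / 2) * g l) = l powr e * (f l * g l)" for l
      by (metis mult.assoc mult.left_commute)
    then show "\<forall>\<^sub>F l in at_right 0. (l powr (e / 2) * f l) * (l powr (e / 2) * g l) = l powr e * (f l * g l)" by simp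
  qed
qed

lemma slow_of_tendsto: "(f \<longlongrightarrow> c) (at_right 0) \<Longrightarrow> slow f"
  unfolding slow_def
proof (intro allI impI)
  fix e :: real assume f: "(f \<longlongrightarrow> c) (at_right 0)" and e: "e > 0"
  have "((\<lambda>l. l powr e) \<longlongrightarrow> 0) (at_right (0::real))" using e by real_asymp
  from tendsto_mult[OF this f] show "((\<lambda>l. l powr e * f l) \<longlongrightarrow> 0) (at_right 0)" by simp
qed

lemma slow_add: "slow f \<Longrightarrow> slow g \<Longrightarrow> slow (\<lambda>l. f l + g l)"
  unfolding slow_def by (auto simp: ring_distribs intro: tendsto_add_zero)

lemma slow_cmult: "slow f \<Longrightarrow> slow (\<lambda>l. c * f l)"
  using slow_mult[OF slow_of_tendsto[OF tendsto_const]] .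

lemma slow_diff: "slow f \<Longrightarrow> slow g \<Longrightarrow> slow (\<lambda>l. f l - g l)"
  using slow_add[of f "\<lambda>l. (-1) * g l"] slow_cmult[of g "-1"] by simp

lemma slow_sum: "(\<And>i. i \<in> I \<Longrightarrow> slow (f i)) \<Longrightarrow> slow (\<lambda>l. \<Sum>i\<in>I. f i l)"
  by (induction I rule: infinite_finite_induct) (auto intro: slow_add slow_of_tendsto)

lemma slow_cong: "slow f \<Longrightarrow> eventually (\<lambda>l. f l = g l) (at_right 0) \<Longrightarrow> slow g"
  unfolding slow_def by (auto elim!: Lim_transform_eventually eventually_mono)

text \<open>The Leibniz identity of order \<open>k\<close> is solved for its top term. All mixed
  products of lower derivatives are slow, so after multiplication by \<open>l powr r\<close> only
  \<open>N k\<close> and \<open>F 0\<close> times \<open>D k\<close> contribute to the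
  limit.\<close>

lemma laplace_quotient:
  fixes F D N :: "nat \<Rightarrow> real \<Rightarrow> real"
  assumes leib: "\<And>j l. l > 0 \<Longrightarrow> j \<le> k \<Longrightarrow> (\<Sum>i\<le>j. real (j choose i) * F i l * D (j - i) l) = N j l"
    and D0: "(D 0 \<longlongrightarrow> d) (at_right 0)" "d \<noteq> 0" and F0: "(F 0 \<longlongrightarrow> f) (at_right 0)"
    and sl: "\<And>j. j < k \<Longrightarrow> slow (N j)" "\<And>j. j < k \<Longrightarrow> slow (D j)" and k: "k \<ge> 1" and r: "r > 0"
    and lim: "((\<lambda>l. l powr r * N k l) \<longlongrightarrow> n) (at_right 0)" "((\<lambda>l. l powr r * D k l) \<longlongrightarrow> e) (at_right 0)"
  shows "((\<lambda>l. l powr r * F k l) \<longlongrightarrow> (n - f * e) / d) (at_right 0)"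
proof -
  have nz: "eventually (\<lambda>l. l > 0 \<and> D 0 l \<noteq> 0) (at_right 0)"
    using tendsto_imp_eventually_ne[OF D0] eventually_at_right_less[of 0] by eventually_elim simp
  have solve: "F j l = (N j l - (\<Sum>i<j. real (j choose i) * F i l * D (j - i) l)) * (1 / D 0 l)"
    if "j \<le> k" "l > 0" "D 0 l \<noteq> 0" for j l
  proof -
    have "(\<Sum>i<j. real (j choose i) * F i l * D (j - i) l) + F j l * D 0 l = N j l"
      using leib[OF that(2,1)] by (simp add: lessThan_Suc_atMost[symmetric])
    then show ?thesis using that(3) by (simp add: field_simps)
  qed
  have inv: "slow (\<lambda>l. 1 / D 0 l)"
    using D0 by (intro slow_of_tendsto[of _ "1 / d"] tendsto_intros) auto
  \<comment> \<open>Each \<open>F j\<close> is expressed by strictly lower ones and the reciprocal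
    of \<open>D 0\<close>, which converges; hence the course-of-values induction.\<close>
  have sF: "slow (F j)" if "j < k" for j
    using that
  proof (induction j rule: less_induct)
    case (less j)
    have "slow (\<lambda>l. (N j l - (\<Sum>i<j. real (j choose i) * F i l * D (j - i) l)) * (1 / D 0 l))"
      using less by (intro slow_mult slow_diff slow_sum slow_cmult sl inv) auto
    then show ?case
      by (rule slow_cong) (use nz less solve in \<open>auto elim!: eventually_mono\<close>)
  qed
  have "((\<lambda>l. (l powr r * N k l - F 0 l * (l powr r * D k l) - (\<Sum>i\<in>{1..<k}. l powr r * (real (k choose i) * F i l * D (k - i) l))) * (1 / D 0 l))
      \<longlongrightarrow> (n - f * e - (\<Sum>i\<in>{1..<k}. 0)) * (1 / d)) (at_right 0)"
  proof (intro tendsto_mult tendsto_diff lim F0 tendsto_sum)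
    show "((\<lambda>l. 1 / D 0 l) \<longlongrightarrow> 1 / d) (at_right 0)" using D0 by (intro tendsto_intros) auto
    fix i assume "i \<in> {1..<k}"
    then have "slow (\<lambda>l. real (k choose i) * F i l * D (k - i) l)"
      by (intro slow_mult slow_cmult sF sl) auto
    then show "((\<lambda>l. l powr r * (real (k choose i) * F i l * D (k - i) l)) \<longlongrightarrow> 0) (at_right 0)"
      using r by (rule slowD)
  qed
  then have "((\<lambda>l. (l powr r * N k l - F 0 l * (l powr r * D k l) - (\<Sum>i\<in>{1..<k}. l powr r * (real (k choose i) * F i l * D (k - i) l))) * (1 / D 0 l))
      \<longlongrightarrow> (n - f * e) / d) (at_right 0)" by simp
  then show ?thesis
  proof (rule Lim_transform_eventually)
    show "\<forall>\<^sub>F l in at_right 0. (l powr r * N k l - F 0 l * (l powr r * D k l) - (\<Sum>i\<in>{1..<k}. l powr r * (real (k choose i) * F i l * D (k - i) l))) * (1 / D 0 l) = l powr r * F k l"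
      using nz
    proof eventually_elim
      case (elim l)
      have "{..<k} = insert 0 {1..<k}" using k by auto
      then have "(\<Sum>i<k. real (k choose i) * F i l * D (k - i) l) = F 0 l * D k l + (\<Sum>i\<in>{1..<k}. real (k choose i) * F i l * D (k - i) l)"
        by simp
      then have "F k l = (N k l - (F 0 l * D k l + (\<Sum>i\<in>{1..<k}. real (k choose i) * F i l * D (k - i) l))) * (1 / D 0 l)"
        using solve[of k l] elim by simp
      then have "l powr r * F k l = l powr r * ((N k l - (F 0 l * D k l + (\<Sum>i\<in>{1..<k}. real (k choose i) * F i l * D (k - i) l))) * (1 / D 0 l))"
        by simp
      also have "\<dots> = (l powr r * N k l - F 0 l * (l powr r * D k l) - (\<Sum>i\<in>{1..<k}. l powr r * (real (k choose i) * F i l * D (k - i) l))) * (1 / D 0 l)"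
        by (simp only: sum_distrib_left[symmetric]) (simp only: algebra_simps)
      finally show ?case by simp
    qed
  qed
qed

context random_walk
begin

text \<open>Up to the sign \<open>(-1) ^ j\<close>, the functions \<open>gm j\<close>,
  \<open>Abm j\<close> and \<open>hm j\<close> are the j-th derivatives in \<open>l\<close> of
  \<open>GF\<close>, \<open>Ab\<close> and \<open>hit_minus\<close>.\<close>

definition gm :: "nat \<Rightarrow> int^'d \<Rightarrow> real \<Rightarrow> real" where
  "gm j v l = (\<integral>t. indicator {0..} t * (t ^ j * exp (- l * t) * pF t v) \<partial>lborel)"

text \<open>The middle term stems from differentiating the factor \<open>1 + l / a\<close> once. For
  \<open>j = 0\<close> the truncated \<open>j - 1\<close> is harmless, as the term then has
  coefficient 0.\<close>

definition Abm :: "nat \<Rightarrow> int^'d \<Rightarrow> real \<Rightarrow> real" where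
  "Abm j v l = (1 + l / a) * gm j v l - j / a * gm (j - 1) v l - (if j = 0 \<and> v = 0 then 1 / a else 0)"

definition hm :: "nat \<Rightarrow> int^'d \<Rightarrow> int^'d \<Rightarrow> int^'d \<Rightarrow> real \<Rightarrow> real" where
  "hm j x y z l = (\<integral>t. indicator {0..} t * (t ^ j * exp (- l * t)) \<partial>nu x y z)"

lemma gm_0: "l > 0 \<Longrightarrow> gm 0 v l = GF l v"
  by (simp add: gm_def GF_laplace)

lemma gm_deriv: "l > 0 \<Longrightarrow> (gm j v has_real_derivative - gm (Suc j) v l) (at l)"
  unfolding gm_def[abs_def] by (rule laplace_moment_deriv[OF _ _ integrable_pF_laplace]) auto

lemma Abm_deriv: "l > 0 \<Longrightarrow> (Abm j v has_real_derivative - Abm (Suc j) v l) (at l)"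
proof -
  assume l: "l > 0"
  have j: "(gm (j - 1) v has_real_derivative - gm (Suc (j - 1)) v l) (at l)" "(gm j v has_real_derivative - gm (Suc j) v l) (at l)"
    using gm_deriv[OF l] by auto
  have gen: "((\<lambda>l. (1 + l / a) * f l - c * g l - e) has_real_derivative (1 / a) * f l + (1 + l / a) * (- f') - c * (- g') - 0) (at l)"
    if "(f has_real_derivative - f') (at l)" "(g has_real_derivative - g') (at l)" for f g :: "real \<Rightarrow> real" and f' g' c e
    using a_pos by (auto intro!: derivative_eq_intros that)
  have "((\<lambda>l. (1 + l / a) * gm j v l - j / a * gm (j - 1) v l - (if j = 0 \<and> v = 0 then 1 / a else 0)) has_real_derivative
     (1 / a) * gm j v l + (1 + l / a) * (- gm (Suc j) v l) - j / a * (- gm (Suc (j - 1)) v l) - 0) (at l)"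
    by (rule gen[OF j(2,1)])
  also have "(1 / a) * gm j v l + (1 + l / a) * (- gm (Suc j) v l) - j / a * (- gm (Suc (j - 1)) v l) - 0 = - Abm (Suc j) v l"
    using a_pos by (cases j) (auto simp: Abm_def field_simps)
  finally show ?thesis unfolding Abm_def[abs_def] .
qed

lemma Abm_0: "l > 0 \<Longrightarrow> Abm 0 v l = Ab l v"
  by (simp add: Abm_def Ab_def gm_0)

lemma hm_0: "y \<noteq> z \<Longrightarrow> l > 0 \<Longrightarrow> hm 0 x y z l = hit_minus l y z x"
  unfolding hm_def hit_minus_nu using AE_nu_nonneg[of y z x]
  by (intro integral_cong_AE) (auto elim!: eventually_mono simp: measurable_cong_sets[OF sets_nu refl])

lemma hm_deriv: "y \<noteq> z \<Longrightarrow> l > 0 \<Longrightarrow> (hm j x y z has_real_derivative - hm (Suc j) x y z l) (at l)"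
proof -
  assume yz: "y \<noteq> z" and l: "l > 0"
  interpret N: finite_measure "nu x y z" by (rule finite_nu[OF yz])
  have "((\<lambda>l. \<integral>t. indicator {0..} t * (t ^ j * exp (- l * t) * 1) \<partial>nu x y z) has_real_derivative
      - (\<integral>t. indicator {0..} t * (t ^ Suc j * exp (- l * t) * 1) \<partial>nu x y z)) (at l)"
  proof (rule laplace_moment_deriv[OF _ sets_nu _ l])
    show "integrable (nu x y z) (\<lambda>t. indicator {0..} t * (exp (- l * t) * 1))" if "l > 0" for l :: real
      by (rule N.integrable_const_bound[of _ 1]) (use that in \<open>auto simp: indicator_def measurable_cong_sets[OF sets_nu refl]\<close>)
  qed auto
  then show ?thesis unfolding hm_def[abs_def] by simp
qed

end

section \<open>Dimension at least three: Green function at zero and the tail\<close>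

locale transient_walk = random_walk +
  assumes dim: "CARD('a) \<ge> 3"
begin

text \<open>With \<open>k\<close> half the dimension rounded down, \<open>t ^ k * pF t v\<close>
  decays with exponent 0 or \<open>1 / 2\<close>, so its transform diverges like a power with
  exponent \<open>r\<close>, equal to 1 or \<open>1 / 2\<close>. The inequality \<open>r < k\<close>
  required by \<open>tauberian_tail\<close> is where dimension at least three enters, and
  \<open>k - r\<close> is the exponent of the tail.\<close>

lemma k_s: "(CARD('a) div 2) \<ge> 1" "0 \<le> (real CARD('a) / 2 - real (CARD('a) div 2))" "(real CARD('a) / 2 - real (CARD('a) div 2)) < 1" "1 - (real CARD('a) / 2 - real (CARD('a) div 2)) < (CARD('a) div 2)" "(CARD('a) div 2) - (1 - (real CARD('a) / 2 - real (CARD('a) div 2))) = CARD('a) / 2 - 1"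
proof -
  have "CARD('a) = 2 * (CARD('a) div 2) + CARD('a) mod 2" by simp
  then have c: "real CARD('a) = 2 * real (CARD('a) div 2) + real (CARD('a) mod 2)" by (metis of_nat_add of_nat_mult of_nat_numeral)
  have m: "CARD('a) mod 2 = 0 \<or> CARD('a) mod 2 = 1" by auto
  have mb: "0 \<le> real (CARD('a) mod 2)" "real (CARD('a) mod 2) \<le> 1" using m by auto
  show "(CARD('a) div 2) \<ge> 1" using dim by auto
  show "0 \<le> (real CARD('a) / 2 - real (CARD('a) div 2))" "(real CARD('a) / 2 - real (CARD('a) div 2)) < 1" using c mb by linarith+
  show "(CARD('a) div 2) - (1 - (real CARD('a) / 2 - real (CARD('a) div 2))) = CARD('a) / 2 - 1" by simp
  have "n div 2 \<ge> 2 \<or> n mod 2 = 1" if "n \<ge> 3" for n :: nat using that by presburger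
  from this[OF dim] have "CARD('a) div 2 \<ge> 2 \<or> CARD('a) mod 2 = 1" .
  then show "1 - (real CARD('a) / 2 - real (CARD('a) div 2)) < (CARD('a) div 2)" using c dim m by auto
qed

lemma gm_slow: "j < (CARD('a) div 2) \<Longrightarrow> slow (gm j v)"
  unfolding slow_def
proof (intro allI impI)
  fix e :: real assume j: "j < (CARD('a) div 2)" and e: "e > 0"
  \<comment> \<open>Positivity of \<open>d\<close> keeps the decay exponent below 1, which covers
    the logarithmic case; \<open>d < e\<close> leaves a positive power of \<open>l\<close>;
    \<open>d\<close> at most 1 keeps the exponent \<open>real j + 1 - d\<close> nonnegative.\<close>
  define d where "d = min (e / 2) 1"
  have d: "0 < d" "d \<le> 1" "d < e" using e by (auto simp: d_def)
  have "real j + 1 \<le> real (CARD('a) div 2)" using j by linarith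
  then have "real j + 1 - d \<le> CARD('a) / 2" using k_s d by linarith
  then obtain C where C: "\<And>t. t > 0 \<Longrightarrow> \<bar>pF t v\<bar> \<le> C * t powr - (real j + 1 - d)"
    using pF_bound'[of "real j + 1 - d" v] d by auto
  have C': "\<bar>t ^ j * pF t v\<bar> \<le> C * t powr - (1 - d)" if t: "t > 0" for t
  proof -
    have "t ^ j * \<bar>pF t v\<bar> \<le> t ^ j * (C * t powr - (real j + 1 - d))" using t by (intro mult_left_mono C) auto
    also have "\<dots> = C * (t powr real j * t powr - (real j + 1 - d))" using t by (simp add: powr_realpow)
    also have "t powr real j * t powr - (real j + 1 - d) = t powr - (1 - d)" by (simp flip: powr_add)
    finally show ?thesis using t by (simp add: abs_mult)
  qed
  have "((\<lambda>l. C * Gamma d * l powr (e - d)) \<longlongrightarrow> C * Gamma d * 0) (at_right 0)"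
    using d by (intro tendsto_mult tendsto_const) real_asymp
  then have lim: "((\<lambda>l. C * Gamma d * l powr (e - d)) \<longlongrightarrow> 0) (at_right 0)" by simp
  show "((\<lambda>l. l powr e * gm j v l) \<longlongrightarrow> 0) (at_right 0)"
  proof (rule Lim_null_comparison[OF _ lim])
    show "\<forall>\<^sub>F l in at_right 0. norm (l powr e * gm j v l) \<le> C * Gamma d * l powr (e - d)"
      using eventually_at_right_less[of 0]
    proof eventually_elim
      case (elim l)
      have "\<bar>\<integral>t. indicator {0..} t * (exp (- l * t) * (t ^ j * pF t v)) \<partial>lborel\<bar> \<le> C * Gamma (1 - (1 - d)) * l powr ((1 - d) - 1)"
        by (rule laplace_bound(1)[OF _ C' _ elim]) (use d in auto)
      then have "\<bar>gm j v l\<bar> \<le> C * Gamma d * l powr (- d)" by (simp add: gm_def mult_ac)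
      then have "l powr e * \<bar>gm j v l\<bar> \<le> l powr e * (C * Gamma d * l powr (- d))" by (intro mult_left_mono) auto
      also have "\<dots> = C * Gamma d * (l powr e * l powr (- d))" by simp
      also have "l powr e * l powr (- d) = l powr (e - d)" by (simp flip: powr_add)
      finally show ?case by (simp add: abs_mult)
    qed
  qed
qed

lemma gm_k: "((\<lambda>l. l powr (1 - (real CARD('a) / 2 - real (CARD('a) div 2))) * gm (CARD('a) div 2) v l) \<longlongrightarrow> gamma_d A * Gamma (1 - (real CARD('a) / 2 - real (CARD('a) div 2)))) (at_right 0)"
proof -
  obtain C where C: "\<And>t. t > 0 \<Longrightarrow> \<bar>pF t v\<bar> \<le> C * t powr - (CARD('a) / 2)" using pF_bound'[of "CARD('a) / 2" v] by auto
  have C': "\<bar>t ^ (CARD('a) div 2) * pF t v\<bar> \<le> C * t powr - (real CARD('a) / 2 - real (CARD('a) div 2))" if t: "t > 0" for t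
  proof -
    have "t ^ (CARD('a) div 2) * \<bar>pF t v\<bar> \<le> t ^ (CARD('a) div 2) * (C * t powr - (CARD('a) / 2))" using t by (intro mult_left_mono C) auto
    also have "\<dots> = C * (t powr real (CARD('a) div 2) * t powr - (CARD('a) / 2))" using t by (simp add: powr_realpow)
    also have "t powr real (CARD('a) div 2) * t powr - (CARD('a) / 2) = t powr - (real CARD('a) / 2 - real (CARD('a) div 2))" by (simp flip: powr_add)
    finally show ?thesis using t by (simp add: abs_mult)
  qed
  have "((\<lambda>t. t powr (real CARD('a) / 2 - real (CARD('a) div 2)) * (t ^ (CARD('a) div 2) * pF t v)) \<longlongrightarrow> gamma_d A) at_top"
  proof (rule Lim_transform_eventually[OF pF_limit])
    show "\<forall>\<^sub>F t in at_top. t powr (CARD('a) / 2) * pF t v = t powr (real CARD('a) / 2 - real (CARD('a) div 2)) * (t ^ (CARD('a) div 2) * pF t v)"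
      using eventually_gt_at_top[of 0]
    proof eventually_elim
      case (elim t)
      have "t powr (real CARD('a) / 2 - real (CARD('a) div 2)) * t powr real (CARD('a) div 2) = t powr (CARD('a) / 2)" by (simp flip: powr_add)
      then show ?case using elim by (simp add: powr_realpow flip: mult.assoc)
    qed
  qed
  from abelian_exp[OF _ C' this k_s(3)] show ?thesis by (simp add: gm_def mult_ac)
qed

lemma Abm_slow: "j < (CARD('a) div 2) \<Longrightarrow> slow (Abm j v)"
  unfolding Abm_def[abs_def]
proof (intro slow_diff slow_mult)
  show "slow (\<lambda>l. 1 + l / a)" by (rule slow_of_tendsto[of _ "1 + 0 / a"]) (use a_pos in \<open>intro tendsto_intros, auto\<close>)
  show "slow (\<lambda>l. if j = 0 \<and> v = 0 then 1 / a else 0)" "slow (\<lambda>l. real j / a)" by (rule slow_of_tendsto, rule tendsto_const)+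
qed (auto intro: gm_slow)

text \<open>Averaging over one jump does not change the leading singularity: the factor
  \<open>1 + l / a\<close> tends to 1 and the lower moment is slow.\<close>

lemma Abm_k: "((\<lambda>l. l powr (1 - (real CARD('a) / 2 - real (CARD('a) div 2))) * Abm (CARD('a) div 2) v l) \<longlongrightarrow> gamma_d A * Gamma (1 - (real CARD('a) / 2 - real (CARD('a) div 2)))) (at_right 0)"
proof -
  have "((\<lambda>l. (1 + l / a) * (l powr (1 - (real CARD('a) / 2 - real (CARD('a) div 2))) * gm (CARD('a) div 2) v l) - real (CARD('a) div 2) / a * (l powr (1 - (real CARD('a) / 2 - real (CARD('a) div 2))) * gm ((CARD('a) div 2) - 1) v l)) \<longlongrightarrow>
      (1 + 0 / a) * (gamma_d A * Gamma (1 - (real CARD('a) / 2 - real (CARD('a) div 2)))) - real (CARD('a) div 2) / a * 0) (at_right 0)"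
    using a_pos k_s slowD[OF gm_slow[of "(CARD('a) div 2) - 1" v], of "1 - (real CARD('a) / 2 - real (CARD('a) div 2))"] by (intro tendsto_intros gm_k) auto
  moreover have "(\<lambda>l. (1 + l / a) * (l powr (1 - (real CARD('a) / 2 - real (CARD('a) div 2))) * gm (CARD('a) div 2) v l) - real (CARD('a) div 2) / a * (l powr (1 - (real CARD('a) / 2 - real (CARD('a) div 2))) * gm ((CARD('a) div 2) - 1) v l)) =
      (\<lambda>l. l powr (1 - (real CARD('a) / 2 - real (CARD('a) div 2))) * Abm (CARD('a) div 2) v l)"
    using k_s(1) by (auto simp: Abm_def fun_eq_iff algebra_simps)
  ultimately show ?thesis by simp
qed

definition G0 :: "int^'a \<Rightarrow> real" where
  "G0 v = (\<integral>t. indicator {0..} t * pF t v \<partial>lborel)"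

lemma GF_tendsto_G0: "((\<lambda>l. GF l v) \<longlongrightarrow> G0 v) (at_right 0)"
proof -
  obtain C where C: "\<And>t. t > 0 \<Longrightarrow> \<bar>pF t v\<bar> \<le> C * t powr - (CARD('a) / 2)" using pF_bound'[of "CARD('a) / 2" v] by auto
  have p: "0 < real CARD('a) / 2 - 1" using dim by simp
  have "integrable lborel (\<lambda>t. indicator {0..1} t *\<^sub>R (1::real) + \<bar>C\<bar> * (indicator {1<..} t * t powr (- (real CARD('a) / 2 - 1) - 1)))"
    using powr_tail_integral(1)[OF p] by (intro Bochner_Integration.integrable_add integrable_mult_right) auto
  then have "integrable lborel (\<lambda>t. indicator {0..} t * pF t v)"
  proof (rule Bochner_Integration.integrable_bound)
    show "AE t in lborel. norm (indicator {0..} t * pF t v) \<le>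
        norm (indicator {0..1} t *\<^sub>R (1::real) + \<bar>C\<bar> * (indicator {1<..} t * t powr (- (real CARD('a) / 2 - 1) - 1)))"
    proof (rule AE_I2)
      fix t :: real
      consider "t < 0" | "0 \<le> t" "t \<le> 1" | "t > 1" by linarith
      then show "norm (indicator {0..} t * pF t v) \<le>
        norm (indicator {0..1} t *\<^sub>R (1::real) + \<bar>C\<bar> * (indicator {1<..} t * t powr (- (real CARD('a) / 2 - 1) - 1)))"
      proof cases
        case 2
        then show ?thesis using abs_pF_le_1[of t v] by simp
      next
        case 3
        have "C * t powr - (CARD('a) / 2) \<le> \<bar>C\<bar> * t powr - (CARD('a) / 2)" by (intro mult_right_mono) auto
        then have "\<bar>pF t v\<bar> \<le> \<bar>C\<bar> * t powr - (CARD('a) / 2)" using C[of t] 3 by linarith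
        then show ?thesis using 3 by (simp add: abs_mult)
      qed simp
    qed
  qed simp
  from laplace_tendsto_integral[OF measurable_pF this]
  show ?thesis unfolding G0_def
    by (rule Lim_transform_eventually) (use eventually_at_right_less[of 0] GF_laplace in \<open>auto elim!: eventually_mono\<close>)
qed

text \<open>At \<open>l = 0\<close> integrability of \<open>ptrans\<close> over time is not known
  beforehand. Monotone convergence along \<open>1 / real (Suc n)\<close> yields it from the bounded
  sequence of Fourier integrals, after which both limits can be compared.\<close>

lemma Green_0: "Green A 0 x y = G0 (x - y)"
proof -
  let ?f = "\<lambda>t. ptrans A t x y"
  have "incseq (\<lambda>n t. ennreal (indicator {0..} t * (exp (- (1 / real (Suc n)) * t) * ?f t)))"
    unfolding incseq_def le_fun_def
  proof (intro allI impI ennreal_leI)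
    fix m n :: nat and t :: real assume mn: "m \<le> n"
    have "1 / real (Suc n) * t \<le> 1 / real (Suc m) * t" if "t \<ge> 0"
      using mn that by (intro mult_right_mono divide_left_mono) auto
    then show "indicator {0..} t * (exp (- (1 / real (Suc m)) * t) * ?f t) \<le> indicator {0..} t * (exp (- (1 / real (Suc n)) * t) * ?f t)"
      using ptrans_nonneg[of t x y] by (auto simp: indicator_def intro!: mult_right_mono)
  qed
  then have "(\<integral>\<^sup>+t. (SUP n. ennreal (indicator {0..} t * (exp (- (1 / real (Suc n)) * t) * ?f t))) \<partial>lborel) =
      (SUP n. \<integral>\<^sup>+t. ennreal (indicator {0..} t * (exp (- (1 / real (Suc n)) * t) * ?f t)) \<partial>lborel)"
    by (intro nn_integral_monotone_convergence_SUP) auto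
  also have "(\<lambda>t. SUP n. ennreal (indicator {0..} t * (exp (- (1 / real (Suc n)) * t) * ?f t))) = (\<lambda>t. ennreal (indicator {0..} t * ?f t))"
  proof
    fix t
    have "(\<lambda>n. ennreal (indicator {0..} t * (exp (- (1 / real (Suc n)) * t) * ?f t))) \<longlonglongrightarrow> ennreal (indicator {0..} t * (exp (- 0 * t) * ?f t))"
      by (intro tendsto_ennrealI tendsto_mult tendsto_const tendsto_exp tendsto_minus) real_asymp
    moreover have "incseq (\<lambda>n. ennreal (indicator {0..} t * (exp (- (1 / real (Suc n)) * t) * ?f t)))"
      using \<open>incseq _\<close> by (auto simp: incseq_def le_fun_def)
    ultimately show "(SUP n. ennreal (indicator {0..} t * (exp (- (1 / real (Suc n)) * t) * ?f t))) = ennreal (indicator {0..} t * ?f t)"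
      using LIMSEQ_SUP LIMSEQ_unique by fastforce
  qed
  also have "(SUP n. \<integral>\<^sup>+t. ennreal (indicator {0..} t * (exp (- (1 / real (Suc n)) * t) * ?f t)) \<partial>lborel) = (SUP n. ennreal (GF (1 / real (Suc n)) (x - y)))"
  proof (rule arg_cong[of _ _ Sup], intro image_cong refl)
    fix n
    have l: "1 / real (Suc n) > 0" by simp
    have int: "integrable lborel (\<lambda>t. indicator {0..} t * (exp (- (1 / real (Suc n)) * t) * ?f t))"
    proof (rule Bochner_Integration.integrable_bound)
      show "integrable lborel (\<lambda>t. indicator {0..} t * exp (- (1 / real (Suc n)) * t))"
        using nn_integral_exp_0(1)[OF l] by (intro integrableI_nonneg) auto
    qed (auto simp: abs_mult ptrans_nonneg ptrans_le_1 indicator_def mult_left_le)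
    have "Green A (1 / real (Suc n)) x y = (\<integral>t. indicator {0..} t * (exp (- (1 / real (Suc n)) * t) * ?f t) \<partial>lborel)"
      by (simp add: Green_def set_lebesgue_integral_def)
    then show "(\<integral>\<^sup>+t. ennreal (indicator {0..} t * (exp (- (1 / real (Suc n)) * t) * ?f t)) \<partial>lborel) = ennreal (GF (1 / real (Suc n)) (x - y))"
      using nn_integral_eq_integral[OF int] Green_eq_GF[OF l] by (simp add: ptrans_nonneg)
  qed
  also have "\<dots> < \<infinity>"
  proof -
    have inv: "filterlim (\<lambda>n. 1 / real (Suc n)) (at_right 0) sequentially" by real_asymp
    have "convergent (\<lambda>n. GF (1 / real (Suc n)) (x - y))"
      using filterlim_compose[OF GF_tendsto_G0 inv] by (auto simp: convergent_def)
    then have "Bseq (\<lambda>n. GF (1 / real (Suc n)) (x - y))" by (rule convergent_imp_Bseq)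
    then obtain B where "\<And>n. norm (GF (1 / real (Suc n)) (x - y)) \<le> B"
      unfolding Bseq_def by blast
    then have "GF (1 / real (Suc n)) (x - y) \<le> B" for n by (metis abs_ge_self order_trans real_norm_def)
    then have "(SUP n. ennreal (GF (1 / real (Suc n)) (x - y))) \<le> ennreal B" by (intro SUP_least ennreal_leI)
    then show ?thesis by (simp add: order_le_less_trans)
  qed
  finally have "integrable lborel (\<lambda>t. indicator {0..} t * ?f t)"
    by (intro integrableI_nonneg) (auto simp: ptrans_nonneg)
  from laplace_tendsto_integral[OF measurable_ptrans this]
  have "((\<lambda>l. Green A l x y) \<longlongrightarrow> Green A 0 x y) (at_right 0)"
    by (simp add: Green_def set_lebesgue_integral_def)
  moreover have "((\<lambda>l. Green A l x y) \<longlongrightarrow> G0 (x - y)) (at_right 0)"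
    by (rule Lim_transform_eventually[OF GF_tendsto_G0])
      (use eventually_at_right_less[of 0] Green_eq_GF in \<open>auto elim!: eventually_mono\<close>)
  ultimately show ?thesis by (rule tendsto_unique[OF trivial_limit_at_right_real])
qed

lemma pot_G0: "pot v = G0 0 - G0 v"
  by (rule tendsto_unique[OF trivial_limit_at_right_real GF_diff_tendsto]) (intro tendsto_intros GF_tendsto_G0)

lemma G0_add_pos: "v \<noteq> 0 \<Longrightarrow> G0 0 + G0 v > 0"
proof -
  assume v: "v \<noteq> 0"
  have l1: "((\<lambda>l. 1 / (l + 2 * a)) \<longlongrightarrow> 1 / (0 + 2 * a)) (at_right 0)"
    using a_pos by (intro tendsto_intros) auto
  have l2: "((\<lambda>l. GF l 0 + GF l v) \<longlongrightarrow> G0 0 + G0 v) (at_right 0)"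
    by (intro tendsto_intros GF_tendsto_G0)
  have "1 / (0 + 2 * a) \<le> G0 0 + G0 v"
    by (rule tendsto_le[OF trivial_limit_at_right_real l2 l1])
      (use eventually_at_right_less[of 0] v in \<open>auto elim!: eventually_mono intro: GF_add_ge\<close>)
  moreover have "1 / (0 + 2 * a) > 0" using a_pos by simp
  ultimately show ?thesis by linarith
qed

lemma Hminus_inf_sum:
  assumes yz: "y \<noteq> z"
  shows "(Hminus_inf A x y z + Hminus_inf A x z y) * (G0 0 + G0 (y - z)) = 2 * G0 0 - (rho A (x - y) + rho A (x - z)) / a"
proof -
  have Ab: "((\<lambda>l. Ab l v) \<longlongrightarrow> G0 0 - rho A v / a) (at_right 0)" for v
  proof -
    have "((\<lambda>l. GF l 0 - (GF l 0 - Ab l v)) \<longlongrightarrow> G0 0 - rho A v / a) (at_right 0)"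
      by (intro tendsto_diff GF_tendsto_G0 Ab_tendsto)
    then show ?thesis by simp
  qed
  have 1: "((\<lambda>l. (hit_minus l y z x + hit_minus l z y x) * (GF l 0 + GF l (y - z))) \<longlongrightarrow>
      (Hminus_inf A x y z + Hminus_inf A x z y) * (G0 0 + G0 (y - z))) (at_right 0)"
    using yz by (intro tendsto_intros hit_minus_tendsto GF_tendsto_G0) auto
  have 2: "((\<lambda>l. Ab l (x - y) + Ab l (x - z)) \<longlongrightarrow> (G0 0 - rho A (x - y) / a) + (G0 0 - rho A (x - z) / a)) (at_right 0)"
    by (intro tendsto_add Ab)
  have 3: "\<forall>\<^sub>F l in at_right 0. (hit_minus l y z x + hit_minus l z y x) * (GF l 0 + GF l (y - z)) = Ab l (x - y) + Ab l (x - z)"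
    using eventually_at_right_less[of 0] by eventually_elim (simp add: hit_minus_system(1)[OF _ yz])
  show ?thesis
    using tendsto_unique[OF trivial_limit_at_right_real Lim_transform_eventually[OF 1 3] 2] by (simp add: add_divide_distrib)
qed

text \<open>At the top order all \<open>gm\<close> and all \<open>Abm\<close> share one leading
  coefficient, whatever the lattice point. In the difference system these coefficients cancel, so
  the singular part of each hitting transform is half that of the sum.\<close>

lemma tail_asymptotic:
  assumes yz: "y \<noteq> z" and pos: "rho A (x - y) + rho A (x - z) - rho A (y - z) > 0"
  shows "((\<lambda>t. t powr (CARD('a) / 2 - 1) * measure (nu x y z) {t<..}) \<longlongrightarrow>
     2 * gamma_d A * (rho A (x - y) + rho A (x - z) - rho A (y - z)) / (a * (CARD('a) - 2) * (G0 0 + G0 (y - z))\<^sup>2)) (at_top)"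
proof -
  let ?g = "gamma_d A * Gamma (1 - (real CARD('a) / 2 - real (CARD('a) div 2)))"
  let ?Gs = "G0 0 + G0 (y - z)"
  let ?P = "Hminus_inf A x y z + Hminus_inf A x z y" and ?M = "Hminus_inf A x y z - Hminus_inf A x z y"
  have zy: "z \<noteq> y" and v: "y - z \<noteq> 0" using yz by auto
  have r: "1 - (real CARD('a) / 2 - real (CARD('a) div 2)) > 0" using k_s by simp
  have hm_lim: "((\<lambda>l. hm 0 x y z l) \<longlongrightarrow> Hminus_inf A x y z) (at_right 0)" if "y \<noteq> z" for y z
    by (rule Lim_transform_eventually[OF hit_minus_tendsto[OF that]])
      (use eventually_at_right_less[of 0] hm_0[OF that] in \<open>auto elim!: eventually_mono\<close>)
  have gm_lim: "((\<lambda>l. gm 0 v l) \<longlongrightarrow> G0 v) (at_right 0)" for v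
    by (rule Lim_transform_eventually[OF GF_tendsto_G0])
      (use eventually_at_right_less[of 0] gm_0 in \<open>auto elim!: eventually_mono\<close>)
  have P: "((\<lambda>l. l powr (1 - (real CARD('a) / 2 - real (CARD('a) div 2))) * (hm (CARD('a) div 2) x y z l + hm (CARD('a) div 2) x z y l)) \<longlongrightarrow> (2 * ?g - ?P * (2 * ?g)) / ?Gs) (at_right 0)"
  proof (rule laplace_quotient[where F = "\<lambda>j l. hm j x y z l + hm j x z y l" and D = "\<lambda>j l. gm j 0 l + gm j (y - z) l" and N = "\<lambda>j l. Abm j (x - y) l + Abm j (x - z) l"])
    show "(\<Sum>i\<le>j. real (j choose i) * (hm i x y z l + hm i x z y l) * (gm (j - i) 0 l + gm (j - i) (y - z) l)) = Abm j (x - y) l + Abm j (x - z) l"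
      if "l > 0" for j l
    proof (rule leibniz_laplace[where F = "\<lambda>j l. hm j x y z l + hm j x z y l" and D = "\<lambda>j l. gm j 0 l + gm j (y - z) l" and N = "\<lambda>j l. Abm j (x - y) l + Abm j (x - z) l"])
    qed (use that yz zy in \<open>auto intro!: derivative_eq_intros hm_deriv gm_deriv Abm_deriv simp: hm_0 gm_0 Abm_0 hit_minus_system\<close>)
    show "?Gs \<noteq> 0" using G0_add_pos[OF v] by simp
    show "((\<lambda>l. l powr (1 - (real CARD('a) / 2 - real (CARD('a) div 2))) * (gm (CARD('a) div 2) 0 l + gm (CARD('a) div 2) (y - z) l)) \<longlongrightarrow> 2 * ?g) (at_right 0)"
      using tendsto_add[OF gm_k[of 0] gm_k[of "y - z"]] by (simp add: ring_distribs)
    show "((\<lambda>l. l powr (1 - (real CARD('a) / 2 - real (CARD('a) div 2))) * (Abm (CARD('a) div 2) (x - y) l + Abm (CARD('a) div 2) (x - z) l)) \<longlongrightarrow> 2 * ?g) (at_right 0)"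
      using tendsto_add[OF Abm_k[of "x - y"] Abm_k[of "x - z"]] by (simp add: ring_distribs)
  qed (use yz zy k_s r in \<open>auto intro!: tendsto_add hm_lim gm_lim slow_add gm_slow Abm_slow\<close>)
  have M: "((\<lambda>l. l powr (1 - (real CARD('a) / 2 - real (CARD('a) div 2))) * (hm (CARD('a) div 2) x y z l - hm (CARD('a) div 2) x z y l)) \<longlongrightarrow> (0 - ?M * 0) / pot (y - z)) (at_right 0)"
  proof (rule laplace_quotient[where F = "\<lambda>j l. hm j x y z l - hm j x z y l" and D = "\<lambda>j l. gm j 0 l - gm j (y - z) l" and N = "\<lambda>j l. Abm j (x - y) l - Abm j (x - z) l"])
    show "(\<Sum>i\<le>j. real (j choose i) * (hm i x y z l - hm i x z y l) * (gm (j - i) 0 l - gm (j - i) (y - z) l)) = Abm j (x - y) l - Abm j (x - z) l"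
      if "l > 0" for j l
    proof (rule leibniz_laplace[where F = "\<lambda>j l. hm j x y z l - hm j x z y l" and D = "\<lambda>j l. gm j 0 l - gm j (y - z) l" and N = "\<lambda>j l. Abm j (x - y) l - Abm j (x - z) l"])
    qed (use that yz zy in \<open>auto intro!: derivative_eq_intros hm_deriv gm_deriv Abm_deriv simp: hm_0 gm_0 Abm_0 hit_minus_system\<close>)
    show "((\<lambda>l. gm 0 0 l - gm 0 (y - z) l) \<longlongrightarrow> pot (y - z)) (at_right 0)"
      unfolding pot_G0 by (intro tendsto_diff gm_lim)
    show "pot (y - z) \<noteq> 0" using pot_pos[OF v] by simp
    show "((\<lambda>l. l powr (1 - (real CARD('a) / 2 - real (CARD('a) div 2))) * (gm (CARD('a) div 2) 0 l - gm (CARD('a) div 2) (y - z) l)) \<longlongrightarrow> 0) (at_right 0)"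
      using tendsto_diff[OF gm_k[of 0] gm_k[of "y - z"]] by (simp add: ring_distribs)
    show "((\<lambda>l. l powr (1 - (real CARD('a) / 2 - real (CARD('a) div 2))) * (Abm (CARD('a) div 2) (x - y) l - Abm (CARD('a) div 2) (x - z) l)) \<longlongrightarrow> 0) (at_right 0)"
      using tendsto_diff[OF Abm_k[of "x - y"] Abm_k[of "x - z"]] by (simp add: ring_distribs)
  qed (use yz zy k_s r in \<open>auto intro!: tendsto_diff hm_lim slow_diff gm_slow Abm_slow\<close>)
  let ?R = "rho A (x - y) + rho A (x - z) - rho A (y - z)"
  have Gs: "?Gs > 0" using G0_add_pos[OF v] .
  \<comment> \<open>\<open>1 - ?P\<close> is the probability of never visiting \<open>{y, z}\<close>
    after the first jump; this identity is what ties the sign of the limit constant to the strict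
    triangle inequality for \<open>rho A\<close>.\<close>
  have "(1 - ?P) * ?Gs = ?R / a"
  proof -
    have "rho A (y - z) / a = G0 0 - G0 (y - z)" using v a_pos by (simp add: rho_pot pot_G0)
    moreover have "(1 - ?P) * ?Gs = ?Gs - ?P * ?Gs" by (simp add: left_diff_distrib)
    ultimately show ?thesis unfolding Hminus_inf_sum[OF yz] by (simp add: diff_divide_distrib add_divide_distrib)
  qed
  then have "1 - ?P = ?R / a / ?Gs" using Gs by (metis less_irrefl nonzero_mult_div_cancel_right)
  then have P1: "1 - ?P = ?R / (a * ?Gs)" by simp
  define c where "c = ?g * ?R / (a * ?Gs\<^sup>2)"
  have G: "Gamma (1 - (real CARD('a) / 2 - real (CARD('a) div 2))) > 0" using r by (rule Gamma_real_pos)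
  have c: "c > 0" unfolding c_def using gamma_d_pos G pos a_pos Gs by (intro divide_pos_pos mult_pos_pos) auto
  have "((\<lambda>l. (l powr (1 - (real CARD('a) / 2 - real (CARD('a) div 2))) * (hm (CARD('a) div 2) x y z l + hm (CARD('a) div 2) x z y l) + l powr (1 - (real CARD('a) / 2 - real (CARD('a) div 2))) * (hm (CARD('a) div 2) x y z l - hm (CARD('a) div 2) x z y l)) / 2) \<longlongrightarrow>
      ((2 * ?g - ?P * (2 * ?g)) / ?Gs + (0 - ?M * 0) / pot (y - z)) / 2) (at_right 0)"
    by (intro tendsto_intros P M) auto
  moreover have "((2 * ?g - ?P * (2 * ?g)) / ?Gs + (0 - ?M * 0) / pot (y - z)) / 2 = c"
  proof -
    have alg: "((2 * g - P * (2 * g)) / G + (0 - M * 0) / q) / 2 = g * (1 - P) / G" for g P G M q :: real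
      by (cases "G = 0") (simp_all add: field_simps)
    have "((2 * ?g - ?P * (2 * ?g)) / ?Gs + (0 - ?M * 0) / pot (y - z)) / 2 = ?g * (1 - ?P) / ?Gs"
      by (rule alg)
    then show ?thesis unfolding P1 c_def by (simp add: power2_eq_square)
  qed
  moreover have "(\<lambda>l. (l powr (1 - (real CARD('a) / 2 - real (CARD('a) div 2))) * (hm (CARD('a) div 2) x y z l + hm (CARD('a) div 2) x z y l) + l powr (1 - (real CARD('a) / 2 - real (CARD('a) div 2))) * (hm (CARD('a) div 2) x y z l - hm (CARD('a) div 2) x z y l)) / 2) = (\<lambda>l. l powr (1 - (real CARD('a) / 2 - real (CARD('a) div 2))) * hm (CARD('a) div 2) x y z l)"
    by (auto simp: fun_eq_iff algebra_simps)
  ultimately have "((\<lambda>l. l powr (1 - (real CARD('a) / 2 - real (CARD('a) div 2))) * (\<integral>t. indicator {0..} t * (t ^ (CARD('a) div 2) * exp (- l * t)) \<partial>nu x y z)) \<longlongrightarrow> c) (at_right 0)"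
    by (simp add: hm_def)
  from tauberian_tail[OF finite_nu[OF yz] sets_nu r k_s(4) c this]
  have "((\<lambda>t. t powr (CARD('a) / 2 - 1) * measure (nu x y z) {t<..}) \<longlongrightarrow> c / (Gamma (1 - (real CARD('a) / 2 - real (CARD('a) div 2))) * (CARD('a) / 2 - 1))) at_top"
    unfolding k_s(5) .
  moreover have "c / (Gamma (1 - (real CARD('a) / 2 - real (CARD('a) div 2))) * (CARD('a) / 2 - 1)) = 2 * gamma_d A * ?R / (a * (CARD('a) - 2) * ?Gs\<^sup>2)"
  proof -
    have alg: "g * h * R / (b * Q) / (h * (m / 2)) = 2 * g * R / (b * m * Q)" if "h \<noteq> 0" for g h R b Q m :: real
      using that by (simp add: mult_ac)
    have e: "CARD('a) / 2 - 1 = (real CARD('a) - 2) / 2" by simp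
    have e': "real (CARD('a) - 2) = real CARD('a) - 2" using dim by simp
    show ?thesis unfolding c_def e e' by (rule alg) (use G in linarith)
  qed
  ultimately show ?thesis by simp
qed

end

section \<open>Rates of convergence in dimensions one and two\<close>

lemma UNIV_singleton: "CARD('n::finite) = 1 \<Longrightarrow> (UNIV :: 'n set) = {SOME i. True}"
  by (metis UNIV_I card_1_singletonE singletonD)

lemma inner_singleton:
  assumes "CARD('n::finite) = 1"
  shows "(u :: real^'n) \<bullet> v = u $ (SOME i. True) * v $ (SOME i. True)"
  by (simp add: inner_vec_def UNIV_singleton[OF assms])

lemma lborel_integral_singleton:
  fixes f :: "real \<Rightarrow> real"
  assumes one: "CARD('n::finite) = 1" and f: "integrable lborel f"
  shows "(\<integral>u. f ((u :: real^'n) $ (SOME i. True)) \<partial>lborel) = (\<integral>t. f t \<partial>lborel)"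
proof -
  have B: "(Basis :: (real^'n) set) = {axis (SOME i. True) 1}"
    by (simp add: Basis_vec_def UNIV_singleton[OF one])
  have "(\<integral>u. (\<Prod>b\<in>Basis. f ((u :: real^'n) \<bullet> b)) \<partial>lborel) = (\<Prod>b\<in>(Basis :: (real^'n) set). \<integral>t. f t \<partial>lborel)"
    by (rule lborel_prod_integral(1)) (rule f)
  then show ?thesis unfolding B by (simp add: inner_axis)
qed

lemma gaussian_moments:
  fixes V :: real
  assumes V: "V > 0"
  shows "integrable lborel (\<lambda>t::real. exp (- (V * t\<^sup>2) / 2))" "(\<integral>t. exp (- (V * t\<^sup>2) / 2) \<partial>lborel) = sqrt (2 * pi / V)"
    "integrable lborel (\<lambda>t::real. t\<^sup>2 * exp (- (V * t\<^sup>2) / 2))" "(\<integral>t. t\<^sup>2 * exp (- (V * t\<^sup>2) / 2) \<partial>lborel) = sqrt (2 * pi / V) / V"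
proof -
  define \<sigma> where "\<sigma> = 1 / sqrt V"
  have \<sigma>: "\<sigma> > 0" "\<sigma>\<^sup>2 = 1 / V" using V by (simp_all add: \<sigma>_def power_divide)
  have c: "sqrt (2 * pi / V) > 0" using V by simp
  have eq: "exp (- (V * t\<^sup>2) / 2) = sqrt (2 * pi / V) * normal_density 0 \<sigma> t" for t
    using c V by (simp add: normal_density_def \<sigma> mult.commute)
  have "has_bochner_integral lborel (\<lambda>t. normal_density 0 \<sigma> t * (t - 0) ^ (2 * 1)) (fact (2 * 1) / ((2 / \<sigma>\<^sup>2) ^ 1 * fact 1))"
    using \<sigma>(1) by (rule normal_moment_even)
  then have m2: "has_bochner_integral lborel (\<lambda>t. normal_density 0 \<sigma> t * t\<^sup>2) (1 / V)"
    by (simp add: \<sigma>(2))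
  show "integrable lborel (\<lambda>t::real. exp (- (V * t\<^sup>2) / 2))" "(\<integral>t. exp (- (V * t\<^sup>2) / 2) \<partial>lborel) = sqrt (2 * pi / V)"
    unfolding eq using \<sigma>(1) by (simp_all add: integrable_normal_density integral_normal_density)
  have eq2: "t\<^sup>2 * exp (- (V * t\<^sup>2) / 2) = sqrt (2 * pi / V) * (normal_density 0 \<sigma> t * t\<^sup>2)" for t
    unfolding eq by simp
  show "integrable lborel (\<lambda>t::real. t\<^sup>2 * exp (- (V * t\<^sup>2) / 2))"
    unfolding eq2 using m2 by (intro integrable_mult_right) (auto simp: has_bochner_integral_iff)
  show "(\<integral>t. t\<^sup>2 * exp (- (V * t\<^sup>2) / 2) \<partial>lborel) = sqrt (2 * pi / V) / V"
    unfolding eq2 using m2 by (simp only: integral_mult_right_zero has_bochner_integral_iff) simp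
qed

context random_walk
begin

lemma DF_deriv:
  assumes l: "l > 0"
  shows "((\<lambda>l. GF l 0 - GF l v) has_real_derivative - (\<integral>t. indicator {0..} t * (exp (- l * t) * (t * (pF t 0 - pF t v))) \<partial>lborel)) (at l)"
proof -
  have int: "integrable lborel (\<lambda>t. indicator {0..} t * (exp (- l * t) * (pF t 0 - pF t v)))" if "l > 0" for l
    using Bochner_Integration.integrable_diff[OF integrable_pF_laplace[OF that, of 0] integrable_pF_laplace[OF that, of v]]
    by (simp add: right_diff_distrib)
  have "((\<lambda>l. \<integral>t. indicator {0..} t * (t ^ 0 * exp (- l * t) * (pF t 0 - pF t v)) \<partial>lborel) has_real_derivative
      - (\<integral>t. indicator {0..} t * (t ^ Suc 0 * exp (- l * t) * (pF t 0 - pF t v)) \<partial>lborel)) (at l)"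
    by (rule laplace_moment_deriv[OF _ _ int]) (use l in auto)
  then have "((\<lambda>l. \<integral>t. indicator {0..} t * (exp (- l * t) * (pF t 0 - pF t v)) \<partial>lborel) has_real_derivative
      - (\<integral>t. indicator {0..} t * (exp (- l * t) * (t * (pF t 0 - pF t v))) \<partial>lborel)) (at l)"
    by (simp add: mult_ac)
  then show ?thesis
    by (rule has_field_derivative_transform_within_open[where S = "{0<..}"]) (use l in \<open>auto simp: pF_diff_laplace\<close>)
qed

text \<open>The defect and \<open>sqrt l\<close> both vanish at 0, so L'Hopital's rule applies. The
  derivative of the defect is the transform of \<open>t * (pF t 0 - pF t v)\<close>, which decays
  like \<open>c / sqrt t\<close>; the Abelian theorem then contributes
  \<open>Gamma (1 / 2)\<close>.\<close>

lemma pot_rate: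
  assumes b: "\<And>t. t > 0 \<Longrightarrow> \<bar>pF t 0 - pF t v\<bar> \<le> C * t powr - (3 / 2)"
    and lim: "((\<lambda>t. t powr (3 / 2) * (pF t 0 - pF t v)) \<longlongrightarrow> c) at_top"
  shows "((\<lambda>l. (pot v - (GF l 0 - GF l v)) / sqrt l) \<longlongrightarrow> 2 * c * sqrt pi) (at_right 0)"
proof -
  let ?I = "\<lambda>l. \<integral>t. indicator {0..} t * (exp (- l * t) * (t * (pF t 0 - pF t v))) \<partial>lborel"
  have "((\<lambda>l. l powr (1 - 1 / 2) * ?I l) \<longlongrightarrow> c * Gamma (1 - 1 / 2)) (at_right 0)"
  proof (rule abelian_exp)
    fix t :: real assume t: "t > 0"
    have "t * \<bar>pF t 0 - pF t v\<bar> \<le> t * (C * t powr - (3 / 2))" using t by (intro mult_left_mono b) auto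
    also have "\<dots> = C * (t powr 1 * t powr - (3 / 2))" using t by simp
    also have "t powr 1 * t powr - (3 / 2) = t powr - (1 / 2)" by (subst powr_add[symmetric]) simp
    finally show "\<bar>t * (pF t 0 - pF t v)\<bar> \<le> C * t powr - (1 / 2)" using t by (simp add: abs_mult)
  next
    show "((\<lambda>t. t powr (1 / 2) * (t * (pF t 0 - pF t v))) \<longlongrightarrow> c) at_top"
    proof (rule Lim_transform_eventually[OF lim])
      show "\<forall>\<^sub>F t in at_top. t powr (3 / 2) * (pF t 0 - pF t v) = t powr (1 / 2) * (t * (pF t 0 - pF t v))"
        using eventually_gt_at_top[of 0]
      proof eventually_elim
        case (elim t)
        have "t powr (1 / 2) * t powr 1 = t powr (3 / 2)" by (subst powr_add[symmetric]) simp
        then show ?case using elim by (simp flip: mult.assoc)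
      qed
    qed
  qed auto
  then have I: "((\<lambda>l. l powr (1 / 2) * ?I l) \<longlongrightarrow> c * sqrt pi) (at_right 0)"
    by (simp add: Gamma_one_half_real)
  show ?thesis
  proof (rule lhopital_right_0[where f' = ?I and g' = "\<lambda>l. inverse (sqrt l) / 2"])
    have "((\<lambda>l. pot v - (GF l 0 - GF l v)) \<longlongrightarrow> pot v - pot v) (at_right 0)"
      by (intro tendsto_diff tendsto_const GF_diff_tendsto)
    then show "((\<lambda>l. pot v - (GF l 0 - GF l v)) \<longlongrightarrow> 0) (at_right 0)" by simp
    show "(sqrt \<longlongrightarrow> 0) (at_right 0)" using tendsto_real_sqrt[OF tendsto_ident_at[of "0::real" "{0<..}"]] by simp
    show "\<forall>\<^sub>F l in at_right (0::real). sqrt l \<noteq> 0" "\<forall>\<^sub>F l in at_right (0::real). inverse (sqrt l) / 2 \<noteq> 0"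
      using eventually_at_right_less[of "0::real"] by (auto elim!: eventually_mono)
    show "\<forall>\<^sub>F l in at_right 0. ((\<lambda>l. pot v - (GF l 0 - GF l v)) has_real_derivative ?I l) (at l)"
      using eventually_at_right_less[of "0::real"]
    proof eventually_elim
      case (elim l)
      show ?case using DERIV_diff[OF DERIV_const[of "pot v"] DF_deriv[OF elim, of v]] by simp
    qed
    show "\<forall>\<^sub>F l in at_right 0. (sqrt has_real_derivative inverse (sqrt l) / 2) (at l)"
      using eventually_at_right_less[of "0::real"] by eventually_elim (rule DERIV_real_sqrt)
    have "((\<lambda>l. 2 * (l powr (1 / 2) * ?I l)) \<longlongrightarrow> 2 * (c * sqrt pi)) (at_right 0)"
      by (intro tendsto_mult tendsto_const I)
    then have "((\<lambda>l. 2 * (l powr (1 / 2) * ?I l)) \<longlongrightarrow> 2 * c * sqrt pi) (at_right 0)" by (simp only: mult.assoc)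
    then show "((\<lambda>l. ?I l / (inverse (sqrt l) / 2)) \<longlongrightarrow> 2 * c * sqrt pi) (at_right 0)"
    proof (rule Lim_transform_eventually)
      show "\<forall>\<^sub>F l in at_right 0. 2 * (l powr (1 / 2) * ?I l) = ?I l / (inverse (sqrt l) / 2)"
        using eventually_at_right_less[of "0::real"] by eventually_elim (simp add: powr_half_sqrt field_simps)
    qed
  qed
qed

lemma Ab_DF: "Ab l v = GF l 0 - ((1 + l / a) * (GF l 0 - GF l v) - l / a * GF l 0 + (if v = 0 then 1 / a else 0))"
  by (simp add: Ab_def algebra_simps)

text \<open>The common core of both recurrent dimensions. The scale \<open>w\<close> tends to
  infinity, so a finite limit of \<open>w l\<close> times the defect of the sum forces the two total
  masses to add up to 1. The constant \<open>g\<close> compares \<open>w\<close> with the divergence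
  of \<open>GF l 0\<close> and governs the sum; \<open>k\<close> measures the convergence to the
  potential kernel and governs the difference.\<close>

lemma hit_minus_rate:
  fixes x y z :: "int^'d" and w :: "real \<Rightarrow> real"
  assumes yz: "y \<noteq> z" and w: "filterlim w at_top (at_right 0)" and lw: "((\<lambda>l. l * w l) \<longlongrightarrow> 0) (at_right 0)"
    and g: "((\<lambda>l. w l / GF l 0) \<longlongrightarrow> g) (at_right 0)"
    and k: "\<And>v. ((\<lambda>l. w l * (pot v - (GF l 0 - GF l v))) \<longlongrightarrow> k v) (at_right 0)"
  defines "R \<equiv> rho A (x - y) + rho A (x - z) - rho A (y - z)"
  shows "Hminus_inf A x y z + Hminus_inf A x z y = 1"
    and "((\<lambda>l. w l * (Hminus_inf A x y z - hit_minus l y z x)) \<longlongrightarrow>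
       (R * g / (2 * a) + (pot (y - z) * (k (x - z) - k (x - y)) - (rho A (x - z) - rho A (x - y)) / a * k (y - z)) / (pot (y - z))\<^sup>2) / 2) (at_right 0)"
proof -
  let ?D = "\<lambda>l v. GF l 0 - GF l v" and ?hy = "\<lambda>l. hit_minus l y z x" and ?hz = "\<lambda>l. hit_minus l z y x"
  let ?V = "y - z" and ?N0 = "(rho A (x - z) - rho A (x - y)) / a"
  have v: "?V \<noteq> 0" and zy: "z \<noteq> y" using yz by auto
  have p: "pot ?V > 0" by (rule pot_pos[OF v])
  have pos: "eventually (\<lambda>l::real. l > 0) (at_right 0)" by (rule eventually_at_right_less)
  have winv: "((\<lambda>l. inverse (w l)) \<longlongrightarrow> 0) (at_right 0)"
    by (rule tendsto_inverse_0_at_top[OF w])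
  have w0: "eventually (\<lambda>l. w l > 0) (at_right 0)" using w by (auto simp: filterlim_at_top_dense)
  have DG: "eventually (\<lambda>l. GF l 0 > 0 \<and> ?D l ?V > 0 \<and> 2 * GF l 0 - ?D l ?V > 0) (at_right 0)"
    using pos
  proof eventually_elim
    case (elim l)
    have "1 / (l + 2 * a) > 0" using elim a_pos by simp
    then show ?case using GF_diff_ge[OF elim v] GF_add_ge[OF elim v] by (intro conjI) linarith+
  qed
  have E: "((\<lambda>l. GF l 0 - Ab l v) \<longlongrightarrow> rho A v / a) (at_right 0)" for v by (rule Ab_tendsto)
  have DG0: "((\<lambda>l. ?D l ?V / GF l 0) \<longlongrightarrow> 0) (at_right 0)"
  proof (rule Lim_transform_eventually)
    show "((\<lambda>l. ?D l ?V * (w l / GF l 0) * inverse (w l)) \<longlongrightarrow> 0) (at_right 0)"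
      using tendsto_mult[OF tendsto_mult[OF GF_diff_tendsto[of ?V] g] winv] by simp
    show "\<forall>\<^sub>F l in at_right 0. ?D l ?V * (w l / GF l 0) * inverse (w l) = ?D l ?V / GF l 0"
      using w0 by eventually_elim simp
  qed
  have sum_lim: "((\<lambda>l. w l * (1 - (?hy l + ?hz l))) \<longlongrightarrow> R * g / (2 * a)) (at_right 0)"
  proof (rule Lim_transform_eventually)
    have "((\<lambda>l. ((GF l 0 - Ab l (x - y)) + (GF l 0 - Ab l (x - z)) - ?D l ?V) * (w l / GF l 0) / (2 - ?D l ?V / GF l 0)) \<longlongrightarrow>
      (rho A (x - y) / a + rho A (x - z) / a - pot ?V) * g / (2 - 0)) (at_right 0)"
      by (intro tendsto_intros E g DG0 GF_diff_tendsto) simp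
    moreover have "(rho A (x - y) / a + rho A (x - z) / a - pot ?V) * g / (2 - 0) = R * g / (2 * a)"
      unfolding R_def rho_pot[of ?V] using v a_pos by (simp add: field_simps)
    ultimately show "((\<lambda>l. ((GF l 0 - Ab l (x - y)) + (GF l 0 - Ab l (x - z)) - ?D l ?V) * (w l / GF l 0) / (2 - ?D l ?V / GF l 0)) \<longlongrightarrow> R * g / (2 * a)) (at_right 0)"
      by (simp only:)
    show "\<forall>\<^sub>F l in at_right 0. ((GF l 0 - Ab l (x - y)) + (GF l 0 - Ab l (x - z)) - ?D l ?V) * (w l / GF l 0) / (2 - ?D l ?V / GF l 0) = w l * (1 - (?hy l + ?hz l))"
      using pos DG
    proof eventually_elim
      case (elim l)
      have G: "GF l 0 > 0" and S: "2 * GF l 0 - ?D l ?V > 0" using elim by auto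
      have sys: "(?hy l + ?hz l) * (2 * GF l 0 - ?D l ?V) = Ab l (x - y) + Ab l (x - z)"
        using hit_minus_system(1)[OF elim(1) yz, of x] by (simp add: algebra_simps)
      have "(GF l 0 - Ab l (x - y)) + (GF l 0 - Ab l (x - z)) - ?D l ?V = (1 - (?hy l + ?hz l)) * (2 * GF l 0 - ?D l ?V)"
        using sys by (simp add: algebra_simps)
      moreover have "(w l / GF l 0) / (2 - ?D l ?V / GF l 0) = w l / (2 * GF l 0 - ?D l ?V)"
        using G by (simp add: field_simps)
      ultimately have "((GF l 0 - Ab l (x - y)) + (GF l 0 - Ab l (x - z)) - ?D l ?V) * (w l / GF l 0) / (2 - ?D l ?V / GF l 0)
         = (1 - (?hy l + ?hz l)) * (2 * GF l 0 - ?D l ?V) * (w l / (2 * GF l 0 - ?D l ?V))"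
        by (metis times_divide_eq_right)
      also have "\<dots> = w l * (1 - (?hy l + ?hz l))" using S by (simp add: field_simps)
      finally show ?case .
    qed
  qed
  have "((\<lambda>l. w l * (1 - (?hy l + ?hz l)) * inverse (w l)) \<longlongrightarrow> R * g / (2 * a) * 0) (at_right 0)"
    by (intro tendsto_mult sum_lim winv)
  then have "((\<lambda>l. 1 - (?hy l + ?hz l)) \<longlongrightarrow> R * g / (2 * a) * 0) (at_right 0)"
    by (rule Lim_transform_eventually) (use w0 in \<open>auto elim!: eventually_mono\<close>)
  moreover have "((\<lambda>l. 1 - (?hy l + ?hz l)) \<longlongrightarrow> 1 - (Hminus_inf A x y z + Hminus_inf A x z y)) (at_right 0)"
    by (intro tendsto_intros hit_minus_tendsto yz zy)
  ultimately show sum1: "Hminus_inf A x y z + Hminus_inf A x z y = 1"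
    using tendsto_unique[OF trivial_limit_at_right_real] by fastforce
  have pr: "pot ?V = rho A ?V / a" using v a_pos by (simp add: rho_pot)
  have diff0: "(Hminus_inf A x y z - Hminus_inf A x z y) * pot ?V = ?N0"
    using hit_minus_difference_tendsto[OF yz, of x] unfolding pr by simp
  define N where "N l = (1 + l / a) * (?D l (x - z) - ?D l (x - y)) + ((if x = z then 1 / a else 0) - (if x = y then 1 / a else 0))" for l
  have N: "Ab l (x - y) - Ab l (x - z) = N l" for l unfolding Ab_DF N_def by (simp add: algebra_simps)
  have N0: "?N0 = pot (x - z) - pot (x - y) + ((if x = z then 1 / a else 0) - (if x = y then 1 / a else 0))"
    using a_pos by (simp add: rho_pot field_simps)
  have wN: "((\<lambda>l. w l * (?N0 - N l)) \<longlongrightarrow> k (x - z) - k (x - y)) (at_right 0)"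
  proof -
    have "((\<lambda>l. w l * (pot (x - z) - ?D l (x - z)) - w l * (pot (x - y) - ?D l (x - y)) - (l * w l) * (?D l (x - z) - ?D l (x - y)) / a) \<longlongrightarrow>
        k (x - z) - k (x - y) - 0 * (pot (x - z) - pot (x - y)) / a) (at_right 0)"
      using a_pos by (intro tendsto_intros k lw GF_diff_tendsto) auto
    moreover have "w l * (pot (x - z) - ?D l (x - z)) - w l * (pot (x - y) - ?D l (x - y)) - (l * w l) * (?D l (x - z) - ?D l (x - y)) / a = w l * (?N0 - N l)" for l
      unfolding N0 N_def by (simp add: algebra_simps add_divide_distrib diff_divide_distrib)
    ultimately show ?thesis by simp
  qed
  \<comment> \<open>The difference of the limiting quotient and the quotient at \<open>l\<close>,
    brought over a common denominator so that each remaining error stands next to its own factor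
    \<open>w l\<close>.\<close>
  have "((\<lambda>l. (pot ?V * (w l * (?N0 - N l)) - ?N0 * (w l * (pot ?V - ?D l ?V))) / (?D l ?V * pot ?V)) \<longlongrightarrow>
      (pot ?V * (k (x - z) - k (x - y)) - ?N0 * k ?V) / (pot ?V * pot ?V)) (at_right 0)"
    using p by (intro tendsto_intros wN k GF_diff_tendsto) auto
  then have diff_lim: "((\<lambda>l. w l * ((Hminus_inf A x y z - Hminus_inf A x z y) - (?hy l - ?hz l))) \<longlongrightarrow>
      (pot ?V * (k (x - z) - k (x - y)) - ?N0 * k ?V) / (pot ?V * pot ?V)) (at_right 0)"
  proof (rule Lim_transform_eventually)
    show "\<forall>\<^sub>F l in at_right 0. (pot ?V * (w l * (?N0 - N l)) - ?N0 * (w l * (pot ?V - ?D l ?V))) / (?D l ?V * pot ?V) =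
       w l * ((Hminus_inf A x y z - Hminus_inf A x z y) - (?hy l - ?hz l))"
      using pos DG
    proof eventually_elim
      case (elim l)
      have alg: "(P * (W * (m * P - f * D)) - (m * P) * (W * (P - D))) / (D * P) = W * (m - f)" if "P \<noteq> 0" "D \<noteq> 0" for P W m f D :: real
        using that by (simp add: field_simps)
      show ?case
        unfolding diff0[symmetric] N[symmetric] hit_minus_system(2)[OF elim(1) yz, symmetric]
        by (rule alg) (use elim p in auto)
    qed
  qed
  have "((\<lambda>l. (w l * (1 - (?hy l + ?hz l)) + w l * ((Hminus_inf A x y z - Hminus_inf A x z y) - (?hy l - ?hz l))) / 2) \<longlongrightarrow>
     (R * g / (2 * a) + (pot ?V * (k (x - z) - k (x - y)) - ?N0 * k ?V) / (pot ?V * pot ?V)) / 2) (at_right 0)"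
    by (intro tendsto_intros sum_lim diff_lim) auto
  moreover have "(w l * (1 - (?hy l + ?hz l)) + w l * ((Hminus_inf A x y z - Hminus_inf A x z y) - (?hy l - ?hz l))) / 2 = w l * (Hminus_inf A x y z - ?hy l)" for l
    unfolding sum1[symmetric] by (simp add: field_simps)
  ultimately show "((\<lambda>l. w l * (Hminus_inf A x y z - ?hy l)) \<longlongrightarrow>
     (R * g / (2 * a) + (pot ?V * (k (x - z) - k (x - y)) - ?N0 * k ?V) / (pot ?V)\<^sup>2) / 2) (at_right 0)"
    by (simp add: power2_eq_square)
qed

lemma hit_minus_le_inf: "y \<noteq> z \<Longrightarrow> l > 0 \<Longrightarrow> hit_minus l y z x \<le> Hminus_inf A x y z"
proof -
  assume yz: "y \<noteq> z" and l: "l > 0"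
  interpret N: finite_measure "nu x y z" by (rule finite_nu[OF yz])
  have sp: "space (nu x y z) = UNIV" using sets_eq_imp_space_eq[OF sets_nu] by simp
  have "(\<integral>t. exp (- l * t) \<partial>nu x y z) \<le> (\<integral>t. 1 \<partial>nu x y z)"
  proof (rule integral_mono_AE)
    show "integrable (nu x y z) (\<lambda>t. exp (- l * t))"
      by (rule N.integrable_const_bound[of _ 1]) (use l AE_nu_nonneg[OF yz, of x] in \<open>auto elim!: eventually_mono simp: measurable_cong_sets[OF sets_nu refl]\<close>)
  qed (use l AE_nu_nonneg[OF yz, of x] in \<open>auto elim!: eventually_mono\<close>)
  then show ?thesis using l by (simp add: hit_minus_nu[OF yz] Hminus_inf_nu[OF yz] sp)
qed

lemma nu_tail_of_rate:
  assumes yz: "y \<noteq> z" and lim: "((\<lambda>l. w l * (Hminus_inf A x y z - hit_minus l y z x)) \<longlongrightarrow> C) (at_right 0)" and C: "C > 0"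
    and w: "\<And>n::nat. n \<ge> 1 \<Longrightarrow> ((\<lambda>l. w l / w (real n * l)) \<longlongrightarrow> real n powr (1 - r)) (at_right 0)" and r: "r > 0"
  shows "((\<lambda>s. w (1 / s) * (Hminus_inf A x y z - Hminus A x y z s)) \<longlongrightarrow> C / Gamma r) at_top"
  unfolding Hminus_tail[OF yz]
proof (rule tauberian_tail_monotone[OF finite_nu[OF yz] sets_nu AE_nu_nonneg[OF yz] _ C w r])
  show "((\<lambda>l. w l * (measure (nu x y z) UNIV - (\<integral>t. exp (- l * t) \<partial>nu x y z))) \<longlongrightarrow> C) (at_right 0)"
    by (rule Lim_transform_eventually[OF lim], rule eventually_mono[OF eventually_at_right_less[of 0]])
      (simp add: hit_minus_nu[OF yz] Hminus_inf_nu[OF yz])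
qed

definition var1 :: real where
  "var1 = a * (\<integral>z. (real_of_int (scal1 z))\<^sup>2 \<partial>J)"

lemma line_variance:
  assumes one: "CARD('d) = 1"
  shows "u \<bullet> (Sig *v u) = var1 * (u $ (SOME i. True))\<^sup>2" and "var1 > 0"
proof -
  have r: "rvec z \<bullet> u = real_of_int (scal1 z) * u $ (SOME i. True)" for z and u :: "real^'d"
    unfolding inner_singleton[OF one] by (simp add: rvec_def scal1_def)
  show q: "u \<bullet> (Sig *v u) = var1 * (u $ (SOME i. True))\<^sup>2" for u
    unfolding Sig_quadratic r var1_def power_mult_distrib by simp
  have "(axis (SOME i. True) 1 :: real^'d) \<noteq> 0" by (simp add: axis_eq_0_iff)
  from Sig_pos[OF this] show "var1 > 0" unfolding q by simp
qed

text \<open>In one dimension \<open>1 / var1\<close> equals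
  \<open>2 * pi * (gamma_d A)\<^sup>2\<close>. This turns the Gaussian second moment in the limit
  into the cube of \<open>gamma_d A\<close>, the cube that appears in \<open>C1\<close>.\<close>

lemma gamma_1:
  assumes one: "CARD('d) = 1"
  shows "gamma_d A = 1 / sqrt (2 * pi * var1)"
    and "((\<lambda>t. t powr (3 / 2) * (pF t 0 - pF t x)) \<longlongrightarrow> pi * gamma_d A ^ 3 * (real_of_int (scal1 x))\<^sup>2) at_top"
proof -
  note V = line_variance(2)[OF one]
  note gm = gaussian_moments[OF V]
  have g: "gamma_d A = sqrt (2 * pi / var1) / (2 * pi)"
    using integral_gaussian_Sig trans[OF lborel_integral_singleton[OF one gm(1)] gm(2)]
    unfolding line_variance(1)[OF one] one power_one_right by simp
  have r: "rvec x \<bullet> u = real_of_int (scal1 x) * u $ (SOME i. True)" for u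
    unfolding inner_singleton[OF one] by (simp add: rvec_def scal1_def)
  let ?x = "real_of_int (scal1 x)"
  have s: "sqrt (2 * pi / var1) = 2 * pi / sqrt (2 * pi * var1)"
  proof -
    have "2 * pi / var1 = (2 * pi)\<^sup>2 / (2 * pi * var1)" using V by (simp add: power2_eq_square)
    then show ?thesis by (simp only: real_sqrt_divide real_sqrt_abs) simp
  qed
  show g': "gamma_d A = 1 / sqrt (2 * pi * var1)" unfolding g s by simp
  have g2: "1 / var1 = 2 * pi * (gamma_d A)\<^sup>2" unfolding g' using V by (simp add: power_divide)
  have "(\<integral>u. (rvec x \<bullet> u)\<^sup>2 / 2 * exp (- (u \<bullet> (Sig *v u)) / 2) \<partial>lborel)
      = ?x\<^sup>2 / 2 * (\<integral>u. ((u :: real^'d) $ (SOME i. True))\<^sup>2 * exp (- (var1 * (u $ (SOME i. True))\<^sup>2) / 2) \<partial>lborel)"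
    unfolding line_variance(1)[OF one] r power_mult_distrib
    by (subst integral_mult_right_zero[symmetric]) (simp add: mult_ac)
  also have "\<dots> = ?x\<^sup>2 / 2 * (sqrt (2 * pi / var1) * (1 / var1))"
    using trans[OF lborel_integral_singleton[OF one gm(3)] gm(4)] by simp
  also have "\<dots> / (2 * pi) = ?x\<^sup>2 / 2 * (gamma_d A * (1 / var1))" unfolding g by simp
  also have "\<dots> = pi * gamma_d A ^ 3 * ?x\<^sup>2" unfolding g2 by (simp add: power2_eq_square power3_eq_cube)
  finally have c: "(\<integral>u. (rvec x \<bullet> u)\<^sup>2 / 2 * exp (- (u \<bullet> (Sig *v u)) / 2) \<partial>lborel) / (2 * pi) = pi * gamma_d A ^ 3 * ?x\<^sup>2" .
  show "((\<lambda>t. t powr (3 / 2) * (pF t 0 - pF t x)) \<longlongrightarrow> pi * gamma_d A ^ 3 * ?x\<^sup>2) at_top"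
    using pF_diff_limit[of x] unfolding one power_one_right c by simp
qed

text \<open>\<open>GF l 0\<close> diverges like \<open>1 / sqrt l\<close> and the potential kernel
  is approached at rate \<open>sqrt l\<close>. Sum and difference therefore contribute at the same
  order, which explains why \<open>C1\<close> consists of several terms.\<close>

lemma rate_1:
  assumes one: "CARD('d) = 1" and yz: "y \<noteq> z"
  shows "Hminus_inf A x y z + Hminus_inf A x z y = 1"
    and "((\<lambda>l. l powr - (1 / 2) * (Hminus_inf A x y z - hit_minus l y z x)) \<longlongrightarrow> C1 A (x - z) (y - z) * sqrt pi) (at_right 0)"
proof -
  let ?g = "gamma_d A"
  let ?w = "\<lambda>l::real. l powr - (1 / 2)"
  let ?k = "\<lambda>v. 2 * (pi * ?g ^ 3 * (real_of_int (scal1 v))\<^sup>2) * sqrt pi"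
  have g0: "?g > 0" by (rule gamma_d_pos)
  have w: "filterlim ?w at_top (at_right 0)" by real_asymp
  have lw: "((\<lambda>l. l * ?w l) \<longlongrightarrow> 0) (at_right 0)" by real_asymp
  obtain C where C: "\<And>t. t > 0 \<Longrightarrow> \<bar>pF t 0\<bar> \<le> C * t powr - (1 / 2)" using pF_bound'[of "1 / 2" 0] one by auto
  have "((\<lambda>l. l powr (1 - 1 / 2) * (\<integral>t. indicator {0..} t * (exp (- l * t) * pF t 0) \<partial>lborel)) \<longlongrightarrow> ?g * Gamma (1 - 1 / 2)) (at_right 0)"
    using pF_limit[of 0] by (intro abelian_exp[OF measurable_pF C]) (auto simp: one)
  then have "((\<lambda>l. l powr (1 / 2) * (\<integral>t. indicator {0..} t * (exp (- l * t) * pF t 0) \<partial>lborel)) \<longlongrightarrow> ?g * sqrt pi) (at_right 0)"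
    by (simp add: Gamma_one_half_real)
  then have "((\<lambda>l. inverse (l powr (1 / 2) * (\<integral>t. indicator {0..} t * (exp (- l * t) * pF t 0) \<partial>lborel))) \<longlongrightarrow> inverse (?g * sqrt pi)) (at_right 0)"
    using g0 by (intro tendsto_inverse) auto
  then have g: "((\<lambda>l. ?w l / GF l 0) \<longlongrightarrow> inverse (?g * sqrt pi)) (at_right 0)"
    by (rule Lim_transform_eventually)
      (use eventually_at_right_less[of 0] in \<open>auto elim!: eventually_mono simp: GF_laplace powr_minus field_simps\<close>)
  have k: "((\<lambda>l. ?w l * (pot v - (GF l 0 - GF l v))) \<longlongrightarrow> ?k v) (at_right 0)" for v
  proof -
    obtain C where C: "\<And>t. t > 0 \<Longrightarrow> \<bar>pF t 0 - pF t v\<bar> \<le> C * t powr - (3 / 2)" using pF_diff_bound'[of v] by (auto simp: one)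
    show ?thesis
      by (rule Lim_transform_eventually[OF pot_rate[OF C gamma_1(2)[OF one]]])
        (use eventually_at_right_less[of 0] in \<open>auto elim!: eventually_mono simp: powr_minus powr_half_sqrt field_simps\<close>)
  qed
  note hr = hit_minus_rate[OF yz w lw g k, of x]
  show "Hminus_inf A x y z + Hminus_inf A x z y = 1" by (rule hr(1))
  define q where "q = sqrt pi"
  have q: "q > 0" "pi = q\<^sup>2" by (simp_all add: q_def)
  have r: "rho A (y - z) > 0" "pot (y - z) = rho A (y - z) / a" using rho_pos[of "y - z"] yz a_pos by (simp_all add: rho_pot)
  have sc: "scal1 (u - v) = scal1 u - scal1 v" for u v :: "int^'d" by (simp add: scal1_def)
  have "rho A (y - x) = rho A (x - y)" using rho_minus[of "x - y"] by simp
  moreover have "y - z - (x - z) = y - x" by simp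
  ultimately have C1: "C1 A (x - z) (y - z) = (rho A (x - y) + rho A (x - z) - rho A (y - z)) / (4 * a * pi * ?g)
      + a * pi * (scal1 y - scal1 z)\<^sup>2 * ?g ^ 3 * (rho A (x - y) - rho A (x - z) - rho A (y - z)) / (rho A (y - z))\<^sup>2
      + 2 * a * pi * (scal1 x - scal1 z) * (scal1 y - scal1 z) * ?g ^ 3 / rho A (y - z)"
    by (simp add: C1_def Let_def sc)
  have alg: "((Rxy + Rxz - r) * inverse (g * q) / (2 * a) + (r / a * (2 * (q\<^sup>2 * g ^ 3 * (x - z)\<^sup>2) * q - 2 * (q\<^sup>2 * g ^ 3 * (x - y)\<^sup>2) * q) - (Rxz - Rxy) / a * (2 * (q\<^sup>2 * g ^ 3 * (y - z)\<^sup>2) * q)) / (r / a)\<^sup>2) / 2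
    = ((Rxy + Rxz - r) / (4 * a * q\<^sup>2 * g) + a * q\<^sup>2 * (y - z)\<^sup>2 * g ^ 3 * (Rxy - Rxz - r) / r\<^sup>2 + 2 * a * q\<^sup>2 * (x - z) * (y - z) * g ^ 3 / r) * q"
    if "g > 0" "a > 0" "r > 0" for Rxy Rxz r g x y z a :: real
  proof -
    \<comment> \<open>The contribution of the sum is the first term of \<open>C1\<close>; that of
      the difference, regrouped below, gives the two terms with the cube of
      \<open>g\<close>.\<close>
    have 1: "(Rxy + Rxz - r) * inverse (g * q) / (2 * a) / 2 = (Rxy + Rxz - r) / (4 * a * q\<^sup>2 * g) * q"
      using q(1) that by (simp add: field_simps power2_eq_square)
    define N Z M u v where "N = Rxz - Rxy" and "Z = (y - z)\<^sup>2" and "M = Rxy - Rxz - r" and "u = x - z" and "v = y - z"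
    note df = N_def Z_def M_def u_def v_def
    define K where "K = 2 * q\<^sup>2 * q * g ^ 3"
    have "r / a * (2 * (q\<^sup>2 * g ^ 3 * (x - z)\<^sup>2) * q - 2 * (q\<^sup>2 * g ^ 3 * (x - y)\<^sup>2) * q) - N / a * (2 * (q\<^sup>2 * g ^ 3 * Z) * q)
       = K * (r * ((x - z)\<^sup>2 - (x - y)\<^sup>2) - N * Z) / a"
      unfolding K_def by (simp add: algebra_simps diff_divide_distrib add_divide_distrib)
    also have "r * ((x - z)\<^sup>2 - (x - y)\<^sup>2) - N * Z = Z * M + 2 * u * v * r"
      unfolding df by (simp add: power2_eq_square algebra_simps)
    also have "K * (Z * M + 2 * u * v * r) / a / (r / a)\<^sup>2 = a * K * (Z * M / r\<^sup>2 + 2 * u * v / r)"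
      using that by (simp add: field_simps power2_eq_square)
    also have "\<dots> / 2 = (a * q\<^sup>2 * Z * g ^ 3 * M / r\<^sup>2 + 2 * a * q\<^sup>2 * u * v * g ^ 3 / r) * q"
      unfolding K_def by (simp add: distrib_left distrib_right mult_ac)
    finally have "((Rxy + Rxz - r) * inverse (g * q) / (2 * a) + (r / a * (2 * (q\<^sup>2 * g ^ 3 * (x - z)\<^sup>2) * q - 2 * (q\<^sup>2 * g ^ 3 * (x - y)\<^sup>2) * q) - N / a * (2 * (q\<^sup>2 * g ^ 3 * Z) * q)) / (r / a)\<^sup>2) / 2
      = ((Rxy + Rxz - r) / (4 * a * q\<^sup>2 * g)) * q + (a * q\<^sup>2 * Z * g ^ 3 * M / r\<^sup>2 + 2 * a * q\<^sup>2 * u * v * g ^ 3 / r) * q"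
      by (simp only: add_divide_distrib 1)
    then show ?thesis unfolding df by (simp only: distrib_right add.assoc)
  qed
  show "((\<lambda>l. ?w l * (Hminus_inf A x y z - hit_minus l y z x)) \<longlongrightarrow> C1 A (x - z) (y - z) * sqrt pi) (at_right 0)"
    using hr(2) unfolding r(2) sc of_int_diff unfolding q_def[symmetric] unfolding q(2) unfolding alg[OF g0 a_pos r(1)] unfolding C1 q(2) of_int_diff of_int_power .
qed

text \<open>The transform never exceeds the total mass, so the limit of the scaled defect cannot be
  negative. Nothing of this sign is visible in the formula; strictness needs the separate argument
  of \<open>C1_pos\<close>.\<close>

lemma C1_nonneg:
  assumes one: "CARD('d) = 1" and yz: "y \<noteq> z"
  shows "C1 A (x - z) (y - z) \<ge> 0"
proof -
  have "C1 A (x - z) (y - z) * sqrt pi \<ge> 0"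
    by (rule tendsto_lowerbound[OF rate_1(2)[OF one yz]])
      (use eventually_at_right_less[of 0] hit_minus_le_inf[OF yz] in \<open>auto elim!: eventually_mono\<close>)
  then show ?thesis using mult_neg_pos[of "C1 A (x - z) (y - z)" "sqrt pi"] by fastforce
qed

lemma tail_1:
  assumes one: "CARD('d) = 1" and yz: "y \<noteq> z" and C: "C1 A (x - z) (y - z) > 0"
  shows "((\<lambda>t. sqrt t * (Hminus_inf A x y z - Hminus A x y z t)) \<longlongrightarrow> C1 A (x - z) (y - z)) at_top"
proof -
  have "((\<lambda>t. (1 / t) powr - (1 / 2) * (Hminus_inf A x y z - Hminus A x y z t)) \<longlongrightarrow> C1 A (x - z) (y - z) * sqrt pi / Gamma (1 / 2)) at_top"
  proof (rule nu_tail_of_rate[OF yz rate_1(2)[OF one yz]])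
    fix n :: nat assume n: "n \<ge> 1"
    have "\<forall>\<^sub>F l::real in at_right 0. real n powr (1 - 1 / 2) = l powr - (1 / 2) / (real n * l) powr - (1 / 2)"
      using eventually_at_right_less[of "0::real"]
      by eventually_elim (use n in \<open>simp add: powr_mult powr_minus field_simps\<close>)
    then show "((\<lambda>l. l powr - (1 / 2) / (real n * l) powr - (1 / 2)) \<longlongrightarrow> real n powr (1 - 1 / 2)) (at_right 0)"
      by (rule Lim_transform_eventually[OF tendsto_const])
  qed (use C in auto)
  then have "((\<lambda>t. (1 / t) powr - (1 / 2) * (Hminus_inf A x y z - Hminus A x y z t)) \<longlongrightarrow> C1 A (x - z) (y - z)) at_top"
    by (simp add: Gamma_one_half_real)
  then show ?thesis
    by (rule Lim_transform_eventually, intro eventually_mono[OF eventually_gt_at_top[of 0]])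
      (simp add: powr_minus powr_divide powr_half_sqrt)
qed

text \<open>On the logarithmic scale the convergence to the potential kernel is too fast to be seen,
  so \<open>k\<close> is 0 and only the sum contributes. This is why \<open>C2\<close> has a single
  term.\<close>

lemma rate_2:
  assumes two: "CARD('d) = 2" and yz: "y \<noteq> z"
  shows "Hminus_inf A x y z + Hminus_inf A x z y = 1"
    and "((\<lambda>l. ln (1 / l) * (Hminus_inf A x y z - hit_minus l y z x)) \<longlongrightarrow> C2 A (x - z) (y - z)) (at_right 0)"
proof -
  let ?g = "gamma_d A"
  let ?w = "\<lambda>l::real. ln (1 / l)"
  have g0: "?g > 0" by (rule gamma_d_pos)
  have w: "filterlim ?w at_top (at_right 0)" by real_asymp
  have lw: "((\<lambda>l. l * ?w l) \<longlongrightarrow> 0) (at_right 0)" by real_asymp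
  obtain C where C: "\<And>t. t > 0 \<Longrightarrow> \<bar>pF t 0\<bar> \<le> C * t powr - 1" using pF_bound'[of 1 0] two by auto
  \<comment> \<open>The decay exponent of \<open>pF\<close> is the critical value 1, which
    \<open>abelian_exp\<close> excludes. Its first moment has exponent 0 and can be treated, and
    L'Hopital's rule then gives the logarithmic divergence of \<open>gm 0 0\<close>.\<close>
  have "((\<lambda>l. l powr (1 - 0) * (\<integral>t. indicator {0..} t * (exp (- l * t) * (t * pF t 0)) \<partial>lborel)) \<longlongrightarrow> ?g * Gamma (1 - 0)) (at_right 0)"
  proof (rule abelian_exp)
    fix t :: real assume t: "t > 0"
    have "t * \<bar>pF t 0\<bar> \<le> t * (C * t powr - 1)" using t by (intro mult_left_mono C) auto
    then show "\<bar>t * pF t 0\<bar> \<le> C * t powr - 0" using t by (simp add: abs_mult powr_minus_divide)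
  next
    show "((\<lambda>t. t powr 0 * (t * pF t 0)) \<longlongrightarrow> ?g) at_top"
      by (rule Lim_transform_eventually[OF pF_limit[of 0]], intro eventually_mono[OF eventually_gt_at_top[of 0]])
        (simp add: two)
  qed auto
  then have "((\<lambda>l. l powr 1 * (\<integral>t. indicator {0..} t * (exp (- l * t) * (t * pF t 0)) \<partial>lborel)) \<longlongrightarrow> ?g) (at_right 0)" by simp
  then have I: "((\<lambda>l. (- gm 1 0 l) / (- (1 / l))) \<longlongrightarrow> ?g) (at_right 0)"
    by (rule Lim_transform_eventually)
      (use eventually_at_right_less[of 0] in \<open>auto elim!: eventually_mono simp: gm_def mult_ac\<close>)
  have "((\<lambda>l. gm 0 0 l / ?w l) \<longlongrightarrow> ?g) (at_right 0)"
  proof (rule lhopital_right_0_at_top[OF w _ _ _ I])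
    show "\<forall>\<^sub>F l::real in at_right 0. - (1 / l) \<noteq> 0"
      using eventually_at_right_less[of "0::real"] by (auto elim!: eventually_mono)
    show "\<forall>\<^sub>F l in at_right 0. (gm 0 0 has_real_derivative - gm 1 0 l) (at l)"
      using eventually_at_right_less[of "0::real"] by eventually_elim (use gm_deriv[of _ 0 0] in auto)
    show "\<forall>\<^sub>F l::real in at_right 0. ((\<lambda>l. ln (1 / l)) has_real_derivative - (1 / l)) (at l)"
      using eventually_at_right_less[of "0::real"]
      by eventually_elim (auto intro!: derivative_eq_intros simp: field_simps power2_eq_square)
  qed
  then have "((\<lambda>l. inverse (gm 0 0 l / ?w l)) \<longlongrightarrow> inverse ?g) (at_right 0)" using g0 by (intro tendsto_inverse) auto
  then have g: "((\<lambda>l. ?w l / GF l 0) \<longlongrightarrow> inverse ?g) (at_right 0)"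
    by (rule Lim_transform_eventually)
      (use eventually_at_right_less[of 0] in \<open>auto elim!: eventually_mono simp: gm_0\<close>)
  have k: "((\<lambda>l. ?w l * (pot v - (GF l 0 - GF l v))) \<longlongrightarrow> 0) (at_right 0)" for v
  proof -
    obtain C where C: "\<And>t. t > 0 \<Longrightarrow> \<bar>pF t 0 - pF t v\<bar> \<le> C * t powr - 2" using pF_diff_bound'[of v] by (auto simp: two)
    \<comment> \<open>\<open>pot_rate\<close> is geared to the exponent \<open>3 / 2\<close> of
      dimension one. The faster decay here is weakened to it with limit constant 0, using the
      trivial bound 2 for \<open>t < 1\<close>; the resulting rate \<open>sqrt l\<close> still beats
      the logarithm.\<close>
    have C': "\<bar>pF t 0 - pF t v\<bar> \<le> (\<bar>C\<bar> + 2) * t powr - (3 / 2)" if t: "t > 0" for t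
    proof (cases "t \<ge> 1")
      case True
      have "C * t powr - 2 \<le> (\<bar>C\<bar> + 2) * t powr - (3 / 2)" using True by (intro mult_mono powr_mono) auto
      then show ?thesis using C[OF t] by linarith
    next
      case False
      have "t powr 0 \<le> t powr - (3 / 2)" using False t by (intro powr_mono') auto
      then have "2 * 1 \<le> (\<bar>C\<bar> + 2) * t powr - (3 / 2)" using t by (intro mult_mono) auto
      moreover have "\<bar>pF t 0 - pF t v\<bar> \<le> 2" using abs_pF_le_1[of t 0] abs_pF_le_1[of t v] t by auto
      ultimately show ?thesis by linarith
    qed
    have "((\<lambda>t. t powr - (1 / 2) * (t powr (CARD('d) / 2 + 1) * (pF t 0 - pF t v))) \<longlongrightarrow> 0 *
      ((\<integral>u. (rvec v \<bullet> u)\<^sup>2 / 2 * exp (- (u \<bullet> (Sig *v u)) / 2) \<partial>lborel) / (2 * pi) ^ CARD('d))) at_top"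
      by (intro tendsto_mult pF_diff_limit) real_asymp
    then have "((\<lambda>t. t powr (3 / 2) * (pF t 0 - pF t v)) \<longlongrightarrow> 0) at_top"
      by (simp add: two flip: mult.assoc powr_add)
    note pr = pot_rate[OF C' this]
    have "((\<lambda>l. ln (1 / l) * sqrt l) \<longlongrightarrow> 0) (at_right (0::real))" by real_asymp
    from tendsto_mult[OF this pr]
    have "((\<lambda>l. ?w l * sqrt l * ((pot v - (GF l 0 - GF l v)) / sqrt l)) \<longlongrightarrow> 0) (at_right 0)"
      by (simp only: mult_zero_left)
    then show ?thesis
      by (rule Lim_transform_eventually)
        (use eventually_at_right_less[of 0] in \<open>auto elim!: eventually_mono\<close>)
  qed
  note hr = hit_minus_rate[OF yz w lw g k, of x]
  show "Hminus_inf A x y z + Hminus_inf A x z y = 1" by (rule hr(1))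
  have r: "rho A (y - z - (x - z)) = rho A (x - y)" using rho_minus[of "x - y"] by simp
  have alg: "(R * inverse g / (2 * c) + (P * (0 - 0) - N / c * 0) / Q) / 2 = R / (4 * c * g)" for R g c P N Q :: real
    by (cases "c = 0"; cases "g = 0") (simp_all add: field_simps)
  show "((\<lambda>l. ln (1 / l) * (Hminus_inf A x y z - hit_minus l y z x)) \<longlongrightarrow> C2 A (x - z) (y - z)) (at_right 0)"
    using hr(2) unfolding alg C2_def r .
qed

lemma tail_2:
  assumes two: "CARD('d) = 2" and yz: "y \<noteq> z" and C: "C2 A (x - z) (y - z) > 0"
  shows "((\<lambda>t. ln t * (Hminus_inf A x y z - Hminus A x y z t)) \<longlongrightarrow> C2 A (x - z) (y - z)) at_top"
proof -
  have "((\<lambda>t. ln (1 / (1 / t)) * (Hminus_inf A x y z - Hminus A x y z t)) \<longlongrightarrow> C2 A (x - z) (y - z) / Gamma 1) at_top"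
  proof (rule nu_tail_of_rate[OF yz rate_2(2)[OF two yz]])
    fix n :: nat assume n: "n \<ge> 1"
    then have "real n > 0" by simp
    then show "((\<lambda>l. ln (1 / l) / ln (1 / (real n * l))) \<longlongrightarrow> real n powr (1 - 1)) (at_right 0)"
      using n by simp real_asymp
  qed (use C in auto)
  then show ?thesis by simp
qed

lemma Hminus_inf_recurrent:
  assumes dim: "CARD('d) = 1 \<or> CARD('d) = 2" and yz: "y \<noteq> z"
  shows "Hminus_inf A x y z + Hminus_inf A x z y = 1"
    and "Hminus_inf A x y z = (rho A (x - z) + rho A (y - z) - rho A (y - x)) / (2 * rho A (y - z))"
proof -
  show s: "Hminus_inf A x y z + Hminus_inf A x z y = 1" using dim rate_1(1)[OF _ yz] rate_2(1)[OF _ yz] by blast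
  have r: "rho A (y - z) > 0" by (rule rho_pos)
  have "rho A (y - x) = rho A (x - y)" using rho_minus[of "x - y"] by simp
  moreover have "2 * Hminus_inf A x y z * rho A (y - z) = (Hminus_inf A x y z + Hminus_inf A x z y) * rho A (y - z) + (Hminus_inf A x y z - Hminus_inf A x z y) * rho A (y - z)"
    by (simp add: algebra_simps)
  ultimately show "Hminus_inf A x y z = (rho A (x - z) + rho A (y - z) - rho A (y - x)) / (2 * rho A (y - z))"
    unfolding s hit_minus_difference_tendsto[OF yz] using r by (simp add: field_simps)
qed

end

section \<open>Strict positivity of limits and constants\<close>

lemma scal1_simps [simp]: "scal1 0 = 0" "scal1 (u + v) = scal1 u + scal1 v" "scal1 (u - v) = scal1 u - scal1 v" "scal1 (- u) = - scal1 u"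
  by (simp_all add: scal1_def)

lemma scal1_inj: "CARD('n::finite) = 1 \<Longrightarrow> scal1 (u :: int^'n) = scal1 v \<longleftrightarrow> u = v"
  unfolding scal1_def vec_eq_iff by (metis UNIV_I UNIV_singleton singletonD)

lemma minus_eq_self_iff: "- s = s \<longleftrightarrow> s = 0" for s :: "int^'n"
  by (simp add: vec_eq_iff)

context random_walk
begin

lemma steps_minus: "s \<in> steps \<Longrightarrow> - s \<in> steps"
  using A_sym[of s] by (simp add: steps_def)

lemma steps_nonempty: "\<exists>s. s \<in> steps"
proof (rule ccontr)
  assume n: "\<nexists>s. s \<in> steps"
  have "v = 0" if "v \<in> generated" for v using that n by induction auto
  from this[OF generated_UNIV, of "axis (SOME i. True) 1"] show False by (simp add: axis_eq_0_iff)
qed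

text \<open>If the steps were only \<open>s\<close> and \<open>- s\<close>, every lattice point
  would be an integer multiple of \<open>s\<close>. For the unit vectors this forces dimension one
  and \<open>s\<close> of modulus 1, and since the rates sum to 0 both steps then have rate
  \<open>a / 2\<close>, the simple walk.\<close>

lemma two_steps:
  assumes nsrw: "\<not> is_srw A"
  shows "\<exists>s\<in>steps. \<exists>t\<in>steps. t \<noteq> s \<and> t \<noteq> - s"
proof (rule ccontr)
  assume neg: "\<not> (\<exists>s\<in>steps. \<exists>t\<in>steps. t \<noteq> s \<and> t \<noteq> - s)"
  obtain s where s: "s \<in> steps" using steps_nonempty by blast
  then have s0: "s \<noteq> 0" by (simp add: steps_def)
  have st: "t = s \<or> t = - s" if "t \<in> steps" for t using neg s that by blast
  have mult: "\<exists>n::int. \<forall>i. v $ i = n * s $ i" if "v \<in> generated" for v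
    using that
  proof induction
    case zero
    show ?case by (intro exI[of _ 0]) simp
  next
    case (step v t)
    then obtain n where n: "\<And>i. v $ i = n * s $ i" by blast
    from st[OF step(2)] show ?case
    proof
      assume "t = s" then show ?thesis by (intro exI[of _ "n + 1"]) (simp add: n distrib_right)
    next
      assume "t = - s" then show ?thesis by (intro exI[of _ "n - 1"]) (simp add: n left_diff_distrib)
    qed
  qed
  obtain i where i: "s $ i \<noteq> 0" using s0 by (auto simp: vec_eq_iff)
  have ax: "\<exists>n. n * s $ j = 1 \<and> (\<forall>k. k \<noteq> j \<longrightarrow> s $ k = 0)" for j
  proof -
    obtain n where n: "\<And>k. (axis j 1 :: int^'d) $ k = n * s $ k" using mult[OF generated_UNIV] by blast
    have "n * s $ j = 1" using n[of j] by (simp add: axis_def)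
    moreover from this have "s $ k = 0" if "k \<noteq> j" for k using n[of k] that by (auto simp: axis_def)
    ultimately show ?thesis by blast
  qed
  have all: "j = i" for j using ax[of j] i by auto
  then have U: "(UNIV :: 'd set) = {i}" by auto
  have one: "CARD('d) = 1" by (simp add: U)
  have si: "\<bar>scal1 s\<bar> = 1"
  proof -
    obtain n where "n * s $ (SOME i. True) = 1" using ax by blast
    then have "s $ (SOME i. True) dvd 1" by (metis dvd_triv_right)
    then show ?thesis by (simp add: scal1_def)
  qed
  have As: "A s = a / 2"
  proof -
    have inf: "infsum A UNIV = 0" using admissible by (simp add: admissible_rates_def)
    have zero: "A v = 0" if "v \<notin> {0, s, - s}" for v
      using A_nonneg[of v] st[of v] that by (force simp: steps_def)
    have "infsum A UNIV = infsum A {0, s, - s}" by (rule infsum_cong_neutral) (auto simp: zero)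
    also have "\<dots> = A 0 + (A s + A (- s))" using s0 minus_eq_self_iff[of s] by (subst infsum_finite) auto
    finally have "A 0 + (A s + A (- s)) = 0" using inf by linarith
    moreover have "A (- s) = A s" using A_sym[of s] by simp
    moreover have "a = - A 0" by (simp add: arate_def)
    ultimately show ?thesis by linarith
  qed
  have "is_srw A"
    unfolding is_srw_def
  proof (intro conjI one allI impI)
    fix v :: "int^'d" assume v: "v \<noteq> 0"
    show "A v = (if \<bar>scal1 v\<bar> = 1 then a / 2 else 0)"
    proof (cases "\<bar>scal1 v\<bar> = 1")
      case True
      then have "scal1 v = scal1 s \<or> scal1 v = scal1 (- s)" using si by auto
      then have "v = s \<or> v = - s" unfolding scal1_inj[OF one] .
      then show ?thesis using True As A_sym[of s] by auto
    next
      case False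
      then have "v \<notin> steps" using st[of v] si by auto
      then show ?thesis using False A_nonneg[of v] v by (force simp: steps_def)
    qed
  qed
  then show False using nsrw by simp
qed

text \<open>Removing one point does not disconnect the range of the walk unless the walk is simple.\<close>
lemma avoid_propagate:
  assumes nsrw: "\<not> is_srw A" and P: "\<And>w s. w \<noteq> z \<Longrightarrow> w + s \<noteq> z \<Longrightarrow> s \<in> steps \<Longrightarrow> P (w + s) \<Longrightarrow> P w"
    and y: "y \<noteq> z" "P y" and w: "w \<noteq> z"
  shows "P w"
proof -
  have iff: "P (w + s) \<longleftrightarrow> P w" if "w \<noteq> z" "w + s \<noteq> z" "s \<in> steps" for w s
    using P[of w s] P[of "w + s" "- s"] that steps_minus by auto
  obtain s t where st: "s \<in> steps" "t \<in> steps" "t \<noteq> s" "t \<noteq> - s" using two_steps[OF nsrw] by blast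
  \<comment> \<open>The neighbours \<open>z + u\<close> and \<open>z + v\<close> of the removed
    point are joined through \<open>z + u + v\<close>, which differs from \<open>z\<close> unless
    the two steps are opposite.\<close>
  have adj: "P (z + u) \<longleftrightarrow> P (z + v)" if "u \<in> steps" "v \<in> steps" "u + v \<noteq> 0" for u v
  proof -
    have "u \<noteq> 0" "v \<noteq> 0" using that by (auto simp: steps_def)
    then show ?thesis
      using iff[of "z + u" v] iff[of "z + v" u] that by (simp add: add.assoc add.commute[of v u])
  qed
  \<comment> \<open>For the opposite neighbour of \<open>z + s\<close> a detour through
    \<open>z + t\<close> is taken; here the second pair of steps is indispensable, and a simple walk
    would be cut in two.\<close>
  have nb: "P (z + u) \<longleftrightarrow> P (z + s)" if u: "u \<in> steps" for u
  proof (cases "u + s = 0")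
    case True
    then have "u + t \<noteq> 0" "t + s \<noteq> 0" using st by (auto simp: add_eq_0_iff)
    then show ?thesis using adj[of u t] adj[of t s] u st by blast
  qed (use adj u st in blast)
  have all: "v \<noteq> 0 \<longrightarrow> (P (z + v) \<longleftrightarrow> P (z + s))" if "v \<in> generated" for v
    using that
  proof induction
    case (step v u)
    show ?case
    proof
      assume vu: "v + u \<noteq> 0"
      show "P (z + (v + u)) \<longleftrightarrow> P (z + s)"
      proof (cases "v = 0")
        case True then show ?thesis using nb[OF step(2)] by simp
      next
        case False
        then show ?thesis using iff[of "z + v" u] step vu by (simp add: add.assoc)
      qed
    qed
  qed simp
  have "P (z + s)" using all[OF generated_UNIV, of "y - z"] y by simp
  then show ?thesis using all[OF generated_UNIV, of "w - z"] w by simp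
qed

text \<open>Positivity passes backwards along a step by the one-step equation, and from
  \<open>y\<close> it reaches every point off \<open>z\<close> by
  \<open>avoid_propagate\<close>.\<close>

lemma hit_pos:
  assumes nsrw: "\<not> is_srw A" and l: "l > 0" and yz: "y \<noteq> z" and w: "w \<noteq> z"
  shows "hit l y z w > 0"
proof (rule avoid_propagate[where P = "\<lambda>w. hit l y z w > 0", OF nsrw _ yz _ w])
  show "hit l y z y > 0" by (simp add: hit_target[OF l yz])
  fix w s assume w: "w \<noteq> z" "w + s \<noteq> z" and s: "s \<in> steps" and h: "hit l y z (w + s) > 0"
  show "hit l y z w > 0"
  proof (cases "w = y")
    case False
    have "A s / a * hit l y z (w + s) \<le> (\<integral>v. hit l y z (w + v) \<partial>J)"
      using hit_abs_le_1[OF l yz] hit_nonneg[OF l yz]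
      by (intro integral_J_ge_step[OF s, of "\<lambda>v. hit l y z (w + v)"] integrable_J_bounded[of _ 1]) auto
    moreover have "A s / a * hit l y z (w + s) > 0" using s h a_pos by (simp add: steps_def)
    ultimately show ?thesis using l a_pos by (simp add: hit_step[OF l yz False w(1)])
  qed (simp add: hit_target[OF l yz])
qed

lemma Hminus_inf_pos:
  assumes nsrw: "\<not> is_srw A" and yz: "y \<noteq> z"
  shows "Hminus_inf A x y z > 0"
proof -
  obtain s where s: "s \<in> steps" using steps_nonempty by blast
  \<comment> \<open>The start \<open>x\<close> may be \<open>z\<close> or a neighbour of
    \<open>z\<close>, so a first step that does not land on \<open>z\<close> is chosen; if
    \<open>s\<close> does, \<open>- s\<close> does not.\<close>
  define u where "u = (if x + s = z then - s else s)"
  have u: "u \<in> steps" using s steps_minus by (simp add: u_def)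
  have "s \<noteq> 0" using s by (simp add: steps_def)
  then have xu: "x + u \<noteq> z" using minus_eq_self_iff[of s] by (auto simp: u_def)
  have l: "(1::real) > 0" by simp
  have "A u / a * hit 1 y z (x + u) \<le> (\<integral>v. hit 1 y z (x + v) \<partial>J)"
    using hit_abs_le_1[OF l yz] hit_nonneg[OF l yz]
    by (intro integral_J_ge_step[OF u, of "\<lambda>v. hit 1 y z (x + v)"] integrable_J_bounded[of _ 1]) auto
  moreover have "A u / a * hit 1 y z (x + u) > 0" using u hit_pos[OF nsrw l yz xu] a_pos by (simp add: steps_def)
  ultimately show ?thesis using hit_minus_le_inf[OF yz l, of x] unfolding hit_minus_eq[OF l yz] by linarith
qed

text \<open>A maximum principle: on the two points the sum is 1, elsewhere it is at most
  \<open>q\<close> times its supremum, and \<open>q < 1\<close> leaves no room for a supremum above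
  1.\<close>

lemma hit_sum_le_1:
  assumes l: "l > 0" and yz: "y \<noteq> z"
  shows "hit l y z w + hit l z y w \<le> 1"
proof -
  have zy: "z \<noteq> y" using yz by simp
  let ?f = "\<lambda>w. hit l y z w + hit l z y w"
  note ab = hit_abs_le_1[OF l yz] hit_abs_le_1[OF l zy] hit_nonneg[OF l yz] hit_nonneg[OF l zy]
  have int: "integrable J (\<lambda>v. hit l y z (w + v))" "integrable J (\<lambda>v. hit l z y (w + v))" for w
    using ab by (auto intro!: integrable_J_bounded[of _ 1])
  have bdd: "bdd_above (range ?f)"
    using hit_le_1[OF l yz] hit_le_1[OF l zy] by (intro bdd_aboveI2[of _ _ 2]) (smt (verit))
  define M where "M = (SUP w. ?f w)"
  have le: "?f w \<le> M" for w unfolding M_def by (rule cSUP_upper[OF UNIV_I bdd])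
  have M0: "0 \<le> M" using le[of y] ab(3)[of y] ab(4)[of y] by linarith
  define q where "q = a / (a + l)"
  have q: "0 \<le> q" "q < 1" using l a_pos by (simp_all add: q_def)
  have "?f w \<le> max 1 (q * M)" for w
  proof (cases "w = y \<or> w = z")
    case True
    then show ?thesis using hit_target[OF l yz] hit_taboo[OF l yz] hit_target[OF l zy] hit_taboo[OF l zy] by auto
  next
    case False
    then have "?f w = q * (\<integral>v. ?f (w + v) \<partial>J)"
      using int by (simp add: hit_step[OF l yz] hit_step[OF l zy] q_def distrib_left)
    also have "\<dots> \<le> q * (\<integral>v. M \<partial>J)"
      using int q le by (intro mult_left_mono integral_mono) auto
    also have "\<dots> = q * M" using J.prob_space by simp
    finally show ?thesis by simp
  qed
  then have "M \<le> max 1 (q * M)" unfolding M_def by (intro cSUP_least) auto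
  moreover have "q * M < M" if "M > 1" using q that by simp
  ultimately have "M \<le> 1" by (smt (verit))
  then show ?thesis using le[of w] by linarith
qed

lemma Hminus_inf_sum_le_1:
  assumes yz: "y \<noteq> z"
  shows "Hminus_inf A x y z + Hminus_inf A x z y \<le> 1"
proof -
  have zy: "z \<noteq> y" using yz by simp
  have "hit_minus l y z x + hit_minus l z y x \<le> 1" if l: "l > 0" for l
  proof -
    note ab = hit_abs_le_1[OF l yz] hit_abs_le_1[OF l zy]
    have int: "integrable J (\<lambda>v. hit l y z (x + v))" "integrable J (\<lambda>v. hit l z y (x + v))"
      using ab by (auto intro!: integrable_J_bounded[of _ 1])
    have "hit_minus l y z x + hit_minus l z y x = (\<integral>v. hit l y z (x + v) + hit l z y (x + v) \<partial>J)"
      using int by (simp add: hit_minus_eq[OF l yz] hit_minus_eq[OF l zy])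
    also have "\<dots> \<le> (\<integral>v. 1 \<partial>J)" using int by (intro integral_mono hit_sum_le_1[OF l yz]) auto
    finally show ?thesis using J.prob_space by simp
  qed
  then have "\<forall>\<^sub>F l in at_right 0. hit_minus l y z x + hit_minus l z y x \<le> 1"
    by (intro eventually_mono[OF eventually_at_right_less[of 0]])
  then show ?thesis
    by (intro tendsto_upperbound[OF tendsto_add[OF hit_minus_tendsto[OF yz] hit_minus_tendsto[OF zy]]]) auto
qed

lemma Hminus_inf_in:
  assumes nsrw: "\<not> is_srw A" and yz: "y \<noteq> z"
  shows "Hminus_inf A x y z \<in> {0<..<1}"
  using Hminus_inf_pos[OF nsrw yz, of x] Hminus_inf_pos[OF nsrw yz[symmetric], of x] Hminus_inf_sum_le_1[OF yz, of x] by simp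

text \<open>Here the convention \<open>rho A 0 = 1\<close> makes the expression strictly positive at
  the end points, where the potential kernel alone would give 0.\<close>

lemma rho_degenerate:
  assumes "y \<noteq> z" "x = y \<or> x = z"
  shows "rho A (x - y) + rho A (x - z) - rho A (y - z) = 1"
  using assms rho_minus[of "y - z"] by (auto simp: rho_def[of A 0])

text \<open>The strict triangle inequality is read off from a hitting probability with permuted
  roles: up to a positive factor the expression is the probability that the walk from
  \<open>y\<close> reaches \<open>z\<close> before \<open>x\<close>.\<close>

lemma rho_triangle_recurrent:
  assumes nsrw: "\<not> is_srw A" and dim: "CARD('d) = 1 \<or> CARD('d) = 2" and yz: "y \<noteq> z"
  shows "rho A (x - y) + rho A (x - z) - rho A (y - z) > 0"
proof (cases "x = y \<or> x = z")
  case True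
  then show ?thesis using rho_degenerate[OF yz, of x] by simp
next
  case False
  then have zx: "z \<noteq> x" by blast
  have "0 < Hminus_inf A y z x * (2 * rho A (z - x))" using Hminus_inf_pos[OF nsrw zx, of y] rho_pos[of "z - x"] by simp
  also have "\<dots> = rho A (y - x) + rho A (z - x) - rho A (z - y)"
    unfolding Hminus_inf_recurrent(2)[OF dim zx] using rho_pos[of "z - x"] by simp
  finally show ?thesis
    using rho_minus[of "x - y"] rho_minus[of "x - z"] rho_minus[of "y - z"] by simp
qed

text \<open>Fatou's lemma along \<open>1 / real (Suc n)\<close> gives integrability and one
  inequality at once, without a majorant for the differences. Away from the origin there is no
  source term, and for the maximum principle the inequality is enough.\<close>

lemma pot_superharmonic:
  assumes v: "v \<noteq> 0"
  shows "integrable J (\<lambda>w. pot (v + w))" and "(\<integral>w. pot (v + w) \<partial>J) \<le> pot v"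
proof -
  let ?L = "\<lambda>n. 1 / real (Suc n)"
  have L: "filterlim ?L (at_right 0) sequentially" by real_asymp
  have Lpos: "?L n > 0" for n by simp
  have D0: "0 \<le> GF l 0 - GF l u" and B: "\<bar>GF l u\<bar> \<le> GF l 0" if l: "l > 0" for l u
  proof -
    have p: "1 / (l + 2 * a) > 0" using l a_pos by simp
    have e: "(axis (SOME i. True) 1 :: int^'d) \<noteq> 0" by (simp add: axis_eq_0_iff)
    have G: "GF l 0 \<ge> 0" using GF_add_ge[OF l e] GF_diff_ge[OF l e] p by linarith
    show "0 \<le> GF l 0 - GF l u"
    proof (cases "u = 0")
      case False
      then show ?thesis using GF_diff_ge[OF l False] p by linarith
    qed simp
    show "\<bar>GF l u\<bar> \<le> GF l 0"
    proof (cases "u = 0")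
      case False
      then show ?thesis using GF_diff_ge[OF l False] GF_add_ge[OF l False] p by linarith
    qed (use G in simp)
  qed
  have "(\<integral>\<^sup>+w. ennreal (pot (v + w)) \<partial>J) = (\<integral>\<^sup>+w. liminf (\<lambda>n. ennreal (GF (?L n) 0 - GF (?L n) (v + w))) \<partial>J)"
  proof (rule nn_integral_cong)
    fix w
    have "(\<lambda>n. ennreal (GF (?L n) 0 - GF (?L n) (v + w))) \<longlonglongrightarrow> ennreal (pot (v + w))"
      by (intro tendsto_ennrealI filterlim_compose[OF GF_diff_tendsto L])
    from lim_imp_Liminf[OF _ this] show "ennreal (pot (v + w)) = liminf (\<lambda>n. ennreal (GF (?L n) 0 - GF (?L n) (v + w)))" by simp
  qed
  also have "\<dots> \<le> liminf (\<lambda>n. \<integral>\<^sup>+w. ennreal (GF (?L n) 0 - GF (?L n) (v + w)) \<partial>J)"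
    by (rule nn_integral_liminf) simp
  also have "\<dots> = liminf (\<lambda>n. ennreal (GF (?L n) 0 - Ab (?L n) v))"
  proof (rule arg_cong[of _ _ liminf], rule ext)
    fix n
    have int: "integrable J (\<lambda>w. GF (?L n) (v + w))" by (rule integrable_J_bounded[OF B[OF Lpos]])
    have "(\<integral>\<^sup>+w. ennreal (GF (?L n) 0 - GF (?L n) (v + w)) \<partial>J) = ennreal (\<integral>w. GF (?L n) 0 - GF (?L n) (v + w) \<partial>J)"
      using int D0[OF Lpos] by (intro nn_integral_eq_integral Bochner_Integration.integrable_diff) auto
    also have "(\<integral>w. GF (?L n) 0 - GF (?L n) (v + w) \<partial>J) = GF (?L n) 0 - Ab (?L n) v"
      using int J.prob_space unfolding Ab_J[OF Lpos] by simp
    finally show "(\<integral>\<^sup>+w. ennreal (GF (?L n) 0 - GF (?L n) (v + w)) \<partial>J) = ennreal (GF (?L n) 0 - Ab (?L n) v)" .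
  qed
  also have "\<dots> = ennreal (rho A v / a)"
    by (intro lim_imp_Liminf tendsto_ennrealI filterlim_compose[OF Ab_tendsto L]) simp
  also have "rho A v / a = pot v" using v a_pos by (simp add: rho_pot)
  finally have le: "(\<integral>\<^sup>+w. ennreal (pot (v + w)) \<partial>J) \<le> ennreal (pot v)" .
  show int: "integrable J (\<lambda>w. pot (v + w))"
    using le by (intro integrableI_nonneg) (auto simp: pot_nonneg order_le_less_trans)
  show "(\<integral>w. pot (v + w) \<partial>J) \<le> pot v"
    using le nn_integral_eq_integral[OF int] by (simp add: pot_nonneg)
qed

lemma scal1_mean:
  assumes one: "CARD('d) = 1"
  shows "integrable J (\<lambda>w. real_of_int (scal1 w))" "(\<integral>w. real_of_int (scal1 w) \<partial>J) = 0"
proof -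
  have eq: "rvec w \<bullet> axis (SOME i. True) 1 = real_of_int (scal1 w)" for w by (simp add: inner_axis scal1_def)
  show int: "integrable J (\<lambda>w. real_of_int (scal1 w))"
    using integrable_lin_J[of "axis (SOME i. True) 1"] unfolding eq .
  have "(\<integral>w. real_of_int (scal1 (- w)) \<partial>J) = (\<integral>w. real_of_int (scal1 w) \<partial>J)"
    by (rule integral_J_reflect(1)[OF int])
  then show "(\<integral>w. real_of_int (scal1 w) \<partial>J) = 0" by simp
qed

lemma finite_scal1_le: "CARD('d) = 1 \<Longrightarrow> finite {v :: int^'d. real_of_int \<bar>scal1 v\<bar> \<le> B}"
proof (rule finite_imageD[of scal1])
  show "finite (scal1 ` {v :: int^'d. real_of_int \<bar>scal1 v\<bar> \<le> B})"
    by (rule finite_subset[of _ "{- \<lfloor>B\<rfloor>..\<lfloor>B\<rfloor>}"]) (auto simp: le_floor_iff abs_le_iff minus_le_iff[of "\<lfloor>B\<rfloor>"])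
qed (auto simp: inj_on_def scal1_inj)

text \<open>Up to a positive factor, \<open>C1 A X y\<close> as a function of \<open>X\<close> is a
  combination of potential kernels centred at 0 and at \<open>y\<close> plus a linear term. Off
  these two points it is nonnegative and superharmonic, so a zero spreads along every step. Its zero
  set is finite because the kernels outgrow the linear term. A walk that is not simple cannot be
  confined to a finite set whose only exits are the two points 0 and \<open>y\<close>.\<close>

lemma C1_pos:
  assumes nsrw: "\<not> is_srw A" and one: "CARD('d) = 1" and y: "y \<noteq> 0"
  shows "C1 A x y > 0"
proof -
  define \<beta> where "\<beta> = 2 * a * pi * (gamma_d A)\<^sup>2"
  have g0: "gamma_d A > 0" by (rule gamma_d_pos)
  have \<beta>: "\<beta> > 0" using g0 a_pos by (simp add: \<beta>_def)
  define k where "k = 4 * a * pi * gamma_d A"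
  have k: "k > 0" using g0 a_pos by (simp add: k_def)
  define sl where "sl y = \<beta> * real_of_int (scal1 y) / rho A y" for y
  \<comment> \<open>\<open>C1\<close> multiplied by \<open>k\<close>, with the cube of
    \<open>gamma_d A\<close> absorbed into the slope \<open>sl y\<close>. The weights
    \<open>1 + s^2\<close> and \<open>1 - s^2\<close> of the two kernels are nonnegative as soon as
    the slope is at most 1 in modulus.\<close>
  define F where "F y X = (1 + (sl y)\<^sup>2) * rho A (y - X) + (1 - (sl y)\<^sup>2) * rho A X - (1 + (sl y)\<^sup>2) * rho A y + 2 * sl y * \<beta> * real_of_int (scal1 X)" for y X
  have FC: "F y X = k * C1 A X y" for y X
  proof -
    have alg: "(1 + (b * Y / r)\<^sup>2) * u + (1 - (b * Y / r)\<^sup>2) * w - (1 + (b * Y / r)\<^sup>2) * r + 2 * (b * Y / r) * b * X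
       = k * ((u + w - r) / k + (b\<^sup>2 / k) * Y\<^sup>2 * (u - w - r) / r\<^sup>2 + 2 * (b\<^sup>2 / k) * X * Y / r)" if "k > 0" "r > 0" for b Y r u w X k :: real
      using that by (simp add: field_simps power2_eq_square)
    have bk: "a * pi * gamma_d A ^ 3 = \<beta>\<^sup>2 / k" using g0 a_pos by (simp add: \<beta>_def k_def power2_eq_square power3_eq_cube)
    have "C1 A X y = (rho A (y - X) + rho A X - rho A y) / k + (a * pi * gamma_d A ^ 3) * (real_of_int (scal1 y))\<^sup>2 * (rho A (y - X) - rho A X - rho A y) / (rho A y)\<^sup>2
       + 2 * (a * pi * gamma_d A ^ 3) * real_of_int (scal1 X) * real_of_int (scal1 y) / rho A y"
      by (simp add: C1_def Let_def k_def mult_ac)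
    then show ?thesis unfolding F_def sl_def bk by (simp only: alg[OF k rho_pos])
  qed
  have Fnn: "F y X \<ge> 0" if "y \<noteq> 0" for y X using C1_nonneg[OF one that, of X] k by (simp add: FC)
  \<comment> \<open>At \<open>X = 0\<close> the two terms with \<open>rho A y\<close> cancel and the
    value is \<open>1 - (sl v)\<^sup>2\<close>; nonnegativity therefore bounds the slope, which
    amounts to linear growth of \<open>rho A\<close> from below.\<close>
  have \<beta>_le: "\<beta> * \<bar>real_of_int (scal1 v)\<bar> \<le> rho A v" if "v \<noteq> 0" for v
  proof -
    have r: "rho A v > 0" by (rule rho_pos)
    have "(sl v)\<^sup>2 \<le> 1" using Fnn[OF that, of 0] by (simp add: F_def rho_def[of A 0])
    then have "\<bar>sl v\<bar> \<le> 1" by (simp add: abs_square_le_1)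
    then show ?thesis using r \<beta> by (simp add: sl_def abs_mult field_simps)
  qed
  define s where "s = sl y"
  define r where "r = rho A y"
  have r: "r > 0" unfolding r_def by (rule rho_pos)
  \<comment> \<open>Strictness comes from doubling: by the strict triangle inequality
    \<open>rho A (y + y)\<close> is less than twice \<open>rho A y\<close>, while the linear lower
    bound doubles exactly.\<close>
  have yy: "y + y \<noteq> 0" using y minus_eq_self_iff[of y] by (auto simp: add_eq_0_iff)
  have "rho A (y - 0) + rho A (y - (y + y)) - rho A (0 - (y + y)) > 0"
    using nsrw one yy by (intro rho_triangle_recurrent) (auto simp del: add_0)
  moreover have a2: "\<bar>Y + Y\<bar> = 2 * \<bar>Y\<bar>" for Y :: real by (simp add: abs_if)
  ultimately have "rho A (y + y) < 2 * r" using rho_minus[of y] rho_minus[of "y + y"] by (simp add: r_def)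
  then have "\<beta> * \<bar>real_of_int (scal1 y)\<bar> < r" using \<beta>_le[OF yy] unfolding scal1_simps of_int_add a2 by linarith
  then have s1: "\<bar>s\<bar> < 1" using r \<beta> by (simp add: s_def sl_def abs_mult r_def)
  then have s2: "s\<^sup>2 < 1" by (simp add: abs_square_less_1)
  have sy: "\<beta> * real_of_int (scal1 y) = s * r" using r by (simp add: s_def sl_def r_def)
  \<comment> \<open>\<open>\<alpha>\<close> agrees with \<open>rho A\<close> except at the origin,
    where it is 0 and not 1. The modified function \<open>F0\<close> is superharmonic off 0 and
    \<open>y\<close> and vanishes at these two points.\<close>
  define \<alpha> where "\<alpha> v = a * pot v" for v
  have \<alpha>0: "\<alpha> 0 = 0" and \<alpha>_rho: "v \<noteq> 0 \<Longrightarrow> rho A v = \<alpha> v" for v by (simp_all add: \<alpha>_def rho_pot)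
  have \<alpha>_minus: "\<alpha> (- v) = \<alpha> v" for v by (simp add: \<alpha>_def pot_minus)
  have \<alpha>_ge: "\<alpha> v \<ge> \<beta> * \<bar>real_of_int (scal1 v)\<bar>" for v
    using \<beta>_le[of v] by (cases "v = 0") (auto simp: \<alpha>0 \<alpha>_rho)
  define F0 where "F0 X = (1 + s\<^sup>2) * \<alpha> (X - y) + (1 - s\<^sup>2) * \<alpha> X - (1 + s\<^sup>2) * r + 2 * s * \<beta> * real_of_int (scal1 X)" for X
  have F0F: "F0 X = F y X" if "X \<noteq> 0" "X \<noteq> y" for X
    using that \<alpha>_minus[of "y - X"] by (simp add: F0_def F_def s_def[symmetric] r_def[symmetric] \<alpha>_rho)
  have \<alpha>y: "\<alpha> y = r" using y by (simp add: r_def \<alpha>_rho)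
  have F00: "F0 0 = 0" using \<alpha>_minus[of y] by (simp add: F0_def \<alpha>0 \<alpha>y)
  have F0y: "F0 y = 0"
  proof -
    have "F0 y = (1 - s\<^sup>2) * r - (1 + s\<^sup>2) * r + 2 * s * (\<beta> * real_of_int (scal1 y))" by (simp add: F0_def \<alpha>0 \<alpha>y)
    then show ?thesis unfolding sy by (simp add: algebra_simps power2_eq_square)
  qed
  have F0nn: "F0 X \<ge> 0" for X using Fnn[OF y, of X] F00 F0y F0F[of X] by (cases "X = 0 \<or> X = y") auto
  \<comment> \<open>The jump average of \<open>F0\<close> is at most its value 0 at
    \<open>v\<close>, because the linear part has mean increment 0. Since \<open>F0\<close> is
    nonnegative, every single step must lead to a zero.\<close>
  have closed: "F0 (v + t) = 0" if v: "F0 v = 0" "v \<noteq> 0" "v \<noteq> y" and t: "t \<in> steps" for v t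
  proof -
    have vy: "v - y \<noteq> 0" using v by simp
    note p = pot_superharmonic[OF v(2)] pot_superharmonic[OF vy] scal1_mean[OF one]
    have eq: "F0 (v + w) = (1 + s\<^sup>2) * a * pot (v - y + w) + (1 - s\<^sup>2) * a * pot (v + w) + (2 * s * \<beta>) * real_of_int (scal1 w) + (2 * s * \<beta> * real_of_int (scal1 v) - (1 + s\<^sup>2) * r)" for w
      by (simp add: F0_def \<alpha>_def algebra_simps)
    have int: "integrable J (\<lambda>w. F0 (v + w))"
      unfolding eq using p by (intro Bochner_Integration.integrable_add integrable_mult_right) auto
    have "(\<integral>w. F0 (v + w) \<partial>J) = (1 + s\<^sup>2) * a * (\<integral>w. pot (v - y + w) \<partial>J) + (1 - s\<^sup>2) * a * (\<integral>w. pot (v + w) \<partial>J) + (2 * s * \<beta> * real_of_int (scal1 v) - (1 + s\<^sup>2) * r)"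
      unfolding eq using p J.prob_space by (simp add: p(6))
    also have "\<dots> \<le> (1 + s\<^sup>2) * a * pot (v - y) + (1 - s\<^sup>2) * a * pot v + (2 * s * \<beta> * real_of_int (scal1 v) - (1 + s\<^sup>2) * r)"
      using p s2 a_pos by (intro add_right_mono add_mono mult_left_mono) auto
    also have "\<dots> = F0 v" by (simp add: F0_def \<alpha>_def)
    finally have "(\<integral>w. F0 (v + w) \<partial>J) \<le> 0" using v by simp
    moreover have "A t / a * F0 (v + t) \<le> (\<integral>w. F0 (v + w) \<partial>J)"
      by (rule integral_J_ge_step[OF t int]) (rule F0nn)
    ultimately have "A t / a * F0 (v + t) \<le> 0" by linarith
    moreover have "A t / a > 0" using t a_pos by (simp add: steps_def)
    ultimately have "F0 (v + t) \<le> 0" by (meson mult_pos_pos not_less)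
    then show ?thesis using F0nn[of "v + t"] by simp
  qed
  \<comment> \<open>At distance \<open>x\<close> the two kernels contribute at least
    \<open>2 * \<beta> * x\<close> up to a constant and the linear term removes at most
    \<open>2 * \<bar>s\<bar> * \<beta> * x\<close>; solving for \<open>x\<close> at a zero gives
    this bound.\<close>
  define B where "B = ((1 + s\<^sup>2) * r + (1 + s\<^sup>2) * \<beta> * \<bar>real_of_int (scal1 y)\<bar>) / (2 * \<beta> * (1 - \<bar>s\<bar>))"
  have fin: "finite {v. F0 v = 0}"
  proof (rule finite_subset[OF _ finite_scal1_le[OF one, of B]], rule, simp only: mem_Collect_eq)
    fix v assume v: "F0 v = 0"
    let ?x = "\<bar>real_of_int (scal1 v)\<bar>" and ?y = "\<bar>real_of_int (scal1 y)\<bar>"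
    have "\<beta> * (?x - ?y) \<le> \<beta> * \<bar>real_of_int (scal1 (v - y))\<bar>" using \<beta> by (intro mult_left_mono) auto
    then have "\<beta> * (?x - ?y) \<le> \<alpha> (v - y)" using \<alpha>_ge[of "v - y"] by linarith
    then have "(1 + s\<^sup>2) * (\<beta> * (?x - ?y)) \<le> (1 + s\<^sup>2) * \<alpha> (v - y)" by (intro mult_left_mono) auto
    moreover have "(1 - s\<^sup>2) * (\<beta> * ?x) \<le> (1 - s\<^sup>2) * \<alpha> v" using \<alpha>_ge[of v] s2 by (intro mult_left_mono) auto
    moreover have "\<bar>2 * s * \<beta> * real_of_int (scal1 v)\<bar> = 2 * \<bar>s\<bar> * \<beta> * ?x" using \<beta> by (simp add: abs_mult)
    ultimately have "(1 + s\<^sup>2) * (\<beta> * (?x - ?y)) + (1 - s\<^sup>2) * (\<beta> * ?x) - (1 + s\<^sup>2) * r - 2 * \<bar>s\<bar> * \<beta> * ?x \<le> 0"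
      using v unfolding F0_def by linarith
    then have "?x * (2 * \<beta> * (1 - \<bar>s\<bar>)) \<le> (1 + s\<^sup>2) * r + (1 + s\<^sup>2) * \<beta> * ?y"
      by (simp add: algebra_simps)
    moreover have "2 * \<beta> * (1 - \<bar>s\<bar>) > 0" using \<beta> s1 by simp
    ultimately have "?x \<le> B" unfolding B_def by (simp only: pos_le_divide_eq)
    then show "real_of_int \<bar>scal1 v\<bar> \<le> B" by simp
  qed
  have noint: "F0 X \<noteq> 0" if X: "X \<noteq> 0" "X \<noteq> y" for X
  proof
    assume F: "F0 X = 0"
    define W where "W = {v. F0 v = 0} - {0, y}"
    have W: "finite W" "X \<in> W" using fin X F by (auto simp: W_def)
    obtain u t where ut: "u \<in> steps" "t \<in> steps" "t \<noteq> u" "t \<noteq> - u" using two_steps[OF nsrw] by blast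
    \<comment> \<open>The upward version of a step. The two steps \<open>u\<close> and
      \<open>t\<close> are neither equal nor opposite, so they yield two different upward
      steps.\<close>
    define p where "p v = (if scal1 v > 0 then v else - v)" for v :: "int^'d"
    have p: "p v \<in> steps" "scal1 (p v) > 0" if "v \<in> steps" for v
    proof -
      show "p v \<in> steps" using that steps_minus by (simp add: p_def)
      have "scal1 v \<noteq> scal1 (0 :: int^'d)" using that unfolding scal1_inj[OF one] by (simp add: steps_def)
      then show "scal1 (p v) > 0" by (auto simp: p_def)
    qed
    have pne: "p u \<noteq> p t" using ut by (auto simp: p_def)
    have next_W: "v + t = 0 \<or> v + t = y" if "v \<in> W" "t \<in> steps" "v + t \<notin> W" for v t
      using closed[of v t] that by (auto simp: W_def)
    have fW: "finite (scal1 ` W)" "scal1 ` W \<noteq> {}" using W by auto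
    obtain v1 where v1: "v1 \<in> W" "scal1 v1 = Max (scal1 ` W)" using Max_in[OF fW] by auto
    obtain v2 where v2: "v2 \<in> W" "scal1 v2 = Min (scal1 ` W)" using Min_in[OF fW] by auto
    have up: "v1 + q \<notin> W" if "scal1 q > 0" for q
    proof
      assume "v1 + q \<in> W"
      then have "scal1 (v1 + q) \<le> scal1 v1" unfolding v1(2) by (intro Max_ge fW(1) imageI)
      then show False using that by simp
    qed
    \<comment> \<open>From the highest point \<open>v1\<close> of \<open>W\<close> two different
      upward steps must lead onto 0 and \<open>y\<close>, so both lie above \<open>v1\<close>. From
      the lowest point \<open>v2\<close> a downward step must also hit 0 or \<open>y\<close>, which
      would then lie below \<open>v2\<close>: a contradiction.\<close>
    have "v2 + - p u \<notin> W"
    proof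
      assume "v2 + - p u \<in> W"
      then have "scal1 v2 \<le> scal1 (v2 + - p u)" unfolding v2(2) by (intro Min_le fW(1) imageI)
      then show False using p[OF ut(1)] by simp
    qed
    then have d: "v2 + - p u = 0 \<or> v2 + - p u = y" using next_W[of v2 "- p u"] v2 p[OF ut(1)] steps_minus by blast
    have "v1 + p u = 0 \<or> v1 + p u = y" "v1 + p t = 0 \<or> v1 + p t = y"
      using next_W[of v1 "p u"] next_W[of v1 "p t"] up v1 p ut by blast+
    moreover have "v1 + p u \<noteq> v1 + p t" using pne by simp
    ultimately have "{v1 + p u, v1 + p t} = {0, y}" by (metis insert_commute)
    then have "scal1 v1 < scal1 (0 :: int^'d)" "scal1 v1 < scal1 y" using p[OF ut(1)] p[OF ut(2)]
      by (metis insert_iff empty_iff less_add_same_cancel1 scal1_simps(2))+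
    moreover have "scal1 v2 \<le> scal1 v1" unfolding v2(2) using v1 fW by (intro Min_le) auto
    moreover have "scal1 (v2 + - p u) < scal1 v2" using p[OF ut(1)] by simp
    ultimately have "scal1 (v2 + - p u) < scal1 (0 :: int^'d)" "scal1 (v2 + - p u) < scal1 y" by linarith+
    then show False using d by (metis less_irrefl)
  qed
  have "F y x > 0"
  proof -
    consider "x = 0" | "x \<noteq> 0" "x = y" | "x \<noteq> 0" "x \<noteq> y" by blast
    then show ?thesis
    proof cases
      case 1
      then show ?thesis using s2 by (simp add: F_def s_def rho_def[of A 0])
    next
      case 2
      have "F y x = (1 + s\<^sup>2) + (1 - s\<^sup>2) * r - (1 + s\<^sup>2) * r + 2 * s * (\<beta> * real_of_int (scal1 y))"
        using 2 by (simp add: F_def s_def r_def rho_def[of A 0])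
      also have "\<dots> = 1 + s\<^sup>2" unfolding sy by (simp add: algebra_simps power2_eq_square)
      finally show ?thesis by (simp add: add_pos_nonneg)
    next
      case 3
      then show ?thesis using F0nn[of x] noint[OF 3] F0F[OF 3] by simp
    qed
  qed
  then show ?thesis using k by (simp add: FC zero_less_mult_iff)
qed

end

section \<open>Limits and the strict triangle inequality in the transient case\<close>

context transient_walk
begin

lemma G0_minus: "G0 (- v) = G0 v"
  by (simp add: G0_def pF_minus)

lemma Hminus_inf_transient:
  assumes yz: "y \<noteq> z"
  shows "Hminus_inf A x y z = (G0 0 * rho A (y - z) - G0 0 * rho A (y - x) + G0 (y - z) * rho A (x - z)) / (rho A (y - z) * (G0 0 + G0 (y - z)))"
proof -
  have v: "y - z \<noteq> 0" using yz by simp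
  let ?Hy = "Hminus_inf A x y z" and ?Hz = "Hminus_inf A x z y"
  define r G D where "r = rho A (y - z)" and "G = G0 0" and "D = G0 (y - z)"
  have r: "r > 0" "G + D > 0" unfolding r_def G_def D_def using rho_pos G0_add_pos[OF v] by auto
  have ra: "r / a = G - D" using v a_pos by (simp add: r_def G_def D_def rho_pot pot_G0)
  have s: "(?Hy + ?Hz) * (G + D) = 2 * G - (rho A (x - y) + rho A (x - z)) / a"
    unfolding G_def D_def by (rule Hminus_inf_sum[OF yz])
  have d: "(?Hy - ?Hz) * r = rho A (x - z) - rho A (x - y)" unfolding r_def by (rule hit_minus_difference_tendsto[OF yz])
  have "2 * (?Hy * (r * (G + D))) = ((?Hy + ?Hz) * (G + D)) * r + ((?Hy - ?Hz) * r) * (G + D)" by (simp add: algebra_simps)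
  also have "\<dots> = 2 * G * r - (rho A (x - y) + rho A (x - z)) * (r / a) + (rho A (x - z) - rho A (x - y)) * (G + D)"
    unfolding s d by (simp add: left_diff_distrib)
  also have "\<dots> = 2 * (G * r - G * rho A (x - y) + D * rho A (x - z))" unfolding ra by (simp add: algebra_simps)
  finally have "?Hy * (r * (G + D)) = G * r - G * rho A (x - y) + D * rho A (x - z)" by simp
  moreover have "rho A (y - x) = rho A (x - y)" using rho_minus[of "x - y"] by simp
  ultimately show ?thesis using r unfolding r_def[symmetric] G_def[symmetric] D_def[symmetric] by (simp add: eq_divide_eq)
qed

text \<open>As in the recurrent case, from a positive hitting probability with permuted roles. Its
  numerator carries unequal weights; since \<open>G0 (z - x)\<close> is at most \<open>G0 0\<close>,
  replacing it by \<open>G0 0\<close> only increases the expression and lets the common factor be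
  divided out.\<close>

lemma rho_triangle_transient:
  assumes nsrw: "\<not> is_srw A" and yz: "y \<noteq> z"
  shows "rho A (x - y) + rho A (x - z) - rho A (y - z) > 0"
proof (cases "x = y \<or> x = z")
  case True
  then show ?thesis using rho_degenerate[OF yz, of x] by simp
next
  case False
  then have zx: "z \<noteq> x" by blast
  then have v: "z - x \<noteq> 0" by simp
  have r: "rho A (z - x) * (G0 0 + G0 (z - x)) > 0" using rho_pos G0_add_pos[OF v] by simp
  have "0 < Hminus_inf A y z x * (rho A (z - x) * (G0 0 + G0 (z - x)))" using Hminus_inf_pos[OF nsrw zx, of y] r by (rule mult_pos_pos)
  also have "\<dots> = G0 0 * rho A (z - x) - G0 0 * rho A (z - y) + G0 (z - x) * rho A (y - x)"
    unfolding Hminus_inf_transient[OF zx] using r by (metis less_irrefl nonzero_divide_eq_eq)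
  also have "\<dots> \<le> G0 0 * rho A (z - x) - G0 0 * rho A (z - y) + G0 0 * rho A (y - x)"
    using pot_nonneg[of "z - x"] rho_pos[of "y - x"] by (intro add_left_mono mult_right_mono) (auto simp: pot_G0)
  also have "\<dots> = G0 0 * (rho A (y - x) + rho A (z - x) - rho A (z - y))" by (simp add: algebra_simps)
  finally have "0 < G0 0 * (rho A (y - x) + rho A (z - x) - rho A (z - y))" .
  moreover have "G0 0 > 0" using G0_add_pos[OF v] pot_nonneg[of "z - x"] by (simp add: pot_G0)
  ultimately have "0 < rho A (y - x) + rho A (z - x) - rho A (z - y)" by (simp add: zero_less_mult_iff)
  then show ?thesis
    using rho_minus[of "x - y"] rho_minus[of "x - z"] rho_minus[of "y - z"] by simp
qed

end

section \<open>From scaled limits to asymptotic equivalence\<close>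

lemma asymp_equiv_of_scaled:
  fixes f w :: "real \<Rightarrow> real"
  assumes lim: "((\<lambda>t. w t * f t) \<longlongrightarrow> C) at_top" and C: "C \<noteq> 0"
  shows "f \<sim>[at_top] (\<lambda>t. C / w t)"
proof (rule asymp_equivI')
  have "((\<lambda>t. w t * f t / C) \<longlongrightarrow> C / C) at_top" by (intro tendsto_divide lim tendsto_const C)
  then show "((\<lambda>t. f t / (C / w t)) \<longlongrightarrow> 1) at_top" using C by (simp add: mult.commute)
qed

context random_walk
begin

lemma tail_equiv_1:
  assumes one: "CARD('d) = 1" and yz: "y \<noteq> z" and C: "C1 A (x - z) (y - z) > 0"
  shows "(\<lambda>t. Hminus_inf A x y z - Hminus A x y z t) \<sim>[at_top] (\<lambda>t. C1 A (x - z) (y - z) / sqrt t)"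
  by (rule asymp_equiv_of_scaled[OF tail_1[OF one yz C]]) (use C in simp)

lemma tail_equiv_2:
  assumes nsrw: "\<not> is_srw A" and two: "CARD('d) = 2" and yz: "y \<noteq> z"
  shows "(\<lambda>t. Hminus_inf A x y z - Hminus A x y z t) \<sim>[at_top] (\<lambda>t. C2 A (x - z) (y - z) / ln t)"
proof -
  have "rho A (y - z - (x - z)) = rho A (x - y)" using rho_minus[of "x - y"] by simp
  then have C: "C2 A (x - z) (y - z) > 0"
    using rho_triangle_recurrent[OF nsrw _ yz, of x] two gamma_d_pos a_pos by (simp add: C2_def)
  show ?thesis by (rule asymp_equiv_of_scaled[OF tail_2[OF two yz C]]) (use C in simp)
qed

section \<open>The simple random walk on the line\<close>

definition e1 :: "int^'d" where "e1 = axis (SOME i. True) 1"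

lemma scal1_e1 [simp]: "scal1 e1 = 1"
  by (simp add: e1_def scal1_def)

context
  assumes srw: "is_srw A"
begin

lemma srw_one: "CARD('d) = 1"
  using srw by (simp add: is_srw_def)

lemma srw_e1: "v \<noteq> 0 \<Longrightarrow> A v = (if v = e1 \<or> v = - e1 then a / 2 else 0)"
proof -
  assume v: "v \<noteq> 0"
  have "v = e1 \<or> v = - e1 \<longleftrightarrow> \<bar>scal1 v\<bar> = 1"
    unfolding scal1_inj[OF srw_one, symmetric] by auto
  then show ?thesis using srw v by (simp add: is_srw_def)
qed

lemma e1_neq: "e1 \<noteq> 0" "- e1 \<noteq> 0" "e1 \<noteq> - e1"
  unfolding scal1_inj[OF srw_one, symmetric] by simp_all

lemma srw_AE_J: "AE v in J. v = e1 \<or> v = - e1"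
  using AE_J_steps by eventually_elim (auto simp: steps_def srw_e1 split: if_splits)

lemma srw_integrable_J: "integrable J (f :: int^'d \<Rightarrow> real)"
proof (rule J.integrable_const_bound[of _ "\<bar>f e1\<bar> + \<bar>f (- e1)\<bar>"])
  show "AE v in J. norm (f v) \<le> \<bar>f e1\<bar> + \<bar>f (- e1)\<bar>" using srw_AE_J by eventually_elim auto
qed simp

lemma srw_integral_J:
  fixes f :: "int^'d \<Rightarrow> real"
  shows "(\<integral>v. f v \<partial>J) = (f e1 + f (- e1)) / 2"
proof -
  have zero: "A v * f v = 0" if "v \<notin> {0, e1, - e1}" for v using that by (simp add: srw_e1)
  have sub: "{v \<in> UNIV. A v * f v \<noteq> 0} \<subseteq> {0, e1, - e1}" using zero by blast
  have "(\<integral>v. A v * f v \<partial>count_space UNIV) = (\<Sum>v | v \<in> UNIV \<and> A v * f v \<noteq> 0. A v * f v)"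
    by (rule lebesgue_integral_count_space_finite_support) (rule finite_subset[OF sub], simp)
  also have "\<dots> = (\<Sum>v\<in>{0, e1, - e1}. A v * f v)"
    using sub by (intro sum.mono_neutral_left) auto
  also have "\<dots> = A 0 * f 0 + (A e1 * f e1 + A (- e1) * f (- e1))" using e1_neq by simp
  also have "\<dots> = - a * f 0 + a / 2 * (f e1 + f (- e1))" using e1_neq by (simp add: srw_e1 arate_def field_simps)
  finally have "a * (\<integral>v. f v \<partial>J) = a * ((f e1 + f (- e1)) / 2)"
    using integral_J(2)[OF srw_integrable_J[of f]] by simp
  then show ?thesis using a_pos by simp
qed

lemma srw_gamma: "gamma_d A = 1 / sqrt (2 * pi * a)"
  unfolding gamma_1(1)[OF srw_one] by (simp add: var1_def srw_integral_J)

text \<open>The average over a jump of the differences of \<open>GF\<close> is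
  \<open>GF l 0 - Ab l v\<close>, so in the limit the discrete Laplace equation for the potential
  appears, with its source at the origin hidden in \<open>rho A 0 = 1\<close>.\<close>

lemma srw_pot: "(pot (v + e1) + pot (v - e1)) / 2 = rho A v / a"
proof -
  have 1: "((\<lambda>l. ((GF l 0 - GF l (v + e1)) + (GF l 0 - GF l (v - e1))) / 2) \<longlongrightarrow> (pot (v + e1) + pot (v - e1)) / 2) (at_right 0)"
    by (intro tendsto_divide tendsto_add GF_diff_tendsto tendsto_const) simp
  have "\<forall>\<^sub>F l in at_right 0. ((GF l 0 - GF l (v + e1)) + (GF l 0 - GF l (v - e1))) / 2 = GF l 0 - Ab l v"
    by (rule eventually_mono[OF eventually_at_right_less[of 0]]) (simp add: Ab_J srw_integral_J field_simps)
  from tendsto_unique[OF trivial_limit_at_right_real Lim_transform_eventually[OF 1 this] Ab_tendsto] show ?thesis .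
qed

text \<open>The discrete Laplace equation is a second-order recursion, so the induction carries two
  consecutive values. They start from \<open>pot 0 = 0\<close> and from the value at
  \<open>e1\<close>, which symmetry and the source term determine.\<close>

lemma srw_rho: "v \<noteq> 0 \<Longrightarrow> rho A v = real_of_int \<bar>scal1 v\<bar>"
proof -
  have ind: "(\<forall>v. scal1 v = int n \<longrightarrow> a * pot v = n) \<and> (\<forall>v. scal1 v = int (Suc n) \<longrightarrow> a * pot v = Suc n)" for n
  proof (induction n)
    case 0
    have "a * pot v = 0" if "scal1 v = 0" for v
    proof -
      have "v = 0" using that scal1_inj[OF srw_one, of v 0] by simp
      then show ?thesis by simp
    qed
    moreover have "a * pot v = 1" if "scal1 v = 1" for v
    proof -
      have v: "v = e1" using that scal1_inj[OF srw_one, of v e1] by simp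
      have "pot (- e1) = pot e1" by (rule pot_minus)
      then show ?thesis using srw_pot[of 0] a_pos unfolding v by (simp add: rho_def[of A 0] field_simps)
    qed
    ultimately show ?case by auto
  next
    case (Suc n)
    have "a * pot v = Suc (Suc n)" if v: "scal1 v = int (Suc (Suc n))" for v
    proof -
      have "scal1 (v - e1) = int (Suc n)" "scal1 (v - e1 - e1) = int n" unfolding scal1_simps scal1_e1 using v by simp_all
      then have h: "a * pot (v - e1) = Suc n" "a * pot (v - e1 - e1) = n" using Suc by blast+
      have "v - e1 \<noteq> 0" unfolding scal1_inj[OF srw_one, symmetric] using v by simp
      then have "rho A (v - e1) / a = pot (v - e1)" using a_pos by (simp add: rho_pot)
      then have "pot v = 2 * pot (v - e1) - pot (v - e1 - e1)" using srw_pot[of "v - e1"] by simp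
      moreover have "a * (2 * P - Q) = 2 * (a * P) - a * Q" for P Q :: real by (simp add: algebra_simps)
      ultimately have "a * pot v = 2 * (a * pot (v - e1)) - a * pot (v - e1 - e1)" by (simp only:)
      then show ?thesis unfolding h by simp
    qed
    then show ?case using Suc by blast
  qed
  have nn: "a * pot v = real_of_int (scal1 v)" if v: "scal1 v \<ge> 0" for v
  proof -
    obtain n where "scal1 v = int n" using v nonneg_int_cases by blast
    then show ?thesis using ind[of n] by simp
  qed
  assume v: "v \<noteq> 0"
  show ?thesis
  proof (cases "scal1 v \<ge> 0")
    case True then show ?thesis using nn[OF True] v by (simp add: rho_pot)
  next
    case False then show ?thesis using nn[of "- v"] v by (simp add: rho_pot pot_minus)
  qed
qed

text \<open>Here \<open>a * pi * (gamma_d A)\<^sup>2\<close> equals \<open>1 / 2\<close>, so all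
  coefficients become multiples of \<open>gamma_d A / 2\<close>; the two occurrences of
  \<open>rho A x\<close> then cancel.\<close>

lemma srw_C1:
  assumes y: "y \<noteq> 0"
  shows "C1 A x y = gamma_d A * (rho A (y - x) - \<bar>real_of_int (scal1 y)\<bar> + real_of_int (scal1 x) * real_of_int (scal1 y) / \<bar>real_of_int (scal1 y)\<bar>)"
proof -
  define g where "g = gamma_d A"
  define Y r where "Y = real_of_int (scal1 y)" and "r = \<bar>Y\<bar>"
  have g: "g > 0" unfolding g_def by (rule gamma_d_pos)
  have "scal1 y \<noteq> 0" using y scal1_inj[OF srw_one, of y 0] by simp
  then have r: "r > 0" "Y\<^sup>2 = r\<^sup>2" by (simp_all add: r_def Y_def)
  have ry: "rho A y = r" using srw_rho[OF y] by (simp add: r_def Y_def)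
  have "g\<^sup>2 = 1 / (2 * pi * a)" using a_pos by (simp add: g_def srw_gamma power_divide)
  then have h: "a * pi * g\<^sup>2 = 1 / 2" using a_pos by simp
  have g3: "a * pi * g ^ 3 = g / 2"
  proof -
    have "a * pi * g ^ 3 = (a * pi * g\<^sup>2) * g" by (simp add: power2_eq_square power3_eq_cube)
    then show ?thesis unfolding h by simp
  qed
  have g1: "c / (4 * a * pi * g) = c * (g / 2)" for c
  proof -
    have "(4 * a * pi * g) * (g / 2) = 2 * (a * pi * g\<^sup>2)" by (simp add: power2_eq_square)
    then have "(4 * a * pi * g) * (g / 2) = 1" unfolding h by simp
    then have "g / 2 = 1 / (4 * a * pi * g)" by (metis mult_zero_left nonzero_mult_div_cancel_left zero_neq_one)
    then show ?thesis by (simp only:) simp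
  qed
  define u w X where "u = rho A (y - x)" and "w = rho A x" and "X = real_of_int (scal1 x)"
  have "C1 A x y = (u + w - r) / (4 * a * pi * g) + (a * pi * g ^ 3) * Y\<^sup>2 * (u - w - r) / r\<^sup>2 + 2 * (a * pi * g ^ 3) * X * Y / r"
    by (simp add: C1_def Let_def ry u_def w_def X_def Y_def g_def mult_ac)
  also have "\<dots> = g * (u - r + X * Y / r)"
    unfolding g1 g3 r(2) using r(1) by (simp add: field_simps)
  finally show ?thesis by (simp add: g_def u_def X_def Y_def r_def)
qed

lemma srw_Hminus_inf:
  assumes yz: "y \<noteq> z"
  shows "Hminus_inf A x y z = (rho A (x - z) + real_of_int \<bar>scal1 (y - z)\<bar> - rho A (y - x)) / (2 * real_of_int \<bar>scal1 (y - z)\<bar>)"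
  using Hminus_inf_recurrent(2)[OF disjI1[OF srw_one] yz, of x] srw_rho[of "y - z"] yz by simp

lemma srw_neq: "scal1 u \<noteq> scal1 v \<longleftrightarrow> u \<noteq> (v :: int^'d)"
  using scal1_inj[OF srw_one] by blast

text \<open>On the segment between \<open>z\<close> and \<open>y\<close> the exponential moment of
  the hitting time is compared with a positive eigenfunction of the jump average. The exponent is
  chosen so small that waiting and averaging together still contract, and a starting point at
  \<open>z\<close> is covered because a jump away from \<open>y\<close> contributes nothing.\<close>

lemma srw_exp_tail:
  assumes yz: "y \<noteq> z"
    and x: "x = z \<or> scal1 z < scal1 x \<and> scal1 x < scal1 y \<or> scal1 y < scal1 x \<and> scal1 x < scal1 z"
  defines "c \<equiv> cos (pi / (3 * real_of_int \<bar>scal1 (y - z)\<bar>))"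
  assumes t: "t \<ge> 0"
  shows "Hminus_inf A x y z - Hminus A x y z t \<le> 2 * exp (- (a * (1 - c) / 2) * t)"
proof -
  define L where "L = \<bar>scal1 (y - z)\<bar>"
  define sg where "sg = sgn (scal1 (y - z))"
  \<comment> \<open>The position oriented so that \<open>z\<close> is at 0 and \<open>y\<close> is
    at \<open>L\<close>; both orders of the two points are then treated at once.\<close>
  define p where "p w = sg * scal1 (w - z)" for w
  have yz': "scal1 y \<noteq> scal1 z" unfolding srw_neq by (rule yz)
  have L: "L > 0" using yz' by (simp add: L_def)
  have sg: "sg = 1 \<or> sg = - 1" using yz' by (auto simp: sg_def sgn_if)
  have pz: "p w = 0 \<longleftrightarrow> w = z" for w
    using sg scal1_inj[OF srw_one, of w z] by (auto simp: p_def)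
  have py: "p w = L \<longleftrightarrow> w = y" for w
  proof -
    have "p w = L \<longleftrightarrow> scal1 w = scal1 y" using yz' by (auto simp: p_def L_def sg_def sgn_if)
    then show ?thesis using scal1_inj[OF srw_one] by blast
  qed
  have pe: "p (w + e1) = p w + sg" "p (w - e1) = p w - sg" for w by (simp_all add: p_def algebra_simps)
  \<comment> \<open>The angle is calibrated so that \<open>\<kappa> * L\<close> is
    \<open>pi / 3\<close>, whose cosine is \<open>1 / 2\<close>. The doubled cosine thus lies
    between 1 and 2 on the segment.\<close>
  define \<kappa> where "\<kappa> = pi / (3 * real_of_int L)"
  have \<kappa>: "0 < \<kappa>" "\<kappa> * real_of_int L = pi / 3" using L by (simp_all add: \<kappa>_def)
  have "\<kappa> * 1 \<le> \<kappa> * real_of_int L" using \<kappa>(1) L by (intro mult_left_mono) auto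
  then have \<kappa>3: "\<kappa> \<le> pi / 3" unfolding \<kappa>(2) by simp
  have c: "c = cos \<kappa>" by (simp add: c_def \<kappa>_def L_def)
  have c1: "c < 1" using cos_monotone_0_pi[of 0 \<kappa>] \<kappa> \<kappa>3 pi_gt_zero unfolding c by simp
  define \<Psi> where "\<Psi> w = 2 * cos (\<kappa> * real_of_int (p w))" for w
  have \<Psi>1: "\<Psi> w \<ge> 1" if "0 \<le> p w" "p w \<le> L" for w
  proof -
    have "\<kappa> * real_of_int (p w) \<le> \<kappa> * real_of_int L" using that \<kappa>(1) by (intro mult_left_mono) auto
    then have "\<kappa> * real_of_int (p w) \<le> pi / 3" unfolding \<kappa>(2) .
    moreover have "0 \<le> \<kappa> * real_of_int (p w)" using that \<kappa>(1) by simp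
    ultimately have "cos (pi / 3) \<le> cos (\<kappa> * real_of_int (p w))" by (intro cos_monotone_0_pi_le) auto
    then show ?thesis by (simp add: \<Psi>_def cos_60)
  qed
  have \<Psi>2: "\<Psi> w \<le> 2" for w by (simp add: \<Psi>_def)
  have \<Psi>_harm: "\<Psi> (w + e1) + \<Psi> (w - e1) = 2 * c * \<Psi> w" for w
  proof -
    have "\<kappa> * real_of_int (p (w + e1)) = \<kappa> * real_of_int (p w) + \<kappa> * real_of_int sg" "\<kappa> * real_of_int (p (w - e1)) = \<kappa> * real_of_int (p w) - \<kappa> * real_of_int sg"
      unfolding pe by (simp_all add: algebra_simps)
    moreover have "cos (\<kappa> * real_of_int sg) = c" using sg unfolding c by auto
    ultimately show ?thesis by (simp add: \<Psi>_def cos_add cos_diff)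
  qed
  \<comment> \<open>Any exponent below \<open>a * (1 - c)\<close> would contract; half of it gives
    the factor \<open>r = 2 / (1 + c)\<close> from the holding time, and
    \<open>r * c < 1\<close>.\<close>
  define \<delta> where "\<delta> = a * (1 - c) / 2"
  have cge: "c \<ge> - 1" unfolding c by simp
  have \<delta>: "0 < \<delta>" "\<delta> < a + \<delta>" using c1 a_pos by (simp_all add: \<delta>_def)
  define r where "r = a / (a - \<delta>)"
  have ad: "a - \<delta> = a * (1 + c) / 2" by (simp add: \<delta>_def field_simps)
  have cpos: "c > 0" unfolding c using \<kappa> \<kappa>3 pi_gt_zero by (intro cos_gt_zero_pi) auto
  have adp: "a - \<delta> > 0" unfolding ad using a_pos cpos by simp
  have r: "r > 0" using adp a_pos by (simp add: r_def)
  have "r = 2 / (1 + c)" unfolding r_def ad using a_pos by simp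
  then have rc: "r * c < 1" using cpos c1 by (simp add: divide_less_eq)
  \<comment> \<open>The exponential weight is truncated at time \<open>t\<close>, so that all
    moments are finite before any bound is known. The estimates obtained do not depend on
    \<open>t\<close>, and beyond \<open>t\<close> the weight is exactly
    \<open>exp (\<delta> * t)\<close>.\<close>
  define lt where "lt s = (if s < \<infinity> then ennreal (exp (\<delta> * min (real_of_ereal s) t)) else 0)" for s :: ereal
  have lt_le: "lt s \<le> ennreal (exp (\<delta> * t))" for s using \<delta>(1) by (auto simp: lt_def intro!: ennreal_leI)
  have [measurable]: "lt \<in> borel_measurable borel" unfolding lt_def[abs_def] by measurable
  have [measurable]: "sigma y z w \<in> borel_measurable (Omega A)" for w using yz by measurable
  define g where "g w = (\<integral>\<^sup>+\<omega>. lt (sigma y z w \<omega>) \<partial>Omega A)" for w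
  have g_le: "g w \<le> ennreal (exp (\<delta> * t))" for w
  proof -
    have "g w \<le> (\<integral>\<^sup>+\<omega>. ennreal (exp (\<delta> * t)) \<partial>Omega A)" unfolding g_def by (intro nn_integral_mono lt_le)
    then show ?thesis using W.emeasure_space_1 by simp
  qed
  define h where "h w = enn2real (g w)" for w
  have gh: "g w = ennreal (h w)" for w
    using g_le[of w] unfolding h_def by (metis ennreal_enn2real ennreal_less_top order_le_less_trans)
  have h0: "h w \<ge> 0" for w by (simp add: h_def)
  have hy: "h y = 1"
  proof -
    have "g y = (\<integral>\<^sup>+\<omega>. 1 \<partial>Omega A)"
      unfolding g_def using AE_good t by (intro nn_integral_cong_AE) (auto elim!: eventually_mono simp: sigma_target[OF _ yz] lt_def)
    then show ?thesis using W.emeasure_space_1 by (simp add: h_def)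
  qed
  have hz: "h z = 0"
  proof -
    have "g z = (\<integral>\<^sup>+\<omega>. 0 \<partial>Omega A)"
      unfolding g_def using AE_good by (intro nn_integral_cong_AE) (auto elim!: eventually_mono simp: sigma_taboo lt_def)
    then show ?thesis by (simp add: h_def)
  qed
  have gJ: "(\<integral>\<^sup>+v. g (w + v) \<partial>J) = ennreal ((h (w + e1) + h (w - e1)) / 2)" for w
    unfolding gh using nn_integral_eq_integral[OF srw_integrable_J[of "\<lambda>v. h (w + v)"]] h0 by (simp add: srw_integral_J)
  have lt_add: "lt (ereal s + u) \<le> ennreal (exp (\<delta> * s)) * lt u" if "s > 0" "u \<ge> 0" for s u
  proof (cases u)
    case (real q)
    have "\<delta> * min (s + q) t \<le> \<delta> * s + \<delta> * min q t"
      using that \<delta>(1) by (simp add: distrib_left[symmetric] min_def)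
    then have "exp (\<delta> * min (s + q) t) \<le> exp (\<delta> * s) * exp (\<delta> * min q t)" by (simp flip: exp_add)
    then show ?thesis using real by (simp add: lt_def ennreal_mult[symmetric] ennreal_leI)
  qed (use that in \<open>auto simp: lt_def\<close>)
  have step: "h w \<le> r * ((h (w + e1) + h (w - e1)) / 2)" if w: "w \<noteq> y" "w \<noteq> z" for w
  proof -
    have "g w = (\<integral>\<^sup>+v. \<integral>\<^sup>+s. \<integral>\<^sup>+\<omega>. lt (ereal s + sigma y z (w + v) \<omega>) \<partial>Omega A \<partial>E \<partial>J)"
      unfolding g_def using w by (intro nn_integral_W_good) (auto simp: sigma_Cons)
    also have "\<dots> \<le> (\<integral>\<^sup>+v. \<integral>\<^sup>+s. \<integral>\<^sup>+\<omega>. ennreal (exp (\<delta> * s)) * lt (sigma y z (w + v) \<omega>) \<partial>Omega A \<partial>E \<partial>J)"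
      using AE_E_pos by (intro nn_integral_mono nn_integral_mono_AE) (auto elim!: eventually_mono intro!: nn_integral_mono lt_add sigma_nonneg)
    also have "\<dots> = (\<integral>\<^sup>+v. \<integral>\<^sup>+s. ennreal (exp (\<delta> * s)) * g (w + v) \<partial>E \<partial>J)"
      by (simp add: nn_integral_cmult g_def)
    also have "\<dots> = (\<integral>\<^sup>+v. ennreal r * g (w + v) \<partial>J)"
      using nn_integral_exp_E[of "- \<delta>"] adp by (subst nn_integral_multc) (auto simp: r_def)
    also have "\<dots> = ennreal r * ennreal ((h (w + e1) + h (w - e1)) / 2)"
      by (simp add: nn_integral_cmult gJ)
    also have "\<dots> = ennreal (r * ((h (w + e1) + h (w - e1)) / 2))" using r h0 by (intro ennreal_mult[symmetric]) (auto intro: add_nonneg_nonneg)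
    finally show ?thesis unfolding gh using r h0[of "w + e1"] h0[of "w - e1"] by (simp add: ennreal_le_iff)
  qed
  define S where "S = {w. 0 < p w \<and> p w < L}"
  have finS: "finite S"
  proof (rule finite_subset[OF _ finite_scal1_le[OF srw_one, of "real_of_int (\<bar>scal1 z\<bar> + L)"]], rule)
    fix w assume "w \<in> S"
    then have "\<bar>scal1 w - scal1 z\<bar> < L" using sg by (auto simp: S_def p_def)
    then have "\<bar>scal1 w\<bar> \<le> \<bar>scal1 z\<bar> + L" by linarith
    then show "w \<in> {w. real_of_int \<bar>scal1 w\<bar> \<le> real_of_int (\<bar>scal1 z\<bar> + L)}" by (simp only: mem_Collect_eq of_int_le_iff)
  qed
  have cases_p: "w = z \<or> w = y \<or> w \<in> S" if "0 \<le> p w" "p w \<le> L" for w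
    using that pz[of w] py[of w] by (auto simp: S_def)
  have hS: "h w \<le> \<Psi> w" if wS: "w \<in> S" for w
  proof -
    \<comment> \<open>The largest ratio of the moment to the eigenfunction over the finite interior.
      The one-step inequality gives that \<open>M\<close> is at most \<open>r * c\<close> times
      \<open>max 1 M\<close>, which excludes \<open>M > 1\<close>.\<close>
    define M where "M = Max ((\<lambda>w. h w / \<Psi> w) ` S)"
    have \<Psi>S: "\<Psi> w > 0" if "w \<in> S" for w using \<Psi>1[of w] that by (simp add: S_def)
    have hM: "h w \<le> M * \<Psi> w" if "w \<in> S" for w
    proof -
      have "h w / \<Psi> w \<le> M" unfolding M_def using finS that by (intro Max_ge) auto
      then show ?thesis using \<Psi>S[OF that] by (simp add: pos_divide_le_eq)
    qed
    let ?N = "max 1 M"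
    have hN: "h u \<le> ?N * \<Psi> u" if u: "0 \<le> p u" "p u \<le> L" for u
    proof -
      have \<Psi>u: "\<Psi> u \<ge> 1" by (rule \<Psi>1[OF u])
      from cases_p[OF u] show ?thesis
      proof (elim disjE)
        assume "u = z" then show ?thesis using hz \<Psi>u by simp
      next
        assume "u = y" then show ?thesis using hy mult_mono[of 1 ?N 1 "\<Psi> u"] \<Psi>u by simp
      next
        assume "u \<in> S"
        then have "h u \<le> M * \<Psi> u" by (rule hM)
        also have "M * \<Psi> u \<le> ?N * \<Psi> u" using \<Psi>u by (intro mult_right_mono) auto
        finally show ?thesis .
      qed
    qed
    have "h w / \<Psi> w \<le> r * c * ?N" if w: "w \<in> S" for w
    proof -
      have nb: "0 \<le> p (w + e1)" "p (w + e1) \<le> L" "0 \<le> p (w - e1)" "p (w - e1) \<le> L" using w sg unfolding pe S_def by auto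
      have "w \<noteq> y" "w \<noteq> z" using w py[of w] pz[of w] by (auto simp: S_def)
      then have "h w \<le> r * ((h (w + e1) + h (w - e1)) / 2)" by (rule step)
      also have "\<dots> \<le> r * ((?N * \<Psi> (w + e1) + ?N * \<Psi> (w - e1)) / 2)"
        using r by (intro mult_left_mono divide_right_mono add_mono hN nb) auto
      also have "\<dots> = r * ?N * (\<Psi> (w + e1) + \<Psi> (w - e1)) / 2" by (simp add: algebra_simps)
      also have "\<dots> = r * c * ?N * \<Psi> w" unfolding \<Psi>_harm by simp
      finally show ?thesis using \<Psi>S[OF w] by (simp add: pos_divide_le_eq)
    qed
    moreover have "M \<in> (\<lambda>w. h w / \<Psi> w) ` S" unfolding M_def using finS wS by (intro Max_in) auto
    ultimately have "M \<le> r * c * ?N" by blast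
    moreover have "r * c * M < M" if "M > 1" using rc that by simp
    ultimately have "M \<le> 1" using rc by (cases "M > 1") auto
    then have "M * \<Psi> w \<le> 1 * \<Psi> w" using \<Psi>S[OF wS] by (intro mult_right_mono) auto
    then show ?thesis using hM[OF wS] by linarith
  qed
  have beyond: "h u = 0" if u: "p u = - 1" for u
  proof -
    \<comment> \<open>The limits are known for hitting counted from the first jump, so the argument
      starts one step further out: from \<open>u'\<close> the limiting probability is 0, and
      \<open>u\<close> is one of its two neighbours, hence hitting from \<open>u\<close> has
      probability 0 too.\<close>
    define u' where "u' = u + (u - z)"
    have pu': "p u' = - 2" using u sg unfolding u'_def p_def scal1_simps by (elim disjE) simp_all
    have uu: "u = u' + e1 \<or> u = u' - e1"
    proof -
      have "scal1 u - scal1 z = 1 \<or> scal1 u - scal1 z = - 1" using u sg unfolding p_def scal1_simps by (elim disjE) simp_all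
      then have "scal1 u = scal1 (u' + e1) \<or> scal1 u = scal1 (u' - e1)" unfolding u'_def scal1_simps scal1_e1 by arith
      then show ?thesis unfolding scal1_inj[OF srw_one] .
    qed
    have "u' \<noteq> z" "u' \<noteq> y" using pz[of u'] py[of u'] pu' L by auto
    then have rh: "rho A (u' - z) = 2" "rho A (y - u') = real_of_int (L + 2)"
    proof -
      assume ne: "u' \<noteq> z" "u' \<noteq> y"
      have "\<bar>scal1 (u' - z)\<bar> = 2" using pu' sg by (auto simp: p_def)
      then show "rho A (u' - z) = 2" using ne srw_rho[of "u' - z"] by simp
      have "\<bar>scal1 (y - u')\<bar> = L + 2" using pu' yz' by (auto simp: p_def L_def sg_def sgn_if split: if_splits)
      then show "rho A (y - u') = real_of_int (L + 2)" using ne srw_rho[of "y - u'"] by simp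
    qed
    have "Hminus_inf A u' y z = 0" unfolding srw_Hminus_inf[OF yz] rh L_def[symmetric] by simp
    then have "hit_minus 1 y z u' \<le> 0" using hit_minus_le_inf[OF yz, of 1 u'] by simp
    then have "hit 1 y z (u' + e1) + hit 1 y z (u' - e1) \<le> 0"
      using hit_minus_eq[of 1 y z u'] yz by (simp add: srw_integral_J)
    then have "hit 1 y z u = 0"
      using uu hit_nonneg[of 1 y z "u' + e1"] hit_nonneg[of 1 y z "u' - e1"] yz by auto
    then have "(\<integral>\<^sup>+\<omega>. ennreal (ltrans 1 (sigma y z u \<omega>)) \<partial>Omega A) = 0" using nn_hit[of 1 y z u] yz by simp
    then have "AE \<omega> in Omega A. ltrans 1 (sigma y z u \<omega>) \<le> 0"
      by (subst (asm) nn_integral_0_iff_AE) (auto simp: ennreal_eq_0_iff)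
    then have "g u = (\<integral>\<^sup>+\<omega>. 0 \<partial>Omega A)"
      unfolding g_def by (intro nn_integral_cong_AE) (auto elim!: eventually_mono simp: lt_def ltrans_def split: if_splits)
    then show ?thesis by (simp add: h_def)
  qed
  have h2: "h u \<le> 2" if "- 1 \<le> p u" "p u \<le> L" for u
  proof (cases "0 \<le> p u")
    case True
    from cases_p[OF True that(2)] show ?thesis using hz hy hS[of u] \<Psi>2[of u] by auto
  next
    case False
    then have "p u = - 1" using that by simp
    then show ?thesis using beyond by simp
  qed
  have px: "0 \<le> p x" "p x < L" using x yz' by (auto simp: p_def L_def sg_def sgn_if)
  have [measurable]: "tau_yz_minus x y z \<in> borel_measurable (Omega A)" using yz by measurable
  have "ennreal (exp (\<delta> * t)) * emeasure (nu x y z) {t<..} = (\<integral>\<^sup>+s. ennreal (exp (\<delta> * t)) * indicator {t<..} s \<partial>nu x y z)"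
    by (simp add: nn_integral_cmult_indicator sets_nu)
  also have "\<dots> \<le> (\<integral>\<^sup>+s. ennreal (exp (\<delta> * min s t)) \<partial>nu x y z)"
    by (intro nn_integral_mono) (auto simp: indicator_def min_def)
  also have "\<dots> = (\<integral>\<^sup>+\<omega>. lt (tau_yz_minus x y z \<omega>) \<partial>Omega A)"
    by (subst nn_integral_nu[OF yz]) (auto simp: lt_def intro!: nn_integral_cong)
  also have "\<dots> = (\<integral>\<^sup>+v. \<integral>\<^sup>+s. \<integral>\<^sup>+\<omega>. lt (sigma y z (x + v) \<omega>) \<partial>Omega A \<partial>E \<partial>J)"
    by (intro nn_integral_W_good) (auto simp: tau_yz_minus_Cons)
  also have "\<dots> = (\<integral>\<^sup>+v. g (x + v) \<partial>J)" using E.emeasure_space_1 by (simp add: g_def)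
  \<comment> \<open>After the first jump the position lies between \<open>- 1\<close> and
    \<open>L\<close>: the value \<open>- 1\<close> occurs only for the start at \<open>z\<close>,
    and there the moment is 0. Elsewhere the eigenfunction bound gives 2.\<close>
  also have "\<dots> \<le> ennreal 2"
    unfolding gJ using h2[of "x + e1"] h2[of "x - e1"] px sg unfolding pe by (intro ennreal_leI) auto
  finally have fin: "ennreal (exp (\<delta> * t)) * emeasure (nu x y z) {t<..} \<le> ennreal 2" .
  interpret N: finite_measure "nu x y z" by (rule finite_nu[OF yz])
  have "ennreal (exp (\<delta> * t) * measure (nu x y z) {t<..}) \<le> ennreal 2"
    using fin unfolding N.emeasure_eq_measure by (simp add: ennreal_mult'[symmetric])
  then have "exp (\<delta> * t) * measure (nu x y z) {t<..} \<le> 2" by (subst (asm) ennreal_le_iff) auto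
  then have "measure (nu x y z) {t<..} \<le> 2 * exp (- (\<delta> * t))" by (simp add: exp_minus field_simps)
  then show ?thesis unfolding Hminus_tail[OF yz] \<delta>_def by simp
qed

text \<open>\<open>\<epsilon>\<close> is chosen so that the exponent of \<open>srw_exp_tail\<close>
  is twice \<open>a * \<epsilon>\<close>; the spare factor converts the bound into a strictly
  smaller order.\<close>

lemma srw_smallo:
  assumes yz: "y \<noteq> z"
    and x: "x = z \<or> scal1 z < scal1 x \<and> scal1 x < scal1 y \<or> scal1 y < scal1 x \<and> scal1 x < scal1 z"
  defines "\<epsilon> \<equiv> (1 - cos (pi / (3 * real_of_int \<bar>scal1 (y - z)\<bar>))) / 4"
  assumes \<epsilon>: "\<epsilon> > 0"
  shows "(\<lambda>t. Hminus_inf A x y z - Hminus A x y z t) \<in> o[at_top](\<lambda>t. exp (- a * \<epsilon> * t))"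
proof (rule landau_o.big_small_trans)
  define k where "k = a * \<epsilon>"
  have k: "k > 0" using a_pos \<epsilon> by (simp add: k_def)
  have eq: "a * (1 - cos (pi / (3 * real_of_int \<bar>scal1 (y - z)\<bar>))) / 2 = 2 * k" by (simp add: k_def \<epsilon>_def)
  show "(\<lambda>t. Hminus_inf A x y z - Hminus A x y z t) \<in> O[at_top](\<lambda>t. exp (- (2 * k) * t))"
  proof (rule bigoI[of _ 2], rule eventually_mono[OF eventually_ge_at_top[of 0]])
    fix t :: real assume "0 \<le> t"
    from srw_exp_tail[OF yz x this] show "norm (Hminus_inf A x y z - Hminus A x y z t) \<le> 2 * norm (exp (- (2 * k) * t))"
      unfolding eq Hminus_tail[OF yz] by simp
  qed
  show "(\<lambda>t. exp (- (2 * k) * t)) \<in> o[at_top](\<lambda>t. exp (- a * \<epsilon> * t))"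
  proof -
    have "(\<lambda>t. exp (- (2 * k) * t)) \<in> o[at_top](\<lambda>t. exp (- k * t))" using k by real_asymp
    then show ?thesis by (simp add: k_def)
  qed
qed

lemma srw_epsilon:
  fixes y z :: "int^'d"
  assumes yz: "y \<noteq> z"
  defines "\<epsilon> \<equiv> (1 - cos (pi / (3 * real_of_int \<bar>scal1 (y - z)\<bar>))) / 4"
  shows "0 < \<epsilon>" "\<epsilon> < 1"
proof -
  define L where "L = real_of_int \<bar>scal1 (y - z)\<bar>"
  have "scal1 y \<noteq> scal1 z" unfolding srw_neq by (rule yz)
  then have L: "L \<ge> 1" by (simp add: L_def)
  have "pi / (3 * L) \<le> pi / 1" using L pi_gt_zero by (intro divide_left_mono) auto
  then have "cos (pi / (3 * L)) < cos 0" using L pi_gt_zero by (intro cos_monotone_0_pi) auto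
  then show "0 < \<epsilon>" by (simp add: \<epsilon>_def L_def)
  have "(1 - c) / 4 < 1" if "- 1 \<le> c" for c :: real using that by simp
  from this[OF cos_ge_minus_one] show "\<epsilon> < 1" unfolding \<epsilon>_def .
qed

text \<open>With \<open>y\<close> separating \<open>x\<close> from \<open>z\<close> the limit is 1.
  In \<open>srw_C1\<close> the absolute values then combine to twice the distance from
  \<open>x\<close> to \<open>y\<close>.\<close>

lemma srw_outside:
  assumes x: "scal1 x < scal1 y \<and> scal1 y < scal1 z \<or> scal1 z < scal1 y \<and> scal1 y < scal1 x"
  shows "(\<lambda>t. 1 - Hminus A x y z t) \<sim>[at_top] (\<lambda>t. sqrt 2 * \<bar>real_of_int (scal1 y - scal1 x)\<bar> / (sqrt (a * pi) * sqrt t))"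
proof -
  have ne: "y \<noteq> z" "x - z \<noteq> 0" "y - x \<noteq> 0" using x by auto
  let ?d = "\<bar>real_of_int (scal1 y - scal1 x)\<bar>"
  have H: "Hminus_inf A x y z = 1" unfolding srw_Hminus_inf[OF ne(1)] srw_rho[OF ne(2)] srw_rho[OF ne(3)] using x by auto
  define X Y where "X = real_of_int (scal1 (x - z))" and "Y = real_of_int (scal1 (y - z))"
  have "0 < X \<and> 0 < Y \<or> X < 0 \<and> Y < 0" using x by (auto simp: X_def Y_def)
  moreover have "X * Y / \<bar>Y\<bar> = \<bar>X\<bar>" if "0 < X \<and> 0 < Y \<or> X < 0 \<and> Y < 0" for X Y :: real
    using that by (elim disjE) (simp_all add: field_simps)
  ultimately have "X * Y / \<bar>Y\<bar> = \<bar>X\<bar>" by blast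
  moreover have "\<bar>X\<bar> - \<bar>Y\<bar> = ?d" using x by (auto simp: X_def Y_def)
  ultimately have XY: "X * Y / \<bar>Y\<bar> = \<bar>X\<bar>" "\<bar>X\<bar> - \<bar>Y\<bar> = ?d" by blast+
  have "C1 A (x - z) (y - z) = gamma_d A * (rho A (y - x) - \<bar>Y\<bar> + X * Y / \<bar>Y\<bar>)"
    using srw_C1[of "y - z" "x - z"] ne(1) unfolding X_def Y_def by simp
  also have "\<dots> = gamma_d A * (2 * ?d)" unfolding XY(1) XY(2)[symmetric] srw_rho[OF ne(3)] using XY(2) by simp
  also have "\<dots> = sqrt 2 * ?d / sqrt (a * pi)"
  proof -
    have "sqrt (2 * pi * a) = sqrt 2 * sqrt (a * pi)" by (simp add: real_sqrt_mult)
    moreover have "2 = sqrt 2 * sqrt (2::real)" by simp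
    ultimately show ?thesis unfolding srw_gamma using a_pos by (simp add: field_simps)
  qed
  finally have C: "C1 A (x - z) (y - z) = sqrt 2 * ?d / sqrt (a * pi)" .
  have "C1 A (x - z) (y - z) > 0" unfolding C using x a_pos by auto
  from tail_equiv_1[OF srw_one ne(1) this] show ?thesis unfolding H C by simp
qed

text \<open>Starting at the target, the value \<open>rho A 0 = 1\<close> enters both the limit and
  the constant, and \<open>C1\<close> reduces to \<open>gamma_d A\<close>.\<close>

lemma srw_target:
  assumes yz: "y \<noteq> z"
  shows "(\<lambda>t. 1 - 1 / (2 * \<bar>real_of_int (scal1 y - scal1 z)\<bar>) - Hminus A y y z t) \<sim>[at_top] (\<lambda>t. 1 / (sqrt (2 * a * pi) * sqrt t))"
proof -
  have ne: "y - z \<noteq> 0" using yz by simp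
  have "scal1 y \<noteq> scal1 z" unfolding srw_neq by (rule yz)
  then have H: "Hminus_inf A y y z = 1 - 1 / (2 * \<bar>real_of_int (scal1 y - scal1 z)\<bar>)"
    unfolding srw_Hminus_inf[OF yz] srw_rho[OF ne] by (simp add: rho_def[of A 0] field_simps)
  define Y where "Y = real_of_int (scal1 (y - z))"
  have "Y * Y / \<bar>Y\<bar> = \<bar>Y\<bar>" by (simp add: abs_if)
  then have "C1 A (y - z) (y - z) = gamma_d A"
    unfolding srw_C1[OF ne] Y_def[symmetric] by (simp add: rho_def[of A 0])
  then have C: "C1 A (y - z) (y - z) = 1 / sqrt (2 * a * pi)" unfolding srw_gamma by (simp add: mult_ac)
  have "C1 A (y - z) (y - z) > 0" unfolding C using a_pos by simp
  from tail_equiv_1[OF srw_one yz this] show ?thesis unfolding H C by simp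
qed

lemma srw_between:
  assumes x: "scal1 z < scal1 x \<and> scal1 x < scal1 y \<or> scal1 y < scal1 x \<and> scal1 x < scal1 z"
  shows "Hminus_inf A x y z = real_of_int (scal1 x - scal1 z) / real_of_int (scal1 y - scal1 z)"
proof -
  have ne: "y \<noteq> z" "x - z \<noteq> 0" "y - x \<noteq> 0" using x by auto
  show ?thesis unfolding srw_Hminus_inf[OF ne(1)] srw_rho[OF ne(2)] srw_rho[OF ne(3)] using x by (auto simp: field_simps)
qed

lemma srw_taboo:
  assumes yz: "y \<noteq> z"
  shows "Hminus_inf A z y z = 1 / (2 * \<bar>real_of_int (scal1 y - scal1 z)\<bar>)"
proof -
  have ne: "y - z \<noteq> 0" using yz by simp
  show ?thesis unfolding srw_Hminus_inf[OF yz] srw_rho[OF ne] by (simp add: rho_def[of A 0])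
qed

text \<open>The formula for the limit gives total mass 0, and the distribution function lies between
  0 and its limit.\<close>

lemma srw_separated:
  assumes x: "scal1 x < scal1 z \<and> scal1 z < scal1 y \<or> scal1 y < scal1 z \<and> scal1 z < scal1 x"
  shows "Hminus A x y z t = 0"
proof -
  have ne: "y \<noteq> z" "x - z \<noteq> 0" "y - x \<noteq> 0" using x by auto
  have "Hminus_inf A x y z = 0" unfolding srw_Hminus_inf[OF ne(1)] srw_rho[OF ne(2)] srw_rho[OF ne(3)] using x by auto
  moreover have "Hminus A x y z t \<ge> 0" "Hminus_inf A x y z - Hminus A x y z t \<ge> 0"
    unfolding Hminus_tail[OF ne(1)] by (simp_all add: Hminus_def)
  ultimately show ?thesis by simp
qed

end

end

section \<open>The transient tail and the assembled statement\<close>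

context transient_walk
begin

lemma tail_equiv_transient:
  assumes nsrw: "\<not> is_srw A" and yz: "y \<noteq> z"
  shows "(\<lambda>t. Hminus_inf A x y z - Hminus A x y z t) \<sim>[at_top] (\<lambda>t. Cd A (x - z) (y - z) / t powr (real CARD('a) / 2 - 1))"
proof -
  have d: "real (CARD('a) - 2) = real CARD('a) - 2" using dim by simp
  have r: "rho A (y - z - (x - z)) = rho A (x - y)" using rho_minus[of "x - y"] by simp
  have G: "Green A 0 0 (y - z) = G0 (y - z)" using G0_minus[of "y - z"] by (simp add: Green_0)
  have v: "y - z \<noteq> 0" using yz by simp
  note R = rho_triangle_transient[OF nsrw yz, of x]
  have C: "Cd A (x - z) (y - z) = 2 * gamma_d A * (rho A (x - y) + rho A (x - z) - rho A (y - z)) / (a * (real CARD('a) - 2) * (G0 0 + G0 (y - z))\<^sup>2)"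
    unfolding Cd_def r G by (simp add: Green_0)
  have "Cd A (x - z) (y - z) > 0"
    unfolding C using R gamma_d_pos a_pos dim G0_add_pos[OF v] by (intro divide_pos_pos mult_pos_pos) auto
  then have nz: "Cd A (x - z) (y - z) \<noteq> 0" by simp
  have "((\<lambda>t. t powr (real CARD('a) / 2 - 1) * (Hminus_inf A x y z - Hminus A x y z t)) \<longlongrightarrow> Cd A (x - z) (y - z)) at_top"
    using tail_asymptotic[OF yz R] unfolding Hminus_tail[OF yz] C d .
  from asymp_equiv_of_scaled[OF this nz] show ?thesis .
qed

end

theorem theorem3:
  fixes A :: "int^'d \<Rightarrow> real" and x y z :: "int^'d"
  assumes "admissible_rates A" and "y \<noteq> z"
  shows "Hminus_inf A x y z = Hinf A x y z \<and>
    (\<not> is_srw A \<longrightarrow>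
       ((CARD('d) = 1 \<or> CARD('d) = 2) \<longrightarrow>
          Hminus_inf A x y z = (rho A (x - z) + rho A (y - z) - rho A (y - x)) / (2 * rho A (y - z))) \<and>
       (CARD('d) \<ge> 3 \<longrightarrow>
          Hminus_inf A x y z =
            (Green A 0 0 0 * rho A (y - z) - Green A 0 0 0 * rho A (y - x) + Green A 0 y z * rho A (x - z))
            / (rho A (y - z) * (Green A 0 0 0 + Green A 0 y z))) \<and>
       Hminus_inf A x y z \<in> {0<..<1} \<and>
       (CARD('d) = 1 \<longrightarrow>
          (\<lambda>t. Hminus_inf A x y z - Hminus A x y z t) \<sim>[at_top] (\<lambda>t. C1 A (x - z) (y - z) / sqrt t)) \<and>
       (CARD('d) = 2 \<longrightarrow>
          (\<lambda>t. Hminus_inf A x y z - Hminus A x y z t) \<sim>[at_top] (\<lambda>t. C2 A (x - z) (y - z) / ln t)) \<and>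
       (CARD('d) \<ge> 3 \<longrightarrow>
          (\<lambda>t. Hminus_inf A x y z - Hminus A x y z t) \<sim>[at_top]
            (\<lambda>t. Cd A (x - z) (y - z) / t powr (real CARD('d) / 2 - 1)))) \<and>
    (is_srw A \<longrightarrow> (\<exists>\<epsilon>::real. 0 < \<epsilon> \<and> \<epsilon> < 1 \<and>
       ((scal1 x < scal1 y \<and> scal1 y < scal1 z \<or> scal1 z < scal1 y \<and> scal1 y < scal1 x) \<longrightarrow>
          (\<lambda>t. 1 - Hminus A x y z t) \<sim>[at_top]
            (\<lambda>t. sqrt 2 * \<bar>real_of_int (scal1 y - scal1 x)\<bar> / (sqrt (arate A * pi) * sqrt t))) \<and>
       (\<lambda>t. 1 - 1 / (2 * \<bar>real_of_int (scal1 y - scal1 z)\<bar>) - Hminus A y y z t) \<sim>[at_top]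
          (\<lambda>t. 1 / (sqrt (2 * arate A * pi) * sqrt t)) \<and>
       ((scal1 z < scal1 x \<and> scal1 x < scal1 y \<or> scal1 y < scal1 x \<and> scal1 x < scal1 z) \<longrightarrow>
          (\<lambda>t. real_of_int (scal1 x - scal1 z) / real_of_int (scal1 y - scal1 z) - Hminus A x y z t)
            \<in> o[at_top](\<lambda>t. exp (- arate A * \<epsilon> * t))) \<and>
       (\<lambda>t. 1 / (2 * \<bar>real_of_int (scal1 y - scal1 z)\<bar>) - Hminus A z y z t)
            \<in> o[at_top](\<lambda>t. exp (- arate A * \<epsilon> * t)) \<and>
       ((scal1 x < scal1 z \<and> scal1 z < scal1 y \<or> scal1 y < scal1 z \<and> scal1 z < scal1 x) \<longrightarrow>
          (\<forall>t. Hminus A x y z t = 0))))"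
proof -
  interpret random_walk A by unfold_locales (rule assms(1))
  note yz = assms(2)
  have tr: "Hminus_inf A x y z = (Green A 0 0 0 * rho A (y - z) - Green A 0 0 0 * rho A (y - x) + Green A 0 y z * rho A (x - z))
            / (rho A (y - z) * (Green A 0 0 0 + Green A 0 y z))" if dim: "CARD('d) \<ge> 3"
  proof -
    interpret transient_walk A by unfold_locales (rule dim)
    show ?thesis unfolding Green_0 using Hminus_inf_transient[OF yz, of x] by simp
  qed
  have te: "(\<lambda>t. Hminus_inf A x y z - Hminus A x y z t) \<sim>[at_top]
            (\<lambda>t. Cd A (x - z) (y - z) / t powr (real CARD('d) / 2 - 1))" if dim: "CARD('d) \<ge> 3" and nsrw: "\<not> is_srw A"
  proof -
    interpret transient_walk A by unfold_locales (rule dim)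
    show ?thesis by (rule tail_equiv_transient[OF nsrw yz])
  qed
  have C1: "C1 A (x - z) (y - z) > 0" if "CARD('d) = 1" "\<not> is_srw A"
    using C1_pos[OF that(2,1), of "y - z" "x - z"] yz by simp
  \<comment> \<open>This rate depends on \<open>y\<close> and \<open>z\<close> only, so a single
    choice serves both exponential claims.\<close>
  let ?\<epsilon> = "(1 - cos (pi / (3 * real_of_int \<bar>scal1 (y - z)\<bar>))) / 4"
  show ?thesis
  proof (intro conjI impI)
    show "Hminus_inf A x y z = Hinf A x y z" by (rule Hinf_eq[OF yz, symmetric])
  next
    assume "is_srw A"
    note srw = this
    note eps = srw_epsilon[OF srw yz]
    show "\<exists>\<epsilon>::real. 0 < \<epsilon> \<and> \<epsilon> < 1 \<and>
       ((scal1 x < scal1 y \<and> scal1 y < scal1 z \<or> scal1 z < scal1 y \<and> scal1 y < scal1 x) \<longrightarrow>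
          (\<lambda>t. 1 - Hminus A x y z t) \<sim>[at_top]
            (\<lambda>t. sqrt 2 * \<bar>real_of_int (scal1 y - scal1 x)\<bar> / (sqrt (arate A * pi) * sqrt t))) \<and>
       (\<lambda>t. 1 - 1 / (2 * \<bar>real_of_int (scal1 y - scal1 z)\<bar>) - Hminus A y y z t) \<sim>[at_top]
          (\<lambda>t. 1 / (sqrt (2 * arate A * pi) * sqrt t)) \<and>
       ((scal1 z < scal1 x \<and> scal1 x < scal1 y \<or> scal1 y < scal1 x \<and> scal1 x < scal1 z) \<longrightarrow>
          (\<lambda>t. real_of_int (scal1 x - scal1 z) / real_of_int (scal1 y - scal1 z) - Hminus A x y z t)
            \<in> o[at_top](\<lambda>t. exp (- arate A * \<epsilon> * t))) \<and>
       (\<lambda>t. 1 / (2 * \<bar>real_of_int (scal1 y - scal1 z)\<bar>) - Hminus A z y z t)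
            \<in> o[at_top](\<lambda>t. exp (- arate A * \<epsilon> * t)) \<and>
       ((scal1 x < scal1 z \<and> scal1 z < scal1 y \<or> scal1 y < scal1 z \<and> scal1 z < scal1 x) \<longrightarrow>
          (\<forall>t. Hminus A x y z t = 0))"
    proof (intro exI[of _ ?\<epsilon>] conjI impI allI)
      show "0 < ?\<epsilon>" "?\<epsilon> < 1" by (fact eps)+
      show "(\<lambda>t. 1 - Hminus A x y z t) \<sim>[at_top]
            (\<lambda>t. sqrt 2 * \<bar>real_of_int (scal1 y - scal1 x)\<bar> / (sqrt (arate A * pi) * sqrt t))"
        if "scal1 x < scal1 y \<and> scal1 y < scal1 z \<or> scal1 z < scal1 y \<and> scal1 y < scal1 x"
        by (rule srw_outside[OF srw that])
      show "(\<lambda>t. 1 - 1 / (2 * \<bar>real_of_int (scal1 y - scal1 z)\<bar>) - Hminus A y y z t) \<sim>[at_top]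
          (\<lambda>t. 1 / (sqrt (2 * arate A * pi) * sqrt t))"
        by (rule srw_target[OF srw yz])
      show "(\<lambda>t. real_of_int (scal1 x - scal1 z) / real_of_int (scal1 y - scal1 z) - Hminus A x y z t)
            \<in> o[at_top](\<lambda>t. exp (- arate A * ?\<epsilon> * t))"
        if x: "scal1 z < scal1 x \<and> scal1 x < scal1 y \<or> scal1 y < scal1 x \<and> scal1 x < scal1 z"
        using srw_smallo[OF srw yz disjI2[OF x] eps(1)] unfolding srw_between[OF srw x] .
      show "(\<lambda>t. 1 / (2 * \<bar>real_of_int (scal1 y - scal1 z)\<bar>) - Hminus A z y z t)
            \<in> o[at_top](\<lambda>t. exp (- arate A * ?\<epsilon> * t))"
        using srw_smallo[OF srw yz disjI1[OF refl] eps(1)] unfolding srw_taboo[OF srw yz] .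
      show "Hminus A x y z t = 0"
        if "scal1 x < scal1 z \<and> scal1 z < scal1 y \<or> scal1 y < scal1 z \<and> scal1 z < scal1 x" for t
        by (rule srw_separated[OF srw that])
    qed
  qed (use Hminus_inf_recurrent(2)[OF _ yz, of x] Hminus_inf_in[OF _ yz, of x] tr te tail_equiv_1[OF _ yz C1] tail_equiv_2[OF _ _ yz, of x] in blast)+
qed

end
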